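(* Let $N\ge 3$, $s\in(0,1)$, let $k\in\mathbb{N}$ with $2\le k<\infty$, and let $0<\alpha_1<\alpha_2<\cdots<\alpha_k<N$. Put $2^*_s=\frac{2N}{N-2s}$ and $2^*_{\alpha_i}=\frac{2N-\alpha_i}{N-2s}$. Then the problem $$(-\Delta)^s u=\sum_{i=1}^k\left(\int_{\mathbb{R}^N}\frac{|u(y)|^{2^*_{\alpha_i}}}{|x-y|^{\alpha_i}}\,\mathrm{d}y\right)|u|^{2^*_{\alpha_i}-2}u+|u|^{2^*_s-2}u\quad\text{in }\mathbb{R}^N$$ has a nonnegative solution $\bar v(x)$. Moreover, set $$\bar{\bar v}(x)=\frac{1}{|x|^{N-2s}}\,\bar v\!\left(\frac{x}{|x|^2}\right).$$ Then $\bar{\bar v}(x)$ is a nonnegative solution of the problem $$(-\Delta)^s\bar{\bar v}=\sum_{i=1}^k\left(\int_{\mathbb{R}^N}\frac{|\bar{\bar v}(y)|^{\frac{2N-\alpha_i}{N-2s}}}{|x-y|^{\alpha_i}}\,\mathrm{d}y\right)|\bar{\bar v}|^{\frac{4s-\alpha_i}{N-2s}}\bar{\bar v}+|\bar{\bar v}|^{\frac{4s}{N-2s}}\bar{\bar v}\quad\text{in }\mathbb{R}^N\setminus\{0\}.$$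
   Context: $(-\Delta)^s$ is the fractional Laplacian, $(-\Delta)^s u=\mathcal{F}^{-1}(|\xi|^{2s}\mathcal{F}u)$, with $\mathcal{F}$ the Fourier transform. $D^{s,2}(\mathbb{R}^N)$ is the completion of $C_0^\infty(\mathbb{R}^N)$ with respect to the norm $\|u\|_D=\|(-\Delta)^{s/2}u\|_{L^2(\mathbb{R}^N)}$. All functions are real valued. Solutions of the first problem are understood variationally, i.e. as critical points on $D^{s,2}(\mathbb{R}^N)$ of the associated energy functional $$I_1(u)=\tfrac12\|u\|_D^2-\sum_{i=1}^k\frac{1}{2\cdot 2^*_{\alpha_i}}\int_{\mathbb{R}^N}\int_{\mathbb{R}^N}\frac{|u(x)|^{2^*_{\alpha_i}}|u(y)|^{2^*_{\alpha_i}}}{|x-y|^{\alpha_i}}\,\mathrm{d}x\,\mathrm{d}y-\frac{1}{2^*_s}\int_{\mathbb{R}^N}|u|^{2^*_s}\,\mathrm{d}x .$$ Nonnegative means $\ge 0$ almost everywhere. The equation in $\mathbb{R}^N\setminus\{0\}$ is likewise understood weakly. *)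

theory Defs
  imports "HOL-Analysis.Analysis"
begin

primrec C_k :: "nat \<Rightarrow> (real^'n \<Rightarrow> real) \<Rightarrow> bool" where
  "C_k 0 f \<longleftrightarrow> continuous_on UNIV f"
| "C_k (Suc m) f \<longleftrightarrow> (\<forall>x. f differentiable at x) \<and>
     (\<forall>i. C_k m (\<lambda>x. frechet_derivative f (at x) (axis i 1)))"

text \<open>The space of smooth functions with compact support contained in \<open>\<Omega>\<close>.\<close>

definition test_functions :: "(real^'n) set \<Rightarrow> (real^'n \<Rightarrow> real) set" where
  "test_functions \<Omega> = {\<phi>. (\<forall>m. C_k m \<phi>) \<and>
     compact (closure {x. \<phi> x \<noteq> 0}) \<and> closure {x. \<phi> x \<noteq> 0} \<subseteq> \<Omega>}"

text \<open>The unitary normalisation of the Fourier transform, for which the symbol of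
  the Laplacian \<open>-\<Delta>\<close> is \<open>|\<xi>|\<^sup>2\<close>. The integrals converge absolutely in the uses below.\<close>

definition fourier :: "(real^'n \<Rightarrow> complex) \<Rightarrow> real^'n \<Rightarrow> complex" where
  "fourier f \<xi> = of_real ((2 * pi) powr (- real CARD('n) / 2)) *
     (LINT x|lborel. cis (- (x \<bullet> \<xi>)) * f x)"

definition inv_fourier :: "(real^'n \<Rightarrow> complex) \<Rightarrow> real^'n \<Rightarrow> complex" where
  "inv_fourier g x = of_real ((2 * pi) powr (- real CARD('n) / 2)) *
     (LINT \<xi>|lborel. cis (x \<bullet> \<xi>) * g \<xi>)"

text \<open>The fractional Laplacian of order \<open>2 s\<close> of a test function. The inverse
  transform is already real valued (the symbol is real and even); \<open>Re\<close> only adjusts the type.\<close>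

definition frac_laplacian :: "real \<Rightarrow> (real^'n \<Rightarrow> real) \<Rightarrow> real^'n \<Rightarrow> real" where
  "frac_laplacian s \<phi> x =
     Re (inv_fourier (\<lambda>\<xi>. of_real (norm \<xi> powr (2 * s)) * fourier (\<lambda>y. of_real (\<phi> y)) \<xi>) x)"

definition test_norm :: "real \<Rightarrow> (real^'n \<Rightarrow> real) \<Rightarrow> real" where
  "test_norm s \<phi> = sqrt (LINT x|lborel. (frac_laplacian (s / 2) \<phi> x)\<^sup>2)"

definition two_star :: "real \<Rightarrow> real \<Rightarrow> real" where
  "two_star N s = 2 * N / (N - 2 * s)"

definition two_star_hls :: "real \<Rightarrow> real \<Rightarrow> real \<Rightarrow> real" where
  "two_star_hls N s a = (2 * N - a) / (N - 2 * s)"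

text \<open>The completion of the test functions with respect to \<^const>\<open>test_norm\<close> is realised
  as a space of functions: by the Sobolev inequality a Cauchy sequence for this norm
  converges in \<open>L\<close> with exponent \<^const>\<open>two_star\<close>, and its class in the completion is
  identified with that limit. Elements are represented by Borel functions, equality being
  equality almost everywhere. The extended nonnegative integral is used so that
  convergence includes finiteness of the integrals.\<close>

definition D_limit :: "real \<Rightarrow> (nat \<Rightarrow> real^'n \<Rightarrow> real) \<Rightarrow> (real^'n \<Rightarrow> real) \<Rightarrow> bool" where
  "D_limit s \<phi> u \<longleftrightarrow>
     (\<forall>n. \<phi> n \<in> test_functions UNIV) \<and>
     (\<forall>e>0. \<exists>M. \<forall>m\<ge>M. \<forall>n\<ge>M. test_norm s (\<lambda>x. \<phi> m x - \<phi> n x) < e) \<and>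
     ((\<lambda>n. \<integral>\<^sup>+x. ennreal (\<bar>\<phi> n x - u x\<bar> powr two_star (real CARD('n)) s) \<partial>lborel)
        \<longlonglongrightarrow> 0)"

definition D_space :: "real \<Rightarrow> (real^'n \<Rightarrow> real) set" where
  "D_space s = {u \<in> borel_measurable borel. \<exists>\<phi>. D_limit s \<phi> u}"

text \<open>The extension of \<open>(-\<Delta>)\<^bsup>s/2\<^esup>\<close> from test functions to \<^const>\<open>D_space\<close>
  by continuity. The limit exists since \<open>L\<^sup>2\<close> is complete, and up to null sets it
  does not depend on the approximating sequence.\<close>

definition half_laplacian :: "real \<Rightarrow> (real^'n \<Rightarrow> real) \<Rightarrow> real^'n \<Rightarrow> real" where
  "half_laplacian s u = (SOME g. g \<in> borel_measurable borel \<and> (\<exists>\<phi>. D_limit s \<phi> u \<and>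
     ((\<lambda>n. \<integral>\<^sup>+x. ennreal ((frac_laplacian (s / 2) (\<phi> n) x - g x)\<^sup>2) \<partial>lborel)
        \<longlonglongrightarrow> 0)))"

definition D_norm :: "real \<Rightarrow> (real^'n \<Rightarrow> real) \<Rightarrow> real" where
  "D_norm s u = sqrt (LINT x|lborel. (half_laplacian s u x)\<^sup>2)"

definition D_inner :: "real \<Rightarrow> (real^'n \<Rightarrow> real) \<Rightarrow> (real^'n \<Rightarrow> real) \<Rightarrow> real" where
  "D_inner s u w = (LINT x|lborel. half_laplacian s u x * half_laplacian s w x)"

text \<open>The energy functional \<open>I\<^sub>1\<close>. On \<^const>\<open>D_space\<close> all its integrals are finite, by the
  Hardy--Littlewood--Sobolev and Sobolev inequalities. The value of the kernel
  on the diagonal is irrelevant.\<close>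

definition energy :: "real \<Rightarrow> nat \<Rightarrow> (nat \<Rightarrow> real) \<Rightarrow> (real^'n \<Rightarrow> real) \<Rightarrow> real" where
  "energy s k \<alpha> u = (let N = real CARD('n) in
     1 / 2 * (D_norm s u)\<^sup>2
     - (\<Sum>i=1..k. 1 / (2 * two_star_hls N s (\<alpha> i)) *
         (LINT x|lborel. LINT y|lborel.
            \<bar>u x\<bar> powr two_star_hls N s (\<alpha> i) * \<bar>u y\<bar> powr two_star_hls N s (\<alpha> i)
              / norm (x - y) powr \<alpha> i))
     - 1 / two_star N s * (LINT x|lborel. \<bar>u x\<bar> powr two_star N s))"

text \<open>The Frechet derivative of \<open>I\<close> on the space \<^const>\<open>D_space\<close> exists and vanishes at \<open>u\<close>.\<close>

definition critical_point ::
    "real \<Rightarrow> ((real^'n \<Rightarrow> real) \<Rightarrow> real) \<Rightarrow> (real^'n \<Rightarrow> real) \<Rightarrow> bool" where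
  "critical_point s I u \<longleftrightarrow> u \<in> D_space s \<and>
     (\<forall>e>0. \<exists>d>0. \<forall>h \<in> D_space s. D_norm s h < d \<longrightarrow>
        \<bar>I (\<lambda>x. u x + h x) - I u\<bar> \<le> e * D_norm s h)"

text \<open>The right-hand side of the equation satisfied by the transformed function. The exponents
  of \<open>|u x|\<close> may be negative; the products vanish where \<open>u\<close> does, since \<open>0 powr a = 0\<close>.\<close>

definition nonlinearity ::
    "real \<Rightarrow> nat \<Rightarrow> (nat \<Rightarrow> real) \<Rightarrow> (real^'n \<Rightarrow> real) \<Rightarrow> real^'n \<Rightarrow> real" where
  "nonlinearity s k \<alpha> u x = (let N = real CARD('n) in
     (\<Sum>i=1..k. (LINT y|lborel. \<bar>u y\<bar> powr ((2 * N - \<alpha> i) / (N - 2 * s)) / norm (x - y) powr \<alpha> i)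
        * \<bar>u x\<bar> powr ((4 * s - \<alpha> i) / (N - 2 * s)) * u x)
     + \<bar>u x\<bar> powr (4 * s / (N - 2 * s)) * u x)"

text \<open>Weak solutions of \<open>(-\<Delta>)\<^sup>s u = nonlinearity\<close> in \<open>\<Omega>\<close>.\<close>

definition weak_solution_on ::
    "(real^'n) set \<Rightarrow> real \<Rightarrow> nat \<Rightarrow> (nat \<Rightarrow> real) \<Rightarrow> (real^'n \<Rightarrow> real) \<Rightarrow> bool" where
  "weak_solution_on \<Omega> s k \<alpha> u \<longleftrightarrow> u \<in> D_space s \<and>
     (\<forall>\<phi> \<in> test_functions \<Omega>.
        integrable lborel (\<lambda>x. nonlinearity s k \<alpha> u x * \<phi> x) \<and>
        D_inner s u \<phi> = (LINT x|lborel. nonlinearity s k \<alpha> u x * \<phi> x))"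

definition kelvin :: "real \<Rightarrow> (real^'n \<Rightarrow> real) \<Rightarrow> real^'n \<Rightarrow> real" where
  "kelvin s v x = 1 / norm x powr (real CARD('n) - 2 * s) * v (x /\<^sub>R (norm x)\<^sup>2)"

definition ae_nonneg :: "(real^'n \<Rightarrow> real) \<Rightarrow> bool" where
  "ae_nonneg u \<longleftrightarrow> (AE x in lborel. 0 \<le> u x)"

end

(* The solution is explicit. For a suitable tau > 0 the function
     v x = tau * (1 + |x|^2) powr (- (N - 2 s) / 2)
   solves the problem and is invariant under the Kelvin transform away from the origin. Indeed,
   writing negative powers of 1 + |x|^2 as Gamma mixtures of Gaussians shows that the fractional
   Laplacian of v, the local term and each nonlocal term are all multiples of the same function
   (1 + |x|^2) powr (- (N + 2 s) / 2), so the equation reduces to a scalar equation in tau that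
   the intermediate value theorem solves. On the energy space the inner product is a multiple of the
   Gagliardo form; with the Hardy-Littlewood-Sobolev and Sobolev inequalities the energy at v + h
   is expanded to first order with an error O(|h|^(1 + theta)), and the linear part vanishes. *)

theory Submission
  imports Defs "HOL-Probability.Probability" "HOL-Real_Asymp.Real_Asymp"
begin

section \<open>Integrals of Gaussians and powers\<close>

text \<open>An explicit solution exists because every exponent is critical. With
  \<open>g = (N - 2 s) / 2\<close> the powers of the profile that occur are
  \<open>g * q = N - a / 2\<close> in a nonlocal term and \<open>g * p = N\<close>, and these are
  exactly the exponents at which a Riesz potential or a local power leads back to one and the same
  profile. The first obstacle lies in the definitions: \<open>half_laplacian\<close> is a chosen L2
  limit whose values cannot be computed, and the bubble is no test function. The Gagliardo form, a
  genuine double integral, takes its place: both agree on test functions by Plancherel and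
  polarisation, and the identity survives limits. The second obstacle is differentiability in the
  strong sense. Exponents may lie below 2, so the remainder is only of order 1 + \<theta> with
  \<theta> = min 1 (2 s / (N - 2 s)). A direction is written \<open>h = A * w\<close> with
  \<open>w\<close> normalised in the critical Lebesgue space and \<open>A\<close> any number above a
  multiple of the norm of \<open>h\<close>, which also covers directions of norm 0.\<close>

lemma nn_integral_lborel_shift:
  fixes f :: "'a::euclidean_space \<Rightarrow> ennreal"
  assumes [measurable]: "f \<in> borel_measurable borel"
  shows "(\<integral>\<^sup>+x. f (a + x) \<partial>lborel) = (\<integral>\<^sup>+x. f x \<partial>lborel)"
  by (subst lborel_distr_plus[of a, symmetric]) (simp add: nn_integral_distr)

lemma nn_integral_lborel_affine:
  fixes f :: "'a::euclidean_space \<Rightarrow> ennreal"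
  assumes [measurable]: "f \<in> borel_measurable borel" and "c \<noteq> 0"
  shows "(\<integral>\<^sup>+x. f x \<partial>lborel) = ennreal (\<bar>c\<bar> powr DIM('a)) * (\<integral>\<^sup>+x. f (t + c *\<^sub>R x) \<partial>lborel)"
  by (subst lborel_affine[OF \<open>c \<noteq> 0\<close>, of t])
     (use \<open>c \<noteq> 0\<close> in \<open>simp add: nn_integral_density nn_integral_distr nn_integral_cmult powr_realpow\<close>)

lemma nn_integral_lborel_uminus:
  fixes f :: "'a::euclidean_space \<Rightarrow> ennreal"
  assumes [measurable]: "f \<in> borel_measurable borel"
  shows "(\<integral>\<^sup>+x. f (- x) \<partial>lborel) = (\<integral>\<^sup>+x. f x \<partial>lborel)"
  using nn_integral_lborel_affine[of f "-1" 0] by simp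

lemma nn_integral_lborel_reflect:
  fixes f :: "'a::euclidean_space \<Rightarrow> ennreal"
  assumes [measurable]: "f \<in> borel_measurable borel"
  shows "(\<integral>\<^sup>+y. f (x - y) \<partial>lborel) = (\<integral>\<^sup>+y. f y \<partial>lborel)"
  using nn_integral_lborel_affine[of f "-1" x] by simp

text \<open>Euler's integral after scaling \<open>t\<close> by \<open>r\<close>. Read from right to
  left it turns a negative power of \<open>r\<close> into a mixture of exponentials; with
  \<open>r\<close> quadratic in \<open>norm x\<close> these are Gaussians, the device behind almost
  every explicit integral below.\<close>

lemma nn_integral_Gamma:
  assumes "0 < a" "0 < r"
  shows "(\<integral>\<^sup>+t\<in>{0<..}. ennreal (t powr (a - 1) * exp (- (r * t))) \<partial>lborel) = ennreal (Gamma a * r powr (- a))"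
proof -
  have "ennreal (Gamma a) = (\<integral>\<^sup>+t. ennreal (indicator {0..} t * t powr (a - 1) / exp t) \<partial>lborel)"
    by (rule Gamma_conv_nn_integral_real) fact
  also have "\<dots> = ennreal r * (\<integral>\<^sup>+t. ennreal (indicator {0..} (r * t) * (r * t) powr (a - 1) / exp (r * t)) \<partial>lborel)"
    using nn_integral_real_affine[of "\<lambda>t. ennreal (indicator {0..} t * t powr (a - 1) / exp t)" r 0] \<open>0 < r\<close> by simp
  also have "\<dots> = ennreal r * (\<integral>\<^sup>+t. ennreal (r powr (a - 1)) * (ennreal (t powr (a - 1) * exp (- (r * t))) * indicator {0<..} t) \<partial>lborel)"
    using \<open>0 < r\<close> by (intro arg_cong2[where f=times] nn_integral_cong refl)
      (auto split: split_indicator simp: powr_mult exp_minus field_simps zero_le_mult_iff ennreal_mult[symmetric])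
  also have "\<dots> = ennreal (r powr a) * (\<integral>\<^sup>+t\<in>{0<..}. ennreal (t powr (a - 1) * exp (- (r * t))) \<partial>lborel)"
    using \<open>0 < r\<close> by (subst nn_integral_cmult) (simp_all add: mult.assoc[symmetric] ennreal_mult[symmetric] powr_mult_base)
  finally have *: "ennreal (r powr a) * (\<integral>\<^sup>+t\<in>{0<..}. ennreal (t powr (a - 1) * exp (- (r * t))) \<partial>lborel) = ennreal (Gamma a)" ..
  have "ennreal (r powr (-a)) * (ennreal (r powr a) * (\<integral>\<^sup>+t\<in>{0<..}. ennreal (t powr (a - 1) * exp (- (r * t))) \<partial>lborel))
      = (\<integral>\<^sup>+t\<in>{0<..}. ennreal (t powr (a - 1) * exp (- (r * t))) \<partial>lborel)"
    using \<open>0 < r\<close> by (simp add: mult.assoc[symmetric] ennreal_mult[symmetric] powr_add[symmetric])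
  then show ?thesis
    using * assms by (simp add: ennreal_mult[symmetric] mult.commute Gamma_real_nonneg)
qed

text \<open>The change of variables rule used here works on compact intervals, so the half line is
  exhausted by the intervals \<open>I n\<close>, each of which the reciprocal maps onto itself;
  monotone convergence does the rest.\<close>

lemma nn_integral_reciprocal:
  fixes f :: "real \<Rightarrow> real"
  assumes [measurable]: "f \<in> borel_measurable borel"
  shows "(\<integral>\<^sup>+t\<in>{0<..}. ennreal (f t) \<partial>lborel) = (\<integral>\<^sup>+t\<in>{0<..}. ennreal (f (1 / t) / t\<^sup>2) \<partial>lborel)"
proof -
  define I :: "nat \<Rightarrow> real set" where "I n = {1 / Suc n .. Suc n}" for n
  have I_ind: "(indicator (I n) t :: ennreal) \<le> indicator (I (Suc n)) t" for n t
  proof -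
    have le: "1 / real (Suc (Suc n)) \<le> 1 / real (Suc n)" by (intro divide_left_mono) auto
    have "I n \<subseteq> I (Suc n)"
      unfolding I_def by (rule atLeastatMost_subset_iff[THEN iffD2, OF disjI2, OF conjI, OF le]) simp
    then show ?thesis by (auto split: split_indicator)
  qed
  have I_SUP: "(SUP n. indicator (I n) t :: ennreal) = indicator {0<..} t" for t
  proof (cases "0 < t")
    case True
    obtain n where n: "max t (1 / t) < real n" using reals_Archimedean2 by blast
    then have "t \<le> real n" "1 / t \<le> real n" by auto
    moreover have "1 / real (Suc n) \<le> t"
      using True \<open>1 / t \<le> real n\<close> by (simp add: divide_le_eq algebra_simps)
    ultimately have "t \<in> I n" unfolding I_def by simp
    then have "(indicator (I n) t :: ennreal) = 1" by simp
    then have "(SUP n. indicator (I n) t :: ennreal) \<ge> 1" by (metis SUP_upper UNIV_I)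
    moreover have "(SUP n. indicator (I n) t :: ennreal) \<le> 1" by (intro SUP_least) (simp add: indicator_def)
    ultimately show ?thesis using True by simp
  next
    case False
    moreover have "0 < 1 / real (Suc n)" for n by simp
    ultimately have "t \<notin> I n" for n unfolding I_def atLeastAtMost_iff by (meson less_le_trans)
    then show ?thesis using False by simp
  qed
  have lim: "(\<integral>\<^sup>+t\<in>{0<..}. ennreal (g t) \<partial>lborel) = (SUP n. \<integral>\<^sup>+t\<in>I n. ennreal (g t) \<partial>lborel)"
    if [measurable]: "g \<in> borel_measurable borel" for g :: "real \<Rightarrow> real"
  proof -
    have "(\<integral>\<^sup>+t\<in>{0<..}. ennreal (g t) \<partial>lborel) = (\<integral>\<^sup>+t. (SUP n. ennreal (g t) * indicator (I n) t) \<partial>lborel)"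
      by (simp add: SUP_mult_left_ennreal[symmetric] I_SUP)
    also have "\<dots> = (SUP n. \<integral>\<^sup>+t\<in>I n. ennreal (g t) \<partial>lborel)"
      by (intro nn_integral_monotone_convergence_SUP)
         (auto simp: incseq_Suc_iff le_fun_def intro!: mult_left_mono I_ind, simp add: I_def)
    finally show ?thesis .
  qed
  have "(\<integral>\<^sup>+t\<in>I n. ennreal (f t) \<partial>lborel) = (\<integral>\<^sup>+t\<in>I n. ennreal (f (1 / t) / t\<^sup>2) \<partial>lborel)" for n
  proof -
    define N where "N = real (Suc n)"
    have N: "N \<ge> 1" "I n = {1/N..N}" by (simp add: N_def) (simp only: I_def N_def)
    have "1 * 1 \<le> N * N" using N by (intro mult_mono) auto
    then have N0: "0 < 1 / N" "1 / N \<le> N" using N by (auto simp: divide_le_eq)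
    \<comment> \<open>The reciprocal is decreasing while the substitution rule asks for an
      increasing map: reflect to the negative half line first, then substitute
      \<open>-1/t\<close>.\<close>
    have "(\<integral>\<^sup>+t\<in>I n. ennreal (f t) \<partial>lborel) = (\<integral>\<^sup>+t. ennreal (f (-t)) * indicator {1/N..N} (-t) \<partial>lborel)"
      using nn_integral_lborel_uminus[of "\<lambda>t. ennreal (f t) * indicator {1/N..N} t"] by (simp add: N)
    also have "\<dots> = (\<integral>\<^sup>+t. ennreal (f (-t) * indicator {-1/(1/N)..-1/N} t) \<partial>lborel)"
      by (intro nn_integral_cong) (auto split: split_indicator)
    also have "\<dots> = (\<integral>\<^sup>+t. ennreal (f (-(-1/t)) * (1/t\<^sup>2) * indicator {1/N..N} t) \<partial>lborel)"
    proof (rule nn_integral_substitution)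
      fix t assume t: "t \<in> {1/N..N}"
      then have "0 < t" using N0(1) unfolding atLeastAtMost_iff by linarith
      then show "((\<lambda>t. -1/t) has_real_derivative 1/t\<^sup>2) (at t)"
        by (auto intro!: derivative_eq_intros simp: power2_eq_square)
    next
      show "continuous_on {1/N..N} (\<lambda>t::real. 1/t\<^sup>2)"
        using N0(1) by (intro continuous_intros ballI) (unfold atLeastAtMost_iff power_eq_0_iff, linarith)
    next
      show "1/N \<le> N" by (rule N0)
    qed (auto simp: set_borel_measurable_def)
    also have "\<dots> = (\<integral>\<^sup>+t\<in>I n. ennreal (f (1 / t) / t\<^sup>2) \<partial>lborel)"
      by (intro nn_integral_cong) (auto simp: N split: split_indicator)
    finally show ?thesis .
  qed
  then show ?thesis by (simp add: lim)
qed

lemma nn_integral_exp_square: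
  assumes "0 < c"
  shows "(\<integral>\<^sup>+(x::real). ennreal (exp (- (c * x\<^sup>2))) \<partial>lborel) = ennreal (sqrt (pi / c))"
proof -
  \<comment> \<open>The standard deviation for which the normal density is a multiple of
    \<open>exp (- (c * x\<^sup>2))\<close>.\<close>
  define \<sigma> where "\<sigma> = sqrt (1 / (2 * c))"
  have \<sigma>: "\<sigma> > 0" "\<sigma>\<^sup>2 = 1 / (2 * c)" using assms by (auto simp: \<sigma>_def)
  have eq: "exp (- (c * x\<^sup>2)) = sqrt (pi / c) * normal_density 0 \<sigma> x" for x
  proof -
    have "x\<^sup>2 / (2 * \<sigma>\<^sup>2) = c * x\<^sup>2" "2 * pi * \<sigma>\<^sup>2 = pi / c"
      using assms \<sigma> by (simp_all add: field_simps)
    then show ?thesis using assms by (simp add: normal_density_def)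
  qed
  have "(\<integral>\<^sup>+x. ennreal (normal_density 0 \<sigma> x) \<partial>lborel) = ennreal (LINT x|lborel. normal_density 0 \<sigma> x)"
    by (intro nn_integral_eq_integral) (use \<sigma> in auto)
  also have "(LINT x|lborel. normal_density 0 \<sigma> x) = 1"
    using \<sigma> by (simp add: integral_normal_density)
  finally show ?thesis
    using assms unfolding eq by (simp add: ennreal_mult nn_integral_cmult)
qed

lemma norm_square_sum_Basis: "(norm (x::'a::euclidean_space))\<^sup>2 = (\<Sum>b\<in>Basis. (x \<bullet> b)\<^sup>2)"
  by (subst power2_norm_eq_inner, subst euclidean_inner) (simp add: power2_eq_square)

lemma nn_integral_gaussian:
  assumes "0 < c"
  shows "(\<integral>\<^sup>+(x::'a::euclidean_space). ennreal (exp (- (c * (norm x)\<^sup>2))) \<partial>lborel) = ennreal ((pi / c) powr (DIM('a) / 2))"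
proof -
  have "(\<integral>\<^sup>+(x::'a). ennreal (exp (- (c * (norm x)\<^sup>2))) \<partial>lborel)
      = (\<integral>\<^sup>+(x::'a). (\<Prod>b\<in>Basis. ennreal (exp (- (c * (x \<bullet> b)\<^sup>2)))) \<partial>lborel)"
    by (simp add: norm_square_sum_Basis sum_distrib_left exp_sum prod_ennreal sum_negf[symmetric])
  also have "\<dots> = (\<Prod>b\<in>(Basis::'a set). ennreal (sqrt (pi / c)))"
    by (subst nn_integral_lborel_prod) (simp_all add: nn_integral_exp_square[OF assms])
  also have "\<dots> = ennreal ((sqrt (pi / c)) ^ DIM('a))"
    using assms by (simp add: ennreal_power)
  also have "(sqrt (pi / c)) ^ DIM('a) = (pi / c) powr (DIM('a) / 2)"
    using assms by (simp add: powr_half_sqrt[symmetric] powr_realpow[symmetric] powr_powr)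
  finally show ?thesis .
qed

lemma integrable_gaussian:
  assumes "0 < c"
  shows "integrable lborel (\<lambda>x::'a::euclidean_space. exp (- (c * (norm x)\<^sup>2)))"
  by (rule integrableI_nonneg) (auto simp: nn_integral_gaussian[OF assms])

lemma borel_measurable_cis [measurable]: "cis \<in> borel_measurable borel"
  by (intro borel_measurable_continuous_onI continuous_intros)

lemma gaussian_char_1:
  assumes "0 < c"
  shows "integrable lborel (\<lambda>x::real. cis (- (x * \<xi>)) * of_real (exp (- (c * x\<^sup>2))))"
    and "(LINT x|lborel. cis (- (x * \<xi>)) * of_real (exp (- (c * x\<^sup>2)))) = of_real (sqrt (pi / c) * exp (- (\<xi>\<^sup>2 / (4 * c))))"
proof -
  have "integrable lborel (\<lambda>x::real. exp (- (c * x\<^sup>2)))"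
    by (rule integrableI_nonneg) (auto simp: nn_integral_exp_square[OF assms])
  then show "integrable lborel (\<lambda>x::real. cis (- (x * \<xi>)) * of_real (exp (- (c * x\<^sup>2))))"
    by (rule Bochner_Integration.integrable_bound) (measurable, auto simp: norm_mult)
  \<comment> \<open>Scaling the variable by \<open>r\<close> turns the standard normal density into
    a multiple of the Gaussian with parameter \<open>c\<close>; the known characteristic function,
    taken at \<open>- \<xi> / r\<close>, then gives the transform.\<close>
  define r where "r = sqrt (2 * c)"
  have r: "r > 0" "r\<^sup>2 = 2 * c" using assms by (auto simp: r_def)
  have "complex_of_real (exp (- ((- \<xi> / r)\<^sup>2) / 2)) = char std_normal_distribution (- \<xi> / r)"
    by (simp add: char_std_normal_distribution)
  also have "\<dots> = (LINT x|lborel. std_normal_density x *\<^sub>R iexp ((- \<xi> / r) * x))"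
    unfolding char_def by (subst integral_density) auto
  also have "\<dots> = r *\<^sub>R (LINT x|lborel. std_normal_density (0 + r * x) *\<^sub>R iexp ((- \<xi> / r) * (0 + r * x)))"
    using r by (subst lborel_integral_real_affine[of r _ 0]) auto
  also have "(\<lambda>x. std_normal_density (0 + r * x) *\<^sub>R iexp ((- \<xi> / r) * (0 + r * x)))
      = (\<lambda>x. (1 / sqrt (2 * pi)) *\<^sub>R (cis (- (x * \<xi>)) * of_real (exp (- (c * x\<^sup>2)))))"
    using r by (auto simp: fun_eq_iff std_normal_density_def cis_conv_exp power_mult_distrib scaleR_conv_of_real mult_ac)
  also have "r *\<^sub>R (LINT x|lborel. (1 / sqrt (2 * pi)) *\<^sub>R (cis (- (x * \<xi>)) * of_real (exp (- (c * x\<^sup>2)))))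
      = (r / sqrt (2 * pi)) *\<^sub>R (LINT x|lborel. cis (- (x * \<xi>)) * of_real (exp (- (c * x\<^sup>2))))"
    by (simp only: integral_scaleR_right) simp
  finally have "(LINT x|lborel. cis (- (x * \<xi>)) * of_real (exp (- (c * x\<^sup>2)))) = of_real ((sqrt (2 * pi) / r) * exp (- ((- \<xi> / r)\<^sup>2) / 2))"
    using r by (simp add: scaleR_conv_of_real field_simps)
  also have "sqrt (2 * pi) / r = sqrt (pi / c)"
    using assms by (simp add: r_def real_sqrt_divide[symmetric])
  also have "- ((- \<xi> / r)\<^sup>2) / 2 = - (\<xi>\<^sup>2 / (4 * c))"
    using r by (simp add: power_divide)
  finally show "(LINT x|lborel. cis (- (x * \<xi>)) * of_real (exp (- (c * x\<^sup>2)))) = of_real (sqrt (pi / c) * exp (- (\<xi>\<^sup>2 / (4 * c))))" .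
qed

lemma integral_lborel_prod:
  fixes f :: "'a::euclidean_space \<Rightarrow> real \<Rightarrow> complex"
  assumes "\<And>b. b \<in> Basis \<Longrightarrow> integrable lborel (f b)"
  shows "(LINT x|lborel. (\<Prod>b\<in>Basis. f b (x \<bullet> b))) = (\<Prod>b\<in>Basis. LINT t|lborel. f b t)"
proof -
  interpret product_sigma_finite "\<lambda>_::'a. lborel :: real measure" ..
  have [measurable]: "\<And>b. b \<in> Basis \<Longrightarrow> f b \<in> borel_measurable borel"
    using assms borel_measurable_integrable by fastforce
  have "(LINT x|lborel. (\<Prod>b\<in>Basis. f b (x \<bullet> b))) = (LINT g|(\<Pi>\<^sub>M b\<in>Basis. lborel). (\<Prod>b\<in>Basis. f b ((\<Sum>b\<in>Basis. g b *\<^sub>R b) \<bullet> b)))"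
    by (subst lborel_eq, subst integral_distr) simp_all
  also have "\<dots> = (LINT g|(\<Pi>\<^sub>M b\<in>Basis. lborel). (\<Prod>b\<in>Basis. f b (g b)))"
    by (intro Bochner_Integration.integral_cong prod.cong refl) simp
  also have "\<dots> = (\<Prod>b\<in>Basis. LINT t|lborel. f b t)"
    by (intro product_integral_prod) (auto simp: assms)
  finally show ?thesis .
qed

lemma cis_sum: "finite A \<Longrightarrow> cis (\<Sum>a\<in>A. f a) = (\<Prod>a\<in>A. cis (f a))"
  by (induction A rule: finite_induct) (auto simp: cis_mult[symmetric])

lemma gaussian_char:
  fixes \<xi> :: "'a::euclidean_space"
  assumes "0 < c"
  shows "(LINT x|lborel. cis (- (x \<bullet> \<xi>)) * of_real (exp (- (c * (norm x)\<^sup>2))))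
    = of_real ((pi / c) powr (DIM('a) / 2) * exp (- ((norm \<xi>)\<^sup>2 / (4 * c))))"
proof -
  have "cis (- (x \<bullet> \<xi>)) * of_real (exp (- (c * (norm x)\<^sup>2)))
      = (\<Prod>b\<in>Basis. cis (- ((x \<bullet> b) * (\<xi> \<bullet> b))) * complex_of_real (exp (- (c * (x \<bullet> b)\<^sup>2))))" for x :: 'a
  proof -
    have "- (x \<bullet> \<xi>) = (\<Sum>b\<in>Basis. - ((x \<bullet> b) * (\<xi> \<bullet> b)))"
      by (subst euclidean_inner) (simp add: sum_negf)
    moreover have "exp (- (c * (norm x)\<^sup>2)) = (\<Prod>b\<in>Basis. exp (- (c * (x \<bullet> b)\<^sup>2)))"
      by (simp add: norm_square_sum_Basis sum_distrib_left exp_sum sum_negf[symmetric])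
    ultimately show ?thesis
      by (simp only: cis_sum finite_Basis of_real_prod prod.distrib)
  qed
  then have "(LINT x|lborel. cis (- (x \<bullet> \<xi>)) * of_real (exp (- (c * (norm x)\<^sup>2))))
    = (\<Prod>b\<in>(Basis::'a set). of_real (sqrt (pi / c) * exp (- ((\<xi> \<bullet> b)\<^sup>2 / (4 * c)))))"
    by (simp add: integral_lborel_prod[where f="\<lambda>b t. cis (- (t * (\<xi> \<bullet> b))) * complex_of_real (exp (- (c * t\<^sup>2)))"]
        gaussian_char_1[OF assms] del: of_real_mult)
  also have "\<dots> = of_real ((sqrt (pi / c)) ^ DIM('a) * exp (- (\<Sum>b\<in>Basis. (\<xi> \<bullet> b)\<^sup>2 / (4 * c))))"
    by (simp add: prod.distrib exp_sum sum_negf[symmetric] flip: of_real_prod)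
  also have "(\<Sum>b\<in>Basis. (\<xi> \<bullet> b)\<^sup>2 / (4 * c)) = (norm \<xi>)\<^sup>2 / (4 * c)"
    by (simp add: norm_square_sum_Basis sum_divide_distrib)
  also have "(sqrt (pi / c)) ^ DIM('a) = (pi / c) powr (DIM('a) / 2)"
    using assms by (simp add: powr_half_sqrt[symmetric] powr_realpow[symmetric] powr_powr)
  finally show ?thesis .
qed

lemma powr_nn_integral_Gamma:
  assumes "0 < a" "0 < r"
  shows "ennreal (r powr (- a)) = ennreal (1 / Gamma a) * (\<integral>\<^sup>+t\<in>{0<..}. ennreal (t powr (a - 1) * exp (- (r * t))) \<partial>lborel)"
  using assms Gamma_real_pos[of a] by (simp add: nn_integral_Gamma ennreal_mult[symmetric] less_imp_neq[symmetric])

text \<open>Integrating the Gaussians of the Gamma mixture first avoids polar coordinates: each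
  contributes \<open>t\<close> to the power \<open>- DIM('a) / 2\<close>, and a Gamma integral with
  parameter \<open>a - DIM('a) / 2\<close> remains, which is where the hypothesis enters.\<close>

lemma nn_integral_japanese_bracket_finite:
  assumes "DIM('a::euclidean_space) / 2 < a"
  shows "(\<integral>\<^sup>+(x::'a). ennreal ((1 + (norm x)\<^sup>2) powr (- a)) \<partial>lborel) < \<infinity>"
proof -
  have a: "0 < a" using assms by (smt (verit) divide_nonneg_nonneg of_nat_0_le_iff)
  have "(\<integral>\<^sup>+(x::'a). ennreal ((1 + (norm x)\<^sup>2) powr (- a)) \<partial>lborel)
     = ennreal (1 / Gamma a) * (\<integral>\<^sup>+(x::'a). (\<integral>\<^sup>+t\<in>{0<..}. ennreal (t powr (a - 1) * exp (- ((1 + (norm x)\<^sup>2) * t))) \<partial>lborel) \<partial>lborel)"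
    using a by (subst powr_nn_integral_Gamma) (auto intro: add_pos_nonneg simp: nn_integral_cmult)
  also have "(\<integral>\<^sup>+(x::'a). (\<integral>\<^sup>+t\<in>{0<..}. ennreal (t powr (a - 1) * exp (- ((1 + (norm x)\<^sup>2) * t))) \<partial>lborel) \<partial>lborel)
     = (\<integral>\<^sup>+t. (\<integral>\<^sup>+(x::'a). ennreal (t powr (a - 1) * exp (- ((1 + (norm x)\<^sup>2) * t))) * indicator {0<..} t \<partial>lborel) \<partial>lborel)"
    by (rule lborel_pair.Fubini') measurable
  also have "\<dots> = (\<integral>\<^sup>+t\<in>{0<..}. ennreal (pi powr (DIM('a) / 2)) * ennreal (t powr ((a - DIM('a) / 2) - 1) * exp (- (1 * t))) \<partial>lborel)"
  proof (intro nn_integral_cong)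
    fix t :: real
    show "(\<integral>\<^sup>+(x::'a). ennreal (t powr (a - 1) * exp (- ((1 + (norm x)\<^sup>2) * t))) * indicator {0<..} t \<partial>lborel)
      = ennreal (pi powr (DIM('a) / 2)) * ennreal (t powr ((a - DIM('a) / 2) - 1) * exp (- (1 * t))) * indicator {0<..} t"
    proof (cases "0 < t")
      case True
      have "(\<integral>\<^sup>+(x::'a). ennreal (t powr (a - 1) * exp (- ((1 + (norm x)\<^sup>2) * t))) \<partial>lborel)
        = (\<integral>\<^sup>+(x::'a). ennreal (t powr (a - 1) * exp (-t)) * ennreal (exp (- (t * (norm x)\<^sup>2))) \<partial>lborel)"
        by (intro nn_integral_cong) (simp add: ennreal_mult[symmetric] exp_add[symmetric] algebra_simps)
      also have "\<dots> = ennreal (t powr (a - 1) * exp (-t)) * ennreal ((pi / t) powr (DIM('a) / 2))"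
        using True by (simp add: nn_integral_cmult nn_integral_gaussian)
      also have "\<dots> = ennreal (pi powr (DIM('a) / 2)) * ennreal (t powr ((a - DIM('a) / 2) - 1) * exp (- (1 * t)))"
      proof -
        have "t powr ((a - DIM('a) / 2) - 1) = t powr (a - 1) * t powr (- (DIM('a) / 2))"
          by (simp only: powr_add[symmetric]) (simp add: algebra_simps)
        then show ?thesis
          using True by (simp add: ennreal_mult[symmetric] powr_divide powr_minus field_simps)
      qed
      finally show ?thesis using True by simp
    qed simp
  qed
  also have "\<dots> = ennreal (pi powr (DIM('a) / 2)) * ennreal (Gamma (a - DIM('a) / 2))"
    using assms by (subst mult.assoc, subst nn_integral_cmult) (simp_all add: nn_integral_Gamma[of "a - DIM('a) / 2" 1, simplified])
  finally show ?thesis by (simp add: ennreal_mult_less_top)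
qed

text \<open>The singular power is a mixture of Gaussians over \<open>t\<close> with parameter
  \<open>a / 2\<close>, which needs \<open>0 < a\<close>. After the space integral and a second
  mixture over \<open>u\<close>, a Gamma integral with parameter \<open>(?N - a) / 2\<close> is
  left, which needs \<open>a < ?N\<close>.\<close>

lemma nn_integral_powr_gaussian_finite:
  fixes a :: real
  assumes "0 < a" "a < DIM('a::euclidean_space)"
  shows "(\<integral>\<^sup>+(x::'a). ennreal (norm x powr (- a) * exp (- (norm x)\<^sup>2)) \<partial>lborel) < \<infinity>"
proof -
  let ?N = "real DIM('a)"
  have "(\<integral>\<^sup>+(x::'a). ennreal (norm x powr (- a) * exp (- (norm x)\<^sup>2)) \<partial>lborel)
     = (\<integral>\<^sup>+(x::'a). ennreal (1 / Gamma (a / 2)) * (\<integral>\<^sup>+t\<in>{0<..}. ennreal (t powr (a / 2 - 1) * exp (- ((1 + t) * (norm x)\<^sup>2))) \<partial>lborel) \<partial>lborel)"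
  proof (rule nn_integral_cong_AE)
    show "AE x::'a in lborel. ennreal (norm x powr (- a) * exp (- (norm x)\<^sup>2)) = 
      ennreal (1 / Gamma (a / 2)) * (\<integral>\<^sup>+t\<in>{0<..}. ennreal (t powr (a / 2 - 1) * exp (- ((1 + t) * (norm x)\<^sup>2))) \<partial>lborel)"
      using AE_lborel_singleton[of "0::'a"]
    proof eventually_elim
      case (elim x)
      have "ennreal (norm x powr (- a)) = ennreal (((norm x)\<^sup>2) powr (- (a / 2)))"
        using elim by (simp add: powr_powr flip: powr_numeral)
      also have "\<dots> = ennreal (1 / Gamma (a / 2)) * (\<integral>\<^sup>+t\<in>{0<..}. ennreal (t powr (a / 2 - 1) * exp (- ((norm x)\<^sup>2 * t))) \<partial>lborel)"
        using elim assms by (intro powr_nn_integral_Gamma) auto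
      finally have *: "ennreal (norm x powr (- a)) = \<dots>" .
      have "ennreal (norm x powr (- a) * exp (- (norm x)\<^sup>2)) = ennreal (norm x powr (- a)) * ennreal (exp (- (norm x)\<^sup>2))"
        by (simp add: ennreal_mult)
      also have "\<dots> = ennreal (1 / Gamma (a / 2)) * (\<integral>\<^sup>+t. ennreal (t powr (a / 2 - 1) * exp (- ((norm x)\<^sup>2 * t))) * indicator {0<..} t * ennreal (exp (- (norm x)\<^sup>2)) \<partial>lborel)"
        by (subst nn_integral_multc) (simp_all add: * mult.assoc)
      also have "(\<integral>\<^sup>+t. ennreal (t powr (a / 2 - 1) * exp (- ((norm x)\<^sup>2 * t))) * indicator {0<..} t * ennreal (exp (- (norm x)\<^sup>2)) \<partial>lborel)
         = (\<integral>\<^sup>+t\<in>{0<..}. ennreal (t powr (a / 2 - 1) * exp (- ((1 + t) * (norm x)\<^sup>2))) \<partial>lborel)"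
        by (intro nn_integral_cong) (auto split: split_indicator simp: ennreal_mult[symmetric] exp_add[symmetric] algebra_simps)
      finally show ?case .
    qed
  qed
  also have "\<dots> = ennreal (1 / Gamma (a / 2)) * (\<integral>\<^sup>+(x::'a). (\<integral>\<^sup>+t\<in>{0<..}. ennreal (t powr (a / 2 - 1) * exp (- ((1 + t) * (norm x)\<^sup>2))) \<partial>lborel) \<partial>lborel)"
    by (rule nn_integral_cmult) measurable
  also have "(\<integral>\<^sup>+(x::'a). (\<integral>\<^sup>+t\<in>{0<..}. ennreal (t powr (a / 2 - 1) * exp (- ((1 + t) * (norm x)\<^sup>2))) \<partial>lborel) \<partial>lborel)
     = (\<integral>\<^sup>+t. (\<integral>\<^sup>+(x::'a). ennreal (t powr (a / 2 - 1) * exp (- ((1 + t) * (norm x)\<^sup>2))) * indicator {0<..} t \<partial>lborel) \<partial>lborel)"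
    by (rule lborel_pair.Fubini') measurable
  \<comment> \<open>The Gaussian integral leaves a power of \<open>1 + t\<close>; expanding this
    power once more, over \<open>u\<close>, makes the \<open>t\<close>-integral a plain Gamma
    integral.\<close>
  also have "\<dots> = (\<integral>\<^sup>+t. (ennreal (pi powr (?N / 2) / Gamma (?N / 2)) * (\<integral>\<^sup>+u\<in>{0<..}. ennreal (u powr (?N / 2 - 1) * exp (- ((1 + t) * u))) * ennreal (t powr (a / 2 - 1)) * indicator {0<..} t \<partial>lborel)) \<partial>lborel)"
  proof (intro nn_integral_cong)
    fix t :: real
    show "(\<integral>\<^sup>+(x::'a). ennreal (t powr (a / 2 - 1) * exp (- ((1 + t) * (norm x)\<^sup>2))) * indicator {0<..} t \<partial>lborel)
      = ennreal (pi powr (?N / 2) / Gamma (?N / 2)) * (\<integral>\<^sup>+u\<in>{0<..}. ennreal (u powr (?N / 2 - 1) * exp (- ((1 + t) * u))) * ennreal (t powr (a / 2 - 1)) * indicator {0<..} t \<partial>lborel)"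
    proof (cases "0 < t")
      case True
      have "(\<integral>\<^sup>+(x::'a). ennreal (t powr (a / 2 - 1) * exp (- ((1 + t) * (norm x)\<^sup>2))) \<partial>lborel)
        = ennreal (t powr (a / 2 - 1)) * ennreal ((pi / (1 + t)) powr (?N / 2))"
        using True by (simp add: ennreal_mult nn_integral_cmult nn_integral_gaussian)
      also have "ennreal ((pi / (1 + t)) powr (?N / 2)) = ennreal (pi powr (?N / 2)) * ennreal ((1 + t) powr (- (?N / 2)))"
        using True by (simp add: ennreal_mult[symmetric] powr_divide powr_minus field_simps)
      also have "ennreal ((1 + t) powr (- (?N / 2))) = ennreal (1 / Gamma (?N / 2)) * (\<integral>\<^sup>+u\<in>{0<..}. ennreal (u powr (?N / 2 - 1) * exp (- ((1 + t) * u))) \<partial>lborel)"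
        using True by (intro powr_nn_integral_Gamma) auto
      finally have *: "(\<integral>\<^sup>+(x::'a). ennreal (t powr (a / 2 - 1) * exp (- ((1 + t) * (norm x)\<^sup>2))) \<partial>lborel)
        = ennreal (t powr (a / 2 - 1)) * (ennreal (pi powr (?N / 2)) * (ennreal (1 / Gamma (?N / 2)) * (\<integral>\<^sup>+u\<in>{0<..}. ennreal (u powr (?N / 2 - 1) * exp (- ((1 + t) * u))) \<partial>lborel)))" .
      have "(\<integral>\<^sup>+u\<in>{0<..}. ennreal (u powr (?N / 2 - 1) * exp (- ((1 + t) * u))) * ennreal (t powr (a / 2 - 1)) * indicator {0<..} t \<partial>lborel)
        = (\<integral>\<^sup>+u. ennreal (t powr (a / 2 - 1)) * (ennreal (u powr (?N / 2 - 1) * exp (- ((1 + t) * u))) * indicator {0<..} u) \<partial>lborel)"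
        using True by (intro nn_integral_cong) (simp add: mult_ac)
      also have "\<dots> = ennreal (t powr (a / 2 - 1)) * (\<integral>\<^sup>+u\<in>{0<..}. ennreal (u powr (?N / 2 - 1) * exp (- ((1 + t) * u))) \<partial>lborel)"
        by (rule nn_integral_cmult) measurable
      finally have **: "(\<integral>\<^sup>+u\<in>{0<..}. ennreal (u powr (?N / 2 - 1) * exp (- ((1 + t) * u))) * ennreal (t powr (a / 2 - 1)) * indicator {0<..} t \<partial>lborel) = \<dots>" .
      have "ennreal (pi powr (?N / 2) / Gamma (?N / 2)) = ennreal (pi powr (?N / 2)) * ennreal (1 / Gamma (?N / 2))"
        using Gamma_real_pos[of "?N / 2"] by (simp add: ennreal_mult[symmetric])
      then show ?thesis unfolding ** using True by (simp add: *) (simp only: mult_ac)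
    qed simp
  qed
  also have "\<dots> = ennreal (pi powr (?N / 2) / Gamma (?N / 2)) * (\<integral>\<^sup>+t. (\<integral>\<^sup>+u\<in>{0<..}. ennreal (u powr (?N / 2 - 1) * exp (- ((1 + t) * u))) * ennreal (t powr (a / 2 - 1)) * indicator {0<..} t \<partial>lborel) \<partial>lborel)"
    by (rule nn_integral_cmult) measurable
  also have "(\<integral>\<^sup>+t. (\<integral>\<^sup>+u\<in>{0<..}. ennreal (u powr (?N / 2 - 1) * exp (- ((1 + t) * u))) * ennreal (t powr (a / 2 - 1)) * indicator {0<..} t \<partial>lborel) \<partial>lborel)
     = (\<integral>\<^sup>+u. (\<integral>\<^sup>+t. ennreal (u powr (?N / 2 - 1) * exp (- ((1 + t) * u))) * ennreal (t powr (a / 2 - 1)) * indicator {0<..} t * indicator {0<..} u \<partial>lborel) \<partial>lborel)"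
    by (rule lborel_pair.Fubini') measurable
  also have "\<dots> = (\<integral>\<^sup>+u\<in>{0<..}. ennreal (Gamma (a / 2)) * ennreal (u powr ((?N - a) / 2 - 1) * exp (- (1 * u))) \<partial>lborel)"
  proof (intro nn_integral_cong)
    fix u :: real
    show "(\<integral>\<^sup>+t. ennreal (u powr (?N / 2 - 1) * exp (- ((1 + t) * u))) * ennreal (t powr (a / 2 - 1)) * indicator {0<..} t * indicator {0<..} u \<partial>lborel)
      = ennreal (Gamma (a / 2)) * ennreal (u powr ((?N - a) / 2 - 1) * exp (- (1 * u))) * indicator {0<..} u"
    proof (cases "0 < u")
      case True
      have "(\<integral>\<^sup>+t. ennreal (u powr (?N / 2 - 1) * exp (- ((1 + t) * u))) * ennreal (t powr (a / 2 - 1)) * indicator {0<..} t \<partial>lborel)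
        = (\<integral>\<^sup>+t. ennreal (u powr (?N / 2 - 1) * exp (- u)) * (ennreal (t powr (a / 2 - 1) * exp (- (u * t))) * indicator {0<..} t) \<partial>lborel)"
        by (intro nn_integral_cong) (auto split: split_indicator simp: ennreal_mult[symmetric] exp_add[symmetric] algebra_simps)
      also have "\<dots> = ennreal (u powr (?N / 2 - 1) * exp (- u)) * ennreal (Gamma (a / 2) * u powr (- (a / 2)))"
        using True assms by (subst nn_integral_cmult) (simp_all add: nn_integral_Gamma)
      also have "\<dots> = ennreal (Gamma (a / 2)) * ennreal (u powr ((?N - a) / 2 - 1) * exp (- (1 * u)))"
      proof -
        have "u powr ((?N - a) / 2 - 1) = u powr (?N / 2 - 1) * u powr (- (a / 2))"
          by (simp only: powr_add[symmetric], intro arg_cong2[where f="(powr)"]) (simp_all add: field_simps)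
        then show ?thesis using assms by (simp add: ennreal_mult[symmetric] Gamma_real_nonneg mult_ac)
      qed
      finally show ?thesis using True by simp
    qed simp
  qed
  also have "\<dots> = ennreal (Gamma (a / 2)) * ennreal (Gamma ((?N - a) / 2))"
    using assms by (subst mult.assoc, subst nn_integral_cmult) (simp_all add: nn_integral_Gamma[of "(?N - a) / 2" 1, simplified])
  finally show ?thesis by (simp add: ennreal_mult_less_top)
qed

section \<open>The Hardy--Littlewood--Sobolev and Sobolev inequalities\<close>

text \<open>Homogeneity under dilation by \<open>R\<close>. Testing \<open>norm x / R\<close>
  instead of \<open>norm x\<close> lets one set \<open>S\<close> describe balls, or their
  complements, of every radius.\<close>

lemma nn_integral_powr_shell:
  fixes S :: "real set" and e R :: real
  assumes [measurable]: "S \<in> sets borel" and "0 < R"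
  shows "(\<integral>\<^sup>+(x::'a::euclidean_space). ennreal (norm x powr e) * indicator S (norm x / R) \<partial>lborel)
    = ennreal (R powr (DIM('a) + e)) * (\<integral>\<^sup>+(x::'a). ennreal (norm x powr e) * indicator S (norm x) \<partial>lborel)"
proof -
  have "(\<integral>\<^sup>+(x::'a). ennreal (norm x powr e) * indicator S (norm x / R) \<partial>lborel)
      = ennreal (R powr DIM('a)) * (\<integral>\<^sup>+(x::'a). ennreal (R powr e) * (ennreal (norm x powr e) * indicator S (norm x)) \<partial>lborel)"
    using \<open>0 < R\<close> by (subst nn_integral_lborel_affine[of _ R 0])
      (auto simp: powr_mult ennreal_mult mult.assoc)
  also have "\<dots> = ennreal (R powr (DIM('a) + e)) * (\<integral>\<^sup>+(x::'a). ennreal (norm x powr e) * indicator S (norm x) \<partial>lborel)"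
    by (subst nn_integral_cmult) (auto simp: powr_add ennreal_mult mult.assoc)
  finally show ?thesis .
qed

text \<open>By homogeneity only radius 1 matters, and there
  \<open>1 \<le> exp 1 * exp (- (norm x)\<^sup>2)\<close> reduces the integral to the one damped by
  a Gaussian.\<close>

lemma nn_integral_powr_near:
  fixes a :: real
  assumes "0 < a" "a < DIM('a::euclidean_space)"
  shows "\<exists>C>0. \<forall>R>0. \<forall>x::'a.
    (\<integral>\<^sup>+y. ennreal (norm (x - y) powr (- a)) * indicator {..<1} (norm (x - y) / R) \<partial>lborel) \<le> ennreal (C * R powr (DIM('a) - a))"
proof -
  let ?K = "\<integral>\<^sup>+(x::'a). ennreal (norm x powr (- a)) * indicator {..<1} (norm x) \<partial>lborel"
  have "?K \<le> (\<integral>\<^sup>+(x::'a). ennreal (exp 1) * ennreal (norm x powr (- a) * exp (- (norm x)\<^sup>2)) \<partial>lborel)"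
  proof (intro nn_integral_mono)
    fix x :: 'a
    have "norm x powr (- a) \<le> exp 1 * (norm x powr (- a) * exp (- (norm x)\<^sup>2))" if "norm x < 1"
    proof -
      have "(norm x)\<^sup>2 \<le> 1" using that by (simp add: abs_square_le_1)
      then have "1 \<le> exp 1 * exp (- (norm x)\<^sup>2)" by (simp flip: exp_add)
      then have "norm x powr (- a) * 1 \<le> norm x powr (- a) * (exp 1 * exp (- (norm x)\<^sup>2))"
        by (intro mult_left_mono) auto
      then show ?thesis by (simp add: mult_ac)
    qed
    then show "ennreal (norm x powr (- a)) * indicator {..<1} (norm x) \<le> ennreal (exp 1) * ennreal (norm x powr (- a) * exp (- (norm x)\<^sup>2))"
      by (auto simp: ennreal_mult[symmetric] split: split_indicator)
  qed
  also have "\<dots> < \<infinity>"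
    using nn_integral_powr_gaussian_finite[OF assms] by (simp add: nn_integral_cmult ennreal_mult_less_top)
  finally have K: "?K < \<infinity>" .
  show ?thesis
  \<comment> \<open>The summand 1 makes the constant strictly positive.\<close>
  proof (intro exI[of _ "enn2real ?K + 1"] conjI allI impI)
    show "0 < enn2real ?K + 1" by (simp add: add_nonneg_pos)
  next
    fix R :: real and x :: 'a assume "0 < R"
    have "(\<integral>\<^sup>+y. ennreal (norm (x - y) powr (- a)) * indicator {..<1} (norm (x - y) / R) \<partial>lborel)
       = (\<integral>\<^sup>+(y::'a). ennreal (norm y powr (- a)) * indicator {..<1} (norm y / R) \<partial>lborel)"
      by (rule nn_integral_lborel_reflect[of "\<lambda>y. ennreal (norm y powr (- a)) * indicator {..<1} (norm y / R)" x]) measurable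
    also have "\<dots> = ennreal (R powr (DIM('a) - a)) * ennreal (enn2real ?K)"
      using \<open>0 < R\<close> K by (subst nn_integral_powr_shell) auto
    also have "\<dots> \<le> ennreal ((enn2real ?K + 1) * R powr (DIM('a) - a))"
      by (subst ennreal_mult[symmetric]) (auto intro!: ennreal_leI mult_left_mono simp: mult.commute[of _ "R powr _"])
    finally show "(\<integral>\<^sup>+y. ennreal (norm (x - y) powr (- a)) * indicator {..<1} (norm (x - y) / R) \<partial>lborel) \<le> \<dots>" .
  qed
qed

text \<open>Again radius 1 suffices. There
  \<open>1 + (norm x)\<^sup>2 \<le> 2 * (norm x)\<^sup>2\<close>, so the power is dominated by a
  bracket of exponent \<open>b / 2\<close>, integrable because \<open>b\<close> exceeds the
  dimension.\<close>

lemma nn_integral_powr_far: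
  fixes b :: real
  assumes "DIM('a::euclidean_space) < b"
  shows "\<exists>C>0. \<forall>R>0. \<forall>x::'a.
    (\<integral>\<^sup>+y. ennreal (norm (x - y) powr (- b)) * indicator {1..} (norm (x - y) / R) \<partial>lborel) \<le> ennreal (C * R powr (DIM('a) - b))"
proof -
  let ?K = "\<integral>\<^sup>+(x::'a). ennreal (norm x powr (- b)) * indicator {1..} (norm x) \<partial>lborel"
  have b: "0 < b" using assms by (meson of_nat_0_le_iff order_le_less_trans)
  have "?K \<le> (\<integral>\<^sup>+(x::'a). ennreal (2 powr (b / 2)) * ennreal ((1 + (norm x)\<^sup>2) powr (- (b / 2))) \<partial>lborel)"
  proof (intro nn_integral_mono)
    fix x :: 'a
    have "norm x powr (- b) \<le> 2 powr (b / 2) * (1 + (norm x)\<^sup>2) powr (- (b / 2))" if "1 \<le> norm x"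
    proof -
      have "1 \<le> (norm x)\<^sup>2" using that by (simp add: power2_eq_square) (metis mult_mono' mult_1 norm_ge_zero zero_le_one)
      then have "(1 + (norm x)\<^sup>2) / 2 \<le> (norm x)\<^sup>2" "0 < (1 + (norm x)\<^sup>2) / 2" by auto
      then have "((norm x)\<^sup>2) powr (- (b / 2)) \<le> ((1 + (norm x)\<^sup>2) / 2) powr (- (b / 2))"
        using b by (intro powr_mono2') auto
      also have "\<dots> = 2 powr (b / 2) * (1 + (norm x)\<^sup>2) powr (- (b / 2))"
        by (subst powr_divide) (auto simp: powr_minus divide_simps)
      also have "((norm x)\<^sup>2) powr (- (b / 2)) = norm x powr (- b)"
        using that by (simp add: powr_powr flip: powr_numeral)
      finally show ?thesis .
    qed
    then show "ennreal (norm x powr (- b)) * indicator {1..} (norm x) \<le> ennreal (2 powr (b / 2)) * ennreal ((1 + (norm x)\<^sup>2) powr (- (b / 2)))"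
      by (auto simp: ennreal_mult[symmetric] split: split_indicator)
  qed
  also have "\<dots> < \<infinity>"
    using nn_integral_japanese_bracket_finite[where 'a='a, of "b / 2"] assms by (simp add: nn_integral_cmult ennreal_mult_less_top)
  finally have K: "?K < \<infinity>" .
  show ?thesis
  proof (intro exI[of _ "enn2real ?K + 1"] conjI allI impI)
    show "0 < enn2real ?K + 1" by (simp add: add_nonneg_pos)
  next
    fix R :: real and x :: 'a assume "0 < R"
    have "(\<integral>\<^sup>+y. ennreal (norm (x - y) powr (- b)) * indicator {1..} (norm (x - y) / R) \<partial>lborel)
       = (\<integral>\<^sup>+(y::'a). ennreal (norm y powr (- b)) * indicator {1..} (norm y / R) \<partial>lborel)"
      by (rule nn_integral_lborel_reflect[of "\<lambda>y. ennreal (norm y powr (- b)) * indicator {1..} (norm y / R)" x]) measurable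
    also have "\<dots> = ennreal (R powr (DIM('a) - b)) * ennreal (enn2real ?K)"
      using \<open>0 < R\<close> K by (subst nn_integral_powr_shell) auto
    also have "\<dots> \<le> ennreal ((enn2real ?K + 1) * R powr (DIM('a) - b))"
      by (subst ennreal_mult[symmetric]) (auto intro!: ennreal_leI mult_left_mono simp: mult.commute[of _ "R powr _"])
    finally show "(\<integral>\<^sup>+y. ennreal (norm (x - y) powr (- b)) * indicator {1..} (norm (x - y) / R) \<partial>lborel) \<le> \<dots>" .
  qed
qed

text \<open>Young's inequality without sharp constants: if \<open>b\<close> is at most
  \<open>a powr (p - 1)\<close> the product is below the first term, otherwise below the
  second.\<close>

lemma mult_le_powr_add_powr:
  fixes a b p :: real
  assumes "0 \<le> a" "0 \<le> b" "1 < p"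
  shows "a * b \<le> a powr p + b powr (p / (p - 1))"
proof (cases "b \<le> a powr (p - 1)")
  case True
  then have "a * b \<le> a * a powr (p - 1)" using assms by (intro mult_left_mono)
  also have "\<dots> = a powr p" using assms by (simp add: powr_mult_base)
  finally show ?thesis by (simp add: add_increasing2)
next
  case False
  have "a = (a powr (p - 1)) powr (1 / (p - 1))" using assms by (simp add: powr_powr)
  also have "\<dots> \<le> b powr (1 / (p - 1))" using False assms by (intro powr_mono2) auto
  finally have "a * b \<le> b powr (1 / (p - 1)) * b" using assms by (intro mult_right_mono)
  also have "\<dots> = b powr (1 + 1 / (p - 1))" using assms by (simp add: powr_mult_base mult.commute)
  also have "1 + 1 / (p - 1) = p / (p - 1)" using assms by (simp add: field_simps)
  finally show ?thesis by (simp add: add_increasing)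
qed

text \<open>Fix \<open>x\<close> and put \<open>t = f x\<close>. Inside the ball of radius
  \<open>R\<close> the restriction \<open>g y \<le> t\<close> is used, outside it Young's inequality
  and the bound on \<open>g\<close>. Every piece becomes a multiple of
  \<open>t powr (p - 1)\<close>, so that the factor \<open>f x\<close> completes it to
  \<open>f x powr p\<close>, whose integral is at most 1.\<close>

lemma HLS_half:
  fixes a :: real
  assumes "0 < a" "a < DIM('a::euclidean_space)"
  defines "p \<equiv> 2 * real DIM('a) / (2 * real DIM('a) - a)"
  shows "\<exists>C>0. \<forall>f g :: 'a \<Rightarrow> real. f \<in> borel_measurable borel \<longrightarrow> g \<in> borel_measurable borel \<longrightarrow>
    (\<forall>x. 0 \<le> f x) \<longrightarrow> (\<forall>x. 0 \<le> g x) \<longrightarrow>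
    (\<integral>\<^sup>+x. ennreal (f x powr p) \<partial>lborel) \<le> 1 \<longrightarrow> (\<integral>\<^sup>+x. ennreal (g x powr p) \<partial>lborel) \<le> 1 \<longrightarrow>
    (\<integral>\<^sup>+x. \<integral>\<^sup>+y. ennreal (f x * g y * norm (x - y) powr (- a)) * indicator {y. g y \<le> f x} y \<partial>lborel \<partial>lborel) \<le> ennreal C"
proof -
  let ?N = "real DIM('a)"
  obtain C1 where C1: "0 < C1" "\<And>R x::'a. 0 < R \<Longrightarrow>
    (\<integral>\<^sup>+y. ennreal (norm (x - y) powr (- a)) * indicator {..<1} (norm (x - y) / R) \<partial>lborel) \<le> ennreal (C1 * R powr (?N - a))"
    using nn_integral_powr_near[OF assms(1,2)] by blast
  obtain C2 where C2: "0 < C2" "\<And>R x::'a. 0 < R \<Longrightarrow>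
    (\<integral>\<^sup>+y. ennreal (norm (x - y) powr (- (2 * ?N))) * indicator {1..} (norm (x - y) / R) \<partial>lborel) \<le> ennreal (C2 * R powr (?N - 2 * ?N))"
    using nn_integral_powr_far[where 'a='a, of "2 * ?N"] by auto
  have p: "1 < p" "p / (p - 1) = 2 * ?N / a" using assms by (auto simp: p_def field_simps)
  show ?thesis
  proof (intro exI[of _ "C1 + 1 + C2"] conjI allI impI)
    show "0 < C1 + 1 + C2" using C1 C2 by simp
  next
    fix f g :: "'a \<Rightarrow> real"
    assume [measurable]: "f \<in> borel_measurable borel" "g \<in> borel_measurable borel"
      and "\<forall>x. 0 \<le> f x" "\<forall>x. 0 \<le> g x"
      and f1: "(\<integral>\<^sup>+x. ennreal (f x powr p) \<partial>lborel) \<le> 1" and g1: "(\<integral>\<^sup>+x. ennreal (g x powr p) \<partial>lborel) \<le> 1"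
    then have nn: "\<And>x. 0 \<le> f x" "\<And>x. 0 \<le> g x" by auto
    have "(\<integral>\<^sup>+y. ennreal (f x * g y * norm (x - y) powr (- a)) * indicator {y. g y \<le> f x} y \<partial>lborel) \<le> ennreal (C1 + 1 + C2) * ennreal (f x powr p)" for x
    proof (cases "f x = 0")
      case False
      define t where "t = f x"
      have t: "0 < t" using False nn(1)[of x] by (simp add: t_def)
      \<comment> \<open>\<open>R\<close> is forced by
        \<open>t * R powr (?N - a) = t powr (p - 1)\<close>, and \<mu> by giving the two terms of
        Young's inequality, \<open>\<mu> powr p\<close> and
        \<open>(1 / \<mu>) powr (2 * ?N / a) * R powr (- ?N)\<close>, the same size.\<close>
      define R where "R = t powr (- 2 / (2 * ?N - a))"
      define \<mu> where "\<mu> = R powr (- (a * (2 * ?N - a) / (4 * ?N)))"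
      have R: "0 < R" "0 < \<mu>" using t by (auto simp: R_def \<mu>_def)
      have \<mu>p: "\<mu> powr p = R powr (- a / 2)"
      proof -
        have "- (a * (2 * ?N - a) / (4 * ?N)) * p = - a / 2"
          unfolding p_def using assms(1,2) by (simp add: divide_simps)
        then show ?thesis by (simp only: \<mu>_def powr_powr)
      qed
      have \<mu>p': "(1 / \<mu>) powr (2 * ?N / a) = R powr (?N - a / 2)"
      proof -
        have "(a * (2 * ?N - a) / (4 * ?N)) * (2 * ?N / a) = ?N - a / 2"
          using assms(1,2) by (simp add: divide_simps)
        moreover have "1 / \<mu> = R powr (a * (2 * ?N - a) / (4 * ?N))"
          unfolding \<mu>_def by (simp add: powr_minus_divide)
        ultimately show ?thesis by (simp only: powr_powr)
      qed
      have Ra: "R powr (- a / 2) = t powr (p - 1)"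
      proof -
        have "(- 2 / (2 * ?N - a)) * (- a / 2) = p - 1"
          unfolding p_def using assms(1,2) by (simp add: divide_simps)
        then show ?thesis by (simp add: R_def powr_powr)
      qed
      have RN: "t * R powr (?N - a) = t powr (p - 1)"
      proof -
        have "1 + (- 2 / (2 * ?N - a)) * (?N - a) = p - 1"
          unfolding p_def using assms(1,2) by (simp add: divide_simps)
        then show ?thesis using t by (simp only: R_def powr_powr powr_mult_base less_imp_le)
      qed
      have RR: "R powr (?N - a / 2) * R powr (?N - 2 * ?N) = R powr (- a / 2)"
        by (simp add: powr_add[symmetric])
      have "(\<integral>\<^sup>+y. ennreal (g y * norm (x - y) powr (- a)) * indicator {y. g y \<le> t} y \<partial>lborel)
        \<le> (\<integral>\<^sup>+y. ennreal t * (ennreal (norm (x - y) powr (- a)) * indicator {..<1} (norm (x - y) / R))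
              + ennreal (\<mu> powr p) * ennreal (g y powr p)
              + ennreal ((1 / \<mu>) powr (2 * ?N / a)) * (ennreal (norm (x - y) powr (- (2 * ?N))) * indicator {1..} (norm (x - y) / R)) \<partial>lborel)"
      proof (intro nn_integral_mono)
        fix y
        let ?k = "norm (x - y) powr (- a)"
        show "ennreal (g y * ?k) * indicator {y. g y \<le> t} y
          \<le> ennreal t * (ennreal ?k * indicator {..<1} (norm (x - y) / R))
              + ennreal (\<mu> powr p) * ennreal (g y powr p)
              + ennreal ((1 / \<mu>) powr (2 * ?N / a)) * (ennreal (norm (x - y) powr (- (2 * ?N))) * indicator {1..} (norm (x - y) / R))"
        proof (cases "g y \<le> t")
          case gt: True
          show ?thesis
          proof (cases "norm (x - y) / R < 1")
            case True
            have "g y * ?k \<le> t * ?k" using gt by (intro mult_right_mono) auto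
            then show ?thesis using True gt t
              by (auto simp: ennreal_mult[symmetric] intro!: add_increasing2 ennreal_leI)
          next
            case False
            \<comment> \<open>The kernel is not integrable at infinity. Young's inequality raises it
              to the conjugate exponent \<open>2 * ?N / a\<close>, which yields the power
              \<open>- (2 * ?N)\<close> and hence an integrable tail.\<close>
            have "g y * ?k = (\<mu> * g y) * (1 / \<mu> * ?k)" using R by simp
            also have "\<dots> \<le> (\<mu> * g y) powr p + (1 / \<mu> * ?k) powr (2 * ?N / a)"
              using mult_le_powr_add_powr[of "\<mu> * g y" "1 / \<mu> * ?k" p] p R nn by simp
            also have "\<dots> = \<mu> powr p * g y powr p + (1 / \<mu>) powr (2 * ?N / a) * norm (x - y) powr (- (2 * ?N))"
              using R nn assms by (simp add: powr_mult powr_powr del: divide_inverse) (simp add: powr_mult powr_powr powr_divide)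
            finally show ?thesis using False gt R
              by (auto simp: ennreal_mult[symmetric] ennreal_plus[symmetric] simp del: ennreal_plus intro!: ennreal_leI)
          qed
        qed simp
      qed
      also have "\<dots> = ennreal t * (\<integral>\<^sup>+y. ennreal (norm (x - y) powr (- a)) * indicator {..<1} (norm (x - y) / R) \<partial>lborel)
              + ennreal (\<mu> powr p) * (\<integral>\<^sup>+y. ennreal (g y powr p) \<partial>lborel)
              + ennreal ((1 / \<mu>) powr (2 * ?N / a)) * (\<integral>\<^sup>+y. ennreal (norm (x - y) powr (- (2 * ?N))) * indicator {1..} (norm (x - y) / R) \<partial>lborel)"
        by (simp add: nn_integral_add nn_integral_cmult)
      also have "\<dots> \<le> ennreal t * ennreal (C1 * R powr (?N - a)) + ennreal (\<mu> powr p) * 1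
              + ennreal ((1 / \<mu>) powr (2 * ?N / a)) * ennreal (C2 * R powr (?N - 2 * ?N))"
        by (intro add_mono mult_left_mono C1 C2 R g1) auto
      also have "\<dots> = ennreal (C1 * (t * R powr (?N - a)) + \<mu> powr p + C2 * (((1 / \<mu>) powr (2 * ?N / a)) * R powr (?N - 2 * ?N)))"
        using t C1 C2 by (simp add: ennreal_mult[symmetric] ennreal_plus[symmetric] mult_ac del: ennreal_plus)
      also have "\<dots> = ennreal ((C1 + 1 + C2) * t powr (p - 1))"
        unfolding \<mu>p \<mu>p' RR RN Ra by (simp add: algebra_simps)
      finally have *: "(\<integral>\<^sup>+y. ennreal (g y * norm (x - y) powr (- a)) * indicator {y. g y \<le> t} y \<partial>lborel) \<le> \<dots>" .
      have "(\<integral>\<^sup>+y. ennreal (f x * g y * norm (x - y) powr (- a)) * indicator {y. g y \<le> f x} y \<partial>lborel)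
        = (\<integral>\<^sup>+y. ennreal t * (ennreal (g y * norm (x - y) powr (- a)) * indicator {y. g y \<le> t} y) \<partial>lborel)"
        using t nn by (intro nn_integral_cong) (auto simp: t_def[symmetric] ennreal_mult[symmetric] mult_ac split: split_indicator)
      also have "\<dots> = ennreal t * (\<integral>\<^sup>+y. ennreal (g y * norm (x - y) powr (- a)) * indicator {y. g y \<le> t} y \<partial>lborel)"
        by (rule nn_integral_cmult) measurable
      also have "\<dots> \<le> ennreal t * ennreal ((C1 + 1 + C2) * t powr (p - 1))" by (intro mult_left_mono *) auto
      also have "\<dots> = ennreal (C1 + 1 + C2) * ennreal (f x powr p)"
      proof -
        have "t * ((C1 + 1 + C2) * t powr (p - 1)) = (C1 + 1 + C2) * (t * t powr (p - 1))" by simp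
        also have "t * t powr (p - 1) = t powr p" using t by (simp add: powr_mult_base)
        finally show ?thesis
          using t C1(1) C2(1) by (simp add: ennreal_mult[symmetric] t_def[symmetric] del: ennreal_plus)
      qed
      finally show ?thesis .
    qed simp
    then have "(\<integral>\<^sup>+x. \<integral>\<^sup>+y. ennreal (f x * g y * norm (x - y) powr (- a)) * indicator {y. g y \<le> f x} y \<partial>lborel \<partial>lborel)
      \<le> (\<integral>\<^sup>+x. ennreal (C1 + 1 + C2) * ennreal (f x powr p) \<partial>lborel)"
      by (intro nn_integral_mono) auto
    also have "\<dots> \<le> ennreal (C1 + 1 + C2) * 1"
      by (subst nn_integral_cmult, measurable) (rule mult_left_mono[OF f1], simp)
    finally show "(\<integral>\<^sup>+x. \<integral>\<^sup>+y. ennreal (f x * g y * norm (x - y) powr (- a)) * indicator {y. g y \<le> f x} y \<partial>lborel \<partial>lborel) \<le> ennreal (C1 + 1 + C2)"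
      by simp
  qed
qed

text \<open>After normalisation the plane of pairs is cut into \<open>G y \<le> F x\<close> and
  \<open>F x \<le> G y\<close>; symmetry of the kernel turns the second half into the first with the
  roles exchanged. The norms enter through positive upper bounds \<open>A\<close> and
  \<open>B\<close>, so functions that vanish almost everywhere form no separate case.\<close>

theorem Hardy_Littlewood_Sobolev:
  fixes a :: real
  assumes "0 < a" "a < DIM('a::euclidean_space)"
  defines "p \<equiv> 2 * real DIM('a) / (2 * real DIM('a) - a)"
  shows "\<exists>C>0. \<forall>(f :: 'a \<Rightarrow> real) g A B. f \<in> borel_measurable borel \<longrightarrow> g \<in> borel_measurable borel \<longrightarrow>
    (\<forall>x. 0 \<le> f x) \<longrightarrow> (\<forall>x. 0 \<le> g x) \<longrightarrow> 0 < A \<longrightarrow> 0 < B \<longrightarrow>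
    (\<integral>\<^sup>+x. ennreal (f x powr p) \<partial>lborel) \<le> ennreal (A powr p) \<longrightarrow>
    (\<integral>\<^sup>+x. ennreal (g x powr p) \<partial>lborel) \<le> ennreal (B powr p) \<longrightarrow>
    (\<integral>\<^sup>+x. \<integral>\<^sup>+y. ennreal (f x * g y * norm (x - y) powr (- a)) \<partial>lborel \<partial>lborel) \<le> ennreal (C * A * B)"
proof -
  obtain C where C: "0 < C" "\<And>f g :: 'a \<Rightarrow> real. f \<in> borel_measurable borel \<Longrightarrow> g \<in> borel_measurable borel \<Longrightarrow>
    (\<And>x. 0 \<le> f x) \<Longrightarrow> (\<And>x. 0 \<le> g x) \<Longrightarrow>
    (\<integral>\<^sup>+x. ennreal (f x powr p) \<partial>lborel) \<le> 1 \<Longrightarrow> (\<integral>\<^sup>+x. ennreal (g x powr p) \<partial>lborel) \<le> 1 \<Longrightarrow>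
    (\<integral>\<^sup>+x. \<integral>\<^sup>+y. ennreal (f x * g y * norm (x - y) powr (- a)) * indicator {y. g y \<le> f x} y \<partial>lborel \<partial>lborel) \<le> ennreal C"
    using HLS_half[OF assms(1,2)] unfolding p_def by blast
  show ?thesis
  proof (intro exI[of _ "2 * C"] conjI allI impI)
    show "0 < 2 * C" using C by simp
  next
    fix f g :: "'a \<Rightarrow> real" and A B :: real
    assume [measurable]: "f \<in> borel_measurable borel" "g \<in> borel_measurable borel"
      and "\<forall>x. 0 \<le> f x" "\<forall>x. 0 \<le> g x" and AB: "0 < A" "0 < B"
      and fA: "(\<integral>\<^sup>+x. ennreal (f x powr p) \<partial>lborel) \<le> ennreal (A powr p)"
      and gB: "(\<integral>\<^sup>+x. ennreal (g x powr p) \<partial>lborel) \<le> ennreal (B powr p)"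
    then have nn: "\<And>x. 0 \<le> f x" "\<And>x. 0 \<le> g x" by auto
    define F where "F x = f x / A" for x
    define G where "G x = g x / B" for x
    have [measurable]: "F \<in> borel_measurable borel" "G \<in> borel_measurable borel"
      by (simp_all add: F_def[abs_def] G_def[abs_def])
    have nn': "0 \<le> F x" "0 \<le> G x" for x using nn AB by (auto simp: F_def G_def intro!: divide_nonneg_nonneg mult_nonneg_nonneg nn)
    have normalise: "(\<integral>\<^sup>+x. ennreal ((h x / c) powr p) \<partial>lborel) \<le> 1"
      if "0 < c" "\<And>x. 0 \<le> h x" "(\<integral>\<^sup>+x. ennreal (h x powr p) \<partial>lborel) \<le> ennreal (c powr p)" and [measurable]: "h \<in> borel_measurable borel"
      for h :: "'a \<Rightarrow> real" and c
    proof -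
      have "(\<integral>\<^sup>+x. ennreal ((h x / c) powr p) \<partial>lborel) = ennreal (1 / c powr p) * (\<integral>\<^sup>+x. ennreal (h x powr p) \<partial>lborel)"
        using that by (subst nn_integral_cmult[symmetric]) (auto simp: powr_divide ennreal_mult[symmetric])
      also have "\<dots> \<le> ennreal (1 / c powr p) * ennreal (c powr p)" by (intro mult_left_mono that) auto
      also have "\<dots> = 1" using that by (simp add: ennreal_mult[symmetric])
      finally show ?thesis .
    qed
    have F1: "(\<integral>\<^sup>+x. ennreal (F x powr p) \<partial>lborel) \<le> 1" unfolding F_def using AB nn fA by (intro normalise) auto
    have G1: "(\<integral>\<^sup>+x. ennreal (G x powr p) \<partial>lborel) \<le> 1" unfolding G_def using AB nn gB by (intro normalise) auto
    have "(\<integral>\<^sup>+x. \<integral>\<^sup>+y. ennreal (F x * G y * norm (x - y) powr (- a)) \<partial>lborel \<partial>lborel)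
      \<le> (\<integral>\<^sup>+x. \<integral>\<^sup>+y. ennreal (F x * G y * norm (x - y) powr (- a)) * indicator {y. G y \<le> F x} y +
             ennreal (F x * G y * norm (x - y) powr (- a)) * indicator {x. F x \<le> G y} x \<partial>lborel \<partial>lborel)"
      by (intro nn_integral_mono) (auto split: split_indicator)
    also have "\<dots> = (\<integral>\<^sup>+x. \<integral>\<^sup>+y. ennreal (F x * G y * norm (x - y) powr (- a)) * indicator {y. G y \<le> F x} y \<partial>lborel \<partial>lborel)
      + (\<integral>\<^sup>+x. \<integral>\<^sup>+y. ennreal (F x * G y * norm (x - y) powr (- a)) * indicator {x. F x \<le> G y} x \<partial>lborel \<partial>lborel)"
      by (simp add: nn_integral_add)
    also have "(\<integral>\<^sup>+x. \<integral>\<^sup>+y. ennreal (F x * G y * norm (x - y) powr (- a)) * indicator {x. F x \<le> G y} x \<partial>lborel \<partial>lborel)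
      = (\<integral>\<^sup>+y. \<integral>\<^sup>+x. ennreal (F x * G y * norm (x - y) powr (- a)) * indicator {x. F x \<le> G y} x \<partial>lborel \<partial>lborel)"
      by (rule lborel_pair.Fubini') measurable
    also have "\<dots> = (\<integral>\<^sup>+y. \<integral>\<^sup>+x. ennreal (G y * F x * norm (y - x) powr (- a)) * indicator {x. F x \<le> G y} x \<partial>lborel \<partial>lborel)"
      by (simp add: mult_ac norm_minus_commute)
    also have "(\<integral>\<^sup>+x. \<integral>\<^sup>+y. ennreal (F x * G y * norm (x - y) powr (- a)) * indicator {y. G y \<le> F x} y \<partial>lborel \<partial>lborel) + \<dots> \<le> ennreal C + ennreal C"
      by (intro add_mono C F1 G1 nn') measurable
    finally have *: "(\<integral>\<^sup>+x. \<integral>\<^sup>+y. ennreal (F x * G y * norm (x - y) powr (- a)) \<partial>lborel \<partial>lborel) \<le> ennreal (2 * C)"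
      using C by (simp add: ennreal_plus[symmetric] del: ennreal_plus)
    have "(\<integral>\<^sup>+x. \<integral>\<^sup>+y. ennreal (f x * g y * norm (x - y) powr (- a)) \<partial>lborel \<partial>lborel)
      = (\<integral>\<^sup>+x. \<integral>\<^sup>+y. ennreal (A * B) * ennreal (F x * G y * norm (x - y) powr (- a)) \<partial>lborel \<partial>lborel)"
      using AB nn' by (intro nn_integral_cong, subst ennreal_mult[symmetric]) (auto simp: F_def G_def intro!: divide_nonneg_nonneg mult_nonneg_nonneg nn)
    also have "\<dots> = ennreal (A * B) * (\<integral>\<^sup>+x. \<integral>\<^sup>+y. ennreal (F x * G y * norm (x - y) powr (- a)) \<partial>lborel \<partial>lborel)"
      by (simp add: nn_integral_cmult)
    also have "\<dots> \<le> ennreal (A * B) * ennreal (2 * C)" by (intro mult_left_mono *) auto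
    also have "\<dots> = ennreal (2 * C * A * B)" using AB C by (simp add: ennreal_mult[symmetric] mult_ac)
    finally show "(\<integral>\<^sup>+x. \<integral>\<^sup>+y. ennreal (f x * g y * norm (x - y) powr (- a)) \<partial>lborel \<partial>lborel) \<le> ennreal (2 * C * A * B)" .
  qed
qed

text \<open>The square of the Gagliardo seminorm, without a normalising factor. It is an extended
  number, so that finiteness is a statement and Tonelli and Fatou apply directly.\<close>

definition gagliardo :: "real \<Rightarrow> ('a::euclidean_space \<Rightarrow> real) \<Rightarrow> ennreal" where
  "gagliardo s u = (\<integral>\<^sup>+x. \<integral>\<^sup>+y. ennreal ((u x - u y)\<^sup>2 * norm (x - y) powr (- (real DIM('a) + 2 * s))) \<partial>lborel \<partial>lborel)"

text \<open>Averaging \<open>u x - u y\<close> over a ball around \<open>x\<close> of radius optimised against the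
  global bound \<open>P\<close> gives the Sobolev inequality without Fourier analysis: integrate over \<open>x\<close>.\<close>

lemma sobolev_pointwise:
  fixes s :: real and u :: "'a::euclidean_space \<Rightarrow> real"
  defines "p \<equiv> 2 * real DIM('a) / (real DIM('a) - 2 * s)" and "\<omega> \<equiv> unit_ball_vol (DIM('a))"
  assumes "0 < s" "2 * s < DIM('a)" and [measurable]: "u \<in> borel_measurable borel"
    and P: "0 < P" "(\<integral>\<^sup>+x. ennreal (\<bar>u x\<bar> powr p) \<partial>lborel) \<le> ennreal P"
    and E: "0 < E" "(\<integral>\<^sup>+y. ennreal ((u x - u y)\<^sup>2 * norm (x - y) powr (- (real DIM('a) + 2 * s))) \<partial>lborel) \<le> ennreal E"
  shows "\<bar>u x\<bar> powr p \<le> (2 + 2 / \<omega>) powr p * (P powr (1 - 2 / p) * E)"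
proof -
  let ?N = "real DIM('a)"
  \<comment> \<open>The two choices balance the estimate: they give
    \<open>R powr (2 * s) * E = m\<^sup>2\<close> and
    \<open>P * m powr (1 - p) = R ^ DIM('a) * m\<close>, so that after integration over the ball
    every term is a multiple of \<open>R ^ DIM('a) * m\<close>.\<close>
  define R where "R = (P powr (2 / p) / E) powr (1 / ?N)"
  define m where "m = (P powr (1 - 2 / p) * E) powr (1 / p)"
  have \<omega>: "0 < \<omega>" by (simp add: \<omega>_def)
  have p: "2 < p" "1 - 2 / p = 2 * s / ?N" using assms by (auto simp: p_def field_simps)
  have R: "0 < R" "0 < m" using P E by (auto simp: R_def m_def)
  have [measurable]: "ball x R \<in> sets borel" by simp
  have RN: "R ^ DIM('a) = P powr (2 / p) / E"
    using R P E by (simp add: R_def powr_powr powr_realpow[symmetric])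
  have mp: "m powr p = P powr (1 - 2 / p) * E"
    using p P E by (simp add: m_def powr_powr)
  have R2s: "R powr (2 * s) * E = m\<^sup>2"
  proof -
    have "R powr (2 * s) = (P powr (2 / p) / E) powr (1 - 2 / p)"
      by (simp add: R_def powr_powr p)
    also have "\<dots> = P powr ((2 / p) * (1 - 2 / p)) / E powr (1 - 2 / p)"
      using P E by (simp add: powr_divide powr_powr)
    also have "\<dots> * E = P powr ((1 - 2 / p) * (2 / p)) * E powr (2 / p)"
      using E by (simp add: powr_diff mult.commute)
    also have "\<dots> = m powr 2"
      using P E by (simp add: m_def powr_powr powr_mult)
    also have "\<dots> = m\<^sup>2" using R by (simp only: powr_numeral)
    finally show ?thesis .
  qed
  have PRm: "P * m powr (1 - p) = R ^ DIM('a) * m"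
  proof -
    have "P * m powr (1 - p) = P / (m powr p) * m" using R by (simp add: powr_diff)
    also have "P / (m powr p) = R ^ DIM('a)"
      unfolding mp RN using P E by (simp add: powr_diff)
    finally show ?thesis .
  qed
  \<comment> \<open>Each of \<open>\<bar>u x - u y\<bar>\<close> and \<open>\<bar>u y\<bar>\<close>
    is at most \<open>m\<close> plus an excess controlled by a power:
    \<open>d \<le> m + d\<^sup>2 / m\<close> for the first,
    \<open>m powr (1 - p) * \<bar>u y\<bar> powr p\<close> for the second. Inside the ball the
    kernel times \<open>R powr (?N + 2 * s)\<close> is at least 1 off the diagonal.\<close>
  have pt: "\<bar>u x\<bar> \<le> 2 * m + R powr (?N + 2 * s) / m * ((u x - u y)\<^sup>2 * norm (x - y) powr (- (?N + 2 * s))) + m powr (1 - p) * \<bar>u y\<bar> powr p"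
    if "y \<in> ball x R" for y
  proof -
    define d where "d = \<bar>u x - u y\<bar>"
    have "d \<le> m + d\<^sup>2 / m"
    proof (cases "d \<le> m")
      case False
      then have "d * m \<le> d * d" using R by (intro mult_left_mono) (auto simp: d_def)
      then have "d \<le> d\<^sup>2 / m" using R by (simp add: field_simps power2_eq_square)
      then show ?thesis using R by simp
    qed (use R in \<open>auto intro: add_increasing2\<close>)
    also have "d\<^sup>2 / m \<le> R powr (?N + 2 * s) / m * ((u x - u y)\<^sup>2 * norm (x - y) powr (- (?N + 2 * s)))"
    proof (cases "x = y")
      case False
      have "R powr (?N + 2 * s) * norm (x - y) powr (- (?N + 2 * s)) \<ge> norm (x - y) powr (?N + 2 * s) * norm (x - y) powr (- (?N + 2 * s))"
        using that assms by (intro mult_right_mono powr_mono2) (auto simp: dist_norm)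
      moreover have "norm (x - y) powr (?N + 2 * s) * norm (x - y) powr (- (?N + 2 * s)) = 1"
        using False by (simp flip: powr_add)
      ultimately have "1 * (d\<^sup>2 / m) \<le> (R powr (?N + 2 * s) * norm (x - y) powr (- (?N + 2 * s))) * (d\<^sup>2 / m)"
        using R by (intro mult_right_mono) auto
      then show ?thesis by (simp add: d_def mult_ac)
    qed (simp add: d_def)
    finally have 1: "d \<le> m + R powr (?N + 2 * s) / m * ((u x - u y)\<^sup>2 * norm (x - y) powr (- (?N + 2 * s)))" by simp
    have 2: "\<bar>u y\<bar> \<le> m + m powr (1 - p) * \<bar>u y\<bar> powr p"
    proof (cases "\<bar>u y\<bar> \<le> m")
      case False
      have "\<bar>u y\<bar> = \<bar>u y\<bar> powr p * \<bar>u y\<bar> powr (1 - p)" using False R by (simp flip: powr_add)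
      also have "\<dots> \<le> \<bar>u y\<bar> powr p * m powr (1 - p)"
        using False R p by (intro mult_left_mono powr_mono2') auto
      finally show ?thesis using R by (simp add: mult.commute)
    qed (use R in \<open>auto intro: add_increasing2\<close>)
    have "\<bar>u x\<bar> \<le> d + \<bar>u y\<bar>" unfolding d_def by linarith
    then show ?thesis using 1 2 by linarith
  qed
  have "ennreal (\<bar>u x\<bar> * (\<omega> * R ^ DIM('a))) = (\<integral>\<^sup>+y. ennreal \<bar>u x\<bar> * indicator (ball x R) y \<partial>lborel)"
    using R \<omega> by (simp add: nn_integral_cmult_indicator emeasure_ball \<omega>_def ennreal_mult)
  also have "\<dots> \<le> (\<integral>\<^sup>+y. ennreal (2 * m) * indicator (ball x R) y +
     ennreal (R powr (?N + 2 * s) / m) * ennreal ((u x - u y)\<^sup>2 * norm (x - y) powr (- (?N + 2 * s)))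
     + ennreal (m powr (1 - p)) * ennreal (\<bar>u y\<bar> powr p) \<partial>lborel)"
  proof (intro nn_integral_mono)
    fix y
    show "ennreal \<bar>u x\<bar> * indicator (ball x R) y \<le> ennreal (2 * m) * indicator (ball x R) y +
     ennreal (R powr (?N + 2 * s) / m) * ennreal ((u x - u y)\<^sup>2 * norm (x - y) powr (- (?N + 2 * s)))
     + ennreal (m powr (1 - p)) * ennreal (\<bar>u y\<bar> powr p)"
    proof (cases "y \<in> ball x R")
      case True
      show ?thesis
        using ennreal_leI[OF pt[OF True]] True R
        by (simp add: ennreal_mult[symmetric] ennreal_plus[symmetric] del: ennreal_plus mem_ball)
    qed simp
  qed
  also have "\<dots> = ennreal (2 * m) * ennreal (\<omega> * R ^ DIM('a)) +
     ennreal (R powr (?N + 2 * s) / m) * (\<integral>\<^sup>+y. ennreal ((u x - u y)\<^sup>2 * norm (x - y) powr (- (?N + 2 * s))) \<partial>lborel)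
     + ennreal (m powr (1 - p)) * (\<integral>\<^sup>+y. ennreal (\<bar>u y\<bar> powr p) \<partial>lborel)"
    by (subst nn_integral_add, measurable, subst nn_integral_add, measurable)
       (use R in \<open>simp add: nn_integral_cmult nn_integral_cmult_indicator emeasure_ball \<omega>_def\<close>)
  also have "\<dots> \<le> ennreal (2 * m) * ennreal (\<omega> * R ^ DIM('a)) + ennreal (R powr (?N + 2 * s) / m) * ennreal E + ennreal (m powr (1 - p)) * ennreal P"
    by (intro add_mono mult_left_mono order_refl P E) auto
  also have "\<dots> = ennreal (2 * m * (\<omega> * R ^ DIM('a)) + R powr (?N + 2 * s) / m * E + m powr (1 - p) * P)"
    using R P E \<omega> by (simp add: ennreal_mult[symmetric] ennreal_plus[symmetric] del: ennreal_plus)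
  also have "2 * m * (\<omega> * R ^ DIM('a)) + R powr (?N + 2 * s) / m * E + m powr (1 - p) * P = ((2 + 2 / \<omega>) * m) * (\<omega> * R ^ DIM('a))"
  proof -
    have "R powr (?N + 2 * s) / m * E = R ^ DIM('a) * (R powr (2 * s) * E) / m"
      using R by (simp add: powr_add powr_realpow)
    also have "\<dots> = R ^ DIM('a) * m" unfolding R2s using R by (simp add: power2_eq_square)
    finally show ?thesis using PRm \<omega> by (simp add: field_simps)
  qed
  finally have "\<bar>u x\<bar> * (\<omega> * R ^ DIM('a)) \<le> ((2 + 2 / \<omega>) * m) * (\<omega> * R ^ DIM('a))"
    using R \<omega> by (subst (asm) ennreal_le_iff) auto
  then have "\<bar>u x\<bar> \<le> (2 + 2 / \<omega>) * m" using R \<omega> by simp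
  then have "\<bar>u x\<bar> powr p \<le> ((2 + 2 / \<omega>) * m) powr p" using p by (intro powr_mono2) auto
  also have "\<dots> = (2 + 2 / \<omega>) powr p * (P powr (1 - 2 / p) * E)" using R \<omega> by (simp add: powr_mult mp)
  finally show ?thesis .
qed

text \<open>Integrating the pointwise bound gives \<open>P \<le> K * P powr (1 - 2 / p) * G\<close>
  for the integral \<open>P\<close>. As \<open>P\<close> is finite by hypothesis and the case
  \<open>P = 0\<close> is trivial, the power of \<open>P\<close> can be divided out.\<close>

theorem sobolev_gagliardo:
  fixes s :: real
  assumes "0 < s" "2 * s < DIM('a::euclidean_space)"
  defines "p \<equiv> 2 * real DIM('a) / (real DIM('a) - 2 * s)"
  shows "\<exists>C>0. \<forall>(u :: 'a \<Rightarrow> real) G. u \<in> borel_measurable borel \<longrightarrow>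
    (\<integral>\<^sup>+x. ennreal (\<bar>u x\<bar> powr p) \<partial>lborel) < \<infinity> \<longrightarrow> 0 \<le> G \<longrightarrow> gagliardo s u \<le> ennreal G \<longrightarrow>
    (\<integral>\<^sup>+x. ennreal (\<bar>u x\<bar> powr p) \<partial>lborel) \<le> ennreal ((C * G) powr (p / 2))"
proof -
  define K where "K = (2 + 2 / unit_ball_vol (real DIM('a))) powr p"
  have p: "2 < p" using assms by (auto simp: p_def field_simps)
  have vol: "0 < unit_ball_vol (real DIM('a))" by simp
  have "2 + 2 / unit_ball_vol (real DIM('a)) \<noteq> 0" using vol by (metis add_pos_pos divide_pos_pos less_irrefl zero_less_numeral)
  then have K: "0 < K" unfolding K_def by simp
  show ?thesis
  proof (intro exI[of _ K] conjI allI impI)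
    show "0 < K" by fact
  next
    fix u :: "'a \<Rightarrow> real" and G :: real
    assume [measurable]: "u \<in> borel_measurable borel" and fin: "(\<integral>\<^sup>+x. ennreal (\<bar>u x\<bar> powr p) \<partial>lborel) < \<infinity>"
      and G: "0 \<le> G" "gagliardo s u \<le> ennreal G"
    obtain P where P: "0 \<le> P" "(\<integral>\<^sup>+x. ennreal (\<bar>u x\<bar> powr p) \<partial>lborel) = ennreal P"
      using fin by (cases "(\<integral>\<^sup>+x. ennreal (\<bar>u x\<bar> powr p) \<partial>lborel)") auto
    have "P \<le> (K * G) powr (p / 2)"
    proof (cases "P = 0")
      case False
      then have P0: "0 < P" using P by simp
      let ?D = "\<lambda>x. \<integral>\<^sup>+y. ennreal ((u x - u y)\<^sup>2 * norm (x - y) powr (- (real DIM('a) + 2 * s))) \<partial>lborel"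
      have pt: "ennreal (\<bar>u x\<bar> powr p) \<le> ennreal (K * P powr (1 - 2 / p)) * ?D x" for x
      proof (cases "?D x")
        case (real E)
        \<comment> \<open>The pointwise estimate asks for a strictly positive bound. It is applied
          to every \<open>E'\<close> above \<open>E\<close>, and \<open>E'\<close> is then lowered
          to \<open>E\<close>, which includes \<open>E = 0\<close>.\<close>
        have *: "\<bar>u x\<bar> powr p \<le> K * P powr (1 - 2 / p) * E'" if "E < E'" for E'
          using sobolev_pointwise[of s u P E' x] that real assms P P0 unfolding p_def[symmetric] K_def[symmetric]
          by (auto simp: mult.assoc intro: ennreal_leI)
        have "\<bar>u x\<bar> powr p \<le> K * P powr (1 - 2 / p) * E"
        proof (rule field_le_epsilon)
          fix e :: real assume "0 < e"
          let ?c = "K * P powr (1 - 2 / p)"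
          have c: "0 < ?c" using K P0 by simp
          have "\<bar>u x\<bar> powr p \<le> ?c * (E + e / ?c)" using \<open>0 < e\<close> c by (intro *) simp
          also have "\<dots> = ?c * E + e" using K P0 by (simp add: distrib_left)
          finally show "\<bar>u x\<bar> powr p \<le> ?c * E + e" .
        qed
        then show ?thesis using real K by (simp add: ennreal_mult[symmetric] ennreal_leI)
      next
        case top
        then show ?thesis using K P0 by (simp add: ennreal_mult_top)
      qed
      have "ennreal P \<le> (\<integral>\<^sup>+x. ennreal (K * P powr (1 - 2 / p)) * ?D x \<partial>lborel)"
        unfolding P(2)[symmetric] by (intro nn_integral_mono pt)
      also have "\<dots> = ennreal (K * P powr (1 - 2 / p)) * gagliardo s u"
        unfolding gagliardo_def by (rule nn_integral_cmult) measurable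
      also have "\<dots> \<le> ennreal (K * P powr (1 - 2 / p)) * ennreal G" by (intro mult_left_mono G) auto
      finally have "P \<le> K * P powr (1 - 2 / p) * G" using K P G by (simp add: ennreal_mult[symmetric])
      then have "P powr (2 / p) \<le> K * G" using P0 by (simp add: powr_diff field_simps)
      then have "(P powr (2 / p)) powr (p / 2) \<le> (K * G) powr (p / 2)" using p by (intro powr_mono2) auto
      then show ?thesis using P0 p by (simp add: powr_powr)
    qed simp
    then show "(\<integral>\<^sup>+x. ennreal (\<bar>u x\<bar> powr p) \<partial>lborel) \<le> ennreal ((K * G) powr (p / 2))"
      unfolding P by (rule ennreal_leI)
  qed
qed

section \<open>The Fourier transform and the Gagliardo seminorm\<close>

lemma lborel_integral_affine:
  fixes f :: "'a::euclidean_space \<Rightarrow> 'b::{banach, second_countable_topology}"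
  assumes [measurable]: "f \<in> borel_measurable borel" and "c \<noteq> 0"
  shows "(LINT x|lborel. f x) = (\<bar>c\<bar> powr DIM('a)) *\<^sub>R (LINT x|lborel. f (t + c *\<^sub>R x))"
proof -
  have "(LINT x|lborel. f x) = (LINT x|density (distr lborel borel (\<lambda>x. t + c *\<^sub>R x)) (\<lambda>_. \<bar>c\<bar>^DIM('a)). f x)"
    using lborel_affine[OF \<open>c \<noteq> 0\<close>, of t] by simp
  also have "\<dots> = (LINT x|lborel. \<bar>c\<bar>^DIM('a) *\<^sub>R f (t + c *\<^sub>R x))"
    by (subst integral_density) (auto simp: integral_distr)
  finally show ?thesis using \<open>c \<noteq> 0\<close> by (simp add: powr_realpow)
qed

lemma borel_measurable_cnj [measurable]: "cnj \<in> borel_measurable borel"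
  by (intro borel_measurable_continuous_onI continuous_intros)

lemma integrable_pair_mult:
  fixes f g :: "'a::euclidean_space \<Rightarrow> complex"
  assumes f: "integrable lborel f" and g: "integrable lborel g"
  shows "integrable (lborel \<Otimes>\<^sub>M lborel) (\<lambda>(x, y). f x * g y)"
proof -
  have [measurable]: "f \<in> borel_measurable borel" "g \<in> borel_measurable borel"
    using f g by (auto dest: borel_measurable_integrable)
  show ?thesis
  proof (rule lborel_pair.Fubini_integrable)
    show "integrable lborel (\<lambda>x. LINT y|lborel. norm (case (x, y) of (x, y) \<Rightarrow> f x * g y))"
      using f by (simp add: norm_mult)
    show "AE x in lborel. integrable lborel (\<lambda>y. case (x, y) of (x, y) \<Rightarrow> f x * g y)"
      using g by simp
  qed measurable
qed

lemma norm_fourier_le: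
  fixes f :: "real^'n \<Rightarrow> complex"
  shows "norm (fourier f \<xi>) \<le> (2 * pi) powr (- real CARD('n) / 2) * (LINT x|lborel. norm (f x))"
proof -
  have "norm (LINT x|lborel. cis (- (x \<bullet> \<xi>)) * f x) \<le> (LINT x|lborel. norm (cis (- (x \<bullet> \<xi>)) * f x))"
    by (rule integral_norm_bound)
  also have "\<dots> = (LINT x|lborel. norm (f x))" by (simp add: norm_mult)
  finally show ?thesis by (simp add: fourier_def norm_mult mult_left_mono)
qed

lemma integrable_cis_mult:
  fixes f :: "real^'n \<Rightarrow> complex"
  assumes "integrable lborel f"
  shows "integrable lborel (\<lambda>x. cis (x \<bullet> \<xi>) * f x)" "integrable lborel (\<lambda>x. cis (- (x \<bullet> \<xi>)) * f x)"
    "integrable lborel (\<lambda>x. cis (\<xi> \<bullet> x) * f x)"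
proof -
  have [measurable]: "f \<in> borel_measurable borel" using assms by (auto dest: borel_measurable_integrable)
  have "integrable lborel (\<lambda>x. cis (g x) * f x)" if [measurable]: "g \<in> borel_measurable borel" for g :: "real^'n \<Rightarrow> real"
    by (rule Bochner_Integration.integrable_bound[OF assms]) (measurable, simp add: norm_mult)
  then show "integrable lborel (\<lambda>x. cis (x \<bullet> \<xi>) * f x)" "integrable lborel (\<lambda>x. cis (- (x \<bullet> \<xi>)) * f x)"
    "integrable lborel (\<lambda>x. cis (\<xi> \<bullet> x) * f x)"
    by simp_all
qed

lemma continuous_fourier:
  fixes f :: "real^'n \<Rightarrow> complex"
  assumes f: "integrable lborel f"
  shows "continuous_on UNIV (fourier f)"
proof -
  have [measurable]: "f \<in> borel_measurable borel" using f by (auto dest: borel_measurable_integrable)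
  have "(\<lambda>n. LINT x|lborel. cis (- (x \<bullet> X n)) * f x) \<longlonglongrightarrow> (LINT x|lborel. cis (- (x \<bullet> \<xi>)) * f x)"
    if "X \<longlonglongrightarrow> \<xi>" for X \<xi>
  proof (rule integral_dominated_convergence[where w="\<lambda>x. norm (f x)"])
    show "AE x in lborel. (\<lambda>n. cis (- (x \<bullet> X n)) * f x) \<longlonglongrightarrow> cis (- (x \<bullet> \<xi>)) * f x"
      using that by (intro AE_I2 tendsto_intros) 
  qed (use f in \<open>auto simp: norm_mult\<close>)
  then show ?thesis
    unfolding fourier_def[abs_def]
    by (intro continuous_on_mult_left) (simp add: continuous_on_sequentially o_def)
qed

lemma borel_measurable_fourier [measurable]:
  fixes f :: "real^'n \<Rightarrow> complex"
  assumes [measurable]: "f \<in> borel_measurable borel"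
  shows "fourier f \<in> borel_measurable borel"
  unfolding fourier_def[abs_def] by measurable

text \<open>Fubini. Below it does the work of an inversion theorem: transforms are undone only by
  pairing them with Gaussians, whose transforms are explicit.\<close>

lemma fourier_multiplication_formula:
  fixes f g :: "real^'n \<Rightarrow> complex"
  assumes f: "integrable lborel f" and g: "integrable lborel g"
  shows "(LINT \<xi>|lborel. fourier f \<xi> * g \<xi>) = (LINT x|lborel. f x * fourier g x)"
proof -
  have [measurable]: "f \<in> borel_measurable borel" "g \<in> borel_measurable borel"
    using f g by (auto dest: borel_measurable_integrable)
  let ?c = "complex_of_real ((2 * pi) powr (- real CARD('n) / 2))"
  have int: "integrable (lborel \<Otimes>\<^sub>M lborel) (case_prod (\<lambda>x \<xi>. cis (- (x \<bullet> \<xi>)) * (f x * g \<xi>)))"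
    by (rule Bochner_Integration.integrable_bound[OF integrable_pair_mult[OF f g]]) (auto simp: norm_mult)
  have "(LINT \<xi>|lborel. fourier f \<xi> * g \<xi>) = (LINT \<xi>|lborel. ?c * (LINT x|lborel. cis (- (x \<bullet> \<xi>)) * (f x * g \<xi>)))"
  proof (rule Bochner_Integration.integral_cong[OF refl])
    fix \<xi>
    have "(LINT x|lborel. cis (- (x \<bullet> \<xi>)) * (f x * g \<xi>)) = (LINT x|lborel. cis (- (x \<bullet> \<xi>)) * f x) * g \<xi>"
      by (simp add: mult.assoc[symmetric])
    then show "fourier f \<xi> * g \<xi> = ?c * (LINT x|lborel. cis (- (x \<bullet> \<xi>)) * (f x * g \<xi>))"
      by (simp add: fourier_def)
  qed
  also have "\<dots> = ?c * (LINT \<xi>|lborel. LINT x|lborel. cis (- (x \<bullet> \<xi>)) * (f x * g \<xi>))" by simp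
  also have "(LINT \<xi>|lborel. LINT x|lborel. cis (- (x \<bullet> \<xi>)) * (f x * g \<xi>)) = (LINT x|lborel. LINT \<xi>|lborel. cis (- (x \<bullet> \<xi>)) * (f x * g \<xi>))"
    by (rule lborel_pair.Fubini_integral[OF int])
  also have "?c * \<dots> = (LINT x|lborel. ?c * (LINT \<xi>|lborel. cis (- (x \<bullet> \<xi>)) * (f x * g \<xi>)))" by simp
  also have "\<dots> = (LINT x|lborel. f x * fourier g x)"
  proof (rule Bochner_Integration.integral_cong[OF refl])
    fix x
    have "(LINT \<xi>|lborel. cis (- (x \<bullet> \<xi>)) * (f x * g \<xi>)) = (LINT \<xi>|lborel. f x * (cis (- (\<xi> \<bullet> x)) * g \<xi>))"
      by (simp add: mult_ac inner_commute)
    also have "\<dots> = f x * (LINT \<xi>|lborel. cis (- (\<xi> \<bullet> x)) * g \<xi>)" by simp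
    finally show "?c * (LINT \<xi>|lborel. cis (- (x \<bullet> \<xi>)) * (f x * g \<xi>)) = f x * fourier g x"
      by (simp add: fourier_def)
  qed
  finally show ?thesis .
qed

lemma fourier_gaussian:
  fixes \<xi> :: "real^'n"
  assumes "0 < c"
  shows "fourier (\<lambda>x. of_real (exp (- (c * (norm x)\<^sup>2)))) \<xi> = of_real ((2 * c) powr (- real CARD('n) / 2) * exp (- ((norm \<xi>)\<^sup>2 / (4 * c))))"
proof -
  have "(2 * pi) powr (- real CARD('n) / 2) * (pi / c) powr (real CARD('n) / 2) = (2 * c) powr (- real CARD('n) / 2)"
    using assms by (simp add: powr_minus powr_divide powr_mult field_simps)
  then show ?thesis
    unfolding fourier_def gaussian_char[OF assms] by (simp flip: of_real_mult mult.assoc)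
qed

lemma fourier_cnj:
  fixes f :: "real^'n \<Rightarrow> complex"
  shows "cnj (fourier f \<xi>) = fourier (\<lambda>x. cnj (f (- x))) \<xi>"
proof (cases "f \<in> borel_measurable borel")
  case True
  then have [measurable]: "f \<in> borel_measurable borel" .
  have "cnj (LINT x|lborel. cis (- (x \<bullet> \<xi>)) * f x) = (LINT x|lborel. cis (x \<bullet> \<xi>) * cnj (f x))"
    by (subst Bochner_Integration.integral_cnj[symmetric]) (simp add: cis_cnj)
  also have "\<dots> = (LINT x|lborel. cis (- (x \<bullet> \<xi>)) * cnj (f (- x)))"
    by (subst lborel_integral_affine[of _ "-1" 0]) simp_all
  finally show ?thesis by (simp add: fourier_def)
next
  \<comment> \<open>If \<open>f\<close> is not measurable, neither integrand is integrable, since a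
    unimodular factor and a reflection can be undone; both transforms then take the default value
    0.\<close>
  case False
  then have 1: "\<not> integrable lborel (\<lambda>x. cis (- (x \<bullet> \<xi>)) * f x)"
  proof (rule contrapos_nn)
    assume "integrable lborel (\<lambda>x. cis (- (x \<bullet> \<xi>)) * f x)"
    then have [measurable]: "(\<lambda>x. cis (- (x \<bullet> \<xi>)) * f x) \<in> borel_measurable borel"
      by (auto dest: borel_measurable_integrable)
    have "(\<lambda>x. cis (x \<bullet> \<xi>) * (cis (- (x \<bullet> \<xi>)) * f x)) \<in> borel_measurable borel" by measurable
    then show "f \<in> borel_measurable borel" by (simp add: mult.assoc[symmetric] cis_mult)
  qed
  have 2: "\<not> integrable lborel (\<lambda>x. cis (- (x \<bullet> \<xi>)) * cnj (f (- x)))"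
  proof
    assume "integrable lborel (\<lambda>x. cis (- (x \<bullet> \<xi>)) * cnj (f (- x)))"
    then have [measurable]: "(\<lambda>x. cis (- (x \<bullet> \<xi>)) * cnj (f (- x))) \<in> borel_measurable borel"
      by (auto dest: borel_measurable_integrable)
    have "(\<lambda>x. cis (x \<bullet> \<xi>) * (cis (- (x \<bullet> \<xi>)) * cnj (f (- x)))) \<in> borel_measurable borel" by measurable
    then have [measurable]: "(\<lambda>x. cnj (f (- x))) \<in> borel_measurable borel" by (simp add: mult.assoc[symmetric] cis_mult)
    have "(\<lambda>x. cnj ((\<lambda>x. cnj (f (- x))) (- x))) \<in> borel_measurable borel" by measurable
    then show False using False by simp
  qed
  show ?thesis using 1 2 by (simp add: fourier_def not_integrable_integral_eq)
qed

text \<open>A Gaussian damping factor makes the multiplication formula applicable and turns the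
  damped integral into the pairing of \<open>f\<close> with a Gaussian average of
  \<open>cnj f\<close>. As the damping disappears, the averages converge to \<open>cnj f\<close> by
  continuity, under the bound \<open>B\<close>.\<close>

theorem plancherel:
  fixes f :: "real^'n \<Rightarrow> complex"
  assumes cont: "continuous_on UNIV f" and B: "\<And>x. norm (f x) \<le> B" and f: "integrable lborel f"
  shows "(\<integral>\<^sup>+\<xi>. ennreal ((norm (fourier f \<xi>))\<^sup>2) \<partial>lborel) = (\<integral>\<^sup>+x. ennreal ((norm (f x))\<^sup>2) \<partial>lborel)"
proof -
  have [measurable]: "f \<in> borel_measurable borel" using f by (auto dest: borel_measurable_integrable)
  let ?g = "\<lambda>x. complex_of_real (exp (- (norm (x::real^'n))\<^sup>2))"
  define N where "N = real CARD('n)"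
  define L where "L = (2 * pi) powr (- N / 2) * (LINT x|lborel. norm (f x))"
  have L: "norm (fourier f \<xi>) \<le> L" for \<xi> unfolding L_def N_def by (rule norm_fourier_le)
  have g_int: "integrable lborel ?g" using integrable_gaussian[of 1, where 'a="real^'n"] by (auto intro: integrable_of_real)
  have g_val: "(LINT x|lborel. ?g x) = of_real (pi powr (N / 2))"
    using gaussian_char[of 1 "0::real^'n"] by (simp add: N_def)
  \<comment> \<open>The average of \<open>cnj f\<close> around \<open>x\<close> with respect to a
    Gaussian of width \<open>e\<close>; the factor \<open>pi powr (- N / 2)\<close> makes the total
    mass 1.\<close>
  define H where "H e x = of_real (pi powr (- N / 2)) * (LINT z|lborel. cnj (f (x + e *\<^sub>R z)) * ?g z)" for e :: real and x
  have regularised: "(LINT \<xi>|lborel. of_real ((norm (fourier f \<xi>))\<^sup>2 * exp (- (e\<^sup>2 / 4 * (norm \<xi>)\<^sup>2)))) = (LINT x|lborel. f x * H e x)" if "0 < e" for e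
  proof -
    define E where "E = (\<lambda>\<xi>::real^'n. complex_of_real (exp (- (e\<^sup>2 / 4 * (norm \<xi>)\<^sup>2))))"
    have E: "integrable lborel E" unfolding E_def using that integrable_gaussian[of "e\<^sup>2 / 4", where 'a="real^'n"] by (auto intro: integrable_of_real)
    have [measurable]: "E \<in> borel_measurable borel" unfolding E_def by measurable
    have EF: "integrable lborel (\<lambda>\<xi>. E \<xi> * cnj (fourier f \<xi>))"
      by (rule Bochner_Integration.integrable_bound[where f="\<lambda>\<xi>. L *\<^sub>R E \<xi>"])
         (use E L in \<open>auto simp: norm_mult mult.commute[of L] abs_of_nonneg[OF order_trans[OF norm_ge_zero L]] intro!: mult_left_mono\<close>)
    \<comment> \<open>The multiplication formula is used a second time here, to move the transform
      from \<open>f\<close> to a modulated Gaussian; modulation becomes translation, which centres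
      the average at \<open>x\<close>.\<close>
    have F: "fourier (\<lambda>\<xi>. E \<xi> * cnj (fourier f \<xi>)) x = H e x" for x
    proof -
      let ?c = "complex_of_real ((2 * pi) powr (- real CARD('n) / 2))"
      have f': "integrable lborel (\<lambda>y. cnj (f (- y)))"
      proof -
        have "integrable lborel (\<lambda>y. f (- y))"
        proof (rule integrableI_bounded)
          show "(\<integral>\<^sup>+ x. ennreal (norm (f (- x))) \<partial>lborel) < \<infinity>"
            using nn_integral_lborel_uminus[of "\<lambda>x. ennreal (norm (f x))"] f by (simp add: integrable_iff_bounded)
        qed simp
        then show ?thesis by simp
      qed
      have "fourier (\<lambda>\<xi>. E \<xi> * cnj (fourier f \<xi>)) x = ?c * (LINT \<xi>|lborel. fourier (\<lambda>y. cnj (f (- y))) \<xi> * (cis (- (\<xi> \<bullet> x)) * E \<xi>))"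
        unfolding fourier_def[of "\<lambda>\<xi>. E \<xi> * cnj (fourier f \<xi>)" x] by (simp add: fourier_cnj mult_ac)
      also have "\<dots> = ?c * (LINT y|lborel. cnj (f (- y)) * fourier (\<lambda>\<xi>. cis (- (\<xi> \<bullet> x)) * E \<xi>) y)"
        by (subst fourier_multiplication_formula[OF f' integrable_cis_mult(2)[OF E]]) rule
      also have "\<dots> = ?c * (LINT y|lborel. cnj (f (- y)) * fourier E (y + x))"
        by (simp add: fourier_def cis_mult mult.assoc[symmetric] inner_add_right)
      also have "\<dots> = ?c * (LINT y|lborel. cnj (f y) * fourier E (x - y))"
        by (subst lborel_integral_affine[of _ "-1" 0]) simp_all
      also have "\<dots> = ?c * (LINT y|lborel. cnj (f y) * of_real ((e\<^sup>2 / 2) powr (- N / 2) * exp (- ((norm (x - y))\<^sup>2 / e\<^sup>2))))"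
        using that fourier_gaussian[where c="e\<^sup>2 / 4" and 'n='n] by (simp add: E_def N_def)
      also have "\<dots> = ?c * (e powr N *\<^sub>R (LINT z|lborel. cnj (f (x + e *\<^sub>R z)) * of_real ((e\<^sup>2 / 2) powr (- N / 2) * exp (- ((norm (x - (x + e *\<^sub>R z)))\<^sup>2 / e\<^sup>2)))))"
        using that by (subst lborel_integral_affine[of _ e x]) (simp_all add: N_def)
      also have "\<dots> = ?c * (e powr N *\<^sub>R (LINT z|lborel. of_real ((e\<^sup>2 / 2) powr (- N / 2)) * (cnj (f (x + e *\<^sub>R z)) * ?g z)))"
        using that by (simp add: power_mult_distrib mult_ac)
      also have "\<dots> = (?c * of_real (e powr N) * of_real ((e\<^sup>2 / 2) powr (- N / 2))) * (LINT z|lborel. cnj (f (x + e *\<^sub>R z)) * ?g z)"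
        by (simp only: integral_mult_right_zero scaleR_conv_of_real mult.assoc)
      also have "?c * of_real (e powr N) * of_real ((e\<^sup>2 / 2) powr (- N / 2)) = of_real (pi powr (- N / 2))"
      proof -
        have "(e\<^sup>2) powr (- N / 2) = e powr (- N)" using that by (simp add: powr_powr flip: powr_numeral)
        then have "(2 * pi) powr (- N / 2) * e powr N * (e\<^sup>2 / 2) powr (- N / 2) = pi powr (- N / 2)"
          using that by (simp add: powr_divide powr_mult powr_minus field_simps)
        then show ?thesis by (simp add: N_def flip: of_real_mult)
      qed
      finally show ?thesis by (simp add: H_def)
    qed
    have "(LINT \<xi>|lborel. of_real ((norm (fourier f \<xi>))\<^sup>2 * exp (- (e\<^sup>2 / 4 * (norm \<xi>)\<^sup>2)))) = (LINT \<xi>|lborel. fourier f \<xi> * (E \<xi> * cnj (fourier f \<xi>)))"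
      by (intro Bochner_Integration.integral_cong refl) (simp add: E_def complex_norm_square mult_ac del: of_real_power)
    also have "\<dots> = (LINT x|lborel. f x * H e x)"
      by (subst fourier_multiplication_formula[OF f EF]) (simp add: F)
    finally show ?thesis .
  qed
  define e where "e n = 1 / real (Suc n)" for n
  have e: "e \<longlonglongrightarrow> 0" "\<And>n. 0 < e n" "\<And>n. e (Suc n) \<le> e n"
  proof -
    show "e \<longlonglongrightarrow> 0" unfolding e_def by (rule LIMSEQ_Suc[OF lim_1_over_n, unfolded of_nat_Suc[symmetric]])
    show "0 < e n" for n by (simp add: e_def)
    show "e (Suc n) \<le> e n" for n unfolding e_def by (intro divide_left_mono) auto
  qed
  have Hint: "norm (H e x) \<le> B" for e x
  proof -
    have "norm (LINT z|lborel. cnj (f (x + e *\<^sub>R z)) * ?g z) \<le> (LINT z|lborel. norm (cnj (f (x + e *\<^sub>R z)) * ?g z))"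
      by (rule integral_norm_bound)
    also have "\<dots> \<le> (LINT z|lborel. B * exp (- (norm (z::real^'n))\<^sup>2))"
    proof (rule integral_mono_AE')
      show "integrable lborel (\<lambda>z::real^'n. B * exp (- (norm z)\<^sup>2))" using integrable_gaussian[of 1, where 'a="real^'n"] by simp
      show "AE z in lborel. norm (cnj (f (x + e *\<^sub>R z)) * ?g z) \<le> B * exp (- (norm z)\<^sup>2)"
        by (intro AE_I2) (simp add: norm_mult B mult_right_mono)
    qed (use order_trans[OF norm_ge_zero B] in \<open>auto intro!: AE_I2\<close>)
    also have "\<dots> = B * pi powr (N / 2)"
      using nn_integral_gaussian[of 1, where 'a="real^'n"] by (simp add: N_def integral_eq_nn_integral)
    finally show ?thesis
      by (simp add: H_def norm_mult norm_inverse powr_minus field_simps norm_divide)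
  qed
  have Hlim: "(\<lambda>n. H (e n) x) \<longlonglongrightarrow> cnj (f x)" for x
  proof -
    have "(\<lambda>n. LINT z|lborel. cnj (f (x + e n *\<^sub>R z)) * ?g z) \<longlonglongrightarrow> (LINT z|lborel. cnj (f x) * ?g z)"
    proof (rule integral_dominated_convergence[where w="\<lambda>z. B * exp (- (norm z)\<^sup>2)"])
      show "integrable lborel (\<lambda>z::real^'n. B * exp (- (norm z)\<^sup>2))" using integrable_gaussian[of 1, where 'a="real^'n"] by simp
      show "AE z in lborel. norm (cnj (f (x + e n *\<^sub>R z)) * ?g z) \<le> B * exp (- (norm z)\<^sup>2)" for n
        by (intro AE_I2) (simp add: norm_mult B mult_right_mono)
      show "AE z in lborel. (\<lambda>n. cnj (f (x + e n *\<^sub>R z)) * ?g z) \<longlonglongrightarrow> cnj (f x) * ?g z"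
      proof (intro AE_I2 tendsto_intros)
        fix z :: "real^'n"
        have "(\<lambda>n. x + e n *\<^sub>R z) \<longlonglongrightarrow> x + 0 *\<^sub>R z" by (intro tendsto_intros e)
        then have "(\<lambda>n. x + e n *\<^sub>R z) \<longlonglongrightarrow> x" by simp
        then show "(\<lambda>n. f (x + e n *\<^sub>R z)) \<longlonglongrightarrow> f x"
          by (rule continuous_on_tendsto_compose[OF cont]) auto
      qed
    qed measurable
    then have "(\<lambda>n. H (e n) x) \<longlonglongrightarrow> of_real (pi powr (- N / 2)) * (LINT z|lborel. cnj (f x) * ?g z)"
      unfolding H_def by (intro tendsto_intros)
    also have "of_real (pi powr (- N / 2)) * (LINT z|lborel. cnj (f x) * ?g z) = cnj (f x)"
      using g_val by (simp add: powr_minus)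
    finally show ?thesis .
  qed
  have H_meas [measurable]: "H e \<in> borel_measurable borel" for e unfolding H_def[abs_def] by measurable
  have lim: "(\<lambda>n. LINT x|lborel. f x * H (e n) x) \<longlonglongrightarrow> (LINT x|lborel. f x * cnj (f x))"
  proof (rule integral_dominated_convergence[where w="\<lambda>x. norm (f x) * B"])
    show "AE x in lborel. (\<lambda>n. f x * H (e n) x) \<longlonglongrightarrow> f x * cnj (f x)"
      by (intro AE_I2 tendsto_intros Hlim)
  qed (use f Hint in \<open>auto simp: norm_mult intro!: mult_left_mono\<close>)
  have f2: "integrable lborel (\<lambda>x. (norm (f x))\<^sup>2)"
    by (rule Bochner_Integration.integrable_bound[where f="\<lambda>x. B * norm (f x)"])
       (use f B in \<open>auto simp: power2_eq_square abs_mult abs_of_nonneg[OF order_trans[OF norm_ge_zero B]] intro!: mult_right_mono\<close>)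
  have R: "(LINT x|lborel. f x * cnj (f x)) = of_real (LINT x|lborel. (norm (f x))\<^sup>2)"
    using f2 by (simp add: complex_norm_square[symmetric] del: of_real_power)
  have int_e: "integrable lborel (\<lambda>\<xi>. (norm (fourier f \<xi>))\<^sup>2 * exp (- (e\<^sup>2 / 4 * (norm \<xi>)\<^sup>2)))" if "0 < e" for e
    by (rule Bochner_Integration.integrable_bound[where f="\<lambda>\<xi>. L\<^sup>2 * exp (- (e\<^sup>2 / 4 * (norm \<xi>)\<^sup>2))"])
       (use that integrable_gaussian[of "e\<^sup>2/4", where 'a="real^'n"] L in \<open>auto intro!: mult_right_mono power_mono\<close>)
  have nn_e: "(\<integral>\<^sup>+\<xi>. ennreal ((norm (fourier f \<xi>))\<^sup>2 * exp (- ((e n)\<^sup>2 / 4 * (norm \<xi>)\<^sup>2))) \<partial>lborel) = ennreal (Re (LINT x|lborel. f x * H (e n) x))" for n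
  proof -
    have "(LINT x|lborel. f x * H (e n) x) = of_real (LINT \<xi>|lborel. (norm (fourier f \<xi>))\<^sup>2 * exp (- ((e n)\<^sup>2 / 4 * (norm \<xi>)\<^sup>2)))"
      unfolding regularised[OF e(2)[of n], symmetric] by (rule integral_of_real) (rule int_e[OF e(2)])
    moreover have "(\<integral>\<^sup>+\<xi>. ennreal ((norm (fourier f \<xi>))\<^sup>2 * exp (- ((e n)\<^sup>2 / 4 * (norm \<xi>)\<^sup>2))) \<partial>lborel)
        = ennreal (LINT \<xi>|lborel. (norm (fourier f \<xi>))\<^sup>2 * exp (- ((e n)\<^sup>2 / 4 * (norm \<xi>)\<^sup>2)))"
      by (rule nn_integral_eq_integral[OF int_e[OF e(2)[of n]]]) simp
    ultimately show ?thesis by simp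
  qed
  \<comment> \<open>The damping increases to 1 as \<open>e n\<close> decreases, so monotone
    convergence applies before the limit is known to be finite.\<close>
  have "(\<lambda>n. \<integral>\<^sup>+\<xi>. ennreal ((norm (fourier f \<xi>))\<^sup>2 * exp (- ((e n)\<^sup>2 / 4 * (norm \<xi>)\<^sup>2))) \<partial>lborel) \<longlonglongrightarrow> (\<integral>\<^sup>+\<xi>. ennreal ((norm (fourier f \<xi>))\<^sup>2) \<partial>lborel)"
  proof (rule nn_integral_LIMSEQ)
    show "incseq (\<lambda>n \<xi>. ennreal ((norm (fourier f \<xi>))\<^sup>2 * exp (- ((e n)\<^sup>2 / 4 * (norm \<xi>)\<^sup>2))))"
      unfolding incseq_Suc_iff le_fun_def
      by (auto intro!: ennreal_leI mult_left_mono mult_right_mono power_mono e less_imp_le[OF e(2)] simp: divide_right_mono)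
    show "(\<lambda>n. ennreal ((norm (fourier f \<xi>))\<^sup>2 * exp (- ((e n)\<^sup>2 / 4 * (norm \<xi>)\<^sup>2)))) \<longlonglongrightarrow> ennreal ((norm (fourier f \<xi>))\<^sup>2)" for \<xi>
    proof (rule tendsto_ennrealI)
      have "(\<lambda>n. (norm (fourier f \<xi>))\<^sup>2 * exp (- ((e n)\<^sup>2 / 4 * (norm \<xi>)\<^sup>2))) \<longlonglongrightarrow> (norm (fourier f \<xi>))\<^sup>2 * exp (- (0\<^sup>2 / 4 * (norm \<xi>)\<^sup>2))"
        by (intro tendsto_intros e) simp
      then show "(\<lambda>n. (norm (fourier f \<xi>))\<^sup>2 * exp (- ((e n)\<^sup>2 / 4 * (norm \<xi>)\<^sup>2))) \<longlonglongrightarrow> (norm (fourier f \<xi>))\<^sup>2" by simp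
    qed
  qed measurable
  moreover have "(\<lambda>n. \<integral>\<^sup>+\<xi>. ennreal ((norm (fourier f \<xi>))\<^sup>2 * exp (- ((e n)\<^sup>2 / 4 * (norm \<xi>)\<^sup>2))) \<partial>lborel) \<longlonglongrightarrow> ennreal (LINT x|lborel. (norm (f x))\<^sup>2)"
    unfolding nn_e using tendsto_ennrealI[OF tendsto_Re[OF lim]] unfolding R by simp
  ultimately have "(\<integral>\<^sup>+\<xi>. ennreal ((norm (fourier f \<xi>))\<^sup>2) \<partial>lborel) = ennreal (LINT x|lborel. (norm (f x))\<^sup>2)"
    by (rule LIMSEQ_unique)
  also have "\<dots> = (\<integral>\<^sup>+x. ennreal ((norm (f x))\<^sup>2) \<partial>lborel)"
    by (rule nn_integral_eq_integral[symmetric, OF f2]) auto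
  finally show ?thesis .
qed

text \<open>The ratio between the Gagliardo form and its Fourier side. The integral in it stays
  unevaluated: its positivity and finiteness suffice, and the constant cancels when the inner
  product of the energy space is formed.\<close>

definition gagliardo_const :: "real \<Rightarrow> real \<Rightarrow> real" where
  "gagliardo_const N s = 2 * pi powr (N / 2) / Gamma (N / 2 + s) *
     enn2real (\<integral>\<^sup>+t\<in>{0<..}. ennreal (t powr (s - 1) * (1 - exp (- (1 / (4 * t))))) \<partial>lborel)"

text \<open>On the unit interval the integrand is at most \<open>t powr (s - 1)\<close>, integrable
  for \<open>0 < s\<close>. Beyond 1 the bound \<open>1 - exp (- x) \<le> x\<close> leaves
  \<open>t powr (s - 2)\<close>, integrable for \<open>s < 1\<close>; the reciprocal carries it back
  to the unit interval.\<close>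

lemma gagliardo_const_integral:
  assumes "0 < s" "s < 1"
  shows "(\<integral>\<^sup>+t\<in>{0<..}. ennreal (t powr (s - 1) * (1 - exp (- (1 / (4 * t))))) \<partial>lborel) < \<infinity>" (is "?I < \<infinity>")
    and "0 < (\<integral>\<^sup>+t\<in>{0<..}. ennreal (t powr (s - 1) * (1 - exp (- (1 / (4 * t))))) \<partial>lborel)"
proof -
  let ?f = "\<lambda>t::real. t powr (s - 2) * indicator {1<..} t"
  have near: "(\<integral>\<^sup>+t\<in>{0<..}. ennreal (t powr (r - 1) * indicator {..1} t) \<partial>lborel) < \<infinity>" if "0 < r" for r :: real
  proof -
    have "(\<integral>\<^sup>+t\<in>{0<..}. ennreal (t powr (r - 1) * indicator {..1} t) \<partial>lborel)
        \<le> (\<integral>\<^sup>+t. ennreal (exp 1) * (ennreal (t powr (r - 1) * exp (- (1 * t))) * indicator {0<..} t) \<partial>lborel)"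
    proof (intro nn_integral_mono)
      fix t :: real
      have "t powr (r - 1) * 1 \<le> t powr (r - 1) * (exp 1 * exp (- t))" if "t \<le> 1"
        using that by (intro mult_left_mono) (auto simp flip: exp_add)
      then show "ennreal (t powr (r - 1) * indicator {..1} t) * indicator {0<..} t
          \<le> ennreal (exp 1) * (ennreal (t powr (r - 1) * exp (- (1 * t))) * indicator {0<..} t)"
        by (auto split: split_indicator simp: ennreal_mult[symmetric] mult_ac intro!: ennreal_leI)
    qed
    also have "\<dots> = ennreal (exp 1) * ennreal (Gamma r * 1 powr (- r))"
      using that by (subst nn_integral_cmult) (simp_all add: nn_integral_Gamma[of r 1, simplified])
    finally show ?thesis by (simp add: ennreal_mult_less_top order_le_less_trans)
  qed
  have "?I \<le> (\<integral>\<^sup>+t. ennreal (t powr (s - 1) * indicator {..1} t) * indicator {0<..} t + ennreal (?f t) * indicator {0<..} t \<partial>lborel)"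
  proof (intro nn_integral_mono)
    fix t :: real
    show "ennreal (t powr (s - 1) * (1 - exp (- (1 / (4 * t))))) * indicator {0<..} t
      \<le> ennreal (t powr (s - 1) * indicator {..1} t) * indicator {0<..} t + ennreal (?f t) * indicator {0<..} t"
    proof (cases "0 < t")
      case True
      show ?thesis
      proof (cases "t \<le> 1")
        case t1: True
        have "t powr (s - 1) * (1 - exp (- (1 / (4 * t)))) \<le> t powr (s - 1) * 1" by (intro mult_left_mono) auto
        then show ?thesis using True t1 by (auto intro!: ennreal_leI)
      next
        case False
        have "1 - exp (- (1 / (4 * t))) \<le> 1 / (4 * t)" using exp_ge_add_one_self[of "- (1 / (4 * t))"] by linarith
        also have "\<dots> \<le> 1 / t" using True by (simp add: field_simps)
        finally have "t powr (s - 1) * (1 - exp (- (1 / (4 * t)))) \<le> t powr (s - 1) * (1 / t)" by (intro mult_left_mono) auto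
        also have "\<dots> = t powr (s - 1 - 1)" using True by (subst powr_diff) simp
        finally show ?thesis using True False by (auto intro!: ennreal_leI)
      qed
    qed simp
  qed
  also have "\<dots> = (\<integral>\<^sup>+t\<in>{0<..}. ennreal (t powr (s - 1) * indicator {..1} t) \<partial>lborel) + (\<integral>\<^sup>+t\<in>{0<..}. ennreal (?f t) \<partial>lborel)"
    by (rule nn_integral_add) measurable
  also have "(\<integral>\<^sup>+t\<in>{0<..}. ennreal (?f t) \<partial>lborel) = (\<integral>\<^sup>+t\<in>{0<..}. ennreal (?f (1 / t) / t\<^sup>2) \<partial>lborel)"
    by (rule nn_integral_reciprocal) measurable
  also have "\<dots> \<le> (\<integral>\<^sup>+t\<in>{0<..}. ennreal (t powr ((1 - s) - 1) * indicator {..1} t) \<partial>lborel)"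
  proof (intro nn_integral_mono)
    fix t :: real
    have "(1 / t) powr (s - 2) / t\<^sup>2 = t powr ((1 - s) - 1)" if "0 < t"
    proof -
      have "(1 / t) powr (s - 2) = t powr (2 - s)"
        using that by (simp add: powr_divide powr_diff)
      moreover have "t\<^sup>2 = t powr 2" using that by simp
      ultimately show ?thesis by (simp only: powr_diff[symmetric]) simp
    qed
    then show "ennreal (?f (1 / t) / t\<^sup>2) * indicator {0<..} t \<le> ennreal (t powr ((1 - s) - 1) * indicator {..1} t) * indicator {0<..} t"
      by (auto split: split_indicator simp: less_divide_eq)
  qed
  finally show "?I < \<infinity>" using near[of s] near[of "1 - s"] assms by (simp add: order_le_less_trans)
  show "0 < ?I"
  proof (rule ccontr)
    assume "\<not> 0 < ?I"
    then have "?I = 0" by (simp add: not_less)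
    then have "AE t in lborel. ennreal (t powr (s - 1) * (1 - exp (- (1 / (4 * t))))) * indicator {0<..} t = 0"
      by (subst (asm) nn_integral_0_iff_AE) measurable
    then have "AE t in lborel. t \<notin> {0::real<..<1}"
      by eventually_elim (auto split: split_indicator_asm simp: ennreal_eq_0_iff mult_le_0_iff)
    then have "{0::real<..<1} \<in> null_sets lborel"
      by (subst AE_iff_null_sets) auto
    then show False by (simp add: null_sets_def)
  qed
qed

lemma gagliardo_const_pos:
  assumes "0 < s" "s < 1" "0 \<le> N"
  shows "0 < gagliardo_const N s"
proof -
  have "0 < Gamma (N / 2 + s)" using assms by (intro Gamma_real_pos) (simp add: add_nonneg_pos)
  moreover have "0 < enn2real (\<integral>\<^sup>+t\<in>{0<..}. ennreal (t powr (s - 1) * (1 - exp (- (1 / (4 * t))))) \<partial>lborel)"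
    using gagliardo_const_integral[OF assms(1,2)] by (simp add: enn2real_positive_iff)
  ultimately show ?thesis by (simp add: gagliardo_const_def)
qed

lemma nn_integral_cos_gaussian:
  fixes \<xi> :: "'a::euclidean_space"
  assumes "0 < t"
  shows "(\<integral>\<^sup>+h. ennreal ((2 - 2 * cos (h \<bullet> \<xi>)) * exp (- (t * (norm h)\<^sup>2))) \<partial>lborel)
    = ennreal (2 * (pi / t) powr (DIM('a) / 2) * (1 - exp (- ((norm \<xi>)\<^sup>2 / (4 * t)))))"
proof -
  have g: "integrable lborel (\<lambda>x::'a. exp (- (t * (norm x)\<^sup>2)))" by (rule integrable_gaussian[OF assms])
  have gc: "integrable lborel (\<lambda>x::'a. cos (x \<bullet> \<xi>) * exp (- (t * (norm x)\<^sup>2)))"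
    by (rule Bochner_Integration.integrable_bound[OF g]) (auto simp: abs_mult mult_left_le_one_le)
  have gcis: "integrable lborel (\<lambda>x::'a. cis (- (x \<bullet> \<xi>)) * of_real (exp (- (t * (norm x)\<^sup>2))))"
    by (rule Bochner_Integration.integrable_bound[OF g]) (auto simp: norm_mult)
  have c: "(LINT x|lborel. cos (x \<bullet> \<xi>) * exp (- (t * (norm x)\<^sup>2))) = (pi / t) powr (DIM('a) / 2) * exp (- ((norm \<xi>)\<^sup>2 / (4 * t)))"
  proof -
    have "(LINT x|lborel. cos (x \<bullet> \<xi>) * exp (- (t * (norm x)\<^sup>2))) = (LINT x|lborel. Re (cis (- (x \<bullet> \<xi>)) * of_real (exp (- (t * (norm x)\<^sup>2)))))"
      by simp
    also have "\<dots> = Re (LINT x|lborel. cis (- (x \<bullet> \<xi>)) * of_real (exp (- (t * (norm x)\<^sup>2))))"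
      by (rule integral_Re[OF gcis])
    finally show ?thesis unfolding gaussian_char[OF assms] by simp
  qed
  have c0: "(LINT x|lborel. exp (- (t * (norm (x::'a))\<^sup>2))) = (pi / t) powr (DIM('a) / 2)"
    by (subst integral_eq_nn_integral) (auto simp: nn_integral_gaussian[OF assms])
  have "(\<integral>\<^sup>+h. ennreal ((2 - 2 * cos (h \<bullet> \<xi>)) * exp (- (t * (norm h)\<^sup>2))) \<partial>lborel)
     = ennreal (LINT h|lborel. 2 * exp (- (t * (norm h)\<^sup>2)) - 2 * (cos (h \<bullet> \<xi>) * exp (- (t * (norm h)\<^sup>2))))"
    using g gc by (subst nn_integral_eq_integral[symmetric]) (auto simp: algebra_simps intro!: AE_I2)
  also have "(LINT h|lborel. 2 * exp (- (t * (norm h)\<^sup>2)) - 2 * (cos (h \<bullet> \<xi>) * exp (- (t * (norm h)\<^sup>2))))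
    = 2 * (pi / t) powr (DIM('a) / 2) * (1 - exp (- ((norm \<xi>)\<^sup>2 / (4 * t))))"
    using g gc by (subst Bochner_Integration.integral_diff) (simp_all add: c c0 algebra_simps)
  finally show ?thesis .
qed

text \<open>The kernel is a Gamma mixture of Gaussians with parameter \<open>?r\<close>, half its
  exponent. Gaussians integrate explicitly against the cosine, and rescaling the mixing variable by
  \<open>(norm \<xi>)\<^sup>2\<close> extracts the power of \<open>norm \<xi>\<close>.\<close>

lemma nn_integral_cos_kernel:
  fixes \<xi> :: "'a::euclidean_space"
  assumes "0 < s" "s < 1"
  shows "(\<integral>\<^sup>+h. ennreal ((2 - 2 * cos (h \<bullet> \<xi>)) * norm h powr (- (real DIM('a) + 2 * s))) \<partial>lborel)
    = ennreal (gagliardo_const DIM('a) s * norm \<xi> powr (2 * s))"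
proof -
  let ?N = "real DIM('a)"
  let ?r = "?N / 2 + s"
  let ?c = "\<lambda>h. 2 - 2 * cos (h \<bullet> \<xi>)"
  have r: "0 < ?r" using assms by (simp add: add_nonneg_pos)
  have "(\<integral>\<^sup>+h. ennreal (?c h * norm h powr (- (?N + 2 * s))) \<partial>lborel)
     = (\<integral>\<^sup>+h. ennreal (1 / Gamma ?r) * (\<integral>\<^sup>+t\<in>{0<..}. ennreal (t powr (?r - 1) * (?c h * exp (- (t * (norm h)\<^sup>2)))) \<partial>lborel) \<partial>lborel)"
  proof (rule nn_integral_cong_AE)
    show "AE h in lborel. ennreal (?c h * norm h powr (- (?N + 2 * s)))
       = ennreal (1 / Gamma ?r) * (\<integral>\<^sup>+t\<in>{0<..}. ennreal (t powr (?r - 1) * (?c h * exp (- (t * (norm h)\<^sup>2)))) \<partial>lborel)"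
      using AE_lborel_singleton[of "0::'a"]
    proof eventually_elim
      case (elim h)
      have "ennreal (norm h powr (- (?N + 2 * s))) = ennreal (((norm h)\<^sup>2) powr (- ?r))"
      proof -
        have "2 * (- ?r) = - (?N + 2 * s)" by (simp add: field_simps)
        then have "(norm h powr 2) powr (- ?r) = norm h powr (- (?N + 2 * s))" by (simp only: powr_powr)
        then show ?thesis using elim by simp
      qed
      also have "\<dots> = ennreal (1 / Gamma ?r) * (\<integral>\<^sup>+t\<in>{0<..}. ennreal (t powr (?r - 1) * exp (- ((norm h)\<^sup>2 * t))) \<partial>lborel)"
        using elim by (intro powr_nn_integral_Gamma r) auto
      finally have *: "ennreal (norm h powr (- (?N + 2 * s))) = \<dots>" .
      have "ennreal (?c h * norm h powr (- (?N + 2 * s))) = ennreal (1 / Gamma ?r) * (ennreal (?c h) * (\<integral>\<^sup>+t\<in>{0<..}. ennreal (t powr (?r - 1) * exp (- ((norm h)\<^sup>2 * t))) \<partial>lborel))"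
        unfolding mult.left_commute[of "ennreal (1 / Gamma ?r)"] *[symmetric] by (simp add: ennreal_mult)
      also have "ennreal (?c h) * (\<integral>\<^sup>+t\<in>{0<..}. ennreal (t powr (?r - 1) * exp (- ((norm h)\<^sup>2 * t))) \<partial>lborel)
        = (\<integral>\<^sup>+t. ennreal (?c h) * (ennreal (t powr (?r - 1) * exp (- ((norm h)\<^sup>2 * t))) * indicator {0<..} t) \<partial>lborel)"
        by (rule nn_integral_cmult[symmetric]) measurable
      also have "\<dots> = (\<integral>\<^sup>+t\<in>{0<..}. ennreal (t powr (?r - 1) * (?c h * exp (- (t * (norm h)\<^sup>2)))) \<partial>lborel)"
        by (intro nn_integral_cong) (auto split: split_indicator simp: ennreal_mult[symmetric] mult_ac)
      finally show ?case .
    qed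
  qed
  also have "\<dots> = ennreal (1 / Gamma ?r) * (\<integral>\<^sup>+h. (\<integral>\<^sup>+t\<in>{0<..}. ennreal (t powr (?r - 1) * (?c h * exp (- (t * (norm h)\<^sup>2)))) \<partial>lborel) \<partial>lborel)"
    by (rule nn_integral_cmult) measurable
  also have "(\<integral>\<^sup>+h. (\<integral>\<^sup>+t\<in>{0<..}. ennreal (t powr (?r - 1) * (?c h * exp (- (t * (norm h)\<^sup>2)))) \<partial>lborel) \<partial>lborel)
    = (\<integral>\<^sup>+t. (\<integral>\<^sup>+h. ennreal (t powr (?r - 1) * (?c h * exp (- (t * (norm h)\<^sup>2)))) * indicator {0<..} t \<partial>lborel) \<partial>lborel)"
    by (rule lborel_pair.Fubini') measurable
  also have "\<dots> = (\<integral>\<^sup>+t. ennreal (2 * pi powr (?N / 2)) * (ennreal (t powr (s - 1) * (1 - exp (- ((norm \<xi>)\<^sup>2 / (4 * t))))) * indicator {0<..} t) \<partial>lborel)"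
  proof (intro nn_integral_cong)
    fix t :: real
    show "(\<integral>\<^sup>+h. ennreal (t powr (?r - 1) * (?c h * exp (- (t * (norm h)\<^sup>2)))) * indicator {0<..} t \<partial>lborel)
      = ennreal (2 * pi powr (?N / 2)) * (ennreal (t powr (s - 1) * (1 - exp (- ((norm \<xi>)\<^sup>2 / (4 * t))))) * indicator {0<..} t)"
    proof (cases "0 < t")
      case True
      have "(\<integral>\<^sup>+h. ennreal (t powr (?r - 1) * (?c h * exp (- (t * (norm h)\<^sup>2)))) \<partial>lborel)
        = ennreal (t powr (?r - 1)) * (\<integral>\<^sup>+h. ennreal (?c h * exp (- (t * (norm h)\<^sup>2))) \<partial>lborel)"
        by (simp add: ennreal_mult nn_integral_cmult)
      also have "\<dots> = ennreal (t powr (?r - 1) * (2 * (pi / t) powr (?N / 2) * (1 - exp (- ((norm \<xi>)\<^sup>2 / (4 * t))))))"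
        unfolding nn_integral_cos_gaussian[OF True]           by (rule ennreal_mult[symmetric]) (use True in \<open>auto intro!: mult_nonneg_nonneg divide_nonneg_nonneg\<close>)
      also have "t powr (?r - 1) * (2 * (pi / t) powr (?N / 2) * (1 - exp (- ((norm \<xi>)\<^sup>2 / (4 * t)))))
        = 2 * pi powr (?N / 2) * (t powr (s - 1) * (1 - exp (- ((norm \<xi>)\<^sup>2 / (4 * t)))))"
      proof -
        have "t powr (?r - 1) = t powr (s - 1) * t powr (?N / 2)"
          by (simp only: powr_add[symmetric], intro arg_cong2[where f="(powr)"]) simp_all
        then show ?thesis using True by (simp add: powr_divide)
      qed
      finally show ?thesis using True by (simp add: ennreal_mult)
    qed simp
  qed
  also have "\<dots> = ennreal (2 * pi powr (?N / 2)) * (\<integral>\<^sup>+t\<in>{0<..}. ennreal (t powr (s - 1) * (1 - exp (- ((norm \<xi>)\<^sup>2 / (4 * t))))) \<partial>lborel)"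
    by (rule nn_integral_cmult) measurable
  also have "(\<integral>\<^sup>+t\<in>{0<..}. ennreal (t powr (s - 1) * (1 - exp (- ((norm \<xi>)\<^sup>2 / (4 * t))))) \<partial>lborel)
    = ennreal (norm \<xi> powr (2 * s)) * (\<integral>\<^sup>+t\<in>{0<..}. ennreal (t powr (s - 1) * (1 - exp (- (1 / (4 * t))))) \<partial>lborel)"
  proof (cases "\<xi> = 0")
    case False
    define c where "c = (norm \<xi>)\<^sup>2"
    have c: "0 < c" using False by (simp add: c_def)
    have "(\<integral>\<^sup>+t\<in>{0<..}. ennreal (t powr (s - 1) * (1 - exp (- (c / (4 * t))))) \<partial>lborel)
      = ennreal c * (\<integral>\<^sup>+t. ennreal ((c * t) powr (s - 1) * (1 - exp (- (c / (4 * (c * t)))))) * indicator {0<..} (c * t) \<partial>lborel)"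
      using c by (subst nn_integral_real_affine[where c=c and t=0]) simp_all
    also have "\<dots> = ennreal c * (\<integral>\<^sup>+t. ennreal (c powr (s - 1)) * (ennreal (t powr (s - 1) * (1 - exp (- (1 / (4 * t))))) * indicator {0<..} t) \<partial>lborel)"
    proof (rule arg_cong2[where f=times, OF refl], rule nn_integral_cong)
      fix t :: real
      have "c / (4 * (c * t)) = 1 / (4 * t)" using c by simp
      then show "ennreal ((c * t) powr (s - 1) * (1 - exp (- (c / (4 * (c * t)))))) * indicator {0<..} (c * t)
        = ennreal (c powr (s - 1)) * (ennreal (t powr (s - 1) * (1 - exp (- (1 / (4 * t))))) * indicator {0<..} t)"
        using c by (cases "0 < t") (simp_all add: powr_mult ennreal_mult mult.assoc zero_less_mult_iff)
    qed
    also have "\<dots> = ennreal (c powr s) * (\<integral>\<^sup>+t\<in>{0<..}. ennreal (t powr (s - 1) * (1 - exp (- (1 / (4 * t))))) \<partial>lborel)"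
      using c by (subst nn_integral_cmult) (auto simp: mult.assoc[symmetric] ennreal_mult[symmetric] powr_mult_base)
    also have "c powr s = norm \<xi> powr (2 * s)"
      using False by (simp add: c_def powr_powr flip: powr_numeral)
    finally show ?thesis by (simp add: c_def)
  qed simp
  also have "(\<integral>\<^sup>+t\<in>{0<..}. ennreal (t powr (s - 1) * (1 - exp (- (1 / (4 * t))))) \<partial>lborel)
    = ennreal (enn2real (\<integral>\<^sup>+t\<in>{0<..}. ennreal (t powr (s - 1) * (1 - exp (- (1 / (4 * t))))) \<partial>lborel))"
    using gagliardo_const_integral(1)[OF assms] by simp
  finally show ?thesis using Gamma_real_pos[OF r]
    by (simp add: gagliardo_const_def ennreal_mult[symmetric] mult_ac)
qed

lemma integrable_lborel_shift:
  fixes f :: "'a::euclidean_space \<Rightarrow> 'b::{banach, second_countable_topology}"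
  assumes "integrable lborel f"
  shows "integrable lborel (\<lambda>x. f (x + h))"
proof (rule integrableI_bounded)
  have [measurable]: "f \<in> borel_measurable borel" using assms by (auto dest: borel_measurable_integrable)
  then show "(\<lambda>x. f (x + h)) \<in> borel_measurable lborel" by simp
  show "(\<integral>\<^sup>+ x. ennreal (norm (f (x + h))) \<partial>lborel) < \<infinity>"
    using nn_integral_lborel_shift[of "\<lambda>x. ennreal (norm (f x))" h] assms by (simp add: integrable_iff_bounded add.commute)
qed

lemma fourier_translate_diff:
  fixes f :: "real^'n \<Rightarrow> complex"
  assumes f: "integrable lborel f"
  shows "fourier (\<lambda>x. f (x + h) - f x) \<xi> = (cis (h \<bullet> \<xi>) - 1) * fourier f \<xi>"
proof -
  have [measurable]: "f \<in> borel_measurable borel" using f by (auto dest: borel_measurable_integrable)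
  have "(LINT x|lborel. cis (- (x \<bullet> \<xi>)) * f (x + h)) = (LINT x|lborel. cis (- ((- h + x) \<bullet> \<xi>)) * f x)"
    by (subst lborel_integral_affine[of _ 1 "- h"]) simp_all
  also have "\<dots> = (LINT x|lborel. cis (h \<bullet> \<xi>) * (cis (- (x \<bullet> \<xi>)) * f x))"
    by (simp add: cis_mult inner_diff_left mult.assoc[symmetric])
  also have "\<dots> = cis (h \<bullet> \<xi>) * (LINT x|lborel. cis (- (x \<bullet> \<xi>)) * f x)" by simp
  finally have "(LINT x|lborel. cis (- (x \<bullet> \<xi>)) * f (x + h)) = \<dots>" .
  then show ?thesis
    unfolding fourier_def right_diff_distrib
    by (subst Bochner_Integration.integral_diff)
       (use integrable_cis_mult(2)[OF f] integrable_cis_mult(2)[OF integrable_lborel_shift[OF f, of h]] in \<open>auto simp: left_diff_distrib right_diff_distrib mult_ac\<close>)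
qed

text \<open>For fixed \<open>h\<close> Plancherel applies to \<open>u (x + h) - u x\<close>, whose
  transform carries a factor of squared modulus \<open>2 - 2 * cos (h \<bullet> \<xi>)\<close>;
  integrating in \<open>h\<close> against the kernel produces the symbol. All exchanges are
  Tonelli's, so both sides may be infinite.\<close>

theorem gagliardo_fourier:
  fixes u :: "real^'n \<Rightarrow> real"
  assumes s: "0 < s" "s < 1"
    and cont: "continuous_on UNIV u" and B: "\<And>x. \<bar>u x\<bar> \<le> B" and u: "integrable lborel u"
  shows "gagliardo s u = ennreal (gagliardo_const CARD('n) s) *
    (\<integral>\<^sup>+\<xi>. ennreal (norm \<xi> powr (2 * s) * (norm (fourier (\<lambda>x. of_real (u x)) \<xi>))\<^sup>2) \<partial>lborel)"
proof -
  have [measurable]: "u \<in> borel_measurable borel" using u by (auto dest: borel_measurable_integrable)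
  let ?U = "\<lambda>x. complex_of_real (u x)"
  let ?k = "\<lambda>h::real^'n. norm h powr (- (real DIM(real^'n) + 2 * s))"
  have U: "integrable lborel ?U" using u by (rule integrable_of_real)
  have translate: "(\<integral>\<^sup>+x. ennreal ((u (x + h) - u x)\<^sup>2) \<partial>lborel) = (\<integral>\<^sup>+\<xi>. ennreal ((2 - 2 * cos (h \<bullet> \<xi>)) * (norm (fourier ?U \<xi>))\<^sup>2) \<partial>lborel)" for h
  proof -
    let ?V = "\<lambda>x. complex_of_real (u (x + h))"
    have V: "integrable lborel ?V" by (rule integrable_lborel_shift[OF U])
    have F: "fourier (\<lambda>x. ?V x - ?U x) \<xi> = (cis (h \<bullet> \<xi>) - 1) * fourier ?U \<xi>" for \<xi>
      by (rule fourier_translate_diff[OF U])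
    have n: "(norm (cis \<theta> - 1))\<^sup>2 = 2 - 2 * cos \<theta>" for \<theta>
      using sin_cos_squared_add[of \<theta>] by (simp add: cmod_power2 power2_diff)
    have "(\<integral>\<^sup>+x. ennreal ((u (x + h) - u x)\<^sup>2) \<partial>lborel) = (\<integral>\<^sup>+x. ennreal ((norm (?V x - ?U x))\<^sup>2) \<partial>lborel)"
      by (simp flip: of_real_diff)
    also have "\<dots> = (\<integral>\<^sup>+\<xi>. ennreal ((norm (fourier (\<lambda>x. ?V x - ?U x) \<xi>))\<^sup>2) \<partial>lborel)"
    proof (rule plancherel[symmetric, where B="2 * B"])
      show "continuous_on UNIV (\<lambda>x. ?V x - ?U x)"
        by (intro continuous_intros continuous_on_compose2[OF cont] cont) auto
      show "norm (?V x - ?U x) \<le> 2 * B" for x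
        using B[of x] B[of "x + h"] by (simp flip: of_real_diff)
    qed (use U V in auto)
    finally show ?thesis by (simp add: F norm_mult power_mult_distrib n)
  qed
  have "gagliardo s u = (\<integral>\<^sup>+x. \<integral>\<^sup>+h. ennreal ((u (x + h) - u x)\<^sup>2 * ?k h) \<partial>lborel \<partial>lborel)"
    unfolding gagliardo_def
  proof (rule nn_integral_cong)
    fix x
    show "(\<integral>\<^sup>+y. ennreal ((u x - u y)\<^sup>2 * norm (x - y) powr (- (real DIM(real^'n) + 2 * s))) \<partial>lborel) = (\<integral>\<^sup>+h. ennreal ((u (x + h) - u x)\<^sup>2 * ?k h) \<partial>lborel)"
      by (subst nn_integral_lborel_shift[of _ x, symmetric]) (simp_all add: power2_commute)
  qed
  also have "\<dots> = (\<integral>\<^sup>+h. \<integral>\<^sup>+x. ennreal ((u (x + h) - u x)\<^sup>2 * ?k h) \<partial>lborel \<partial>lborel)"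
    by (rule lborel_pair.Fubini') measurable
  also have "\<dots> = (\<integral>\<^sup>+h. \<integral>\<^sup>+\<xi>. ennreal ((2 - 2 * cos (h \<bullet> \<xi>)) * ?k h) * ennreal ((norm (fourier ?U \<xi>))\<^sup>2) \<partial>lborel \<partial>lborel)"
  proof (rule nn_integral_cong)
    fix h
    have "(\<integral>\<^sup>+x. ennreal ((u (x + h) - u x)\<^sup>2 * ?k h) \<partial>lborel) = (\<integral>\<^sup>+x. ennreal ((u (x + h) - u x)\<^sup>2) \<partial>lborel) * ennreal (?k h)"
      by (simp add: ennreal_mult nn_integral_multc)
    also have "\<dots> = (\<integral>\<^sup>+\<xi>. ennreal ((2 - 2 * cos (h \<bullet> \<xi>)) * (norm (fourier ?U \<xi>))\<^sup>2) * ennreal (?k h) \<partial>lborel)"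
      unfolding translate by (rule nn_integral_multc[symmetric]) measurable
    also have "\<dots> = (\<integral>\<^sup>+\<xi>. ennreal ((2 - 2 * cos (h \<bullet> \<xi>)) * ?k h) * ennreal ((norm (fourier ?U \<xi>))\<^sup>2) \<partial>lborel)"
      by (intro nn_integral_cong) (simp add: ennreal_mult[symmetric] mult_ac)
    finally show "(\<integral>\<^sup>+x. ennreal ((u (x + h) - u x)\<^sup>2 * ?k h) \<partial>lborel) = \<dots>" .
  qed
  also have "\<dots> = (\<integral>\<^sup>+\<xi>. \<integral>\<^sup>+h. ennreal ((2 - 2 * cos (h \<bullet> \<xi>)) * ?k h) * ennreal ((norm (fourier ?U \<xi>))\<^sup>2) \<partial>lborel \<partial>lborel)"
    by (rule lborel_pair.Fubini') measurable
  also have "\<dots> = (\<integral>\<^sup>+\<xi>. ennreal (gagliardo_const DIM(real^'n) s) * ennreal (norm \<xi> powr (2 * s) * (norm (fourier ?U \<xi>))\<^sup>2) \<partial>lborel)"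
  proof (rule nn_integral_cong)
    fix \<xi> :: "real^'n"
    have "(\<integral>\<^sup>+h. ennreal ((2 - 2 * cos (h \<bullet> \<xi>)) * ?k h) * ennreal ((norm (fourier ?U \<xi>))\<^sup>2) \<partial>lborel)
      = (\<integral>\<^sup>+h. ennreal ((2 - 2 * cos (h \<bullet> \<xi>)) * ?k h) \<partial>lborel) * ennreal ((norm (fourier ?U \<xi>))\<^sup>2)"
      by (rule nn_integral_multc) measurable
    also have "\<dots> = ennreal (gagliardo_const DIM(real^'n) s) * ennreal (norm \<xi> powr (2 * s) * (norm (fourier ?U \<xi>))\<^sup>2)"
      using gagliardo_const_pos[OF s, of "DIM(real^'n)"]
      by (simp only: nn_integral_cos_kernel[OF s]) (simp add: ennreal_mult mult.assoc)
    finally show "(\<integral>\<^sup>+h. ennreal ((2 - 2 * cos (h \<bullet> \<xi>)) * ?k h) * ennreal ((norm (fourier ?U \<xi>))\<^sup>2) \<partial>lborel) = \<dots>" .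
  qed
  also have "\<dots> = ennreal (gagliardo_const CARD('n) s) * (\<integral>\<^sup>+\<xi>. ennreal (norm \<xi> powr (2 * s) * (norm (fourier ?U \<xi>))\<^sup>2) \<partial>lborel)"
    by (subst nn_integral_cmult) simp_all
  finally show ?thesis .
qed

section \<open>Test functions\<close>

lemma frechet_derivative_eqI:
  "(f has_derivative f') (at x) \<Longrightarrow> frechet_derivative f (at x) h = f' h"
  by (metis frechet_derivative_at)

lemma C_k_const: "C_k m (\<lambda>x. c)"
proof (induction m arbitrary: c)
  case (Suc m)
  have "frechet_derivative (\<lambda>x::real^'n. c) (at x) h = 0" for x h
    by (rule frechet_derivative_eqI[OF has_derivative_const])
  then show ?case using Suc by simp
qed simp

lemma C_k_SucD: "C_k (Suc m) f \<Longrightarrow> C_k m f"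
proof (induction m arbitrary: f)
  case 0
  then show ?case
    by (auto intro!: continuous_at_imp_continuous_on differentiable_imp_continuous_within)
qed (metis C_k.simps(2))

lemma C_k_continuous: "C_k m f \<Longrightarrow> continuous_on UNIV f"
  by (induction m) (auto dest: C_k_SucD simp del: C_k.simps(2))

lemma C_k_linear_combination:
  "C_k m f \<Longrightarrow> C_k m g \<Longrightarrow> C_k m (\<lambda>x. a * f x + b * g x)"
proof (induction m arbitrary: f g)
  case 0
  then show ?case by (auto intro!: continuous_intros)
next
  case (Suc m)
  have d: "((\<lambda>x. a * f x + b * g x) has_derivative (\<lambda>h. a * frechet_derivative f (at x) h + b * frechet_derivative g (at x) h)) (at x)" for x
    using Suc.prems by (auto intro!: has_derivative_add has_derivative_mult_right simp: frechet_derivative_works[symmetric])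
  then have "(\<lambda>x. a * f x + b * g x) differentiable at x" for x by (rule differentiableI)
  then show ?case using Suc by (simp add: frechet_derivative_eqI[OF d])
qed

lemma C_k_mult: "C_k m f \<Longrightarrow> C_k m g \<Longrightarrow> C_k m (\<lambda>x. f x * g x)"
proof (induction m arbitrary: f g)
  case 0
  then show ?case by (auto intro!: continuous_intros)
next
  case (Suc m)
  have d: "((\<lambda>x. f x * g x) has_derivative (\<lambda>h. f x * frechet_derivative g (at x) h + frechet_derivative f (at x) h * g x)) (at x)" for x
    using Suc.prems by (auto intro!: has_derivative_mult simp: frechet_derivative_works[symmetric])
  then have "(\<lambda>x. f x * g x) differentiable at x" for x by (rule differentiableI)
  moreover have "C_k m (\<lambda>x. 1 * (f x * frechet_derivative g (at x) (axis i 1)) + 1 * (frechet_derivative f (at x) (axis i 1) * g x))" for i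
    using Suc by (intro C_k_linear_combination Suc.IH) (auto dest: C_k_SucD simp del: C_k.simps(2), auto)
  ultimately show ?case by (simp add: frechet_derivative_eqI[OF d])
qed

text \<open>The outer function comes with all its derivatives as a sequence \<open>d\<close>,
  because the induction passes from \<open>d j\<close> to \<open>d (Suc j)\<close>. The set
  \<open>X\<close> admits outer functions that are smooth only where \<open>f\<close> takes its
  values.\<close>

lemma C_k_compose:
  fixes f :: "real^'n \<Rightarrow> real"
  assumes d: "\<And>j t. t \<in> X \<Longrightarrow> (d j has_real_derivative d (Suc j) t) (at t)" and X: "\<And>x. f x \<in> X"
  shows "C_k m f \<Longrightarrow> C_k m (\<lambda>x. d j (f x))"
proof (induction m arbitrary: j)
  case 0
  have "continuous (at (f x)) (d j)" for x
    using d[OF X] by (rule DERIV_isCont)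
  then show ?case using 0
    by (auto simp: continuous_on_eq_continuous_at intro!: continuous_at_compose[of _ f "d j", unfolded o_def])
next
  case (Suc m)
  have D: "((\<lambda>x. d j (f x)) has_derivative (\<lambda>h. d (Suc j) (f x) * frechet_derivative f (at x) h)) (at x)" for x
    using has_derivative_compose[of f "frechet_derivative f (at x)" x UNIV "d j" "times (d (Suc j) (f x))"] Suc.prems d[OF X[of x], of j]
    by (simp add: frechet_derivative_works[symmetric] has_field_derivative_def)
  then have "(\<lambda>x. d j (f x)) differentiable at x" for x by (rule differentiableI)
  moreover have "C_k m (\<lambda>x. d (Suc j) (f x) * frechet_derivative f (at x) (axis i 1))" for i
    using Suc by (intro C_k_mult Suc.IH) (auto dest: C_k_SucD simp del: C_k.simps(2), auto)
  ultimately show ?case by (simp add: frechet_derivative_eqI[OF D])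
qed

lemma C_k_bounded_linear:
  assumes "bounded_linear f"
  shows "C_k m f"
proof (cases m)
  case 0
  then show ?thesis using assms by (simp add: linear_continuous_on)
next
  case (Suc k)
  have "(f has_derivative f) (at x)" for x using assms by (rule bounded_linear_imp_has_derivative)
  then have "f differentiable at x" "frechet_derivative f (at x) h = f h" for x h
    by (blast intro: differentiableI frechet_derivative_eqI)+
  then show ?thesis using Suc by (simp add: C_k_const)
qed

lemma C_k_sum: "finite A \<Longrightarrow> (\<And>a. a \<in> A \<Longrightarrow> C_k m (f a)) \<Longrightarrow> C_k m (\<lambda>x. \<Sum>a\<in>A. f a x)"
proof (induction A rule: finite_induct)
  case (insert a A)
  then show ?case using C_k_linear_combination[of m "f a" "\<lambda>x. \<Sum>a\<in>A. f a x" 1 1] by simp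
qed (simp add: C_k_const)

lemma C_k_norm_square: "C_k m (\<lambda>x::real^'n. (norm x)\<^sup>2)"
proof -
  have "C_k m (\<lambda>x::real^'n. \<Sum>i\<in>UNIV. x $ i * x $ i)"
    by (intro C_k_sum C_k_mult C_k_bounded_linear bounded_linear_vec_nth) simp
  then show ?thesis by (simp add: power2_norm_eq_inner inner_vec_def)
qed

definition partial_deriv :: "'n \<Rightarrow> (real^'n \<Rightarrow> real) \<Rightarrow> real^'n \<Rightarrow> real" where
  "partial_deriv i f x = frechet_derivative f (at x) (axis i 1)"

lemma test_function_C_k: "\<phi> \<in> test_functions \<Omega> \<Longrightarrow> C_k m \<phi>"
  by (simp add: test_functions_def)

lemma test_function_continuous: "\<phi> \<in> test_functions \<Omega> \<Longrightarrow> continuous_on UNIV \<phi>"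
  using test_function_C_k C_k_continuous by blast

lemma test_function_differentiable:
  fixes \<phi> :: "real^'n \<Rightarrow> real"
  shows "\<phi> \<in> test_functions \<Omega> \<Longrightarrow> \<phi> differentiable at x"
  using test_function_C_k[of \<phi> \<Omega> "Suc 0"] by simp

lemma test_function_support:
  fixes \<phi> :: "real^'n \<Rightarrow> real"
  assumes "\<phi> \<in> test_functions \<Omega>"
  obtains R where "0 < R" "\<And>x. R < norm x \<Longrightarrow> \<phi> x = 0"
proof -
  have "bounded (closure {x. \<phi> x \<noteq> 0})" using assms by (simp add: test_functions_def compact_imp_bounded)
  then obtain R where R: "0 < R" "\<forall>x\<in>closure {x. \<phi> x \<noteq> 0}. norm x \<le> R" by (meson bounded_pos)
  have "\<phi> x = 0" if "R < norm x" for x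
    using R that closure_subset[of "{x. \<phi> x \<noteq> 0}"] by force
  then show thesis using that R by blast
qed

lemma test_functionI:
  fixes \<phi> :: "real^'n \<Rightarrow> real"
  assumes "\<And>m. C_k m \<phi>" "\<And>x. R < norm x \<Longrightarrow> \<phi> x = 0"
  shows "\<phi> \<in> test_functions UNIV"
proof -
  have "{x. \<phi> x \<noteq> 0} \<subseteq> cball 0 R" using assms(2) by (force simp: not_less[symmetric])
  then have "bounded {x. \<phi> x \<noteq> 0}" using bounded_subset by blast
  then have "bounded (closure {x. \<phi> x \<noteq> 0})" by (rule bounded_closure)
  then show ?thesis using assms(1) by (simp add: test_functions_def compact_eq_bounded_closed)
qed

lemma test_function_UNIV:
  fixes \<phi> :: "real^'n \<Rightarrow> real"
  shows "\<phi> \<in> test_functions \<Omega> \<Longrightarrow> \<phi> \<in> test_functions UNIV"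
  by (simp add: test_functions_def)

lemma test_function_bounded:
  fixes \<phi> :: "real^'n \<Rightarrow> real"
  assumes "\<phi> \<in> test_functions \<Omega>"
  obtains B where "0 < B" "\<And>x. \<bar>\<phi> x\<bar> \<le> B"
proof -
  obtain R where R: "0 < R" "\<And>x. R < norm x \<Longrightarrow> \<phi> x = 0" using test_function_support[OF assms] by blast
  have "compact (\<phi> ` cball 0 R)"
    using test_function_continuous[OF assms] by (intro compact_continuous_image) (auto intro: continuous_on_subset)
  then obtain B where B: "0 < B" "\<forall>y\<in>\<phi> ` cball 0 R. norm y \<le> B" using compact_imp_bounded bounded_pos by metis
  have "\<bar>\<phi> x\<bar> \<le> B" for x using B R(2)[of x] by (cases "norm x \<le> R") auto
  then show thesis using that B by blast
qed

lemma test_function_measurable: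
  fixes \<phi> :: "real^'n \<Rightarrow> real"
  shows "\<phi> \<in> test_functions \<Omega> \<Longrightarrow> \<phi> \<in> borel_measurable borel"
  using test_function_continuous borel_measurable_continuous_onI by blast

lemma integrable_bounded_support:
  fixes f :: "'a::euclidean_space \<Rightarrow> 'b::{banach, second_countable_topology}"
  assumes "f \<in> borel_measurable borel" "\<And>x. norm (f x) \<le> B" "\<And>x. R < norm x \<Longrightarrow> f x = 0"
  shows "integrable lborel f"
proof (rule Bochner_Integration.integrable_bound)
  show "integrable lborel (\<lambda>x::'a. B * indicator (cball 0 R) x)"
    using emeasure_bounded_finite[of "cball (0::'a) R"] by (auto simp: less_top)
  show "AE x in lborel. norm (f x) \<le> norm (B * indicator (cball 0 R) x)"
    using assms order_trans[OF norm_ge_zero assms(2)] by (intro AE_I2) (auto split: split_indicator)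
qed (use assms in simp)

lemma test_function_integrable:
  fixes \<phi> :: "real^'n \<Rightarrow> real"
  assumes "\<phi> \<in> test_functions \<Omega>"
  shows "integrable lborel \<phi>"
proof -
  obtain R where R: "0 < R" "\<And>x. R < norm x \<Longrightarrow> \<phi> x = 0" using test_function_support[OF assms] by blast
  obtain B where B: "0 < B" "\<And>x. \<bar>\<phi> x\<bar> \<le> B" using test_function_bounded[OF assms] by blast
  show ?thesis by (rule integrable_bounded_support[of _ B R]) (use R B test_function_measurable[OF assms] in auto)
qed

lemma test_function_linear_combination:
  fixes \<phi> \<psi> :: "real^'n \<Rightarrow> real"
  assumes "\<phi> \<in> test_functions UNIV" "\<psi> \<in> test_functions UNIV"
  shows "(\<lambda>x. a * \<phi> x + b * \<psi> x) \<in> test_functions UNIV"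
proof -
  obtain R where R: "0 < R" "\<And>x. R < norm x \<Longrightarrow> \<phi> x = 0" using test_function_support[OF assms(1)] by blast
  obtain R' where R': "0 < R'" "\<And>x. R' < norm x \<Longrightarrow> \<psi> x = 0" using test_function_support[OF assms(2)] by blast
  show ?thesis
    by (rule test_functionI[of _ "max R R'"])
       (use R R' assms in \<open>auto intro!: C_k_linear_combination dest: test_function_C_k\<close>)
qed

lemma test_function_partial_deriv:
  fixes \<phi> :: "real^'n \<Rightarrow> real"
  assumes "\<phi> \<in> test_functions UNIV"
  shows "partial_deriv i \<phi> \<in> test_functions UNIV"
proof -
  obtain R where R: "0 < R" "\<And>x. R < norm x \<Longrightarrow> \<phi> x = 0" using test_function_support[OF assms] by blast
  show ?thesis
  proof (rule test_functionI[of _ R])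
    show "C_k m (partial_deriv i \<phi>)" for m
      using test_function_C_k[OF assms, of "Suc m"] by (simp add: partial_deriv_def[abs_def])
    fix x :: "real^'n" assume "R < norm x"
    then have "x \<in> - cball 0 R" "open (- cball (0::real^'n) R)" by auto
    then have "(\<phi> has_derivative (\<lambda>h. 0)) (at x)"
      using R by (intro has_derivative_transform_within_open[OF has_derivative_const[of 0]]) auto
    then show "partial_deriv i \<phi> x = 0" unfolding partial_deriv_def by (rule frechet_derivative_eqI)
  qed
qed

lemma test_function_line_derivative:
  fixes \<phi> :: "real^'n \<Rightarrow> real"
  assumes "\<phi> \<in> test_functions UNIV"
  shows "((\<lambda>t. \<phi> (x + t *\<^sub>R axis i 1)) has_real_derivative partial_deriv i \<phi> (x + t *\<^sub>R axis i 1)) (at t)"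
proof -
  let ?D = "frechet_derivative \<phi> (at (x + t *\<^sub>R axis i 1))"
  have D: "(\<phi> has_derivative ?D) (at (x + t *\<^sub>R axis i 1))"
    using test_function_differentiable[OF assms] by (simp add: frechet_derivative_works[symmetric])
  have "((\<lambda>t. x + t *\<^sub>R axis i 1) has_derivative (\<lambda>h. h *\<^sub>R axis i 1)) (at t)"
    by (auto intro!: derivative_eq_intros)
  from has_derivative_compose[OF this D]
  have "((\<lambda>t. \<phi> (x + t *\<^sub>R axis i 1)) has_derivative (\<lambda>h. ?D (h *\<^sub>R axis i 1))) (at t)" .
  moreover have "?D (h *\<^sub>R axis i 1) = partial_deriv i \<phi> (x + t *\<^sub>R axis i 1) * h" for h
    using linear_frechet_derivative[OF test_function_differentiable[OF assms]]
    by (simp add: partial_deriv_def linear_scale)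
  ultimately show ?thesis by (simp add: has_field_derivative_def)
qed

text \<open>Difference quotients replace integration by parts: a translation acts on the transform
  by an explicit factor, and the mean value theorem bounds all quotients on one fixed ball.\<close>

lemma fourier_partial_deriv:
  fixes \<phi> :: "real^'n \<Rightarrow> real"
  assumes \<phi>: "\<phi> \<in> test_functions UNIV"
  shows "fourier (\<lambda>x. of_real (partial_deriv i \<phi> x)) \<xi> = \<i> * of_real (\<xi> $ i) * fourier (\<lambda>x. of_real (\<phi> x)) \<xi>"
proof -
  let ?e = "axis i 1 :: real^'n"
  define t where "t n = 1 / real (Suc n)" for n
  have t: "t \<longlonglongrightarrow> 0" "\<And>n. 0 < t n" "\<And>n. t n \<le> 1"
  proof -
    show "t \<longlonglongrightarrow> 0" unfolding t_def by (rule LIMSEQ_Suc[OF lim_1_over_n, unfolded of_nat_Suc[symmetric]])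
  qed (auto simp: t_def)
  have t0: "filterlim t (at 0) sequentially"
    using t(1) less_imp_neq[OF t(2)] by (auto simp: filterlim_at)
  have \<phi>i: "integrable lborel (\<lambda>x. complex_of_real (\<phi> x))" using test_function_integrable[OF \<phi>] by (rule integrable_of_real)
  have [measurable]: "\<phi> \<in> borel_measurable borel" "partial_deriv i \<phi> \<in> borel_measurable borel"
    using test_function_measurable \<phi> test_function_partial_deriv[OF \<phi>] by blast+
  obtain R where R: "0 < R" "\<And>x. R < norm x \<Longrightarrow> \<phi> x = 0" using test_function_support[OF \<phi>] by blast
  obtain B where B: "0 < B" "\<And>x. \<bar>partial_deriv i \<phi> x\<bar> \<le> B" using test_function_bounded[OF test_function_partial_deriv[OF \<phi>]] by blast
  let ?q = "\<lambda>n x. (\<phi> (x + t n *\<^sub>R ?e) - \<phi> x) / t n"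
  have q_lim: "(\<lambda>n. ?q n x) \<longlonglongrightarrow> partial_deriv i \<phi> x" for x
  proof -
    have "((\<lambda>h. (\<phi> (x + h *\<^sub>R ?e) - \<phi> x) / h) \<longlongrightarrow> partial_deriv i \<phi> x) (at 0)"
      using test_function_line_derivative[OF \<phi>, where x=x and i=i and t=0] by (simp add: DERIV_def)
    from filterlim_compose[OF this t0] show ?thesis .
  qed
  \<comment> \<open>Since \<open>t n \<le> 1\<close>, the shift moves the support by at most 1,
    whence the radius \<open>R + 1\<close>.\<close>
  have q_bound: "\<bar>?q n x\<bar> \<le> B * indicator (cball 0 (R + 1)) x" for n x
  proof (cases "norm x \<le> R + 1")
    case True
    obtain z where "\<phi> (x + t n *\<^sub>R ?e) - \<phi> (x + 0 *\<^sub>R ?e) = (t n - 0) * partial_deriv i \<phi> (x + z *\<^sub>R ?e)"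
      using MVT2[of 0 "t n" "\<lambda>h. \<phi> (x + h *\<^sub>R ?e)" "\<lambda>h. partial_deriv i \<phi> (x + h *\<^sub>R ?e)"] t(2)[of n] test_function_line_derivative[OF \<phi>]
      by auto
    then have "?q n x = partial_deriv i \<phi> (x + z *\<^sub>R ?e)" using t(2)[of n] by (simp add: field_simps)
    then show ?thesis using B True by simp
  next
    case False
    have "norm x \<le> norm (x + t n *\<^sub>R ?e) + norm (t n *\<^sub>R ?e)"
      using norm_triangle_ineq4[of "x + t n *\<^sub>R ?e" "t n *\<^sub>R ?e"] by simp
    also have "norm (t n *\<^sub>R ?e) \<le> 1" using t(2,3)[of n] by (simp add: norm_axis_1)
    finally have "R < norm (x + t n *\<^sub>R ?e)" using False by simp
    then show ?thesis using False R by simp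
  qed
  have "(\<lambda>n. LINT x|lborel. cis (- (x \<bullet> \<xi>)) * of_real (?q n x)) \<longlonglongrightarrow> (LINT x|lborel. cis (- (x \<bullet> \<xi>)) * of_real (partial_deriv i \<phi> x))"
  proof (rule integral_dominated_convergence[where w="\<lambda>x. B * indicator (cball 0 (R + 1)) x"])
    show "integrable lborel (\<lambda>x::real^'n. B * indicator (cball 0 (R + 1)) x)"
      using emeasure_bounded_finite[of "cball (0::real^'n) (R + 1)"] by (auto simp: less_top)
    show "AE x in lborel. (\<lambda>n. cis (- (x \<bullet> \<xi>)) * of_real (?q n x)) \<longlonglongrightarrow> cis (- (x \<bullet> \<xi>)) * of_real (partial_deriv i \<phi> x)"
      by (intro AE_I2 tendsto_intros q_lim)
    show "AE x in lborel. norm (cis (- (x \<bullet> \<xi>)) * complex_of_real (?q n x)) \<le> B * indicator (cball 0 (R + 1)) x" for n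
      unfolding norm_mult norm_cis norm_of_real mult_1_left by (intro AE_I2 q_bound)
  qed measurable
  then have L: "(\<lambda>n. fourier (\<lambda>x. of_real (?q n x)) \<xi>) \<longlonglongrightarrow> fourier (\<lambda>x. of_real (partial_deriv i \<phi> x)) \<xi>"
    unfolding fourier_def by (intro tendsto_intros)
  have F: "fourier (\<lambda>x. of_real (?q n x)) \<xi> = ((cis (t n * \<xi> $ i) - 1) / of_real (t n)) * fourier (\<lambda>x. of_real (\<phi> x)) \<xi>" for n
  proof -
    have "fourier (\<lambda>x. of_real (?q n x)) \<xi> = (1 / of_real (t n)) * fourier (\<lambda>x. of_real (\<phi> (x + t n *\<^sub>R ?e)) - of_real (\<phi> x)) \<xi>"
      unfolding fourier_def by (simp add: mult.left_commute)
    then show ?thesis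
      using fourier_translate_diff[OF \<phi>i, of "t n *\<^sub>R ?e" \<xi>] by (simp add: inner_axis')
  qed
  have "(\<lambda>n. (cis (t n * \<xi> $ i) - 1) / of_real (t n)) \<longlonglongrightarrow> \<i> * of_real (\<xi> $ i)"
  proof -
    have "((\<lambda>z. exp (\<i> * (z * of_real (\<xi> $ i)))) has_field_derivative \<i> * of_real (\<xi> $ i)) (at 0)"
      by (auto intro!: derivative_eq_intros)
    then have "((\<lambda>z. (exp (\<i> * (z * of_real (\<xi> $ i))) - 1) / z) \<longlongrightarrow> \<i> * of_real (\<xi> $ i)) (at 0)"
      by (simp add: DERIV_def)
    moreover have "filterlim (\<lambda>n. complex_of_real (t n)) (at 0) sequentially"
      using tendsto_of_real[OF t(1), where 'a=complex] less_imp_neq[OF t(2)] by (auto simp: filterlim_at)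
    ultimately have "(\<lambda>n. (exp (\<i> * (of_real (t n) * of_real (\<xi> $ i))) - 1) / of_real (t n)) \<longlonglongrightarrow> \<i> * of_real (\<xi> $ i)"
      by (rule filterlim_compose)
    then show ?thesis by (simp add: cis_conv_exp)
  qed
  then have "(\<lambda>n. fourier (\<lambda>x. of_real (?q n x)) \<xi>) \<longlonglongrightarrow> \<i> * of_real (\<xi> $ i) * fourier (\<lambda>x. of_real (\<phi> x)) \<xi>"
    unfolding F by (intro tendsto_intros)
  with L show ?thesis by (rule LIMSEQ_unique)
qed

text \<open>Differentiating \<open>m\<close> times in direction \<open>i\<close> bounds
  \<open>\<bar>\<xi> $ i\<bar> ^ m\<close> times the transform. At each frequency the largest
  coordinate is used, which is at least \<open>norm \<xi>\<close> divided by the dimension.\<close>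

lemma fourier_test_function_decay:
  fixes \<phi> :: "real^'n \<Rightarrow> real"
  assumes \<phi>: "\<phi> \<in> test_functions UNIV"
  obtains C where "0 \<le> C" "\<And>\<xi>. norm \<xi> ^ m * norm (fourier (\<lambda>x. of_real (\<phi> x)) \<xi>) \<le> C"
proof -
  let ?F = "\<lambda>\<phi>. fourier (\<lambda>x::real^'n. complex_of_real (\<phi> x))"
  have iter: "(partial_deriv i ^^ k) \<phi> \<in> test_functions UNIV \<and> (\<forall>\<xi>. ?F ((partial_deriv i ^^ k) \<phi>) \<xi> = (\<i> * of_real (\<xi> $ i)) ^ k * ?F \<phi> \<xi>)" for i k
    by (induction k) (auto simp: \<phi> test_function_partial_deriv fourier_partial_deriv)
  define c where "c i = (2 * pi) powr (- real CARD('n) / 2) * (LINT x|lborel. norm (complex_of_real ((partial_deriv i ^^ m) \<phi> x)))" for i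
  have c: "\<bar>\<xi> $ i\<bar> ^ m * norm (?F \<phi> \<xi>) \<le> c i" for \<xi> i
  proof -
    have "\<bar>\<xi> $ i\<bar> ^ m * norm (?F \<phi> \<xi>) = norm (?F ((partial_deriv i ^^ m) \<phi>) \<xi>)"
      using iter[where i=i and k=m] by (simp add: norm_mult norm_power)
    also have "\<dots> \<le> c i" unfolding c_def by (rule norm_fourier_le)
    finally show ?thesis .
  qed
  have c0: "0 \<le> c i" for i using c[of 0 i] by (smt (verit) mult_nonneg_nonneg norm_ge_zero zero_le_power abs_ge_zero)
  show thesis
  proof (rule that[of "real CARD('n) ^ m * (\<Sum>i\<in>UNIV. c i)"])
    show "0 \<le> real CARD('n) ^ m * (\<Sum>i\<in>UNIV. c i)" using c0 by (simp add: sum_nonneg)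
    fix \<xi> :: "real^'n"
    obtain j where j: "\<And>i. \<bar>\<xi> $ i\<bar> \<le> \<bar>\<xi> $ j\<bar>"
    proof -
      have "Max (range (\<lambda>i. \<bar>\<xi> $ i\<bar>)) \<in> range (\<lambda>i. \<bar>\<xi> $ i\<bar>)" by (intro Max_in) auto
      then obtain j where "Max (range (\<lambda>i. \<bar>\<xi> $ i\<bar>)) = \<bar>\<xi> $ j\<bar>" by blast
      then have "\<bar>\<xi> $ i\<bar> \<le> \<bar>\<xi> $ j\<bar>" for i by (metis Max_ge finite_imageI finite rangeI)
      then show thesis by (rule that)
    qed
    have "norm \<xi> \<le> (\<Sum>i\<in>UNIV. \<bar>\<xi> $ i\<bar>)" by (rule norm_le_l1_cart)
    also have "\<dots> \<le> (\<Sum>i\<in>(UNIV::'n set). \<bar>\<xi> $ j\<bar>)" by (intro sum_mono j)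
    finally have "norm \<xi> \<le> real CARD('n) * \<bar>\<xi> $ j\<bar>" by simp
    then have "norm \<xi> ^ m \<le> (real CARD('n) * \<bar>\<xi> $ j\<bar>) ^ m" by (intro power_mono) auto
    then have "norm \<xi> ^ m * norm (?F \<phi> \<xi>) \<le> (real CARD('n) * \<bar>\<xi> $ j\<bar>) ^ m * norm (?F \<phi> \<xi>)" by (intro mult_right_mono) auto
    also have "\<dots> = real CARD('n) ^ m * (\<bar>\<xi> $ j\<bar> ^ m * norm (?F \<phi> \<xi>))" by (simp add: power_mult_distrib)
    also have "\<dots> \<le> real CARD('n) ^ m * c j" by (intro mult_left_mono c) auto
    also have "c j \<le> (\<Sum>i\<in>UNIV. c i)" using c0 by (intro member_le_sum) auto
    finally show "norm \<xi> ^ m * norm (?F \<phi> \<xi>) \<le> real CARD('n) ^ m * (\<Sum>i\<in>UNIV. c i)" by (simp add: mult_left_mono)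
  qed
qed

section \<open>The fractional Laplacian and the energy space\<close>

lemma powr_le_one_plus_square:
  fixes x r :: real
  assumes "0 \<le> x" "0 \<le> r" "r \<le> 2"
  shows "x powr r \<le> 1 + x\<^sup>2"
proof (cases "x \<le> 1")
  case True
  then have "x powr r \<le> 1" using assms by (intro powr_le1) auto
  then show ?thesis by (simp add: add_increasing2)
next
  case False
  then have "x powr r \<le> x powr 2" using assms by (intro powr_mono) auto
  then show ?thesis using False by (simp add: add_increasing)
qed

lemma fourier_multiplier_test_function:
  fixes \<phi> :: "real^'n \<Rightarrow> real"
  assumes \<phi>: "\<phi> \<in> test_functions UNIV" and r: "0 < r" "r \<le> 2"
  defines "g \<equiv> \<lambda>\<xi>. of_real (norm \<xi> powr r) * fourier (\<lambda>x. of_real (\<phi> x)) \<xi>"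
  shows "continuous_on UNIV g" "\<exists>B. \<forall>\<xi>. norm (g \<xi>) \<le> B" "integrable lborel g"
proof -
  let ?F = "fourier (\<lambda>x::real^'n. complex_of_real (\<phi> x))"
  \<comment> \<open>Decay of order \<open>2 * ?M\<close> puts \<open>?M\<close> powers of
    \<open>1 + (norm \<xi>)\<^sup>2\<close> in the denominator. One of them absorbs
    \<open>norm \<xi> powr r\<close>, and the remaining \<open>CARD('n) + 1\<close> are ample for
    integrability.\<close>
  let ?M = "CARD('n) + 2"
  have \<phi>i: "integrable lborel (\<lambda>x. complex_of_real (\<phi> x))" using test_function_integrable[OF \<phi>] by (rule integrable_of_real)
  show c: "continuous_on UNIV g"
    unfolding g_def using r by (intro continuous_intros continuous_fourier[OF \<phi>i] continuous_on_powr') auto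
  obtain C0 where C0: "0 \<le> C0" "\<And>\<xi>. norm \<xi> ^ 0 * norm (?F \<xi>) \<le> C0" using fourier_test_function_decay[OF \<phi>] by blast
  obtain C1 where C1: "0 \<le> C1" "\<And>\<xi>. norm \<xi> ^ (2 * ?M) * norm (?F \<xi>) \<le> C1" using fourier_test_function_decay[OF \<phi>] by blast
  define K where "K = 2 ^ ?M * (C0 + C1)"
  have K: "0 \<le> K" using C0 C1 by (simp add: K_def)
  have bound: "norm (g \<xi>) \<le> K * (1 + (norm \<xi>)\<^sup>2) powr (- (real CARD('n) + 1))" for \<xi>
  proof -
    let ?y = "(norm \<xi>)\<^sup>2"
    have y: "0 < 1 + ?y" by (simp add: add_pos_nonneg)
    have "(1 + ?y) ^ ?M \<le> 2 ^ ?M * (1 + ?y ^ ?M)"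
    proof -
      have "(1 + ?y) ^ ?M \<le> (2 * max 1 ?y) ^ ?M" by (intro power_mono) auto
      also have "\<dots> = 2 ^ ?M * (max 1 ?y) ^ ?M" by (rule power_mult_distrib)
      also have "(max 1 ?y) ^ ?M \<le> 1 + ?y ^ ?M" by (auto simp: max_def)
      finally show ?thesis by simp
    qed
    then have "(1 + ?y) ^ ?M * norm (?F \<xi>) \<le> 2 ^ ?M * (1 + ?y ^ ?M) * norm (?F \<xi>)" by (intro mult_right_mono) auto
    also have "\<dots> = 2 ^ ?M * (norm (?F \<xi>) + norm \<xi> ^ (2 * ?M) * norm (?F \<xi>))"
      unfolding power_mult[of "norm \<xi>" 2 ?M] by (simp only: distrib_right distrib_left mult_1_left mult.assoc)
    also have "\<dots> \<le> K" unfolding K_def using C0(2)[of \<xi>] C1(2)[of \<xi>] by (intro mult_left_mono add_mono) auto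
    finally have F: "norm (?F \<xi>) \<le> K / (1 + ?y) ^ ?M"
      unfolding pos_le_divide_eq[OF zero_less_power[OF y]] by (simp only: mult.commute)
    have "norm (g \<xi>) \<le> (1 + ?y) * (K / (1 + ?y) ^ ?M)"
      unfolding g_def norm_mult norm_of_real using powr_le_one_plus_square[of "norm \<xi>" r] r F by (intro mult_mono) auto
    also have "\<dots> = K * (1 + ?y) powr (- (real CARD('n) + 1))"
    proof -
      have "(1 + ?y) ^ ?M = (1 + ?y) * (1 + ?y) powr (real CARD('n) + 1)"
        using y by (simp add: powr_realpow powr_add power2_eq_square)
      moreover have "a * (K / (a * p)) = K * inverse p" if "0 < a" for a p :: real
        using that by (simp add: divide_inverse)
      ultimately show ?thesis using y by (simp only: powr_minus)
    qed
    finally show ?thesis .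
  qed
  have "norm (g \<xi>) \<le> K" for \<xi>
  proof -
    have "(1 + (norm \<xi>)\<^sup>2) powr (- (real CARD('n) + 1)) \<le> 1 powr (- (real CARD('n) + 1))" by (intro powr_mono2') auto
    then show ?thesis using bound[of \<xi>] K by (simp add: mult_left_le order_trans)
  qed
  then show "\<exists>B. \<forall>\<xi>. norm (g \<xi>) \<le> B" by blast
  show "integrable lborel g"
  proof (rule Bochner_Integration.integrable_bound)
    show "integrable lborel (\<lambda>\<xi>::real^'n. K * (1 + (norm \<xi>)\<^sup>2) powr (- (real CARD('n) + 1)))"
      using nn_integral_japanese_bracket_finite[where 'a="real^'n", of "real CARD('n) + 1"]
      by (intro integrable_mult_right integrableI_nonneg) auto
    show "g \<in> borel_measurable lborel" using borel_measurable_continuous_onI[OF c] by simp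
    show "AE \<xi> in lborel. norm (g \<xi>) \<le> norm (K * (1 + (norm \<xi>)\<^sup>2) powr (- (real CARD('n) + 1)))"
      using bound K by (intro AE_I2) (simp add: abs_mult)
  qed
qed

text \<open>The function on the frequency side is invariant under reflection followed by
  conjugation, so its inverse transform is real and the \<open>Re\<close> of the definition loses
  nothing. Expressing it by the forward transform at \<open>- x\<close> makes Plancherel
  reusable.\<close>

lemma frac_laplacian_eq_fourier:
  fixes \<phi> :: "real^'n \<Rightarrow> real"
  shows "of_real (frac_laplacian r \<phi> x) = fourier (\<lambda>\<xi>. of_real (norm \<xi> powr (2 * r)) * fourier (\<lambda>y. of_real (\<phi> y)) \<xi>) (- x)"
proof -
  let ?g = "\<lambda>\<xi>. of_real (norm \<xi> powr (2 * r)) * fourier (\<lambda>y. of_real (\<phi> y)) \<xi>"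
  have "inv_fourier ?g x = fourier ?g (- x)"
    by (simp add: inv_fourier_def fourier_def inner_commute)
  moreover have "cnj (?g (- \<xi>)) = ?g \<xi>" for \<xi>
  proof -
    have "fourier (\<lambda>y. complex_of_real (\<phi> (- y))) (- \<xi>) = fourier (\<lambda>y. of_real (\<phi> y)) \<xi>"
      using lborel_integral_affine[of "\<lambda>y. cis (- (y \<bullet> \<xi>)) * complex_of_real (\<phi> y)" "-1" 0]
    proof (cases "(\<lambda>y. cis (- (y \<bullet> \<xi>)) * complex_of_real (\<phi> y)) \<in> borel_measurable borel")
      case True
      then show ?thesis using lborel_integral_affine[of "\<lambda>y. cis (- (y \<bullet> \<xi>)) * complex_of_real (\<phi> y)" "-1" 0]
        by (simp add: fourier_def)
    next
      case False
      have "\<not> integrable lborel (\<lambda>y. cis (- (y \<bullet> \<xi>)) * complex_of_real (\<phi> y))"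
        using False by (auto dest: borel_measurable_integrable)
      moreover have "\<not> integrable lborel (\<lambda>y. cis (y \<bullet> \<xi>) * complex_of_real (\<phi> (- y)))"
      proof
        assume "integrable lborel (\<lambda>y. cis (y \<bullet> \<xi>) * complex_of_real (\<phi> (- y)))"
        then have [measurable]: "(\<lambda>y. cis (y \<bullet> \<xi>) * complex_of_real (\<phi> (- y))) \<in> borel_measurable borel"
          by (auto dest: borel_measurable_integrable)
        have "(\<lambda>y. (\<lambda>y. cis (y \<bullet> \<xi>) * complex_of_real (\<phi> (- y))) (- y)) \<in> borel_measurable borel" by measurable
        then show False using False by simp
      qed
      ultimately show ?thesis by (simp add: fourier_def not_integrable_integral_eq)
    qed
    then show ?thesis by (simp add: fourier_cnj)
  qed
  then have "cnj (fourier ?g (- x)) = fourier ?g (- x)" by (simp only: fourier_cnj)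
  ultimately show ?thesis
    by (simp add: frac_laplacian_def complex_eq_iff)
qed

lemma frac_laplacian_linear:
  fixes \<phi> \<psi> :: "real^'n \<Rightarrow> real"
  assumes \<phi>: "\<phi> \<in> test_functions UNIV" and \<psi>: "\<psi> \<in> test_functions UNIV" and r: "0 < r" "r \<le> 1"
  shows "frac_laplacian r (\<lambda>x. a * \<phi> x + b * \<psi> x) x = a * frac_laplacian r \<phi> x + b * frac_laplacian r \<psi> x"
proof -
  let ?F = "\<lambda>\<phi>. fourier (\<lambda>x::real^'n. complex_of_real (\<phi> x))"
  let ?g = "\<lambda>\<phi> \<xi>. of_real (norm \<xi> powr (2 * r)) * ?F \<phi> \<xi>"
  have i: "integrable lborel (\<lambda>x. complex_of_real (\<phi> x))" "integrable lborel (\<lambda>x. complex_of_real (\<psi> x))"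
    using test_function_integrable \<phi> \<psi> by (auto intro!: integrable_of_real)
  have lin: "fourier (\<lambda>x. of_real a * f x + of_real b * g x) \<xi> = of_real a * fourier f \<xi> + of_real b * fourier g \<xi>"
    if "integrable lborel f" "integrable lborel g" for f g :: "real^'n \<Rightarrow> complex" and \<xi>
  proof -
    have "(LINT x|lborel. cis (- (x \<bullet> \<xi>)) * (of_real a * f x + of_real b * g x))
      = (LINT x|lborel. of_real a * (cis (- (x \<bullet> \<xi>)) * f x) + of_real b * (cis (- (x \<bullet> \<xi>)) * g x))"
      by (simp add: algebra_simps)
    also have "\<dots> = of_real a * (LINT x|lborel. cis (- (x \<bullet> \<xi>)) * f x) + of_real b * (LINT x|lborel. cis (- (x \<bullet> \<xi>)) * g x)"
      using integrable_cis_mult(2)[OF that(1), of \<xi>] integrable_cis_mult(2)[OF that(2), of \<xi>]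
      by (subst Bochner_Integration.integral_add) auto
    finally show ?thesis by (simp add: fourier_def algebra_simps)
  qed
  have "?g (\<lambda>x. a * \<phi> x + b * \<psi> x) = (\<lambda>\<xi>. of_real a * ?g \<phi> \<xi> + of_real b * ?g \<psi> \<xi>)"
    using lin[OF i] by (simp add: fun_eq_iff algebra_simps)
  then have "complex_of_real (frac_laplacian r (\<lambda>x. a * \<phi> x + b * \<psi> x) x) = of_real a * of_real (frac_laplacian r \<phi> x) + of_real b * of_real (frac_laplacian r \<psi> x)"
    unfolding frac_laplacian_eq_fourier
    using lin[OF fourier_multiplier_test_function(3)[OF \<phi>, of "2 * r"] fourier_multiplier_test_function(3)[OF \<psi>, of "2 * r"]] r by simp
  then show ?thesis by (simp flip: of_real_mult of_real_add)
qed

lemma borel_measurable_frac_laplacian: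
  fixes \<phi> :: "real^'n \<Rightarrow> real"
  assumes "\<phi> \<in> test_functions \<Omega>"
  shows "frac_laplacian r \<phi> \<in> borel_measurable borel"
proof -
  have [measurable]: "\<phi> \<in> borel_measurable borel" using assms by (rule test_function_measurable)
  show ?thesis unfolding frac_laplacian_def[abs_def] inv_fourier_def by measurable
qed

text \<open>Plancherel is applied on the frequency side, to the symbol times the transform, which is
  continuous, bounded and integrable; its own transform is the fractional Laplacian up to
  reflection. Comparison with \<open>gagliardo_fourier\<close> gives the first claim.\<close>

lemma nn_integral_frac_laplacian:
  fixes \<phi> :: "real^'n \<Rightarrow> real"
  assumes \<phi>: "\<phi> \<in> test_functions UNIV" and s: "0 < s" "s < 1"
  shows "gagliardo s \<phi> = ennreal (gagliardo_const CARD('n) s) * (\<integral>\<^sup>+x. ennreal ((frac_laplacian (s / 2) \<phi> x)\<^sup>2) \<partial>lborel)"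
    and "(\<integral>\<^sup>+x. ennreal ((frac_laplacian (s / 2) \<phi> x)\<^sup>2) \<partial>lborel) < \<infinity>"
proof -
  let ?g = "\<lambda>\<xi>. complex_of_real (norm \<xi> powr s) * fourier (\<lambda>y::real^'n. of_real (\<phi> y)) \<xi>"
  have g: "continuous_on UNIV ?g" "\<exists>B. \<forall>\<xi>. norm (?g \<xi>) \<le> B" "integrable lborel ?g"
    using fourier_multiplier_test_function[OF \<phi>, of s] s by auto
  then obtain B where B: "\<And>\<xi>. norm (?g \<xi>) \<le> B" by blast
  have [measurable]: "?g \<in> borel_measurable borel" using g(3) by (auto dest: borel_measurable_integrable)
  have "(\<integral>\<^sup>+x. ennreal ((frac_laplacian (s / 2) \<phi> x)\<^sup>2) \<partial>lborel) = (\<integral>\<^sup>+x. ennreal ((norm (fourier ?g (- x)))\<^sup>2) \<partial>lborel)"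
  proof (rule nn_integral_cong)
    fix x
    have "complex_of_real (frac_laplacian (s / 2) \<phi> x) = fourier ?g (- x)"
      using frac_laplacian_eq_fourier[of "s / 2" \<phi> x] by simp
    from arg_cong[OF this, of norm] have "\<bar>frac_laplacian (s / 2) \<phi> x\<bar> = norm (fourier ?g (- x))" by simp
    then show "ennreal ((frac_laplacian (s / 2) \<phi> x)\<^sup>2) = ennreal ((norm (fourier ?g (- x)))\<^sup>2)"
      by (metis power2_abs)
  qed
  also have "\<dots> = (\<integral>\<^sup>+x. ennreal ((norm (fourier ?g x))\<^sup>2) \<partial>lborel)"
    by (rule nn_integral_lborel_uminus[of "\<lambda>x. ennreal ((norm (fourier ?g x))\<^sup>2)"]) measurable
  also have "\<dots> = (\<integral>\<^sup>+x. ennreal ((norm (?g x))\<^sup>2) \<partial>lborel)"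
    by (rule plancherel[OF g(1) B g(3)])
  finally have A: "(\<integral>\<^sup>+x. ennreal ((frac_laplacian (s / 2) \<phi> x)\<^sup>2) \<partial>lborel) = (\<integral>\<^sup>+x. ennreal ((norm (?g x))\<^sup>2) \<partial>lborel)" .
  have "(\<integral>\<^sup>+x. ennreal ((norm (?g x))\<^sup>2) \<partial>lborel) \<le> (\<integral>\<^sup>+x. ennreal B * ennreal (norm (?g x)) \<partial>lborel)"
    using order_trans[OF norm_ge_zero B] B
    by (intro nn_integral_mono) (auto simp: ennreal_mult[symmetric] power2_eq_square simp del: norm_mult norm_of_real intro!: ennreal_leI mult_right_mono)
  also have "\<dots> < \<infinity>"
    using g(3) by (simp add: nn_integral_cmult integrable_iff_bounded ennreal_mult_less_top)
  finally show "(\<integral>\<^sup>+x. ennreal ((frac_laplacian (s / 2) \<phi> x)\<^sup>2) \<partial>lborel) < \<infinity>" unfolding A .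
  obtain B' where B': "0 < B'" "\<And>x. \<bar>\<phi> x\<bar> \<le> B'" using test_function_bounded[OF \<phi>] by blast
  have sq: "(norm (?g \<xi>))\<^sup>2 = norm \<xi> powr (2 * s) * (norm (fourier (\<lambda>y. of_real (\<phi> y)) \<xi>))\<^sup>2" for \<xi>
    by (simp add: norm_mult power_mult_distrib) (simp add: power2_eq_square powr_add[symmetric])
  show "gagliardo s \<phi> = ennreal (gagliardo_const CARD('n) s) * (\<integral>\<^sup>+x. ennreal ((frac_laplacian (s / 2) \<phi> x)\<^sup>2) \<partial>lborel)"
    unfolding A sq by (rule gagliardo_fourier[OF s test_function_continuous[OF \<phi>] B'(2) test_function_integrable[OF \<phi>]])
qed

section \<open>Convergence and completeness in L2\<close>

lemma tendsto_0_ennreal_square: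
  fixes X :: "nat \<Rightarrow> ennreal"
  assumes "(\<lambda>n. (X n)\<^sup>2) \<longlonglongrightarrow> 0"
  shows "X \<longlonglongrightarrow> 0"
proof (rule order_tendstoI)
  fix a :: ennreal assume "0 < a"
  then have "0 < a\<^sup>2" by (simp add: power2_eq_square ennreal_zero_less_mult_iff)
  from order_tendstoD(2)[OF assms this] show "\<forall>\<^sub>F n in sequentially. X n < a"
    by eventually_elim (meson not_le power_mono zero_le)
qed simp

lemma integrable_mult_L2:
  fixes f g :: "'a \<Rightarrow> real"
  assumes [measurable]: "f \<in> borel_measurable M" "g \<in> borel_measurable M"
    and "(\<integral>\<^sup>+x. ennreal ((f x)\<^sup>2) \<partial>M) < \<infinity>" "(\<integral>\<^sup>+x. ennreal ((g x)\<^sup>2) \<partial>M) < \<infinity>"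
  shows "integrable M (\<lambda>x. f x * g x)"
proof (rule Bochner_Integration.integrable_bound)
  show "integrable M (\<lambda>x. (f x)\<^sup>2 + (g x)\<^sup>2)"
    using assms by (intro Bochner_Integration.integrable_add integrableI_nonneg) auto
  have "\<bar>f x * g x\<bar> \<le> (f x)\<^sup>2 + (g x)\<^sup>2" for x
  proof -
    have "2 * (\<bar>f x\<bar> * \<bar>g x\<bar>) \<le> (f x)\<^sup>2 + (g x)\<^sup>2" using sum_squares_bound[of "\<bar>f x\<bar>" "\<bar>g x\<bar>"] by simp
    moreover have "0 \<le> \<bar>f x\<bar> * \<bar>g x\<bar>" by simp
    ultimately show ?thesis by (simp only: abs_mult)
  qed
  then show "AE x in M. norm (f x * g x) \<le> norm ((f x)\<^sup>2 + (g x)\<^sup>2)" by (intro AE_I2) simp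
qed measurable

lemma L2_mult_tendsto_0:
  fixes f g :: "nat \<Rightarrow> 'a \<Rightarrow> real"
  assumes [measurable]: "\<And>n. f n \<in> borel_measurable M" "\<And>n. g n \<in> borel_measurable M"
    and f: "(\<lambda>n. \<integral>\<^sup>+x. ennreal ((f n x)\<^sup>2) \<partial>M) \<longlonglongrightarrow> 0"
    and g: "(\<lambda>n. \<integral>\<^sup>+x. ennreal ((g n x)\<^sup>2) \<partial>M) \<longlonglongrightarrow> c" and c: "c < \<infinity>"
  shows "(\<lambda>n. \<integral>\<^sup>+x. ennreal (\<bar>f n x\<bar> * \<bar>g n x\<bar>) \<partial>M) \<longlonglongrightarrow> 0"
proof (rule tendsto_0_ennreal_square)
  have "(\<lambda>n. (\<integral>\<^sup>+x. ennreal ((f n x)\<^sup>2) \<partial>M) * (\<integral>\<^sup>+x. ennreal ((g n x)\<^sup>2) \<partial>M)) \<longlonglongrightarrow> 0 * c"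
    using c by (intro tendsto_mult_ennreal f g) auto
  then have *: "(\<lambda>n. (\<integral>\<^sup>+x. ennreal ((f n x)\<^sup>2) \<partial>M) * (\<integral>\<^sup>+x. ennreal ((g n x)\<^sup>2) \<partial>M)) \<longlonglongrightarrow> 0" by simp
  show "(\<lambda>n. (\<integral>\<^sup>+x. ennreal (\<bar>f n x\<bar> * \<bar>g n x\<bar>) \<partial>M)\<^sup>2) \<longlonglongrightarrow> 0"
  proof (rule tendsto_sandwich[OF _ _ tendsto_const *], simp, rule always_eventually, rule allI)
    fix n
    show "(\<integral>\<^sup>+x. ennreal (\<bar>f n x\<bar> * \<bar>g n x\<bar>) \<partial>M)\<^sup>2 \<le> (\<integral>\<^sup>+x. ennreal ((f n x)\<^sup>2) \<partial>M) * (\<integral>\<^sup>+x. ennreal ((g n x)\<^sup>2) \<partial>M)"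
      using Cauchy_Schwarz_nn_integral[of "\<lambda>x. ennreal \<bar>f n x\<bar>" M "\<lambda>x. ennreal \<bar>g n x\<bar>"]
      by (simp add: ennreal_mult ennreal_power)
  qed
qed

text \<open>The difference of the products splits into the product of the two errors and two mixed
  terms; each tends to 0 in L1 by Cauchy-Schwarz.\<close>

lemma L2_inner_tendsto:
  fixes f g :: "nat \<Rightarrow> 'a \<Rightarrow> real"
  assumes [measurable]: "\<And>n. f n \<in> borel_measurable M" "\<And>n. g n \<in> borel_measurable M" "F \<in> borel_measurable M" "G \<in> borel_measurable M"
    and fin: "\<And>n. (\<integral>\<^sup>+x. ennreal ((f n x)\<^sup>2) \<partial>M) < \<infinity>" "\<And>n. (\<integral>\<^sup>+x. ennreal ((g n x)\<^sup>2) \<partial>M) < \<infinity>"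
      "(\<integral>\<^sup>+x. ennreal ((F x)\<^sup>2) \<partial>M) < \<infinity>" "(\<integral>\<^sup>+x. ennreal ((G x)\<^sup>2) \<partial>M) < \<infinity>"
    and f: "(\<lambda>n. \<integral>\<^sup>+x. ennreal ((f n x - F x)\<^sup>2) \<partial>M) \<longlonglongrightarrow> 0"
    and g: "(\<lambda>n. \<integral>\<^sup>+x. ennreal ((g n x - G x)\<^sup>2) \<partial>M) \<longlonglongrightarrow> 0"
  shows "(\<lambda>n. LINT x|M. f n x * g n x) \<longlonglongrightarrow> (LINT x|M. F x * G x)"
proof (rule tendsto_L1_int)
  show "integrable M (\<lambda>x. f n x * g n x)" for n by (rule integrable_mult_L2) (use fin in auto)
  show "integrable M (\<lambda>x. F x * G x)" by (rule integrable_mult_L2) (use fin in auto)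
  have "(\<lambda>n. (\<integral>\<^sup>+x. ennreal (\<bar>f n x - F x\<bar> * \<bar>g n x - G x\<bar>) \<partial>M) + (\<integral>\<^sup>+x. ennreal (\<bar>f n x - F x\<bar> * \<bar>G x\<bar>) \<partial>M)
      + (\<integral>\<^sup>+x. ennreal (\<bar>g n x - G x\<bar> * \<bar>F x\<bar>) \<partial>M)) \<longlonglongrightarrow> 0 + 0 + 0"
    by (intro tendsto_add L2_mult_tendsto_0[OF _ _ f g] L2_mult_tendsto_0[OF _ _ f tendsto_const] L2_mult_tendsto_0[OF _ _ g tendsto_const])
       (use fin in auto)
  then have *: "(\<lambda>n. (\<integral>\<^sup>+x. ennreal (\<bar>f n x - F x\<bar> * \<bar>g n x - G x\<bar>) \<partial>M) + (\<integral>\<^sup>+x. ennreal (\<bar>f n x - F x\<bar> * \<bar>G x\<bar>) \<partial>M)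
      + (\<integral>\<^sup>+x. ennreal (\<bar>g n x - G x\<bar> * \<bar>F x\<bar>) \<partial>M)) \<longlonglongrightarrow> 0" by simp
  show "(\<lambda>n. \<integral>\<^sup>+x. ennreal (norm (f n x * g n x - F x * G x)) \<partial>M) \<longlonglongrightarrow> 0"
  proof (rule tendsto_sandwich[OF _ _ tendsto_const *], simp, rule always_eventually, rule allI)
    fix n
    have pt: "\<bar>f n x * g n x - F x * G x\<bar> \<le> \<bar>f n x - F x\<bar> * \<bar>g n x - G x\<bar> + \<bar>f n x - F x\<bar> * \<bar>G x\<bar> + \<bar>g n x - G x\<bar> * \<bar>F x\<bar>" for x
    proof -
      have "f n x * g n x - F x * G x = (f n x - F x) * (g n x - G x) + (f n x - F x) * G x + (g n x - G x) * F x" by (simp add: algebra_simps)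
      then show ?thesis unfolding abs_mult[symmetric] by linarith
    qed
    have "(\<integral>\<^sup>+x. ennreal (norm (f n x * g n x - F x * G x)) \<partial>M)
      \<le> (\<integral>\<^sup>+x. ennreal (\<bar>f n x - F x\<bar> * \<bar>g n x - G x\<bar>) + ennreal (\<bar>f n x - F x\<bar> * \<bar>G x\<bar>) + ennreal (\<bar>g n x - G x\<bar> * \<bar>F x\<bar>) \<partial>M)"
      using pt by (intro nn_integral_mono) (simp add: ennreal_plus[symmetric] ennreal_leI del: ennreal_plus)
    also have "\<dots> = (\<integral>\<^sup>+x. ennreal (\<bar>f n x - F x\<bar> * \<bar>g n x - G x\<bar>) \<partial>M) + (\<integral>\<^sup>+x. ennreal (\<bar>f n x - F x\<bar> * \<bar>G x\<bar>) \<partial>M)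
      + (\<integral>\<^sup>+x. ennreal (\<bar>g n x - G x\<bar> * \<bar>F x\<bar>) \<partial>M)" by (simp add: nn_integral_add)
    finally show "(\<integral>\<^sup>+x. ennreal (norm (f n x * g n x - F x * G x)) \<partial>M) \<le> \<dots>" .
  qed
qed

text \<open>Along a subsequence the squared increments have integral at most
  \<open>(1 / 8) ^ k\<close>. With weights \<open>2 ^ k\<close> their sum is still integrable, which
  forces geometric decay of the increments at almost every point and hence a pointwise limit. Fatou
  then transfers the convergence to the whole sequence.\<close>

lemma L2_complete:
  fixes f :: "nat \<Rightarrow> 'a \<Rightarrow> real"
  assumes [measurable]: "\<And>n. f n \<in> borel_measurable M"
    and Cauchy: "\<And>e. 0 < e \<Longrightarrow> \<exists>N. \<forall>m\<ge>N. \<forall>n\<ge>N. (\<integral>\<^sup>+x. ennreal ((f m x - f n x)\<^sup>2) \<partial>M) \<le> ennreal e"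
  shows "\<exists>g\<in>borel_measurable M. (\<lambda>n. \<integral>\<^sup>+x. ennreal ((f n x - g x)\<^sup>2) \<partial>M) \<longlonglongrightarrow> 0"
proof -
  have "\<forall>k. \<exists>N. \<forall>m\<ge>N. \<forall>n\<ge>N. (\<integral>\<^sup>+x. ennreal ((f m x - f n x)\<^sup>2) \<partial>M) \<le> ennreal ((1 / 8) ^ k)"
    using Cauchy by simp
  then obtain N where N: "\<And>k m n. N k \<le> m \<Longrightarrow> N k \<le> n \<Longrightarrow> (\<integral>\<^sup>+x. ennreal ((f m x - f n x)\<^sup>2) \<partial>M) \<le> ennreal ((1 / 8) ^ k)"
    by metis
  \<comment> \<open>The sum keeps the indices above \<open>N k\<close>, the summand \<open>k\<close>
    makes them strictly increasing.\<close>
  define r where "r k = (\<Sum>i\<le>k. N i) + k" for k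
  have r: "strict_mono r" "\<And>k. N k \<le> r k"
    by (auto simp: r_def strict_mono_Suc_iff intro: trans_le_add1 member_le_sum)
  then have r': "N k \<le> r (Suc k)" for k by (meson lessI order_trans less_imp_le strict_mono_less)
  let ?\<Delta> = "\<lambda>k x. f (r (Suc k)) x - f (r k) x"
  have "(\<integral>\<^sup>+x. (\<Sum>k. ennreal (2 ^ k * (?\<Delta> k x)\<^sup>2)) \<partial>M) = (\<Sum>k. \<integral>\<^sup>+x. ennreal (2 ^ k * (?\<Delta> k x)\<^sup>2) \<partial>M)"
    by (rule nn_integral_suminf) measurable
  also have "\<dots> \<le> (\<Sum>k. ennreal ((1 / 4) ^ k))"
  proof (rule suminf_le)
    fix k
    have "(\<integral>\<^sup>+x. ennreal (2 ^ k * (?\<Delta> k x)\<^sup>2) \<partial>M) = ennreal (2 ^ k) * (\<integral>\<^sup>+x. ennreal ((?\<Delta> k x)\<^sup>2) \<partial>M)"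
      by (simp add: ennreal_mult nn_integral_cmult)
    also have "\<dots> \<le> ennreal (2 ^ k) * ennreal ((1 / 8) ^ k)" by (intro mult_left_mono N r r') auto
    also have "\<dots> = ennreal ((1 / 4) ^ k)" by (simp add: ennreal_mult[symmetric] power_mult_distrib[symmetric])
    finally show "(\<integral>\<^sup>+x. ennreal (2 ^ k * (?\<Delta> k x)\<^sup>2) \<partial>M) \<le> ennreal ((1 / 4) ^ k)" .
  qed auto
  also have "\<dots> < \<infinity>"
    by (subst suminf_ennreal2) (auto intro: summable_geometric)
  finally have fin: "(\<integral>\<^sup>+x. (\<Sum>k. ennreal (2 ^ k * (?\<Delta> k x)\<^sup>2)) \<partial>M) < \<infinity>" .
  have "AE x in M. (\<Sum>k. ennreal (2 ^ k * (?\<Delta> k x)\<^sup>2)) \<noteq> \<infinity>"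
    by (rule nn_integral_PInf_AE[OF _ less_imp_neq[OF fin]]) measurable
  then have conv: "AE x in M. convergent (\<lambda>k. f (r k) x)"
  proof eventually_elim
    case (elim x)
    define S where "S = enn2real (\<Sum>k. ennreal (2 ^ k * (?\<Delta> k x)\<^sup>2))"
    have S: "0 \<le> S" "(\<Sum>k. ennreal (2 ^ k * (?\<Delta> k x)\<^sup>2)) = ennreal S"
      unfolding S_def using elim ennreal_enn2real[of "\<Sum>k. ennreal (2 ^ k * (?\<Delta> k x)\<^sup>2)"]
      by (simp_all only: less_top infinity_ennreal_def enn2real_nonneg)
    have d: "\<bar>?\<Delta> k x\<bar> \<le> sqrt S * (1 / sqrt 2) ^ k" for k
    proof -
      have "(\<Sum>k\<in>{k}. ennreal (2 ^ k * (?\<Delta> k x)\<^sup>2)) \<le> (\<Sum>k. ennreal (2 ^ k * (?\<Delta> k x)\<^sup>2))"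
        by (rule sum_le_suminf) auto
      then have "ennreal (2 ^ k * (?\<Delta> k x)\<^sup>2) \<le> ennreal S"
        unfolding S(2) by (simp only: sum.insert sum.empty finite.emptyI empty_iff not_False_eq_True add_0_right)
      then have "2 ^ k * (?\<Delta> k x)\<^sup>2 \<le> S" using S(1) by simp
      then have "(?\<Delta> k x)\<^sup>2 \<le> S * (1 / 2) ^ k" by (simp add: field_simps power_divide)
      then have "sqrt ((?\<Delta> k x)\<^sup>2) \<le> sqrt (S * (1 / 2) ^ k)" by (rule real_sqrt_le_mono)
      moreover have "sqrt (S * (1 / 2) ^ k) = sqrt S * (1 / sqrt 2) ^ k"
        by (simp only: real_sqrt_mult real_sqrt_power real_sqrt_divide real_sqrt_one)
      ultimately show ?thesis by (simp only: real_sqrt_abs)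
    qed
    have "summable (\<lambda>k. ?\<Delta> k x)"
    proof (rule summable_comparison_test')
      show "summable (\<lambda>k. sqrt S * (1 / sqrt 2) ^ k)" by (intro summable_mult summable_geometric) auto
      show "norm (?\<Delta> k x) \<le> sqrt S * (1 / sqrt 2) ^ k" if "0 \<le> k" for k using d by simp
    qed
    then have "convergent (\<lambda>n. \<Sum>k<n. ?\<Delta> k x)" by (simp add: summable_iff_convergent)
    then have "convergent (\<lambda>n. f (r n) x - f (r 0) x)"
      using sum_lessThan_telescope[of "\<lambda>k. f (r k) x"] by (simp only:)
    then have "convergent (\<lambda>n. (f (r n) x - f (r 0) x) + f (r 0) x)" by (intro convergent_add convergent_const)
    then show ?case by simp
  qed
  define g where "g x = lim (\<lambda>k. f (r k) x)" for x
  have [measurable]: "g \<in> borel_measurable M" unfolding g_def[abs_def] by measurable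
  have lim: "AE x in M. (\<lambda>k. f (r k) x) \<longlonglongrightarrow> g x"
    using conv by eventually_elim (simp add: g_def convergent_LIMSEQ_iff)
  have small: "(\<integral>\<^sup>+x. ennreal ((f n x - g x)\<^sup>2) \<partial>M) \<le> ennreal e"
    if "\<And>m n. K \<le> m \<Longrightarrow> K \<le> n \<Longrightarrow> (\<integral>\<^sup>+x. ennreal ((f m x - f n x)\<^sup>2) \<partial>M) \<le> ennreal e" "K \<le> n" for e K n
  proof -
    have "(\<integral>\<^sup>+x. ennreal ((f n x - g x)\<^sup>2) \<partial>M) = (\<integral>\<^sup>+x. liminf (\<lambda>k. ennreal ((f n x - f (r k) x)\<^sup>2)) \<partial>M)"
    proof (rule nn_integral_cong_AE)
      show "AE x in M. ennreal ((f n x - g x)\<^sup>2) = liminf (\<lambda>k. ennreal ((f n x - f (r k) x)\<^sup>2))"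
        using lim
      proof eventually_elim
        case (elim x)
        have "(\<lambda>k. ennreal ((f n x - f (r k) x)\<^sup>2)) \<longlonglongrightarrow> ennreal ((f n x - g x)\<^sup>2)"
          by (intro tendsto_ennrealI tendsto_intros elim)
        then show ?case by (rule lim_imp_Liminf[OF trivial_limit_sequentially, THEN sym])
      qed
    qed
    also have "\<dots> \<le> liminf (\<lambda>k. \<integral>\<^sup>+x. ennreal ((f n x - f (r k) x)\<^sup>2) \<partial>M)"
      by (rule nn_integral_liminf) measurable
    also have "\<dots> \<le> ennreal e"
    proof (rule Liminf_le)
      show "\<forall>\<^sub>F k in sequentially. (\<integral>\<^sup>+x. ennreal ((f n x - f (r k) x)\<^sup>2) \<partial>M) \<le> ennreal e"
        using eventually_ge_at_top[of K]
      proof eventually_elim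
        case (elim k)
        then show ?case using seq_suble[OF r(1), of k] by (intro that) auto
      qed
    qed simp
    finally show ?thesis .
  qed
  have "(\<lambda>n. \<integral>\<^sup>+x. ennreal ((f n x - g x)\<^sup>2) \<partial>M) \<longlonglongrightarrow> 0"
  proof (rule order_tendstoI)
    fix a :: ennreal assume "0 < a"
    then obtain y where y: "0 < y" "y < a" using dense by blast
    then obtain e where e: "0 < e" "ennreal e < a" by (cases y) auto
    then obtain K where "\<And>m n. K \<le> m \<Longrightarrow> K \<le> n \<Longrightarrow> (\<integral>\<^sup>+x. ennreal ((f m x - f n x)\<^sup>2) \<partial>M) \<le> ennreal e" using Cauchy by blast
    then have "(\<integral>\<^sup>+x. ennreal ((f n x - g x)\<^sup>2) \<partial>M) < a" if "K \<le> n" for n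
      using small[of K e n] that e(2) by (meson order_le_less_trans)
    then show "\<forall>\<^sub>F n in sequentially. (\<integral>\<^sup>+x. ennreal ((f n x - g x)\<^sup>2) \<partial>M) < a"
      unfolding eventually_sequentially by blast
  qed simp
  then show ?thesis by (intro bexI[of _ g]) auto
qed

text \<open>A square root, with sign, of the integrand of \<open>gagliardo\<close>. It embeds the
  seminorm isometrically into L2 over pairs of points, which supplies bilinearity, Cauchy-Schwarz
  and limits.\<close>

definition gagliardo_quotient :: "real \<Rightarrow> ('a::euclidean_space \<Rightarrow> real) \<Rightarrow> 'a \<times> 'a \<Rightarrow> real" where
  "gagliardo_quotient s u z = (u (fst z) - u (snd z)) * norm (fst z - snd z) powr (- (real DIM('a) + 2 * s) / 2)"

definition gagliardo_inner :: "real \<Rightarrow> ('a::euclidean_space \<Rightarrow> real) \<Rightarrow> ('a \<Rightarrow> real) \<Rightarrow> real" where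
  "gagliardo_inner s u w = (LINT z|(lborel \<Otimes>\<^sub>M lborel). gagliardo_quotient s u z * gagliardo_quotient s w z)"

lemma borel_measurable_gagliardo_quotient [measurable]:
  fixes u :: "'a::euclidean_space \<Rightarrow> real"
  assumes [measurable]: "u \<in> borel_measurable borel"
  shows "gagliardo_quotient s u \<in> borel_measurable (lborel \<Otimes>\<^sub>M lborel)"
  unfolding gagliardo_quotient_def[abs_def] by measurable

lemma gagliardo_quotient_linear:
  "gagliardo_quotient s (\<lambda>x. a * u x + b * w x) z = a * gagliardo_quotient s u z + b * gagliardo_quotient s w z"
  by (simp add: gagliardo_quotient_def algebra_simps)

lemma gagliardo_quotient_diff:
  "gagliardo_quotient s (\<lambda>x. u x - w x) z = gagliardo_quotient s u z - gagliardo_quotient s w z"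
  by (simp add: gagliardo_quotient_def algebra_simps)

lemma gagliardo_eq_quotient:
  fixes u :: "'a::euclidean_space \<Rightarrow> real"
  assumes [measurable]: "u \<in> borel_measurable borel"
  shows "gagliardo s u = (\<integral>\<^sup>+z. ennreal ((gagliardo_quotient s u z)\<^sup>2) \<partial>(lborel \<Otimes>\<^sub>M lborel))"
proof -
  have sq: "(gagliardo_quotient s u (x, y))\<^sup>2 = (u x - u y)\<^sup>2 * norm (x - y) powr (- (real DIM('a) + 2 * s))" for x y
  proof -
    have "(t powr e)\<^sup>2 = t powr (2 * e)" for t e :: real by (simp add: power2_eq_square powr_add[symmetric])
    moreover have "2 * (- (real DIM('a) + 2 * s) / 2) = - (real DIM('a) + 2 * s)" by simp
    ultimately show ?thesis by (simp only: gagliardo_quotient_def power_mult_distrib fst_conv snd_conv)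
  qed
  have "(\<integral>\<^sup>+z. ennreal ((gagliardo_quotient s u z)\<^sup>2) \<partial>(lborel \<Otimes>\<^sub>M lborel)) = (\<integral>\<^sup>+x. \<integral>\<^sup>+y. ennreal ((gagliardo_quotient s u (x, y))\<^sup>2) \<partial>lborel \<partial>lborel)"
    by (rule lborel.nn_integral_fst[symmetric]) measurable
  then show ?thesis by (simp add: gagliardo_def sq)
qed

lemma gagliardo_inner_scale_left: "gagliardo_inner s (\<lambda>x. c * u x) w = c * gagliardo_inner s u w"
proof -
  have "gagliardo_quotient s (\<lambda>x. c * u x) z = c * gagliardo_quotient s u z" for z
    using gagliardo_quotient_linear[of s c u 0 u z] by simp
  then show ?thesis by (simp add: gagliardo_inner_def mult.assoc)
qed

lemma gagliardo_inner_add_self: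
  fixes u w :: "'a::euclidean_space \<Rightarrow> real"
  assumes [measurable]: "u \<in> borel_measurable borel" "w \<in> borel_measurable borel"
    and fin: "gagliardo s u < \<infinity>" "gagliardo s w < \<infinity>"
  shows "gagliardo_inner s (\<lambda>x. u x + w x) (\<lambda>x. u x + w x) = gagliardo_inner s u u + 2 * gagliardo_inner s u w + gagliardo_inner s w w"
proof -
  let ?P = "lborel \<Otimes>\<^sub>M lborel :: ('a \<times> 'a) measure" and ?Q = "gagliardo_quotient s"
  have sq: "integrable ?P (\<lambda>z. ?Q f z * ?Q f z)" if [measurable]: "f \<in> borel_measurable borel" and "gagliardo s f < \<infinity>" for f
    using that by (intro integrable_mult_L2) (auto simp: gagliardo_eq_quotient)
  have cross: "integrable ?P (\<lambda>z. ?Q u z * ?Q w z)"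
    using fin by (intro integrable_mult_L2) (auto simp: gagliardo_eq_quotient)
  have "gagliardo_inner s (\<lambda>x. u x + w x) (\<lambda>x. u x + w x) = (LINT z|(?P). ?Q u z * ?Q u z + 2 * (?Q u z * ?Q w z) + ?Q w z * ?Q w z)"
    unfolding gagliardo_inner_def
    by (intro Bochner_Integration.integral_cong refl)
       (simp add: gagliardo_quotient_linear[of s 1 u 1 w, simplified] algebra_simps)
  also have "\<dots> = gagliardo_inner s u u + 2 * gagliardo_inner s u w + gagliardo_inner s w w"
    using sq[of u] sq[of w] cross fin by (simp add: gagliardo_inner_def)
  finally show ?thesis .
qed

lemma gagliardo_linear_le:
  fixes u w :: "'a::euclidean_space \<Rightarrow> real"
  assumes [measurable]: "u \<in> borel_measurable borel" "w \<in> borel_measurable borel"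
  shows "gagliardo s (\<lambda>x. a * u x + b * w x) \<le> ennreal (2 * a\<^sup>2) * gagliardo s u + ennreal (2 * b\<^sup>2) * gagliardo s w"
proof -
  have "gagliardo s (\<lambda>x. a * u x + b * w x) = (\<integral>\<^sup>+z. ennreal ((a * gagliardo_quotient s u z + b * gagliardo_quotient s w z)\<^sup>2) \<partial>(lborel \<Otimes>\<^sub>M lborel))"
    by (subst gagliardo_eq_quotient) (simp_all add: gagliardo_quotient_linear)
  also have "\<dots> \<le> (\<integral>\<^sup>+z. ennreal (2 * a\<^sup>2) * ennreal ((gagliardo_quotient s u z)\<^sup>2) + ennreal (2 * b\<^sup>2) * ennreal ((gagliardo_quotient s w z)\<^sup>2) \<partial>(lborel \<Otimes>\<^sub>M lborel))"
  proof (rule nn_integral_mono)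
    fix z
    have "(p + q)\<^sup>2 \<le> 2 * p\<^sup>2 + 2 * q\<^sup>2" for p q :: real
      using sum_squares_bound[of p q] by (simp add: power2_sum)
    from this[of "a * gagliardo_quotient s u z" "b * gagliardo_quotient s w z"]
    show "ennreal ((a * gagliardo_quotient s u z + b * gagliardo_quotient s w z)\<^sup>2)
        \<le> ennreal (2 * a\<^sup>2) * ennreal ((gagliardo_quotient s u z)\<^sup>2) + ennreal (2 * b\<^sup>2) * ennreal ((gagliardo_quotient s w z)\<^sup>2)"
      by (simp add: ennreal_mult[symmetric] ennreal_plus[symmetric] power_mult_distrib ennreal_leI del: ennreal_plus)
  qed
  also have "\<dots> = ennreal (2 * a\<^sup>2) * gagliardo s u + ennreal (2 * b\<^sup>2) * gagliardo s w"
    by (simp add: nn_integral_add nn_integral_cmult gagliardo_eq_quotient)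
  finally show ?thesis .
qed

lemma gagliardo_diff_le:
  fixes u w :: "'a::euclidean_space \<Rightarrow> real"
  assumes "u \<in> borel_measurable borel" "w \<in> borel_measurable borel"
  shows "gagliardo s (\<lambda>x. u x - w x) \<le> 2 * gagliardo s u + 2 * gagliardo s w"
  using gagliardo_linear_le[OF assms, of s 1 "-1"] by simp

text \<open>Fatou is used in each variable separately, so almost everywhere convergence on the
  single space is enough and never has to be lifted to the product.\<close>

lemma gagliardo_liminf:
  fixes v :: "nat \<Rightarrow> 'a::euclidean_space \<Rightarrow> real"
  assumes [measurable]: "\<And>k. v k \<in> borel_measurable borel"
    and lim: "AE x in lborel. (\<lambda>k. v k x) \<longlonglongrightarrow> w x"
  shows "gagliardo s w \<le> liminf (\<lambda>k. gagliardo s (v k))"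
proof -
  let ?f = "\<lambda>u x y. ennreal ((u x - u y)\<^sup>2 * norm (x - y) powr (- (real DIM('a) + 2 * s)))"
  have inner: "AE x in lborel. (\<integral>\<^sup>+y. ?f w x y \<partial>lborel) \<le> liminf (\<lambda>k. \<integral>\<^sup>+y. ?f (v k) x y \<partial>lborel)"
    using lim
  proof eventually_elim
    case x: (elim x)
    have "(\<integral>\<^sup>+y. ?f w x y \<partial>lborel) = (\<integral>\<^sup>+y. liminf (\<lambda>k. ?f (v k) x y) \<partial>lborel)"
    proof (rule nn_integral_cong_AE)
      show "AE y in lborel. ?f w x y = liminf (\<lambda>k. ?f (v k) x y)"
        using lim
      proof eventually_elim
        case (elim y)
        have "(\<lambda>k. ?f (v k) x y) \<longlonglongrightarrow> ?f w x y"
          by (rule tendsto_ennrealI[OF tendsto_mult[OF tendsto_power[OF tendsto_diff[OF x elim]] tendsto_const]])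
        then show ?case by (rule lim_imp_Liminf[OF trivial_limit_sequentially, THEN sym])
      qed
    qed
    also have "\<dots> \<le> liminf (\<lambda>k. \<integral>\<^sup>+y. ?f (v k) x y \<partial>lborel)"
      by (rule nn_integral_liminf) measurable
    finally show ?case .
  qed
  have "gagliardo s w \<le> (\<integral>\<^sup>+x. liminf (\<lambda>k. \<integral>\<^sup>+y. ?f (v k) x y \<partial>lborel) \<partial>lborel)"
    unfolding gagliardo_def by (rule nn_integral_mono_AE[OF inner])
  also have "\<dots> \<le> liminf (\<lambda>k. gagliardo s (v k))"
    unfolding gagliardo_def by (rule nn_integral_liminf) measurable
  finally show ?thesis .
qed

lemma powr_add_le:
  fixes a b p :: real
  assumes "0 \<le> p"
  shows "\<bar>a + b\<bar> powr p \<le> 2 powr p * (\<bar>a\<bar> powr p + \<bar>b\<bar> powr p)"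
proof -
  have "\<bar>a + b\<bar> powr p \<le> (2 * max \<bar>a\<bar> \<bar>b\<bar>) powr p" using assms by (intro powr_mono2) auto
  also have "\<dots> = 2 powr p * (max \<bar>a\<bar> \<bar>b\<bar>) powr p" by (rule powr_mult)
  also have "(max \<bar>a\<bar> \<bar>b\<bar>) powr p \<le> \<bar>a\<bar> powr p + \<bar>b\<bar> powr p" by (auto simp: max_def)
  finally show ?thesis by simp
qed

lemma nn_integral_powr_add_le:
  fixes f g :: "'a \<Rightarrow> real"
  assumes [measurable]: "f \<in> borel_measurable M" "g \<in> borel_measurable M" and "0 \<le> p"
  shows "(\<integral>\<^sup>+x. ennreal (\<bar>f x + g x\<bar> powr p) \<partial>M)
    \<le> ennreal (2 powr p) * ((\<integral>\<^sup>+x. ennreal (\<bar>f x\<bar> powr p) \<partial>M) + (\<integral>\<^sup>+x. ennreal (\<bar>g x\<bar> powr p) \<partial>M))"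
proof -
  have "(\<integral>\<^sup>+x. ennreal (\<bar>f x + g x\<bar> powr p) \<partial>M) \<le> (\<integral>\<^sup>+x. ennreal (2 powr p) * (ennreal (\<bar>f x\<bar> powr p) + ennreal (\<bar>g x\<bar> powr p)) \<partial>M)"
    using powr_add_le[OF \<open>0 \<le> p\<close>]
    by (intro nn_integral_mono) (simp add: ennreal_mult[symmetric] ennreal_plus[symmetric] ennreal_leI del: ennreal_plus)
  also have "\<dots> = ennreal (2 powr p) * ((\<integral>\<^sup>+x. ennreal (\<bar>f x\<bar> powr p) \<partial>M) + (\<integral>\<^sup>+x. ennreal (\<bar>g x\<bar> powr p) \<partial>M))"
    by (simp add: nn_integral_cmult nn_integral_add)
  finally show ?thesis .
qed

text \<open>The functions \<open>\<bar>f n x - g x\<bar> powr p\<close> tend to 0 in L1, where such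
  a subsequence is known. The first \<open>n0\<close> terms are skipped because only the later
  integrals are known to be finite.\<close>

lemma Lp_tendsto_AE_subseq:
  fixes f :: "nat \<Rightarrow> 'a \<Rightarrow> real"
  assumes [measurable]: "\<And>n. f n \<in> borel_measurable M" "g \<in> borel_measurable M" and p: "0 < p"
    and lim: "(\<lambda>n. \<integral>\<^sup>+x. ennreal (\<bar>f n x - g x\<bar> powr p) \<partial>M) \<longlonglongrightarrow> 0"
  shows "\<exists>r. strict_mono r \<and> (AE x in M. (\<lambda>k. f (r k) x) \<longlonglongrightarrow> g x)"
proof -
  from order_tendstoD(2)[OF lim, of 1] obtain n0 where n0: "\<And>n. n0 \<le> n \<Longrightarrow> (\<integral>\<^sup>+x. ennreal (\<bar>f n x - g x\<bar> powr p) \<partial>M) < 1"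
    by (auto simp: eventually_sequentially)
  let ?v = "\<lambda>n x. \<bar>f (n + n0) x - g x\<bar> powr p"
  have int: "integrable M (?v n)" for n
    using n0[of "n + n0"] by (intro integrableI_nonneg) (auto intro: order_less_trans)
  have "(\<lambda>n. ennreal (LINT x|M. norm (?v n x))) \<longlonglongrightarrow> ennreal 0"
    using LIMSEQ_ignore_initial_segment[OF lim, of n0] int
    by (simp add: nn_integral_eq_integral)
  then have "(\<lambda>n. LINT x|M. norm (?v n x)) \<longlonglongrightarrow> 0"
    by (subst (asm) tendsto_ennreal_iff) auto
  from tendsto_L1_AE_subseq[OF int this] obtain r where r: "strict_mono r" "AE x in M. (\<lambda>n. ?v (r n) x) \<longlonglongrightarrow> 0" by blast
  have "AE x in M. (\<lambda>k. f (r k + n0) x) \<longlonglongrightarrow> g x"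
    using r(2)
  proof eventually_elim
    case (elim x)
    have "(\<lambda>k. (?v (r k) x) powr (1 / p)) \<longlonglongrightarrow> 0 powr (1 / p)"
      using p by (intro tendsto_powr' elim tendsto_const) auto
    then have "(\<lambda>k. \<bar>f (r k + n0) x - g x\<bar>) \<longlonglongrightarrow> 0" using p by (simp add: powr_powr)
    then have "(\<lambda>k. f (r k + n0) x - g x) \<longlonglongrightarrow> 0" by (rule tendsto_rabs_zero_cancel)
    then show ?case by (rule LIM_zero_cancel)
  qed
  moreover have "strict_mono (\<lambda>k. r k + n0)" using r(1) by (simp add: strict_mono_def)
  ultimately show ?thesis by blast
qed

lemma integral_mult_polar:
  fixes f g :: "'a \<Rightarrow> real"
  assumes [measurable]: "f \<in> borel_measurable M" "g \<in> borel_measurable M"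
    and fin: "(\<integral>\<^sup>+x. ennreal ((f x)\<^sup>2) \<partial>M) < \<infinity>" "(\<integral>\<^sup>+x. ennreal ((g x)\<^sup>2) \<partial>M) < \<infinity>"
  shows "4 * (LINT x|M. f x * g x) = (LINT x|M. (f x + g x)\<^sup>2) - (LINT x|M. (f x - g x)\<^sup>2)"
proof -
  have i: "integrable M (\<lambda>x. f x * g x)" "integrable M (\<lambda>x. (f x)\<^sup>2)" "integrable M (\<lambda>x. (g x)\<^sup>2)"
    using fin by (auto intro: integrable_mult_L2 integrableI_nonneg)
  have "(LINT x|M. (f x + g x)\<^sup>2) - (LINT x|M. (f x - g x)\<^sup>2) = (LINT x|M. (f x + g x)\<^sup>2 - (f x - g x)\<^sup>2)"
    using i by (intro Bochner_Integration.integral_diff[symmetric]) (auto simp: power2_sum power2_diff mult.assoc)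
  also have "\<dots> = (LINT x|M. 4 * (f x * g x))"
    by (intro Bochner_Integration.integral_cong refl) (simp add: power2_sum power2_diff)
  finally show ?thesis by simp
qed

lemma test_norm_square:
  fixes \<phi> :: "real^'n \<Rightarrow> real"
  assumes \<phi>: "\<phi> \<in> test_functions UNIV" and s: "0 < s" "s < 1"
  shows "ennreal ((test_norm s \<phi>)\<^sup>2) = (\<integral>\<^sup>+x. ennreal ((frac_laplacian (s / 2) \<phi> x)\<^sup>2) \<partial>lborel)"
    "gagliardo s \<phi> = ennreal (gagliardo_const CARD('n) s * (test_norm s \<phi>)\<^sup>2)"
proof -
  have [measurable]: "frac_laplacian (s / 2) \<phi> \<in> borel_measurable borel" by (rule borel_measurable_frac_laplacian[OF \<phi>])
  have "(\<integral>\<^sup>+x. ennreal ((frac_laplacian (s / 2) \<phi> x)\<^sup>2) \<partial>lborel) = ennreal (LINT x|lborel. (frac_laplacian (s / 2) \<phi> x)\<^sup>2)"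
    using nn_integral_frac_laplacian(2)[OF \<phi> s] by (intro nn_integral_eq_integral integrableI_nonneg) auto
  then show 1: "ennreal ((test_norm s \<phi>)\<^sup>2) = (\<integral>\<^sup>+x. ennreal ((frac_laplacian (s / 2) \<phi> x)\<^sup>2) \<partial>lborel)"
    by (simp add: test_norm_def)
  show "gagliardo s \<phi> = ennreal (gagliardo_const CARD('n) s * (test_norm s \<phi>)\<^sup>2)"
    unfolding nn_integral_frac_laplacian(1)[OF \<phi> s] 1[symmetric]
    using gagliardo_const_pos[OF s, of "CARD('n)"] by (simp add: ennreal_mult)
qed

lemma D_limit_cong_AE:
  fixes u w :: "real^'n \<Rightarrow> real"
  assumes "AE x in lborel. u x = w x"
  shows "D_limit s \<phi> u \<longleftrightarrow> D_limit s \<phi> w"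
proof -
  have "(\<integral>\<^sup>+x. ennreal (\<bar>\<phi> n x - u x\<bar> powr two_star (real CARD('n)) s) \<partial>lborel)
    = (\<integral>\<^sup>+x. ennreal (\<bar>\<phi> n x - w x\<bar> powr two_star (real CARD('n)) s) \<partial>lborel)" for n
    by (rule nn_integral_cong_AE) (use assms in auto)
  then show ?thesis by (simp add: D_limit_def)
qed

text \<open>The predicate under the choice sees \<open>u\<close> only up to null sets, so the chosen
  representatives are equal as functions and not merely almost everywhere.\<close>

lemma half_laplacian_cong_AE:
  fixes u w :: "real^'n \<Rightarrow> real"
  assumes "AE x in lborel. u x = w x"
  shows "half_laplacian s u = half_laplacian s w"
  by (simp add: half_laplacian_def D_limit_cong_AE[OF assms])

lemma D_space_cong_AE:
  fixes u w :: "real^'n \<Rightarrow> real"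
  assumes "AE x in lborel. u x = w x" "u \<in> D_space s" "w \<in> borel_measurable borel"
  shows "w \<in> D_space s"
  using assms by (auto simp: D_space_def D_limit_cong_AE[OF assms(1)])

section \<open>The energy space as a function space, its inner product and its Sobolev
  embedding\<close>

context
  fixes s :: real and dim :: "'n::finite itself" and p :: real
  assumes s: "0 < s" "s < 1" and dim: "2 * s < CARD('n)"
  defines "p \<equiv> two_star (real CARD('n)) s"
begin

lemma two_star_pos: "0 < p"
  using s dim by (simp add: p_def two_star_def)

lemma D_limit_test: "D_limit s \<phi> u \<Longrightarrow> \<phi> n \<in> test_functions UNIV"
  by (simp add: D_limit_def)

lemma D_limit_Lp:
  fixes u :: "real^'n \<Rightarrow> real"
  shows "D_limit s \<phi> u \<Longrightarrow> (\<lambda>n. \<integral>\<^sup>+x. ennreal (\<bar>\<phi> n x - u x\<bar> powr p) \<partial>lborel) \<longlonglongrightarrow> 0"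
  by (simp add: D_limit_def p_def)

lemma D_limit_Cauchy:
  fixes u :: "real^'n \<Rightarrow> real"
  assumes "D_limit s \<phi> u" "0 < e"
  shows "\<exists>M. \<forall>m\<ge>M. \<forall>n\<ge>M. gagliardo s (\<lambda>x. \<phi> m x - \<phi> n x) \<le> ennreal e \<and>
    (\<integral>\<^sup>+x. ennreal ((frac_laplacian (s / 2) (\<phi> m) x - frac_laplacian (s / 2) (\<phi> n) x)\<^sup>2) \<partial>lborel) \<le> ennreal e"
proof -
  let ?k = "gagliardo_const CARD('n) s"
  have k: "0 < ?k" using gagliardo_const_pos[OF s] by simp
  \<comment> \<open>Small enough for both claims at once: \<open>d\<^sup>2\<close> is at most
    \<open>e\<close> and at most \<open>e / ?k\<close>.\<close>
  define d where "d = sqrt (min e (e / ?k))"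
  have d: "0 < d" "d\<^sup>2 \<le> e" "?k * d\<^sup>2 \<le> e" using \<open>0 < e\<close> k by (auto simp: d_def min_def field_simps)
  obtain M where M: "\<And>m n. M \<le> m \<Longrightarrow> M \<le> n \<Longrightarrow> test_norm s (\<lambda>x. \<phi> m x - \<phi> n x) < d"
    using assms(1) d(1) unfolding D_limit_def by blast
  have "gagliardo s (\<lambda>x. \<phi> m x - \<phi> n x) \<le> ennreal e \<and>
    (\<integral>\<^sup>+x. ennreal ((frac_laplacian (s / 2) (\<phi> m) x - frac_laplacian (s / 2) (\<phi> n) x)\<^sup>2) \<partial>lborel) \<le> ennreal e" if "M \<le> m" "M \<le> n" for m n
  proof -
    note tests = D_limit_test[OF assms(1), of m] D_limit_test[OF assms(1), of n]
    have t: "(\<lambda>x. \<phi> m x - \<phi> n x) \<in> test_functions UNIV"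
      using test_function_linear_combination[OF tests, of 1 "-1"] by simp
    have A: "frac_laplacian (s / 2) (\<lambda>x. \<phi> m x - \<phi> n x) x = frac_laplacian (s / 2) (\<phi> m) x - frac_laplacian (s / 2) (\<phi> n) x" for x
      using frac_laplacian_linear[OF tests, of "s / 2" 1 "-1" x] s by simp
    have "0 \<le> test_norm s (\<lambda>x. \<phi> m x - \<phi> n x)" by (simp add: test_norm_def)
    then have T: "(test_norm s (\<lambda>x. \<phi> m x - \<phi> n x))\<^sup>2 \<le> d\<^sup>2" using M[OF that] by (intro power_mono) auto
    have "?k * (test_norm s (\<lambda>x. \<phi> m x - \<phi> n x))\<^sup>2 \<le> e" using order_trans[OF mult_left_mono[OF T, of ?k] d(3)] k by simp
    then show ?thesis
      using order_trans[OF T d(2)] unfolding test_norm_square(1)[OF t s, unfolded A, symmetric] test_norm_square(2)[OF t s]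
      by (auto intro: ennreal_leI)
  qed
  then show ?thesis by blast
qed

text \<open>\<open>D_limit\<close> controls only mutual distances in the seminorm. A subsequence
  converges almost everywhere to \<open>u\<close>, and lower semicontinuity bounds the distance to
  \<open>u\<close> by distances within the sequence.\<close>

lemma D_limit_gagliardo:
  fixes u :: "real^'n \<Rightarrow> real"
  assumes D: "D_limit s \<phi> u" and [measurable]: "u \<in> borel_measurable borel"
  shows "(\<lambda>n. gagliardo s (\<lambda>x. \<phi> n x - u x)) \<longlonglongrightarrow> 0"
proof -
  have [measurable]: "\<phi> n \<in> borel_measurable borel" for n by (rule test_function_measurable[OF D_limit_test[OF D]])
  obtain r where r: "strict_mono r" "AE x in lborel. (\<lambda>k. \<phi> (r k) x) \<longlonglongrightarrow> u x"
    using Lp_tendsto_AE_subseq[OF _ _ two_star_pos D_limit_Lp[OF D]] by auto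
  show ?thesis
  proof (rule order_tendstoI)
    fix a :: ennreal assume "0 < a"
    then obtain y where y: "0 < y" "y < a" using dense by blast
    then obtain e where e: "0 < e" "ennreal e < a" by (cases y) auto
    then obtain M where M: "\<And>m n. M \<le> m \<Longrightarrow> M \<le> n \<Longrightarrow> gagliardo s (\<lambda>x. \<phi> m x - \<phi> n x) \<le> ennreal e"
      using D_limit_Cauchy[OF D, of e] by blast
    have "gagliardo s (\<lambda>x. \<phi> n x - u x) < a" if "M \<le> n" for n
    proof -
      have "gagliardo s (\<lambda>x. \<phi> n x - u x) \<le> liminf (\<lambda>k. gagliardo s (\<lambda>x. \<phi> n x - \<phi> (r k) x))"
      proof (rule gagliardo_liminf)
        show "AE x in lborel. (\<lambda>k. \<phi> n x - \<phi> (r k) x) \<longlonglongrightarrow> \<phi> n x - u x"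
          using r(2) by eventually_elim (intro tendsto_intros)
      qed measurable
      also have "\<dots> \<le> ennreal e"
      proof (rule Liminf_le)
        show "\<forall>\<^sub>F k in sequentially. gagliardo s (\<lambda>x. \<phi> n x - \<phi> (r k) x) \<le> ennreal e"
          using eventually_ge_at_top[of M]
        proof eventually_elim
          case (elim k)
          then show ?case using seq_suble[OF r(1), of k] that by (intro M) auto
        qed
      qed simp
      finally show ?thesis using e by simp
    qed
    then show "\<forall>\<^sub>F n in sequentially. gagliardo s (\<lambda>x. \<phi> n x - u x) < a"
      unfolding eventually_sequentially by blast
  qed simp
qed

lemma test_function_gagliardo_finite:
  fixes \<phi> :: "real^'n \<Rightarrow> real"
  shows "\<phi> \<in> test_functions UNIV \<Longrightarrow> gagliardo s \<phi> < \<infinity>"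
  by (simp add: test_norm_square(2)[OF _ s])

lemma D_space_measurable [measurable_dest]:
  fixes u :: "real^'n \<Rightarrow> real"
  shows "u \<in> D_space s \<Longrightarrow> u \<in> borel_measurable borel"
  by (simp add: D_space_def)

lemma D_space_gagliardo_finite:
  fixes u :: "real^'n \<Rightarrow> real"
  assumes "u \<in> D_space s"
  shows "gagliardo s u < \<infinity>"
proof -
  have [measurable]: "u \<in> borel_measurable borel" using assms by (rule D_space_measurable)
  obtain \<phi> where D: "D_limit s \<phi> u" using assms by (auto simp: D_space_def)
  obtain n where n: "gagliardo s (\<lambda>x. \<phi> n x - u x) < 1"
    using order_tendstoD(2)[OF D_limit_gagliardo[OF D \<open>u \<in> borel_measurable borel\<close>], of 1] by (auto simp: eventually_sequentially)
  note t = D_limit_test[OF D, of n]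
  have [measurable]: "\<phi> n \<in> borel_measurable borel" by (rule test_function_measurable[OF t])
  have "gagliardo s u \<le> 2 * gagliardo s (\<phi> n) + 2 * gagliardo s (\<lambda>x. \<phi> n x - u x)"
    using gagliardo_diff_le[of "\<phi> n" "\<lambda>x. \<phi> n x - u x" s] by simp
  also have "\<dots> < \<infinity>" using test_function_gagliardo_finite[OF t] n
    by (auto simp: ennreal_mult_less_top intro: order_less_trans)
  finally show ?thesis .
qed

lemma test_function_Lp_finite:
  fixes \<phi> :: "real^'n \<Rightarrow> real"
  assumes \<phi>: "\<phi> \<in> test_functions UNIV"
  shows "(\<integral>\<^sup>+x. ennreal (\<bar>\<phi> x\<bar> powr p) \<partial>lborel) < \<infinity>"
proof -
  obtain R where R: "0 < R" "\<And>x. R < norm x \<Longrightarrow> \<phi> x = 0" using test_function_support[OF \<phi>] by blast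
  obtain B where B: "0 < B" "\<And>x. \<bar>\<phi> x\<bar> \<le> B" using test_function_bounded[OF \<phi>] by blast
  have [measurable]: "\<phi> \<in> borel_measurable borel" by (rule test_function_measurable[OF \<phi>])
  have "integrable lborel (\<lambda>x. \<bar>\<phi> x\<bar> powr p)"
    by (rule integrable_bounded_support[of _ "B powr p" R]) (use R B two_star_pos in \<open>auto intro!: powr_mono2\<close>)
  then show ?thesis by (simp add: integrable_iff_bounded)
qed

lemma D_space_Lp_finite:
  fixes u :: "real^'n \<Rightarrow> real"
  assumes "u \<in> D_space s"
  shows "(\<integral>\<^sup>+x. ennreal (\<bar>u x\<bar> powr p) \<partial>lborel) < \<infinity>"
proof -
  have [measurable]: "u \<in> borel_measurable borel" using assms by (rule D_space_measurable)
  obtain \<phi> where D: "D_limit s \<phi> u" using assms by (auto simp: D_space_def)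
  obtain n where n: "(\<integral>\<^sup>+x. ennreal (\<bar>\<phi> n x - u x\<bar> powr p) \<partial>lborel) < 1"
    using order_tendstoD(2)[OF D_limit_Lp[OF D], of 1] by (auto simp: eventually_sequentially)
  note t = D_limit_test[OF D, of n]
  have [measurable]: "\<phi> n \<in> borel_measurable borel" by (rule test_function_measurable[OF t])
  have "(\<integral>\<^sup>+x. ennreal (\<bar>u x\<bar> powr p) \<partial>lborel) = (\<integral>\<^sup>+x. ennreal (\<bar>(u x - \<phi> n x) + \<phi> n x\<bar> powr p) \<partial>lborel)" by simp
  also have "\<dots> \<le> ennreal (2 powr p) * ((\<integral>\<^sup>+x. ennreal (\<bar>u x - \<phi> n x\<bar> powr p) \<partial>lborel) + (\<integral>\<^sup>+x. ennreal (\<bar>\<phi> n x\<bar> powr p) \<partial>lborel))"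
    using two_star_pos by (intro nn_integral_powr_add_le) auto
  also have "\<dots> < \<infinity>"
    using n test_function_Lp_finite[OF t] by (auto simp: abs_minus_commute ennreal_mult_less_top intro: order_less_trans)
  finally show ?thesis .
qed

text \<open>For membership proofs the distance to the limit is easier to estimate. The Cauchy
  property follows by the triangle inequality, because on test functions the norm is a fixed
  multiple of the seminorm.\<close>

lemma D_limitI:
  fixes u :: "real^'n \<Rightarrow> real"
  assumes \<phi>: "\<And>n. \<phi> n \<in> test_functions UNIV" and [measurable]: "u \<in> borel_measurable borel"
    and G: "(\<lambda>n. gagliardo s (\<lambda>x. \<phi> n x - u x)) \<longlonglongrightarrow> 0"
    and Lp: "(\<lambda>n. \<integral>\<^sup>+x. ennreal (\<bar>\<phi> n x - u x\<bar> powr p) \<partial>lborel) \<longlonglongrightarrow> 0"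
  shows "D_limit s \<phi> u"
  unfolding D_limit_def
proof (intro conjI allI impI)
  have [measurable]: "\<phi> n \<in> borel_measurable borel" for n by (rule test_function_measurable[OF \<phi>])
  let ?k = "gagliardo_const CARD('n) s"
  have k: "0 < ?k" using gagliardo_const_pos[OF s] by simp
  fix e :: real assume "0 < e"
  \<comment> \<open>The triangle inequality for squares costs \<open>2 * d + 2 * d\<close>, which
    this choice makes half of \<open>?k * e\<^sup>2\<close>; the other half gives the strict
    inequality.\<close>
  define d where "d = ?k * e\<^sup>2 / 8"
  have d: "0 < d" using \<open>0 < e\<close> k by (simp add: d_def)
  obtain M where M: "\<And>n. M \<le> n \<Longrightarrow> gagliardo s (\<lambda>x. \<phi> n x - u x) < ennreal d"
    using order_tendstoD(2)[OF G, of "ennreal d"] d by (auto simp: eventually_sequentially)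
  have "test_norm s (\<lambda>x. \<phi> m x - \<phi> n x) < e" if "M \<le> m" "M \<le> n" for m n
  proof -
    have t: "(\<lambda>x. \<phi> m x - \<phi> n x) \<in> test_functions UNIV"
      using test_function_linear_combination[OF \<phi> \<phi>, of 1 m "-1" n] by simp
    have "ennreal (?k * (test_norm s (\<lambda>x. \<phi> m x - \<phi> n x))\<^sup>2) = gagliardo s (\<lambda>x. (\<phi> m x - u x) - (\<phi> n x - u x))"
      using test_norm_square(2)[OF t s] by simp
    also have "\<dots> \<le> 2 * gagliardo s (\<lambda>x. \<phi> m x - u x) + 2 * gagliardo s (\<lambda>x. \<phi> n x - u x)"
      by (rule gagliardo_diff_le) measurable
    also have "\<dots> \<le> 2 * ennreal d + 2 * ennreal d"
      using M that by (intro add_mono mult_left_mono) (auto intro: less_imp_le)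
    also have "\<dots> = ennreal (?k * e\<^sup>2 / 2)"
    proof -
      have "2 * ennreal d + 2 * ennreal d = ennreal 2 * ennreal d + ennreal 2 * ennreal d" by simp
      also have "\<dots> = ennreal (2 * d + 2 * d)" using d by (simp only: ennreal_mult[symmetric] ennreal_plus[symmetric] less_imp_le mult_nonneg_nonneg zero_le_numeral)
      also have "2 * d + 2 * d = ?k * e\<^sup>2 / 2" by (simp add: d_def)
      finally show ?thesis .
    qed
    finally have "?k * (test_norm s (\<lambda>x. \<phi> m x - \<phi> n x))\<^sup>2 \<le> ?k * e\<^sup>2 / 2" using k by (subst (asm) ennreal_le_iff) auto
    also have "\<dots> < ?k * e\<^sup>2" using k \<open>0 < e\<close> by simp
    finally have "(test_norm s (\<lambda>x. \<phi> m x - \<phi> n x))\<^sup>2 < e\<^sup>2" using k by simp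
    then show ?thesis using \<open>0 < e\<close> by (simp add: power2_less_imp_less)
  qed
  then show "\<exists>M. \<forall>m\<ge>M. \<forall>n\<ge>M. test_norm s (\<lambda>x. \<phi> m x - \<phi> n x) < e" by blast
qed (use \<phi> Lp in \<open>auto simp: p_def\<close>)

lemma D_space_linear_combination:
  fixes u w :: "real^'n \<Rightarrow> real"
  assumes u: "u \<in> D_space s" and w: "w \<in> D_space s"
  shows "(\<lambda>x. a * u x + b * w x) \<in> D_space s"
proof -
  have [measurable]: "u \<in> borel_measurable borel" "w \<in> borel_measurable borel" using u w by (auto intro: D_space_measurable)
  obtain \<phi> \<psi> where D: "D_limit s \<phi> u" "D_limit s \<psi> w" using u w by (auto simp: D_space_def)
  have [measurable]: "\<phi> n \<in> borel_measurable borel" "\<psi> n \<in> borel_measurable borel" for n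
    by (rule test_function_measurable[OF D_limit_test[OF D(1)]], rule test_function_measurable[OF D_limit_test[OF D(2)]])
  have eq: "(\<lambda>x. (a * \<phi> n x + b * \<psi> n x) - (a * u x + b * w x)) = (\<lambda>x. a * (\<phi> n x - u x) + b * (\<psi> n x - w x))" for n
    by (simp add: algebra_simps)
  have "D_limit s (\<lambda>n x. a * \<phi> n x + b * \<psi> n x) (\<lambda>x. a * u x + b * w x)"
  proof (rule D_limitI)
    show "(\<lambda>x. a * \<phi> n x + b * \<psi> n x) \<in> test_functions UNIV" for n
      by (rule test_function_linear_combination[OF D_limit_test[OF D(1)] D_limit_test[OF D(2)]])
    show "(\<lambda>n. gagliardo s (\<lambda>x. (a * \<phi> n x + b * \<psi> n x) - (a * u x + b * w x))) \<longlonglongrightarrow> 0"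
    proof (rule tendsto_sandwich[OF _ _ tendsto_const])
      show "\<forall>\<^sub>F n in sequentially. gagliardo s (\<lambda>x. (a * \<phi> n x + b * \<psi> n x) - (a * u x + b * w x))
         \<le> ennreal (2 * a\<^sup>2) * gagliardo s (\<lambda>x. \<phi> n x - u x) + ennreal (2 * b\<^sup>2) * gagliardo s (\<lambda>x. \<psi> n x - w x)"
        unfolding eq by (intro always_eventually allI gagliardo_linear_le) auto
      have "(\<lambda>n. ennreal (2 * a\<^sup>2) * gagliardo s (\<lambda>x. \<phi> n x - u x) + ennreal (2 * b\<^sup>2) * gagliardo s (\<lambda>x. \<psi> n x - w x))
        \<longlonglongrightarrow> ennreal (2 * a\<^sup>2) * 0 + ennreal (2 * b\<^sup>2) * 0"
        by (intro tendsto_add ennreal_tendsto_cmult D_limit_gagliardo D) auto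
      then show "(\<lambda>n. ennreal (2 * a\<^sup>2) * gagliardo s (\<lambda>x. \<phi> n x - u x) + ennreal (2 * b\<^sup>2) * gagliardo s (\<lambda>x. \<psi> n x - w x)) \<longlonglongrightarrow> 0" by simp
    qed simp
    have scale: "(\<integral>\<^sup>+x. ennreal (\<bar>c * f x\<bar> powr p) \<partial>lborel) = ennreal (\<bar>c\<bar> powr p) * (\<integral>\<^sup>+x. ennreal (\<bar>f x\<bar> powr p) \<partial>lborel)"
      if [measurable]: "f \<in> borel_measurable borel" for c and f :: "real^'n \<Rightarrow> real"
      by (simp add: abs_mult powr_mult ennreal_mult nn_integral_cmult)
    show "(\<lambda>n. \<integral>\<^sup>+x. ennreal (\<bar>(a * \<phi> n x + b * \<psi> n x) - (a * u x + b * w x)\<bar> powr p) \<partial>lborel) \<longlonglongrightarrow> 0"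
    proof (rule tendsto_sandwich[OF _ _ tendsto_const])
      let ?g = "\<lambda>n. ennreal (2 powr p) * (ennreal (\<bar>a\<bar> powr p) * (\<integral>\<^sup>+x. ennreal (\<bar>\<phi> n x - u x\<bar> powr p) \<partial>lborel) + ennreal (\<bar>b\<bar> powr p) * (\<integral>\<^sup>+x. ennreal (\<bar>\<psi> n x - w x\<bar> powr p) \<partial>lborel))"
      show "\<forall>\<^sub>F n in sequentially. (\<integral>\<^sup>+x. ennreal (\<bar>(a * \<phi> n x + b * \<psi> n x) - (a * u x + b * w x)\<bar> powr p) \<partial>lborel) \<le> ?g n"
      proof (intro always_eventually allI)
        fix n
        show "(\<integral>\<^sup>+x. ennreal (\<bar>(a * \<phi> n x + b * \<psi> n x) - (a * u x + b * w x)\<bar> powr p) \<partial>lborel) \<le> ?g n"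
          using nn_integral_powr_add_le[of "\<lambda>x. a * (\<phi> n x - u x)" lborel "\<lambda>x. b * (\<psi> n x - w x)" p] two_star_pos
          by (simp add: scale fun_cong[OF eq])
      qed
      have "?g \<longlonglongrightarrow> ennreal (2 powr p) * (ennreal (\<bar>a\<bar> powr p) * 0 + ennreal (\<bar>b\<bar> powr p) * 0)"
        by (intro tendsto_add ennreal_tendsto_cmult D_limit_Lp D) auto
      then show "?g \<longlonglongrightarrow> 0" by simp
    qed simp
  qed measurable
  then show ?thesis by (auto simp: D_space_def)
qed

lemma test_function_D_space:
  fixes \<phi> :: "real^'n \<Rightarrow> real"
  assumes "\<phi> \<in> test_functions UNIV"
  shows "\<phi> \<in> D_space s"
proof -
  have [measurable]: "\<phi> \<in> borel_measurable borel" by (rule test_function_measurable[OF assms])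
  have "D_limit s (\<lambda>_. \<phi>) \<phi>"
    by (rule D_limitI) (use assms two_star_pos in \<open>auto simp: gagliardo_def\<close>)
  then show ?thesis by (auto simp: D_space_def)
qed

text \<open>The choice in \<open>half_laplacian\<close> is not vacuous: along any approximating
  sequence the images are Cauchy, and L2 is complete.\<close>

lemma half_laplacian_limit:
  fixes u :: "real^'n \<Rightarrow> real"
  assumes "u \<in> D_space s"
  shows "half_laplacian s u \<in> borel_measurable borel"
    "\<exists>\<phi>. D_limit s \<phi> u \<and> (\<lambda>n. \<integral>\<^sup>+x. ennreal ((frac_laplacian (s / 2) (\<phi> n) x - half_laplacian s u x)\<^sup>2) \<partial>lborel) \<longlonglongrightarrow> 0"
proof -
  obtain \<phi> where D: "D_limit s \<phi> u" using assms by (auto simp: D_space_def)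
  have "\<exists>g\<in>borel_measurable lborel. (\<lambda>n. \<integral>\<^sup>+x. ennreal ((frac_laplacian (s / 2) (\<phi> n) x - g x)\<^sup>2) \<partial>lborel) \<longlonglongrightarrow> 0"
  proof (rule L2_complete)
    show "frac_laplacian (s / 2) (\<phi> n) \<in> borel_measurable lborel" for n
      using borel_measurable_frac_laplacian[OF D_limit_test[OF D]] by simp
  qed (use D_limit_Cauchy[OF D] in blast)
  then have "\<exists>g. g \<in> borel_measurable borel \<and> (\<exists>\<phi>. D_limit s \<phi> u \<and>
     ((\<lambda>n. \<integral>\<^sup>+x. ennreal ((frac_laplacian (s / 2) (\<phi> n) x - g x)\<^sup>2) \<partial>lborel) \<longlonglongrightarrow> 0))"
    using D by auto
  from someI_ex[OF this, folded half_laplacian_def]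
  show "half_laplacian s u \<in> borel_measurable borel"
    "\<exists>\<phi>. D_limit s \<phi> u \<and> (\<lambda>n. \<integral>\<^sup>+x. ennreal ((frac_laplacian (s / 2) (\<phi> n) x - half_laplacian s u x)\<^sup>2) \<partial>lborel) \<longlonglongrightarrow> 0"
    by blast+
qed

text \<open>Polarisation of the identity for squares, both sides being L2 inner products of linear
  images.\<close>

lemma test_function_inner:
  fixes \<phi> \<psi> :: "real^'n \<Rightarrow> real"
  assumes \<phi>: "\<phi> \<in> test_functions UNIV" and \<psi>: "\<psi> \<in> test_functions UNIV"
  shows "(LINT x|lborel. frac_laplacian (s / 2) \<phi> x * frac_laplacian (s / 2) \<psi> x) * gagliardo_const CARD('n) s = gagliardo_inner s \<phi> \<psi>"
proof -
  let ?A = "\<lambda>\<phi>. frac_laplacian (s / 2) \<phi>" and ?Q = "\<lambda>\<phi>. gagliardo_quotient s \<phi>" and ?k = "gagliardo_const CARD('n) s"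
  let ?M = "lborel \<Otimes>\<^sub>M lborel :: ((real^'n) \<times> (real^'n)) measure"
  have k: "0 < ?k" using gagliardo_const_pos[OF s] by simp
  have sq: "(LINT x|lborel. (?A \<eta> x)\<^sup>2) * ?k = (LINT z|(?M). (?Q \<eta> z)\<^sup>2)" if \<eta>: "\<eta> \<in> test_functions UNIV" for \<eta> :: "real^'n \<Rightarrow> real"
  proof -
    have [measurable]: "\<eta> \<in> borel_measurable borel" by (rule test_function_measurable[OF \<eta>])
    have [measurable]: "?A \<eta> \<in> borel_measurable borel" by (rule borel_measurable_frac_laplacian[OF \<eta>])
    have "(LINT z|(?M). (?Q \<eta> z)\<^sup>2) = enn2real (gagliardo s \<eta>)"
      by (subst gagliardo_eq_quotient, measurable, subst integral_eq_nn_integral) auto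
    also have "\<dots> = ?k * enn2real (\<integral>\<^sup>+x. ennreal ((?A \<eta> x)\<^sup>2) \<partial>lborel)"
      using k by (simp add: nn_integral_frac_laplacian(1)[OF \<eta> s] enn2real_mult)
    also have "enn2real (\<integral>\<^sup>+x. ennreal ((?A \<eta> x)\<^sup>2) \<partial>lborel) = (LINT x|lborel. (?A \<eta> x)\<^sup>2)"
      by (subst integral_eq_nn_integral) auto
    finally show ?thesis by simp
  qed
  note meas [measurable] = test_function_measurable[OF \<phi>] test_function_measurable[OF \<psi>]
    borel_measurable_frac_laplacian[OF \<phi>, of "s/2"] borel_measurable_frac_laplacian[OF \<psi>, of "s/2"]
  have A: "?A (\<lambda>x. \<phi> x + \<psi> x) x = ?A \<phi> x + ?A \<psi> x" "?A (\<lambda>x. \<phi> x - \<psi> x) x = ?A \<phi> x - ?A \<psi> x" for x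
    using frac_laplacian_linear[OF \<phi> \<psi>, of "s / 2" 1 1 x] frac_laplacian_linear[OF \<phi> \<psi>, of "s / 2" 1 "-1" x] s by simp_all
  have Q: "?Q (\<lambda>x. \<phi> x + \<psi> x) z = ?Q \<phi> z + ?Q \<psi> z" "?Q (\<lambda>x. \<phi> x - \<psi> x) z = ?Q \<phi> z - ?Q \<psi> z" for z
    using gagliardo_quotient_linear[of s 1 \<phi> 1 \<psi> z] gagliardo_quotient_diff[of s \<phi> \<psi> z] by simp_all
  have t: "(\<lambda>x. \<phi> x + \<psi> x) \<in> test_functions UNIV" "(\<lambda>x. \<phi> x - \<psi> x) \<in> test_functions UNIV"
    using test_function_linear_combination[OF \<phi> \<psi>, of 1 1] test_function_linear_combination[OF \<phi> \<psi>, of 1 "-1"] by simp_all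
  have "4 * (LINT x|lborel. ?A \<phi> x * ?A \<psi> x) * ?k = (LINT x|lborel. (?A \<phi> x + ?A \<psi> x)\<^sup>2) * ?k - (LINT x|lborel. (?A \<phi> x - ?A \<psi> x)\<^sup>2) * ?k"
    using nn_integral_frac_laplacian(2)[OF \<phi> s] nn_integral_frac_laplacian(2)[OF \<psi> s] by (subst integral_mult_polar) (auto simp: left_diff_distrib)
  also have "\<dots> = (LINT z|(?M). (?Q \<phi> z + ?Q \<psi> z)\<^sup>2) - (LINT z|(?M). (?Q \<phi> z - ?Q \<psi> z)\<^sup>2)"
    using sq[OF t(1)] sq[OF t(2)] by (simp only: A Q)
  also have "\<dots> = 4 * (LINT z|(?M). ?Q \<phi> z * ?Q \<psi> z)"
    using test_function_gagliardo_finite[OF \<phi>] test_function_gagliardo_finite[OF \<psi>]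
    by (subst integral_mult_polar) (auto simp: gagliardo_eq_quotient)
  finally show ?thesis by (simp add: gagliardo_inner_def)
qed

lemma gagliardo_inner_tendsto:
  fixes u w :: "real^'n \<Rightarrow> real"
  assumes [measurable]: "\<And>n. \<phi> n \<in> borel_measurable borel" "\<And>n. \<psi> n \<in> borel_measurable borel" "u \<in> borel_measurable borel" "w \<in> borel_measurable borel"
    and fin: "\<And>n. gagliardo s (\<phi> n) < \<infinity>" "\<And>n. gagliardo s (\<psi> n) < \<infinity>" "gagliardo s u < \<infinity>" "gagliardo s w < \<infinity>"
    and lim: "(\<lambda>n. gagliardo s (\<lambda>x. \<phi> n x - u x)) \<longlonglongrightarrow> 0" "(\<lambda>n. gagliardo s (\<lambda>x. \<psi> n x - w x)) \<longlonglongrightarrow> 0"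
  shows "(\<lambda>n. gagliardo_inner s (\<phi> n) (\<psi> n)) \<longlonglongrightarrow> gagliardo_inner s u w"
  unfolding gagliardo_inner_def
  by (rule L2_inner_tendsto) (use fin lim in \<open>auto simp: gagliardo_eq_quotient gagliardo_quotient_diff\<close>)

text \<open>Each chosen half Laplacian comes with an approximating sequence of its own. On these
  sequences the identity is known and both sides converge; since the right-hand side mentions no
  choices, the inner product becomes computable although \<open>half_laplacian\<close> is
  not.\<close>

theorem D_inner_eq_gagliardo:
  fixes u w :: "real^'n \<Rightarrow> real"
  assumes u: "u \<in> D_space s" and w: "w \<in> D_space s"
  shows "D_inner s u w = gagliardo_inner s u w / gagliardo_const CARD('n) s"
proof -
  let ?A = "\<lambda>\<phi>. frac_laplacian (s / 2) \<phi>" and ?k = "gagliardo_const CARD('n) s"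
  have k: "0 < ?k" using gagliardo_const_pos[OF s] by simp
  note [measurable] = D_space_measurable[OF u] D_space_measurable[OF w] half_laplacian_limit(1)[OF u] half_laplacian_limit(1)[OF w]
  obtain \<phi> where \<phi>: "D_limit s \<phi> u" "(\<lambda>n. \<integral>\<^sup>+x. ennreal ((?A (\<phi> n) x - half_laplacian s u x)\<^sup>2) \<partial>lborel) \<longlonglongrightarrow> 0"
    using half_laplacian_limit(2)[OF u] by blast
  obtain \<psi> where \<psi>: "D_limit s \<psi> w" "(\<lambda>n. \<integral>\<^sup>+x. ennreal ((?A (\<psi> n) x - half_laplacian s w x)\<^sup>2) \<partial>lborel) \<longlonglongrightarrow> 0"
    using half_laplacian_limit(2)[OF w] by blast
  note t\<phi> = D_limit_test[OF \<phi>(1)] and t\<psi> = D_limit_test[OF \<psi>(1)]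
  note [measurable] = test_function_measurable[OF t\<phi>] test_function_measurable[OF t\<psi>]
    borel_measurable_frac_laplacian[OF t\<phi>, where r="s/2"] borel_measurable_frac_laplacian[OF t\<psi>, where r="s/2"]
  \<comment> \<open>The chosen representatives are square integrable because they lie at finite
    distance from the image of a test function.\<close>
  have fin: "(\<integral>\<^sup>+x. ennreal ((g x)\<^sup>2) \<partial>lborel) < \<infinity>"
    if [measurable]: "g \<in> borel_measurable borel" and lim: "(\<lambda>n. \<integral>\<^sup>+x. ennreal ((?A (\<eta> n) x - g x)\<^sup>2) \<partial>lborel) \<longlonglongrightarrow> 0"
      and t: "\<And>n. \<eta> n \<in> test_functions UNIV" for g and \<eta> :: "nat \<Rightarrow> real^'n \<Rightarrow> real"
  proof -
    obtain n where n: "(\<integral>\<^sup>+x. ennreal ((?A (\<eta> n) x - g x)\<^sup>2) \<partial>lborel) < 1"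
      using order_tendstoD(2)[OF lim, of 1] by (auto simp: eventually_sequentially)
    have [measurable]: "?A (\<eta> n) \<in> borel_measurable borel" by (rule borel_measurable_frac_laplacian[OF t])
    have "(\<integral>\<^sup>+x. ennreal ((g x)\<^sup>2) \<partial>lborel) \<le> (\<integral>\<^sup>+x. ennreal 2 * ennreal ((?A (\<eta> n) x)\<^sup>2) + ennreal 2 * ennreal ((?A (\<eta> n) x - g x)\<^sup>2) \<partial>lborel)"
    proof (rule nn_integral_mono)
      fix x
      have "b\<^sup>2 \<le> 2 * a\<^sup>2 + 2 * (a - b)\<^sup>2" for a b :: real
        using zero_le_power2[of "2 * a - b"] by (simp add: power2_eq_square algebra_simps)
      then show "ennreal ((g x)\<^sup>2) \<le> ennreal 2 * ennreal ((?A (\<eta> n) x)\<^sup>2) + ennreal 2 * ennreal ((?A (\<eta> n) x - g x)\<^sup>2)"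
        by (simp add: ennreal_mult[symmetric] ennreal_plus[symmetric] ennreal_leI del: ennreal_plus ennreal_numeral)
    qed
    also have "\<dots> = ennreal 2 * (\<integral>\<^sup>+x. ennreal ((?A (\<eta> n) x)\<^sup>2) \<partial>lborel) + ennreal 2 * (\<integral>\<^sup>+x. ennreal ((?A (\<eta> n) x - g x)\<^sup>2) \<partial>lborel)"
      by (simp add: nn_integral_add nn_integral_cmult del: ennreal_numeral)
    also have "\<dots> < \<infinity>"
      using n nn_integral_frac_laplacian(2)[OF t s, of n] by (auto simp: ennreal_mult_less_top intro: order_less_trans)
    finally show ?thesis .
  qed
  have 1: "(\<lambda>n. LINT x|lborel. ?A (\<phi> n) x * ?A (\<psi> n) x) \<longlonglongrightarrow> D_inner s u w"
    unfolding D_inner_def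
    by (rule L2_inner_tendsto[OF _ _ _ _ _ _ _ _ \<phi>(2) \<psi>(2)])
       (use nn_integral_frac_laplacian(2)[OF t\<phi> s] nn_integral_frac_laplacian(2)[OF t\<psi> s]
          fin[OF _ \<phi>(2) t\<phi>] fin[OF _ \<psi>(2) t\<psi>] in auto)
  have "(\<lambda>n. gagliardo_inner s (\<phi> n) (\<psi> n)) \<longlonglongrightarrow> gagliardo_inner s u w"
    by (rule gagliardo_inner_tendsto)
       (use test_function_gagliardo_finite[OF t\<phi>] test_function_gagliardo_finite[OF t\<psi>] D_space_gagliardo_finite[OF u] D_space_gagliardo_finite[OF w]
          D_limit_gagliardo[OF \<phi>(1)] D_limit_gagliardo[OF \<psi>(1)] in auto)
  then have "(\<lambda>n. (LINT x|lborel. ?A (\<phi> n) x * ?A (\<psi> n) x) * ?k) \<longlonglongrightarrow> gagliardo_inner s u w"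
    by (simp add: test_function_inner[OF t\<phi> t\<psi>])
  with tendsto_mult_right[OF 1, of ?k] have "D_inner s u w * ?k = gagliardo_inner s u w"
    by (rule LIMSEQ_unique)
  then show ?thesis using k by (simp add: field_simps)
qed

lemma D_norm_square:
  fixes u :: "real^'n \<Rightarrow> real"
  assumes u: "u \<in> D_space s"
  shows "(D_norm s u)\<^sup>2 = D_inner s u u" "gagliardo s u = ennreal (gagliardo_const CARD('n) s * (D_norm s u)\<^sup>2)"
proof -
  note [measurable] = D_space_measurable[OF u]
  have k: "0 < gagliardo_const CARD('n) s" using gagliardo_const_pos[OF s] by simp
  show 1: "(D_norm s u)\<^sup>2 = D_inner s u u"
    by (simp add: D_norm_def D_inner_def power2_eq_square)
  have "gagliardo_inner s u u = enn2real (gagliardo s u)"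
    unfolding gagliardo_inner_def power2_eq_square[symmetric]
    by (subst gagliardo_eq_quotient, measurable, subst integral_eq_nn_integral) auto
  then show "gagliardo s u = ennreal (gagliardo_const CARD('n) s * (D_norm s u)\<^sup>2)"
    unfolding 1 D_inner_eq_gagliardo[OF u u] using k D_space_gagliardo_finite[OF u] by simp
qed

lemma D_norm_square_add:
  fixes u h :: "real^'n \<Rightarrow> real"
  assumes u: "u \<in> D_space s" and h: "h \<in> D_space s"
  shows "(D_norm s (\<lambda>x. u x + h x))\<^sup>2 = (D_norm s u)\<^sup>2 + 2 * D_inner s u h + (D_norm s h)\<^sup>2"
proof -
  have uh: "(\<lambda>x. u x + h x) \<in> D_space s" using D_space_linear_combination[OF u h, of 1 1] by simp
  note sq = D_norm_square(1) D_inner_eq_gagliardo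
  show ?thesis
    using D_space_measurable[OF u] D_space_measurable[OF h]
      D_space_gagliardo_finite[OF u] D_space_gagliardo_finite[OF h]
    by (simp add: sq u h uh gagliardo_inner_add_self add_divide_distrib)
qed

lemma D_sobolev:
  "\<exists>C>0. \<forall>u\<in>D_space s. (\<integral>\<^sup>+x. ennreal (\<bar>u (x::real^'n)\<bar> powr p) \<partial>lborel) \<le> ennreal ((C * D_norm s u) powr p)"
proof -
  let ?k = "gagliardo_const CARD('n) s"
  have k: "0 < ?k" using gagliardo_const_pos[OF s] by simp
  have dim': "2 * s < real DIM(real^'n)" using dim by simp
  have p: "p = 2 * real DIM(real^'n) / (real DIM(real^'n) - 2 * s)" by (simp add: p_def two_star_def)
  obtain C where C: "0 < C" "\<And>(u :: real^'n \<Rightarrow> real) G. u \<in> borel_measurable borel \<Longrightarrow>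
    (\<integral>\<^sup>+x. ennreal (\<bar>u x\<bar> powr p) \<partial>lborel) < \<infinity> \<Longrightarrow> 0 \<le> G \<Longrightarrow> gagliardo s u \<le> ennreal G \<Longrightarrow>
    (\<integral>\<^sup>+x. ennreal (\<bar>u x\<bar> powr p) \<partial>lborel) \<le> ennreal ((C * G) powr (p / 2))"
    using sobolev_gagliardo[OF s(1) dim'] unfolding p[symmetric] by blast
  show ?thesis
  proof (intro exI[of _ "sqrt (C * ?k)"] conjI ballI)
    show "0 < sqrt (C * ?k)" using C k by simp
    fix u :: "real^'n \<Rightarrow> real" assume u: "u \<in> D_space s"
    have D: "0 \<le> D_norm s u" by (simp add: D_norm_def)
    have "(\<integral>\<^sup>+x. ennreal (\<bar>u x\<bar> powr p) \<partial>lborel) \<le> ennreal ((C * (?k * (D_norm s u)\<^sup>2)) powr (p / 2))"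
      using k by (intro C D_space_measurable u D_space_Lp_finite) (auto simp: D_norm_square(2)[OF u])
    also have "C * (?k * (D_norm s u)\<^sup>2) = (sqrt (C * ?k) * D_norm s u)\<^sup>2"
      using C k by (simp add: power_mult_distrib)
    also have "((sqrt (C * ?k) * D_norm s u)\<^sup>2) powr (p / 2) = (sqrt (C * ?k) * D_norm s u) powr p"
    proof (cases "D_norm s u = 0")
      case False
      then have "0 < sqrt (C * ?k) * D_norm s u" using C k D by simp
      then have "(sqrt (C * ?k) * D_norm s u)\<^sup>2 = (sqrt (C * ?k) * D_norm s u) powr 2" by simp
      then show ?thesis by (simp only: powr_powr) simp
    qed simp
    finally show "(\<integral>\<^sup>+x. ennreal (\<bar>u x\<bar> powr p) \<partial>lborel) \<le> ennreal ((sqrt (C * ?k) * D_norm s u) powr p)" .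
  qed
qed

end

section \<open>The equation for the bubble\<close>

text \<open>Fubini with absolute convergence stated as an iterated extended integral, the form in
  which the Gaussian mixtures deliver it.\<close>

lemma (in pair_sigma_finite) Fubini_nn:
  fixes f :: "'a \<Rightarrow> 'b \<Rightarrow> real"
  assumes [measurable]: "case_prod f \<in> borel_measurable (M1 \<Otimes>\<^sub>M M2)"
    and fin: "(\<integral>\<^sup>+x. \<integral>\<^sup>+y. ennreal \<bar>f x y\<bar> \<partial>M2 \<partial>M1) < \<infinity>"
  shows "integrable (M1 \<Otimes>\<^sub>M M2) (case_prod f)"
    and "(LINT y|M2. LINT x|M1. f x y) = (LINT x|M1. LINT y|M2. f x y)"
proof -
  show i: "integrable (M1 \<Otimes>\<^sub>M M2) (case_prod f)"
  proof (rule integrableI_bounded)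
    have "(\<integral>\<^sup>+z. ennreal (norm (case_prod f z)) \<partial>(M1 \<Otimes>\<^sub>M M2)) = (\<integral>\<^sup>+x. \<integral>\<^sup>+y. ennreal (norm (case_prod f (x, y))) \<partial>M2 \<partial>M1)"
      by (rule M2.nn_integral_fst[symmetric]) measurable
    then show "(\<integral>\<^sup>+z. ennreal (norm (case_prod f z)) \<partial>(M1 \<Otimes>\<^sub>M M2)) < \<infinity>" using fin by simp
  qed measurable
  show "(LINT y|M2. LINT x|M1. f x y) = (LINT x|M1. LINT y|M2. f x y)"
    by (rule Fubini_integral[OF i])
qed

text \<open>The unnormalised Gamma density; its factor \<open>exp (- t)\<close> produces the 1 in
  \<open>1 + r\<close>. It also occurs with the parameter \<open>- s\<close>, where a further factor
  \<open>exp (- (a / t))\<close> tames the singularity at 0.\<close>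

definition gamma_weight :: "real \<Rightarrow> real \<Rightarrow> real" where
  "gamma_weight a t = indicator {0<..} t * (t powr (a - 1) * exp (- t))"

lemma borel_measurable_gamma_weight [measurable]: "gamma_weight a \<in> borel_measurable borel"
  unfolding gamma_weight_def[abs_def] by measurable

lemma gamma_weight_nonneg: "0 \<le> gamma_weight a t"
  by (simp add: gamma_weight_def)

lemma nn_integral_gamma_weight:
  assumes "0 < a" "0 \<le> r"
  shows "(\<integral>\<^sup>+t. ennreal (gamma_weight a t * exp (- (t * r))) \<partial>lborel) = ennreal (Gamma a * (1 + r) powr (- a))"
proof -
  have "(\<integral>\<^sup>+t. ennreal (gamma_weight a t * exp (- (t * r))) \<partial>lborel) = (\<integral>\<^sup>+t\<in>{0<..}. ennreal (t powr (a - 1) * exp (- ((1 + r) * t))) \<partial>lborel)"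
    by (intro nn_integral_cong) (auto simp: gamma_weight_def exp_add[symmetric] algebra_simps split: split_indicator)
  then show ?thesis using assms by (simp add: nn_integral_Gamma)
qed

lemma gamma_weight_integral:
  assumes "0 < a" "0 \<le> r"
  shows "integrable lborel (\<lambda>t. gamma_weight a t * exp (- (t * r)))"
    and "(LINT t|lborel. gamma_weight a t * exp (- (t * r))) = Gamma a * (1 + r) powr (- a)"
proof -
  have "0 \<le> Gamma a * (1 + r) powr (- a)" using assms by (simp add: Gamma_real_nonneg)
  from nn_integral_gamma_weight[OF assms] this
  have "has_bochner_integral lborel (\<lambda>t. gamma_weight a t * exp (- (t * r))) (Gamma a * (1 + r) powr (- a))"
    by (intro has_bochner_integral_nn_integral) (auto intro!: AE_I2 simp: gamma_weight_nonneg)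
  then show "integrable lborel (\<lambda>t. gamma_weight a t * exp (- (t * r)))"
    "(LINT t|lborel. gamma_weight a t * exp (- (t * r))) = Gamma a * (1 + r) powr (- a)"
    by (auto simp: has_bochner_integral_iff)
qed

lemma gamma_weight_powr: "gamma_weight a t * t powr b = gamma_weight (a + b) t"
  by (auto simp: gamma_weight_def powr_add[symmetric] algebra_simps split: split_indicator)

lemma gagliardo_scale:
  fixes u :: "'a::euclidean_space \<Rightarrow> real"
  assumes [measurable]: "u \<in> borel_measurable borel" and c: "0 < c"
  shows "gagliardo s (\<lambda>x. u (c *\<^sub>R x)) = ennreal (c powr (2 * s - DIM('a))) * gagliardo s u"
proof -
  let ?N = "real DIM('a)"
  let ?k = "\<lambda>x y. ennreal ((u x - u y)\<^sup>2 * norm (x - y) powr (- (?N + 2 * s)))"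
  have "gagliardo s u = (\<integral>\<^sup>+x. ennreal (c powr ?N) * (\<integral>\<^sup>+y. ?k x (c *\<^sub>R y) \<partial>lborel) \<partial>lborel)"
    unfolding gagliardo_def using c by (subst nn_integral_lborel_affine[of _ c 0]) simp_all
  also have "\<dots> = ennreal (c powr ?N) * (\<integral>\<^sup>+x. ennreal (c powr ?N) * (\<integral>\<^sup>+y. ?k (c *\<^sub>R x) (c *\<^sub>R y) \<partial>lborel) \<partial>lborel)"
    using c by (subst nn_integral_lborel_affine[of _ c 0]) simp_all
  also have "\<dots> = ennreal (c powr ?N) * (ennreal (c powr ?N) * (\<integral>\<^sup>+x. \<integral>\<^sup>+y. ?k (c *\<^sub>R x) (c *\<^sub>R y) \<partial>lborel \<partial>lborel))"
    by (subst nn_integral_cmult) simp_all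
  also have "(\<integral>\<^sup>+x. \<integral>\<^sup>+y. ?k (c *\<^sub>R x) (c *\<^sub>R y) \<partial>lborel \<partial>lborel)
    = (\<integral>\<^sup>+x. \<integral>\<^sup>+y. ennreal (c powr (- (?N + 2 * s))) * ennreal ((u (c *\<^sub>R x) - u (c *\<^sub>R y))\<^sup>2 * norm (x - y) powr (- (?N + 2 * s))) \<partial>lborel \<partial>lborel)"
  proof (intro nn_integral_cong)
    fix x y :: 'a
    have "norm (c *\<^sub>R x - c *\<^sub>R y) = c * norm (x - y)" using c by (simp flip: scaleR_diff_right)
    then show "?k (c *\<^sub>R x) (c *\<^sub>R y) = ennreal (c powr (- (?N + 2 * s))) * ennreal ((u (c *\<^sub>R x) - u (c *\<^sub>R y))\<^sup>2 * norm (x - y) powr (- (?N + 2 * s)))"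
      using c by (simp add: ennreal_mult[symmetric] powr_mult mult_ac)
  qed
  also have "\<dots> = ennreal (c powr (- (?N + 2 * s))) * gagliardo s (\<lambda>x. u (c *\<^sub>R x))"
    by (simp add: gagliardo_def nn_integral_cmult)
  finally have *: "gagliardo s u = ennreal (c powr ?N) * (ennreal (c powr ?N) * (ennreal (c powr (- (?N + 2 * s))) * gagliardo s (\<lambda>x. u (c *\<^sub>R x))))" .
  have "ennreal (c powr (2 * s - ?N)) * gagliardo s u
    = ennreal (c powr (2 * s - ?N) * c powr ?N * c powr ?N * c powr (- (?N + 2 * s))) * gagliardo s (\<lambda>x. u (c *\<^sub>R x))"
    unfolding * by (simp add: ennreal_mult mult.assoc)
  also have "c powr (2 * s - ?N) * c powr ?N * c powr ?N * c powr (- (?N + 2 * s)) = 1"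
    using c by (simp add: powr_add[symmetric])
  finally show ?thesis by simp
qed

definition gaussian :: "real \<Rightarrow> 'a::euclidean_space \<Rightarrow> real" where
  "gaussian t x = exp (- (t * (norm x)\<^sup>2))"

lemma borel_measurable_gaussian [measurable]: "gaussian t \<in> borel_measurable borel"
  unfolding gaussian_def[abs_def] by measurable

lemma gaussian_bounds: "0 < gaussian t x" "0 \<le> t \<Longrightarrow> gaussian t x \<le> 1"
  by (simp_all add: gaussian_def)

text \<open>On the Fourier side the squared transform has two factors
  \<open>exp (- ((norm \<xi>)\<^sup>2 / 4))\<close>. One absorbs the symbol through \<open>norm
  \<xi> powr (2 * s) \<le> 4 * exp ((norm \<xi>)\<^sup>2 / 4)\<close>, the other keeps the integral
  finite.\<close>

lemma gagliardo_gaussian_finite: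
  assumes "0 < s" "s < 1"
  shows "gagliardo s (gaussian 1 :: real^'n \<Rightarrow> real) < \<infinity>"
proof -
  let ?w = "gaussian 1 :: real^'n \<Rightarrow> real"
  let ?c = "2 powr (- real CARD('n) / 2)"
  have F: "fourier (\<lambda>x. of_real (?w x)) \<xi> = of_real (?c * exp (- ((norm \<xi>)\<^sup>2 / 4)))" for \<xi>
    using fourier_gaussian[of 1 \<xi>] by (simp add: gaussian_def)
  have eq: "gagliardo s ?w = ennreal (gagliardo_const CARD('n) s) *
    (\<integral>\<^sup>+\<xi>. ennreal (norm \<xi> powr (2 * s) * (norm (fourier (\<lambda>x. of_real (?w x)) \<xi>))\<^sup>2) \<partial>lborel)"
  proof (rule gagliardo_fourier[OF assms])
    show "continuous_on UNIV ?w" unfolding gaussian_def[abs_def] by (intro continuous_intros)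
    show "\<bar>?w x\<bar> \<le> 1" for x using gaussian_bounds[of 1 x] by simp
    show "integrable lborel ?w" using integrable_gaussian[of 1, where 'a="real^'n"] by (simp add: gaussian_def[abs_def])
  qed
  have "(\<integral>\<^sup>+\<xi>. ennreal (norm \<xi> powr (2 * s) * (norm (fourier (\<lambda>x. of_real (?w x)) \<xi>))\<^sup>2) \<partial>lborel)
    \<le> (\<integral>\<^sup>+(\<xi>::real^'n). ennreal (4 * ?c\<^sup>2) * ennreal (exp (- (1 / 4 * (norm \<xi>)\<^sup>2))) \<partial>lborel)"
  proof (rule nn_integral_mono)
    fix \<xi> :: "real^'n"
    have "norm \<xi> powr (2 * s) \<le> 1 + (norm \<xi>)\<^sup>2" using assms by (intro powr_le_one_plus_square) auto
    also have "\<dots> \<le> 4 * (1 + (norm \<xi>)\<^sup>2 / 4)" by simp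
    also have "\<dots> \<le> 4 * exp ((norm \<xi>)\<^sup>2 / 4)" using exp_ge_add_one_self by (intro mult_left_mono) auto
    finally have "norm \<xi> powr (2 * s) * (?c\<^sup>2 * (exp (- ((norm \<xi>)\<^sup>2 / 4)))\<^sup>2) \<le> (4 * exp ((norm \<xi>)\<^sup>2 / 4)) * (?c\<^sup>2 * (exp (- ((norm \<xi>)\<^sup>2 / 4)))\<^sup>2)"
      by (intro mult_right_mono) auto
    also have "\<dots> = 4 * ?c\<^sup>2 * (exp ((norm \<xi>)\<^sup>2 / 4) * exp (- ((norm \<xi>)\<^sup>2 / 4)) * exp (- ((norm \<xi>)\<^sup>2 / 4)))"
      by (simp only: power2_eq_square mult_ac)
    also have "exp ((norm \<xi>)\<^sup>2 / 4) * exp (- ((norm \<xi>)\<^sup>2 / 4)) = 1" by (simp flip: exp_add)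
    finally show "ennreal (norm \<xi> powr (2 * s) * (norm (fourier (\<lambda>x. of_real (?w x)) \<xi>))\<^sup>2) \<le> ennreal (4 * ?c\<^sup>2) * ennreal (exp (- (1 / 4 * (norm \<xi>)\<^sup>2)))"
      unfolding F norm_of_real power2_abs power_mult_distrib by (simp add: ennreal_mult[symmetric] ennreal_leI)
  qed
  also have "\<dots> < \<infinity>"
    by (simp add: nn_integral_cmult nn_integral_gaussian[of "1/4", simplified] ennreal_mult_less_top)
  finally show ?thesis unfolding eq by (simp add: ennreal_mult_less_top)
qed

text \<open>For \<open>a = (N - 2 s) / 2\<close> this is the Aubin-Talenti profile; the other
  exponents arise from its powers, its potentials and its fractional Laplacian.\<close>

definition bubble :: "real \<Rightarrow> 'a::euclidean_space \<Rightarrow> real" where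
  "bubble a x = (1 + (norm x)\<^sup>2) powr (- a)"

lemma borel_measurable_bubble [measurable]: "bubble a \<in> borel_measurable borel"
  unfolding bubble_def[abs_def] by measurable

lemma bubble_pos: "0 < bubble a x"
  using add_pos_nonneg[of 1 "(norm x)\<^sup>2"] by (simp add: bubble_def)

lemma bubble_le_1: "0 \<le> a \<Longrightarrow> bubble a x \<le> 1"
proof -
  assume "0 \<le> a"
  then have "(1 + (norm x)\<^sup>2) powr (- a) \<le> 1 powr (- a)" by (intro powr_mono2') auto
  then show ?thesis by (simp add: bubble_def)
qed

lemma bubble_powr: "bubble a x powr b = bubble (a * b) x"
  by (simp add: bubble_def powr_powr)

lemma bubble_mult: "bubble a x * bubble b x = bubble (a + b) x"
  by (simp add: bubble_def powr_add[symmetric])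

lemma bubble_gaussian:
  assumes "0 < a"
  shows "integrable lborel (\<lambda>t. gamma_weight a t * gaussian t x)"
    "bubble a x = (LINT t|lborel. gamma_weight a t * gaussian t x) / Gamma a"
  using gamma_weight_integral[OF assms, of "(norm x)\<^sup>2"] Gamma_real_pos[OF assms]
  by (simp_all add: gaussian_def bubble_def)

lemma gagliardo_quotient_bubble:
  fixes z :: "'a::euclidean_space \<times> 'a"
  assumes "0 < a"
  shows "integrable lborel (\<lambda>t. gamma_weight a t * gagliardo_quotient s (gaussian t) z)"
    "gagliardo_quotient s (bubble a) z = (LINT t|lborel. gamma_weight a t * gagliardo_quotient s (gaussian t) z) / Gamma a"
proof -
  let ?k = "norm (fst z - snd z) powr (- (real DIM('a) + 2 * s) / 2)"
  have eq: "(\<lambda>t. gamma_weight a t * gagliardo_quotient s (gaussian t) z)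
      = (\<lambda>t. (gamma_weight a t * gaussian t (fst z) - gamma_weight a t * gaussian t (snd z)) * ?k)"
    by (simp add: gagliardo_quotient_def algebra_simps)
  show "integrable lborel (\<lambda>t. gamma_weight a t * gagliardo_quotient s (gaussian t) z)"
    unfolding eq by (intro integrable_mult_left Bochner_Integration.integrable_diff bubble_gaussian(1) assms)
  show "gagliardo_quotient s (bubble a) z = (LINT t|lborel. gamma_weight a t * gagliardo_quotient s (gaussian t) z) / Gamma a"
    unfolding eq integral_mult_left_zero Bochner_Integration.integral_diff[OF bubble_gaussian(1)[OF assms] bubble_gaussian(1)[OF assms]]
    by (simp add: gagliardo_quotient_def bubble_gaussian(2)[OF assms] diff_divide_distrib left_diff_distrib)
qed

lemma borel_measurable_gagliardo_quotient_gaussian [measurable]: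
  "(\<lambda>(t, z). gagliardo_quotient s (gaussian t) z) \<in> borel_measurable (lborel \<Otimes>\<^sub>M (lborel \<Otimes>\<^sub>M lborel))"
  unfolding gagliardo_quotient_def[abs_def] gaussian_def[abs_def] by measurable

section \<open>Finiteness of the Gagliardo seminorm of the bubble, and the Gagliardo form in Fourier
  variables\<close>

context
  fixes s :: real and dim :: "'n::finite itself" and g :: real
  assumes s: "0 < s" "s < 1" and dim: "2 * s < CARD('n)"
  defines "g \<equiv> (real CARD('n) - 2 * s) / 2"
begin

lemma g_pos: "0 < g" using dim by (simp add: g_def)

lemma gagliardo_gaussian:
  assumes "0 < t"
  shows "gagliardo s (gaussian t :: real^'n \<Rightarrow> real) = ennreal (t powr (- g)) * gagliardo s (gaussian 1 :: real^'n \<Rightarrow> real)"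
proof -
  have "gaussian t = (\<lambda>x::real^'n. gaussian 1 (sqrt t *\<^sub>R x))"
    using assms by (simp add: gaussian_def fun_eq_iff power_mult_distrib)
  moreover have "sqrt t powr (2 * s - real CARD('n)) = t powr (- g)"
  proof -
    have "(1 / 2) * (2 * s - real CARD('n)) = - g" by (simp add: g_def field_simps)
    then have "(t powr (1 / 2)) powr (2 * s - real CARD('n)) = t powr (- g)" by (simp only: powr_powr)
    then show ?thesis using assms by (simp add: powr_half_sqrt)
  qed
  ultimately show ?thesis using assms gagliardo_scale[of "gaussian 1 :: real^'n \<Rightarrow> real" "sqrt t" s] by simp
qed

text \<open>By scaling, the Gaussian with parameter \<open>t\<close> contributes
  \<open>t powr (- g)\<close>, and \<open>gamma_weight g t * t powr (- g)\<close> alone is not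
  integrable at 0. The extra \<open>t powr (g / 2)\<close> repairs this and is the weight for the
  Cauchy-Schwarz inequality of the next estimate.\<close>

lemma gagliardo_gaussian_weighted:
  "(\<integral>\<^sup>+t. ennreal (gamma_weight g t * t powr (g / 2)) * gagliardo s (gaussian t :: real^'n \<Rightarrow> real) \<partial>lborel) < \<infinity>"
proof -
  have "(\<integral>\<^sup>+t. ennreal (gamma_weight g t * t powr (g / 2)) * gagliardo s (gaussian t :: real^'n \<Rightarrow> real) \<partial>lborel)
    = (\<integral>\<^sup>+t. ennreal (gamma_weight (g / 2) t * exp (- (t * 0))) * gagliardo s (gaussian 1 :: real^'n \<Rightarrow> real) \<partial>lborel)"
  proof (rule nn_integral_cong)
    fix t :: real
    show "ennreal (gamma_weight g t * t powr (g / 2)) * gagliardo s (gaussian t :: real^'n \<Rightarrow> real)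
      = ennreal (gamma_weight (g / 2) t * exp (- (t * 0))) * gagliardo s (gaussian 1 :: real^'n \<Rightarrow> real)"
    proof (cases "0 < t")
      case True
      have "gamma_weight g t * t powr (g / 2) * t powr (- g) = gamma_weight (g / 2) t"
        unfolding gamma_weight_powr by (simp add: field_simps)
      then show ?thesis
        unfolding gagliardo_gaussian[OF True] mult.assoc[symmetric]
        by (subst ennreal_mult[symmetric]) (auto simp: gamma_weight_nonneg)
    qed (simp add: gamma_weight_def)
  qed
  also have "\<dots> = ennreal (Gamma (g / 2)) * gagliardo s (gaussian 1 :: real^'n \<Rightarrow> real)"
    using nn_integral_gamma_weight[of "g / 2" 0] g_pos by (simp add: nn_integral_multc)
  also have "\<dots> < \<infinity>" using gagliardo_gaussian_finite[OF s, where 'n='n] by (simp add: ennreal_mult_less_top)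
  finally show ?thesis .
qed

text \<open>Cauchy-Schwarz in the mixing variable, the weight being split into the square roots of
  \<open>gamma_weight (g / 2) t\<close> and of \<open>gamma_weight g t * t powr (g / 2)\<close>. The
  square of the first has integral \<open>Gamma (g / 2)\<close>; the second, integrated over pairs,
  is \<open>gagliardo_gaussian_weighted\<close>.\<close>

lemma gagliardo_bubble_finite: "gagliardo s (bubble g :: real^'n \<Rightarrow> real) < \<infinity>"
proof -
  let ?M = "lborel :: (real^'n) measure"
  let ?Q = "\<lambda>t. gagliardo_quotient s (gaussian t :: real^'n \<Rightarrow> real)"
  let ?W = "gamma_weight g"
  define K where "K = ennreal (Gamma (g / 2))"
  have pt: "ennreal ((gagliardo_quotient s (bubble g) z)\<^sup>2) \<le> ennreal (1 / (Gamma g)\<^sup>2) * (K * (\<integral>\<^sup>+t. ennreal (?W t * t powr (g / 2)) * ennreal ((?Q t z)\<^sup>2) \<partial>lborel))" for z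
  proof -
    have [measurable]: "(\<lambda>t. ?Q t z) \<in> borel_measurable borel"
      unfolding gagliardo_quotient_def gaussian_def by measurable
    have "\<bar>LINT t|lborel. ?W t * ?Q t z\<bar> \<le> (LINT t|lborel. \<bar>?W t * ?Q t z\<bar>)" by (rule integral_abs_bound)
    then have "ennreal (\<bar>LINT t|lborel. ?W t * ?Q t z\<bar>) \<le> (\<integral>\<^sup>+t. ennreal \<bar>?W t * ?Q t z\<bar> \<partial>lborel)"
      using gagliardo_quotient_bubble(1)[OF g_pos, of s z]
      by (subst nn_integral_eq_integral) (auto intro!: ennreal_leI integrable_abs)
    also have "\<dots> = (\<integral>\<^sup>+t. ennreal (sqrt (gamma_weight (g / 2) t)) * ennreal (sqrt (?W t * t powr (g / 2)) * \<bar>?Q t z\<bar>) \<partial>lborel)"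
    proof (rule nn_integral_cong)
      fix t :: real
      have "sqrt (gamma_weight (g / 2) t) * (sqrt (?W t * t powr (g / 2)) * \<bar>?Q t z\<bar>) = \<bar>?W t * ?Q t z\<bar>"
      proof -
        have "gamma_weight (g / 2) t * (?W t * t powr (g / 2)) = (?W t)\<^sup>2"
        proof -
          have "gamma_weight (g / 2) t * (?W t * t powr (g / 2)) = (gamma_weight (g / 2) t * t powr (g / 2)) * ?W t" by simp
          then show ?thesis unfolding gamma_weight_powr by (simp add: power2_eq_square)
        qed
        then have "sqrt (gamma_weight (g / 2) t) * sqrt (?W t * t powr (g / 2)) = ?W t"
          by (simp add: real_sqrt_mult[symmetric] gamma_weight_nonneg)
        then show ?thesis by (simp add: abs_mult gamma_weight_nonneg mult.assoc[symmetric])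
      qed
      then show "ennreal \<bar>?W t * ?Q t z\<bar> = ennreal (sqrt (gamma_weight (g / 2) t)) * ennreal (sqrt (?W t * t powr (g / 2)) * \<bar>?Q t z\<bar>)"
        by (subst ennreal_mult[symmetric]) (auto simp: gamma_weight_nonneg)
    qed
    finally have "(ennreal (\<bar>LINT t|lborel. ?W t * ?Q t z\<bar>))\<^sup>2 \<le> (\<integral>\<^sup>+t. ennreal (sqrt (gamma_weight (g / 2) t)) * ennreal (sqrt (?W t * t powr (g / 2)) * \<bar>?Q t z\<bar>) \<partial>lborel)\<^sup>2"
      by (intro power_mono) auto
    also have "\<dots> \<le> (\<integral>\<^sup>+t. (ennreal (sqrt (gamma_weight (g / 2) t)))\<^sup>2 \<partial>lborel) * (\<integral>\<^sup>+t. (ennreal (sqrt (?W t * t powr (g / 2)) * \<bar>?Q t z\<bar>))\<^sup>2 \<partial>lborel)"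
      by (rule Cauchy_Schwarz_nn_integral) measurable
    also have "(\<integral>\<^sup>+t. (ennreal (sqrt (gamma_weight (g / 2) t)))\<^sup>2 \<partial>lborel) = K"
      using nn_integral_gamma_weight[of "g / 2" 0] g_pos by (simp add: K_def ennreal_power gamma_weight_nonneg)
    also have "(\<integral>\<^sup>+t. (ennreal (sqrt (?W t * t powr (g / 2)) * \<bar>?Q t z\<bar>))\<^sup>2 \<partial>lborel) = (\<integral>\<^sup>+t. ennreal (?W t * t powr (g / 2)) * ennreal ((?Q t z)\<^sup>2) \<partial>lborel)"
      by (intro nn_integral_cong) (simp add: ennreal_power power_mult_distrib gamma_weight_nonneg ennreal_mult[symmetric])
    finally have "ennreal ((LINT t|lborel. ?W t * ?Q t z)\<^sup>2) \<le> K * (\<integral>\<^sup>+t. ennreal (?W t * t powr (g / 2)) * ennreal ((?Q t z)\<^sup>2) \<partial>lborel)"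
      by (simp add: ennreal_power)
    then have "ennreal (1 / (Gamma g)\<^sup>2) * ennreal ((LINT t|lborel. ?W t * ?Q t z)\<^sup>2) \<le> ennreal (1 / (Gamma g)\<^sup>2) * (K * (\<integral>\<^sup>+t. ennreal (?W t * t powr (g / 2)) * ennreal ((?Q t z)\<^sup>2) \<partial>lborel))"
      by (intro mult_left_mono) auto
    then show ?thesis unfolding gagliardo_quotient_bubble(2)[OF g_pos] by (simp add: power_divide ennreal_mult[symmetric])
  qed
  interpret Z: pair_sigma_finite "lborel :: real measure" "?M \<Otimes>\<^sub>M ?M" ..
  have "gagliardo s (bubble g :: real^'n \<Rightarrow> real) \<le> (\<integral>\<^sup>+z. ennreal (1 / (Gamma g)\<^sup>2) * (K * (\<integral>\<^sup>+t. ennreal (?W t * t powr (g / 2)) * ennreal ((?Q t z)\<^sup>2) \<partial>lborel)) \<partial>(?M \<Otimes>\<^sub>M ?M))"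
    unfolding gagliardo_eq_quotient[OF borel_measurable_bubble] by (intro nn_integral_mono pt)
  also have "\<dots> = ennreal (1 / (Gamma g)\<^sup>2) * (K * (\<integral>\<^sup>+z. \<integral>\<^sup>+t. ennreal (?W t * t powr (g / 2)) * ennreal ((?Q t z)\<^sup>2) \<partial>lborel \<partial>(?M \<Otimes>\<^sub>M ?M)))"
    by (subst nn_integral_cmult, measurable, subst nn_integral_cmult, measurable)
  also have "(\<integral>\<^sup>+z. \<integral>\<^sup>+t. ennreal (?W t * t powr (g / 2)) * ennreal ((?Q t z)\<^sup>2) \<partial>lborel \<partial>(?M \<Otimes>\<^sub>M ?M))
    = (\<integral>\<^sup>+t. \<integral>\<^sup>+z. ennreal (?W t * t powr (g / 2)) * ennreal ((?Q t z)\<^sup>2) \<partial>(?M \<Otimes>\<^sub>M ?M) \<partial>lborel)"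
    by (rule Z.Fubini') measurable
  also have "\<dots> = (\<integral>\<^sup>+t. ennreal (?W t * t powr (g / 2)) * gagliardo s (gaussian t :: real^'n \<Rightarrow> real) \<partial>lborel)"
    by (simp add: nn_integral_cmult gagliardo_eq_quotient)
  also have "ennreal (1 / (Gamma g)\<^sup>2) * (K * \<dots>) < \<infinity>"
    using gagliardo_gaussian_weighted by (simp add: K_def ennreal_mult_less_top)
  finally show ?thesis .
qed

text \<open>Polarisation of \<open>gagliardo_fourier\<close>. The hypotheses are chosen so that
  Gaussians, which have no compact support, satisfy them as well as test functions.\<close>

lemma gagliardo_inner_fourier:
  fixes u w :: "real^'n \<Rightarrow> real"
  assumes u: "continuous_on UNIV u" "\<And>x. \<bar>u x\<bar> \<le> A" "integrable lborel u" "gagliardo s u < \<infinity>"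
    and w: "continuous_on UNIV w" "\<And>x. \<bar>w x\<bar> \<le> B" "integrable lborel w" "gagliardo s w < \<infinity>"
  shows "gagliardo_inner s u w = gagliardo_const CARD('n) s *
    (LINT \<xi>|lborel. norm \<xi> powr (2 * s) * Re (fourier (\<lambda>x. of_real (u x)) \<xi> * cnj (fourier (\<lambda>x. of_real (w x)) \<xi>)))"
proof -
  let ?k = "gagliardo_const CARD('n) s"
  let ?F = "\<lambda>u. fourier (\<lambda>x::real^'n. complex_of_real (u x))"
  let ?M = "lborel \<Otimes>\<^sub>M lborel :: ((real^'n) \<times> (real^'n)) measure"
  have k: "0 < ?k" using gagliardo_const_pos[OF s] by simp
  have [measurable]: "u \<in> borel_measurable borel" "w \<in> borel_measurable borel"
    using u(3) w(3) by (auto dest: borel_measurable_integrable)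
  have fin: "(\<integral>\<^sup>+\<xi>. ennreal (norm \<xi> powr (2 * s) * (norm (?F v \<xi>))\<^sup>2) \<partial>lborel) < \<infinity>"
    if v: "continuous_on UNIV v" "\<And>x. \<bar>v x\<bar> \<le> A" "integrable lborel v" "gagliardo s v < \<infinity>" for v A
    using v(4) k unfolding gagliardo_fourier[OF s v(1,2,3)] by (auto simp: ennreal_mult_less_top ennreal_mult_eq_top_iff less_top[symmetric])
  have sq: "(LINT z|(?M). (gagliardo_quotient s v z)\<^sup>2) = ?k * (LINT \<xi>|lborel. norm \<xi> powr (2 * s) * (norm (?F v \<xi>))\<^sup>2)"
    if v: "continuous_on UNIV v" "\<And>x. \<bar>v x\<bar> \<le> A" "integrable lborel v" for v A
  proof -
    have [measurable]: "v \<in> borel_measurable borel" using v(3) by (auto dest: borel_measurable_integrable)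
    have "(LINT z|(?M). (gagliardo_quotient s v z)\<^sup>2) = enn2real (gagliardo s v)"
      by (subst gagliardo_eq_quotient, measurable, subst integral_eq_nn_integral) auto
    also have "\<dots> = ?k * enn2real (\<integral>\<^sup>+\<xi>. ennreal (norm \<xi> powr (2 * s) * (norm (?F v \<xi>))\<^sup>2) \<partial>lborel)"
      using k by (simp add: gagliardo_fourier[OF s v] enn2real_mult)
    also have "enn2real (\<integral>\<^sup>+\<xi>. ennreal (norm \<xi> powr (2 * s) * (norm (?F v \<xi>))\<^sup>2) \<partial>lborel) = (LINT \<xi>|lborel. norm \<xi> powr (2 * s) * (norm (?F v \<xi>))\<^sup>2)"
      by (subst integral_eq_nn_integral) auto
    finally show ?thesis .
  qed
  have i: "integrable lborel (\<lambda>x. complex_of_real (u x))" "integrable lborel (\<lambda>x. complex_of_real (w x))"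
    using u w by (auto intro!: integrable_of_real)
  have add: "?F (\<lambda>x. u x + w x) \<xi> = ?F u \<xi> + ?F w \<xi>" and diff: "?F (\<lambda>x. u x - w x) \<xi> = ?F u \<xi> - ?F w \<xi>" for \<xi>
    using integrable_cis_mult(2)[OF i(1), of \<xi>] integrable_cis_mult(2)[OF i(2), of \<xi>]
    by (simp_all add: fourier_def distrib_left right_diff_distrib)
  have "4 * gagliardo_inner s u w = (LINT z|(?M). (gagliardo_quotient s u z + gagliardo_quotient s w z)\<^sup>2) - (LINT z|(?M). (gagliardo_quotient s u z - gagliardo_quotient s w z)\<^sup>2)"
    unfolding gagliardo_inner_def using u(4) w(4) by (intro integral_mult_polar) (auto simp: gagliardo_eq_quotient)
  also have "\<dots> = (LINT z|(?M). (gagliardo_quotient s (\<lambda>x. u x + w x) z)\<^sup>2) - (LINT z|(?M). (gagliardo_quotient s (\<lambda>x. u x - w x) z)\<^sup>2)"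
    using gagliardo_quotient_linear[of s 1 u 1 w] by (simp add: gagliardo_quotient_diff)
  also have "\<dots> = ?k * (LINT \<xi>|lborel. norm \<xi> powr (2 * s) * (norm (?F u \<xi> + ?F w \<xi>))\<^sup>2) - ?k * (LINT \<xi>|lborel. norm \<xi> powr (2 * s) * (norm (?F u \<xi> - ?F w \<xi>))\<^sup>2)"
  proof -
    have "\<bar>u x + w x\<bar> \<le> A + B" "\<bar>u x - w x\<bar> \<le> A + B" for x using u(2)[of x] w(2)[of x] by linarith+
    then show ?thesis
      using sq[of "\<lambda>x. u x + w x" "A + B"] sq[of "\<lambda>x. u x - w x" "A + B"] u w
      by (simp add: add[simplified] diff[simplified] continuous_on_add continuous_on_diff)
  qed
  also have "\<dots> = ?k * ((LINT \<xi>|lborel. norm \<xi> powr (2 * s) * (norm (?F u \<xi> + ?F w \<xi>))\<^sup>2) - (LINT \<xi>|lborel. norm \<xi> powr (2 * s) * (norm (?F u \<xi> - ?F w \<xi>))\<^sup>2))"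
    by (simp add: right_diff_distrib)
  also have "(LINT \<xi>|lborel. norm \<xi> powr (2 * s) * (norm (?F u \<xi> + ?F w \<xi>))\<^sup>2) - (LINT \<xi>|lborel. norm \<xi> powr (2 * s) * (norm (?F u \<xi> - ?F w \<xi>))\<^sup>2)
    = (LINT \<xi>|lborel. norm \<xi> powr (2 * s) * (norm (?F u \<xi> + ?F w \<xi>))\<^sup>2 - norm \<xi> powr (2 * s) * (norm (?F u \<xi> - ?F w \<xi>))\<^sup>2)"
  proof (rule Bochner_Integration.integral_diff[symmetric])
    \<comment> \<open>One estimate for sum and difference, used with \<open>c\<close> equal to 1 and
      to -1.\<close>
    have b: "integrable lborel (\<lambda>\<xi>. norm \<xi> powr (2 * s) * (norm (?F u \<xi> + c * ?F w \<xi>))\<^sup>2)" if "norm c = 1" for c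
    proof (rule Bochner_Integration.integrable_bound)
      show "integrable lborel (\<lambda>\<xi>. 2 * (norm \<xi> powr (2 * s) * (norm (?F u \<xi>))\<^sup>2) + 2 * (norm \<xi> powr (2 * s) * (norm (?F w \<xi>))\<^sup>2))"
        using fin[OF u] fin[OF w] by (intro Bochner_Integration.integrable_add integrable_mult_right integrableI_nonneg) auto
      show "AE \<xi> in lborel. norm (norm \<xi> powr (2 * s) * (norm (?F u \<xi> + c * ?F w \<xi>))\<^sup>2)
        \<le> norm (2 * (norm \<xi> powr (2 * s) * (norm (?F u \<xi>))\<^sup>2) + 2 * (norm \<xi> powr (2 * s) * (norm (?F w \<xi>))\<^sup>2))"
      proof (rule AE_I2)
        fix \<xi>
        have "(norm (?F u \<xi> + c * ?F w \<xi>))\<^sup>2 \<le> (norm (?F u \<xi>) + norm (?F w \<xi>))\<^sup>2"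
          using norm_triangle_ineq[of "?F u \<xi>" "c * ?F w \<xi>"] that by (intro power_mono) (auto simp: norm_mult)
        also have "\<dots> \<le> 2 * (norm (?F u \<xi>))\<^sup>2 + 2 * (norm (?F w \<xi>))\<^sup>2"
          using sum_squares_bound[of "norm (?F u \<xi>)" "norm (?F w \<xi>)"] by (simp add: power2_sum)
        finally have "norm \<xi> powr (2 * s) * (norm (?F u \<xi> + c * ?F w \<xi>))\<^sup>2 \<le> norm \<xi> powr (2 * s) * (2 * (norm (?F u \<xi>))\<^sup>2 + 2 * (norm (?F w \<xi>))\<^sup>2)"
          by (intro mult_left_mono) auto
        then show "norm (norm \<xi> powr (2 * s) * (norm (?F u \<xi> + c * ?F w \<xi>))\<^sup>2)
        \<le> norm (2 * (norm \<xi> powr (2 * s) * (norm (?F u \<xi>))\<^sup>2) + 2 * (norm \<xi> powr (2 * s) * (norm (?F w \<xi>))\<^sup>2))"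
          by (simp add: algebra_simps)
      qed
    qed measurable
    show "integrable lborel (\<lambda>\<xi>. norm \<xi> powr (2 * s) * (norm (?F u \<xi> + ?F w \<xi>))\<^sup>2)" using b[of 1] by simp
    show "integrable lborel (\<lambda>\<xi>. norm \<xi> powr (2 * s) * (norm (?F u \<xi> - ?F w \<xi>))\<^sup>2)" using b[of "-1"] by simp
  qed
  also have "\<dots> = (LINT \<xi>|lborel. 4 * (norm \<xi> powr (2 * s) * Re (?F u \<xi> * cnj (?F w \<xi>))))"
  proof (intro Bochner_Integration.integral_cong refl)
    fix \<xi>
    have "(norm (a + b))\<^sup>2 - (norm (a - b))\<^sup>2 = 4 * Re (a * cnj b)" for a b
      unfolding cmod_power2 by (simp add: power2_eq_square algebra_simps)
    moreover have "x - y = 4 * r \<Longrightarrow> n * x - n * y = 4 * (n * r)" for n x y r :: real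
      by (simp add: right_diff_distrib[symmetric])
    ultimately show "norm \<xi> powr (2 * s) * (norm (?F u \<xi> + ?F w \<xi>))\<^sup>2 - norm \<xi> powr (2 * s) * (norm (?F u \<xi> - ?F w \<xi>))\<^sup>2
      = 4 * (norm \<xi> powr (2 * s) * Re (?F u \<xi> * cnj (?F w \<xi>)))"
      by blast
  qed
  finally show ?thesis by simp
qed

end

section \<open>The Gagliardo form of the bubble against a test function\<close>

context
  fixes s :: real and dim :: "'n::finite itself" and g :: real
  assumes s: "0 < s" "s < 1" and dim: "2 * s < CARD('n)"
  defines "g \<equiv> (real CARD('n) - 2 * s) / 2"
begin

private lemma g_pos': "0 < g" using dim by (simp add: g_def)

text \<open>Exchanging the mixture with the integral over pairs requires absolute convergence. It
  follows from \<open>a * b \<le> a\<^sup>2 + b\<^sup>2\<close> after distributing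
  \<open>t powr (g / 4)\<close> and its inverse over the two quotients, which leaves an integrable
  weight in both resulting terms.\<close>

lemma gagliardo_inner_bubble_gaussian:
  fixes \<phi> :: "real^'n \<Rightarrow> real"
  assumes [measurable]: "\<phi> \<in> borel_measurable borel" and fin: "gagliardo s \<phi> < \<infinity>"
  shows "gagliardo_inner s (bubble g) \<phi> = (LINT t|lborel. gamma_weight g t * gagliardo_inner s (gaussian t) \<phi>) / Gamma g"
proof -
  let ?M = "lborel \<Otimes>\<^sub>M lborel :: ((real^'n) \<times> (real^'n)) measure"
  let ?W = "gamma_weight g" and ?Q = "\<lambda>t. gagliardo_quotient s (gaussian t :: real^'n \<Rightarrow> real)" and ?R = "gagliardo_quotient s \<phi>"
  interpret Z: pair_sigma_finite "lborel :: real measure" ?M ..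
  let ?f = "\<lambda>t z. ?W t * ?Q t z * ?R z"
  have "(\<integral>\<^sup>+t. \<integral>\<^sup>+z. ennreal \<bar>?f t z\<bar> \<partial>?M \<partial>lborel)
    \<le> (\<integral>\<^sup>+t. ennreal (?W t * t powr (g / 2)) * gagliardo s (gaussian t :: real^'n \<Rightarrow> real) + ennreal (gamma_weight (g / 2) t) * gagliardo s \<phi> \<partial>lborel)"
  proof (rule nn_integral_mono)
    fix t :: real
    show "(\<integral>\<^sup>+z. ennreal \<bar>?f t z\<bar> \<partial>?M) \<le> ennreal (?W t * t powr (g / 2)) * gagliardo s (gaussian t :: real^'n \<Rightarrow> real) + ennreal (gamma_weight (g / 2) t) * gagliardo s \<phi>"
    proof (cases "0 < t")
      case True
      have "(\<integral>\<^sup>+z. ennreal \<bar>?f t z\<bar> \<partial>?M) \<le> (\<integral>\<^sup>+z. ennreal (?W t * t powr (g / 2)) * ennreal ((?Q t z)\<^sup>2) + ennreal (gamma_weight (g / 2) t) * ennreal ((?R z)\<^sup>2) \<partial>?M)"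
      proof (rule nn_integral_mono)
        fix z
        define a where "a = t powr (g / 4) * \<bar>?Q t z\<bar>"
        define b where "b = t powr (- (g / 4)) * \<bar>?R z\<bar>"
        have ab: "a * b = \<bar>?Q t z\<bar> * \<bar>?R z\<bar>"
          using True by (simp add: a_def b_def powr_minus field_simps)
        have sq: "a\<^sup>2 = t powr (g / 2) * (?Q t z)\<^sup>2" "b\<^sup>2 = t powr (- (g / 2)) * (?R z)\<^sup>2"
          by (simp_all add: a_def b_def power_mult_distrib) (simp_all add: power2_eq_square powr_add[symmetric])
        have "a * b \<le> a\<^sup>2 + b\<^sup>2"
        proof -
          have "0 \<le> a * b" by (simp add: a_def b_def)
          then show ?thesis using sum_squares_bound[of a b] by linarith
        qed
        then have "\<bar>?Q t z\<bar> * \<bar>?R z\<bar> \<le> t powr (g / 2) * (?Q t z)\<^sup>2 + t powr (- (g / 2)) * (?R z)\<^sup>2"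
          unfolding ab sq .
        then have "?W t * (\<bar>?Q t z\<bar> * \<bar>?R z\<bar>) \<le> ?W t * (t powr (g / 2) * (?Q t z)\<^sup>2 + t powr (- (g / 2)) * (?R z)\<^sup>2)"
          by (intro mult_left_mono gamma_weight_nonneg)
        also have "\<dots> = (?W t * t powr (g / 2)) * (?Q t z)\<^sup>2 + (?W t * t powr (- (g / 2))) * (?R z)\<^sup>2"
          by (simp add: distrib_left mult.assoc)
        also have "?W t * t powr (- (g / 2)) = gamma_weight (g / 2) t"
          unfolding gamma_weight_powr by (simp add: field_simps)
        finally show "ennreal \<bar>?f t z\<bar> \<le> ennreal (?W t * t powr (g / 2)) * ennreal ((?Q t z)\<^sup>2) + ennreal (gamma_weight (g / 2) t) * ennreal ((?R z)\<^sup>2)"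
          by (simp add: abs_mult gamma_weight_nonneg mult.assoc ennreal_mult[symmetric] ennreal_plus[symmetric] ennreal_leI del: ennreal_plus)
      qed
      also have "\<dots> = ennreal (?W t * t powr (g / 2)) * gagliardo s (gaussian t :: real^'n \<Rightarrow> real) + ennreal (gamma_weight (g / 2) t) * gagliardo s \<phi>"
        by (simp add: nn_integral_add nn_integral_cmult gagliardo_eq_quotient)
      finally show ?thesis .
    qed (simp add: gamma_weight_def)
  qed
  also have "\<dots> = (\<integral>\<^sup>+t. ennreal (?W t * t powr (g / 2)) * gagliardo s (gaussian t :: real^'n \<Rightarrow> real) \<partial>lborel) + (\<integral>\<^sup>+t. ennreal (gamma_weight (g / 2) t * exp (- (t * 0))) * gagliardo s \<phi> \<partial>lborel)"
  proof -
    have [measurable]: "(\<lambda>t. gagliardo s (gaussian t :: real^'n \<Rightarrow> real)) \<in> borel_measurable borel"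
      unfolding gagliardo_eq_quotient[OF borel_measurable_gaussian] by measurable
    show ?thesis by (simp add: nn_integral_add)
  qed
  also have "\<dots> < \<infinity>"
    using gagliardo_gaussian_weighted[OF s dim] fin nn_integral_gamma_weight[of "g / 2" 0] g_pos'
    by (simp add: nn_integral_multc ennreal_mult_less_top g_def)
  finally have f: "(\<integral>\<^sup>+t. \<integral>\<^sup>+z. ennreal \<bar>?f t z\<bar> \<partial>?M \<partial>lborel) < \<infinity>" .
  have "gagliardo_inner s (bubble g) \<phi> = (LINT z|(?M). (LINT t|lborel. ?f t z) / Gamma g)"
    unfolding gagliardo_inner_def gagliardo_quotient_bubble(2)[OF g_pos'] by simp
  also have "\<dots> = (LINT z|(?M). LINT t|lborel. ?f t z) / Gamma g" by simp
  also have "(LINT z|(?M). LINT t|lborel. ?f t z) = (LINT t|lborel. LINT z|(?M). ?f t z)"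
    by (rule Z.Fubini_nn(2)[OF _ f]) measurable
  also have "\<dots> = (LINT t|lborel. ?W t * gagliardo_inner s (gaussian t) \<phi>)"
    by (simp add: gagliardo_inner_def mult.assoc)
  finally show ?thesis .
qed

text \<open>The substitution \<open>t = |\<xi>|\<^sup>2 / (4 r)\<close> exchanges the two exponentials; this is why the
  Fourier transform of the bubble times \<open>|\<xi>|\<^bsup>2s\<^esup>\<close> is again a mixture of Gaussians.\<close>

lemma nn_integral_gamma_weight_inversion:
  assumes "0 < a"
  shows "(\<integral>\<^sup>+t. ennreal (gamma_weight (- s) t * exp (- (a / t))) \<partial>lborel)
    = ennreal (a powr (- s)) * (\<integral>\<^sup>+t. ennreal (gamma_weight s t * exp (- (a / t))) \<partial>lborel)"
proof -
  let ?F = "\<lambda>t. t powr (- s - 1) * exp (- t) * exp (- (a / t))"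
  let ?G = "\<lambda>t. t powr (s - 1) * exp (- (a * t)) * exp (- (1 / t))"
  have "(\<integral>\<^sup>+t. ennreal (gamma_weight (- s) t * exp (- (a / t))) \<partial>lborel) = (\<integral>\<^sup>+t\<in>{0<..}. ennreal (?F t) \<partial>lborel)"
    by (intro nn_integral_cong) (auto simp: gamma_weight_def split: split_indicator)
  also have "\<dots> = (\<integral>\<^sup>+t\<in>{0<..}. ennreal (?F (1 / t) / t\<^sup>2) \<partial>lborel)"
    by (rule nn_integral_reciprocal) measurable
  also have "\<dots> = (\<integral>\<^sup>+t\<in>{0<..}. ennreal (?G t) \<partial>lborel)"
  proof (rule nn_integral_cong)
    fix t :: real
    have "?F (1 / t) / t\<^sup>2 = ?G t" if "0 < t"
    proof -
      have "(1 / t) powr (- s - 1) / t\<^sup>2 = t powr (s - 1)"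
      proof -
        have "(1 / t) powr (- s - 1) = t powr (s + 1)" using that by (simp add: powr_divide powr_diff powr_minus powr_add)
        moreover have "t\<^sup>2 = t powr 2" using that by simp
        ultimately show ?thesis by (simp only: powr_diff[symmetric]) simp
      qed
      then have "(1 / t) powr (- s - 1) = t powr (s - 1) * t\<^sup>2" using that by (simp add: field_simps)
      then show ?thesis using that by (simp add: mult_ac)
    qed
    then show "ennreal (?F (1 / t) / t\<^sup>2) * indicator {0<..} t = ennreal (?G t) * indicator {0<..} t"
      by (auto split: split_indicator)
  qed
  \<comment> \<open>The reciprocal has exchanged the roles of the two exponentials; scaling by
    \<open>a\<close> restores the factors \<open>exp (- t)\<close> and
    \<open>exp (- (a / t))\<close>.\<close>
  also have "\<dots> = ennreal (1 / a) * (\<integral>\<^sup>+t. ennreal (?G (t / a)) * indicator {0<..} (t / a) \<partial>lborel)"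
    using assms by (subst nn_integral_real_affine[where c="1 / a" and t=0]) (simp_all add: divide_inverse mult.commute)
  also have "\<dots> = ennreal (1 / a) * (\<integral>\<^sup>+t. ennreal (a powr (1 - s)) * ennreal (gamma_weight s t * exp (- (a / t))) \<partial>lborel)"
  proof (rule arg_cong2[where f=times, OF refl], rule nn_integral_cong)
    fix t :: real
    show "ennreal (?G (t / a)) * indicator {0<..} (t / a) = ennreal (a powr (1 - s)) * ennreal (gamma_weight s t * exp (- (a / t)))"
      using assms by (cases "0 < t") (simp_all add: gamma_weight_def powr_divide ennreal_mult[symmetric] zero_less_divide_iff powr_diff field_simps)
  qed
  also have "\<dots> = ennreal (1 / a * a powr (1 - s)) * (\<integral>\<^sup>+t. ennreal (gamma_weight s t * exp (- (a / t))) \<partial>lborel)"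
    using assms by (simp add: nn_integral_cmult mult.assoc[symmetric] ennreal_mult[symmetric])
  also have "1 / a * a powr (1 - s) = a powr (- s)"
    using assms by (simp add: powr_diff powr_minus field_simps)
  finally show ?thesis .
qed

text \<open>Since \<open>g - N / 2 = - s\<close> for the dimension \<open>N\<close>, the transform
  of the Gaussians turns the weight into \<open>gamma_weight (- s)\<close>. The inversion makes this
  \<open>gamma_weight s\<close> at the price of
  \<open>((norm \<xi>)\<^sup>2 / 4) powr (- s)\<close>, which cancels the symbol up to
  \<open>4 powr s\<close>.\<close>

lemma gaussian_fourier_mixture:
  fixes \<xi> :: "real^'n"
  assumes "\<xi> \<noteq> 0"
  shows "(\<integral>\<^sup>+t. ennreal (gamma_weight g t * (norm \<xi> powr (2 * s) * ((2 * t) powr (- real CARD('n) / 2) * exp (- ((norm \<xi>)\<^sup>2 / (4 * t)))))) \<partial>lborel)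
    = ennreal (2 powr (- real CARD('n) / 2) * 4 powr s) * (\<integral>\<^sup>+t. ennreal (gamma_weight s t * exp (- ((norm \<xi>)\<^sup>2 / (4 * t)))) \<partial>lborel)"
proof -
  let ?N = "real CARD('n)"
  define a where "a = (norm \<xi>)\<^sup>2 / 4"
  have a: "0 < a" using assms by (simp add: a_def)
  have at: "(norm \<xi>)\<^sup>2 / (4 * t) = a / t" for t by (simp add: a_def)
  have "(\<integral>\<^sup>+t. ennreal (gamma_weight g t * (norm \<xi> powr (2 * s) * ((2 * t) powr (- ?N / 2) * exp (- (a / t))))) \<partial>lborel)
    = (\<integral>\<^sup>+t. ennreal (2 powr (- ?N / 2) * norm \<xi> powr (2 * s)) * ennreal (gamma_weight (- s) t * exp (- (a / t))) \<partial>lborel)"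
  proof (rule nn_integral_cong)
    fix t :: real
    show "ennreal (gamma_weight g t * (norm \<xi> powr (2 * s) * ((2 * t) powr (- ?N / 2) * exp (- (a / t)))))
      = ennreal (2 powr (- ?N / 2) * norm \<xi> powr (2 * s)) * ennreal (gamma_weight (- s) t * exp (- (a / t)))"
    proof (cases "0 < t")
      case True
      have "gamma_weight g t * t powr (- ?N / 2) = gamma_weight (- s) t"
        unfolding gamma_weight_powr by (simp add: g_def field_simps)
      moreover have "gamma_weight g t * (norm \<xi> powr (2 * s) * ((2 * t) powr (- ?N / 2) * exp (- (a / t))))
        = (2 powr (- ?N / 2) * norm \<xi> powr (2 * s)) * ((gamma_weight g t * t powr (- ?N / 2)) * exp (- (a / t)))"
        by (simp add: powr_mult mult_ac)
      ultimately have e: "gamma_weight g t * (norm \<xi> powr (2 * s) * ((2 * t) powr (- ?N / 2) * exp (- (a / t))))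
        = (2 powr (- ?N / 2) * norm \<xi> powr (2 * s)) * (gamma_weight (- s) t * exp (- (a / t)))" by (simp only:)
      show ?thesis unfolding e by (rule ennreal_mult) (auto simp: gamma_weight_nonneg)
    qed (simp add: gamma_weight_def)
  qed
  also have "\<dots> = ennreal (2 powr (- ?N / 2) * norm \<xi> powr (2 * s)) * (ennreal (a powr (- s)) * (\<integral>\<^sup>+t. ennreal (gamma_weight s t * exp (- (a / t))) \<partial>lborel))"
    unfolding nn_integral_gamma_weight_inversion[OF a, symmetric] by (rule nn_integral_cmult) measurable
  also have "\<dots> = ennreal ((2 powr (- ?N / 2) * norm \<xi> powr (2 * s)) * a powr (- s)) * (\<integral>\<^sup>+t. ennreal (gamma_weight s t * exp (- (a / t))) \<partial>lborel)"
    by (simp add: ennreal_mult mult.assoc)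
  also have "(2 powr (- ?N / 2) * norm \<xi> powr (2 * s)) * a powr (- s) = 2 powr (- ?N / 2) * 4 powr s"
  proof -
    have "norm \<xi> powr (2 * s) = (4 * a) powr s"
    proof -
      have "(norm \<xi> powr 2) powr s = norm \<xi> powr (2 * s)" by (simp only: powr_powr)
      moreover have "norm \<xi> powr 2 = 4 * a" using assms by (simp add: a_def)
      ultimately show ?thesis by simp
    qed
    then show ?thesis using a by (simp add: powr_mult powr_minus)
  qed
  finally show ?thesis unfolding at .
qed

text \<open>The factor by which the fractional Laplacian takes \<open>bubble g\<close> to
  \<open>bubble (s + real CARD('n) / 2)\<close>. The two Gamma values normalise the mixtures for the
  two exponents, and \<open>4 powr s\<close> comes from
  \<open>gaussian_fourier_mixture\<close>.\<close>

definition bubble_const :: "real" where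
  "bubble_const = 4 powr s * Gamma (s + real CARD('n) / 2) / Gamma g"

lemma bubble_const_pos: "0 < bubble_const"
  using g_pos' s by (simp add: bubble_const_def Gamma_real_pos)

text \<open>The bubble is taken apart into Gaussians and moved to the frequency side, where the
  mixture identity removes \<open>norm \<xi> powr (2 * s)\<close>. Moving the Gaussians back
  multiplies the weight \<open>gamma_weight s\<close> by \<open>t powr (?N / 2)\<close>, so that
  they reassemble to a bubble of exponent \<open>s + ?N / 2\<close>.\<close>

lemma gagliardo_inner_bubble_test:
  fixes \<phi> :: "real^'n \<Rightarrow> real"
  assumes \<phi>: "\<phi> \<in> test_functions UNIV"
  shows "gagliardo_inner s (bubble g) \<phi> = gagliardo_const CARD('n) s * bubble_const * (LINT x|lborel. bubble (s + real CARD('n) / 2) x * \<phi> x)"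
proof -
  let ?N = "real CARD('n)" and ?k = "gagliardo_const CARD('n) s"
  let ?F = "\<lambda>u. fourier (\<lambda>x::real^'n. complex_of_real (u x))"
  \<comment> \<open>Transforms of Gaussians are real, so only the real part of the transform of
    \<phi> enters.\<close>
  define R where "R \<xi> = Re (?F \<phi> \<xi>)" for \<xi>
  define h where "h t \<xi> = (2 * t) powr (- ?N / 2) * exp (- ((norm \<xi>)\<^sup>2 / (4 * t)))" for t and \<xi> :: "real^'n"
  note [measurable] = test_function_measurable[OF \<phi>]
  have fin\<phi>: "gagliardo s \<phi> < \<infinity>" by (rule test_function_gagliardo_finite[OF s dim \<phi>])
  have \<phi>i: "integrable lborel (\<lambda>x. complex_of_real (\<phi> x))" using test_function_integrable[OF \<phi>] by (rule integrable_of_real)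
  obtain B where B: "0 < B" "\<And>x. \<bar>\<phi> x\<bar> \<le> B" using test_function_bounded[OF \<phi>] by blast
  \<comment> \<open>Inside the unit ball the transform is bounded; outside it is dominated by
    \<open>norm \<xi>\<close> times itself, a multiplier already known to be integrable.\<close>
  have Fi: "integrable lborel (?F \<phi>)"
  proof -
    obtain C0 where C0: "0 \<le> C0" "\<And>\<xi>. norm \<xi> ^ 0 * norm (?F \<phi> \<xi>) \<le> C0" using fourier_test_function_decay[OF \<phi>] by blast
    have i1: "integrable lborel (\<lambda>\<xi>. of_real (norm \<xi> powr 1) * ?F \<phi> \<xi>)" using fourier_multiplier_test_function(3)[OF \<phi>, of 1] by simp
    show ?thesis
    proof (rule Bochner_Integration.integrable_bound)
      show "integrable lborel (\<lambda>\<xi>::real^'n. C0 * indicator (cball 0 1) \<xi> + norm (of_real (norm \<xi> powr 1) * ?F \<phi> \<xi>))"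
        using i1 emeasure_bounded_finite[of "cball (0::real^'n) 1"]
        by (intro Bochner_Integration.integrable_add integrable_norm integrable_mult_right integrable_real_indicator) auto
      show "AE \<xi> in lborel. norm (?F \<phi> \<xi>) \<le> norm (C0 * indicator (cball 0 1) \<xi> + norm (of_real (norm \<xi> powr 1) * ?F \<phi> \<xi>))"
      proof (rule AE_I2)
        fix \<xi> :: "real^'n"
        show "norm (?F \<phi> \<xi>) \<le> norm (C0 * indicator (cball 0 1) \<xi> + norm (of_real (norm \<xi> powr 1) * ?F \<phi> \<xi>))"
        proof (cases "norm \<xi> \<le> 1")
          case True
          then show ?thesis using C0 by (simp add: norm_mult add_increasing2)
        next
          case False
          then have "1 * norm (?F \<phi> \<xi>) \<le> norm \<xi> * norm (?F \<phi> \<xi>)" by (intro mult_right_mono) auto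
          then show ?thesis using False by (simp add: norm_mult)
        qed
      qed
    qed measurable
  qed
  have Ri: "integrable lborel R" unfolding R_def[abs_def] using Fi by (rule integrable_Re)
  have [measurable]: "R \<in> borel_measurable borel" using Ri by (auto dest: borel_measurable_integrable)
  have [measurable]: "(\<lambda>(t, \<xi>). h t \<xi>) \<in> borel_measurable (borel \<Otimes>\<^sub>M borel)" unfolding h_def by measurable
  have g1: "gagliardo_inner s (gaussian t) \<phi> = ?k * (LINT \<xi>|lborel. norm \<xi> powr (2 * s) * (h t \<xi> * R \<xi>))" if t: "0 < t" for t
  proof -
    have F: "?F (gaussian t) \<xi> = of_real (h t \<xi>)" for \<xi>
      using fourier_gaussian[OF t, of \<xi>] by (simp add: gaussian_def h_def)
    have "gagliardo_inner s (gaussian t) \<phi> = ?k * (LINT \<xi>|lborel. norm \<xi> powr (2 * s) * Re (?F (gaussian t) \<xi> * cnj (?F \<phi> \<xi>)))"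
    proof (rule gagliardo_inner_fourier[OF s dim, where A=1 and B=B])
      show "continuous_on UNIV (gaussian t :: real^'n \<Rightarrow> real)" unfolding gaussian_def[abs_def] by (intro continuous_intros)
      show "\<bar>gaussian t x\<bar> \<le> 1" for x :: "real^'n" using gaussian_bounds[of t x] t by simp
      show "integrable lborel (gaussian t :: real^'n \<Rightarrow> real)" using integrable_gaussian[OF t, where 'a="real^'n"] by (simp add: gaussian_def[abs_def])
      show "gagliardo s (gaussian t :: real^'n \<Rightarrow> real) < \<infinity>"
        using gagliardo_gaussian_finite[OF s, where 'n='n] by (subst gagliardo_gaussian[OF s dim t]) (simp add: ennreal_mult_less_top)
    qed (use B fin\<phi> test_function_continuous[OF \<phi>] test_function_integrable[OF \<phi>] in auto)
    then show ?thesis by (simp add: F R_def)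
  qed
  have "gagliardo_inner s (bubble g) \<phi> = (LINT t|lborel. gamma_weight g t * gagliardo_inner s (gaussian t) \<phi>) / Gamma g"
    by (rule gagliardo_inner_bubble_gaussian[OF _ fin\<phi>]) measurable
  also have "(LINT t|lborel. gamma_weight g t * gagliardo_inner s (gaussian t) \<phi>)
    = (LINT t|lborel. ?k * (LINT \<xi>|lborel. R \<xi> * (gamma_weight g t * (norm \<xi> powr (2 * s) * h t \<xi>))))"
  proof (intro Bochner_Integration.integral_cong refl)
    fix t :: real
    show "gamma_weight g t * gagliardo_inner s (gaussian t) \<phi> = ?k * (LINT \<xi>|lborel. R \<xi> * (gamma_weight g t * (norm \<xi> powr (2 * s) * h t \<xi>)))"
    proof (cases "0 < t")
      case True
      have "(LINT \<xi>|lborel. R \<xi> * (gamma_weight g t * (norm \<xi> powr (2 * s) * h t \<xi>))) = (LINT \<xi>|lborel. gamma_weight g t * (norm \<xi> powr (2 * s) * (h t \<xi> * R \<xi>)))"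
        by (simp add: mult_ac)
      then show ?thesis using g1[OF True] by simp
    qed (simp add: gamma_weight_def)
  qed
  also have "\<dots> = ?k * (LINT t|lborel. LINT \<xi>|lborel. R \<xi> * (gamma_weight g t * (norm \<xi> powr (2 * s) * h t \<xi>)))" by simp
  also have "(LINT t|lborel. LINT \<xi>|lborel. R \<xi> * (gamma_weight g t * (norm \<xi> powr (2 * s) * h t \<xi>)))
    = (LINT \<xi>|lborel. LINT t|lborel. R \<xi> * (gamma_weight g t * (norm \<xi> powr (2 * s) * h t \<xi>)))"
  proof (rule lborel_pair.Fubini_nn(2))
    \<comment> \<open>By the mixture identity the \<open>t\<close>-integral is at most a constant
      independent of \<xi>, so the integrability of \<open>R\<close> suffices for the
      exchange.\<close>
    have "(\<integral>\<^sup>+\<xi>. \<integral>\<^sup>+t. ennreal \<bar>R \<xi> * (gamma_weight g t * (norm \<xi> powr (2 * s) * h t \<xi>))\<bar> \<partial>lborel \<partial>lborel)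
      \<le> (\<integral>\<^sup>+\<xi>. ennreal \<bar>R \<xi>\<bar> * ennreal (2 powr (- ?N / 2) * 4 powr s * Gamma s) \<partial>lborel)"
    proof (rule nn_integral_mono_AE)
      show "AE \<xi> in lborel. (\<integral>\<^sup>+t. ennreal \<bar>R \<xi> * (gamma_weight g t * (norm \<xi> powr (2 * s) * h t \<xi>))\<bar> \<partial>lborel) \<le> ennreal \<bar>R \<xi>\<bar> * ennreal (2 powr (- ?N / 2) * 4 powr s * Gamma s)"
        using AE_lborel_singleton[of "0 :: real^'n"]
      proof eventually_elim
        case (elim \<xi>)
        have "(\<integral>\<^sup>+t. ennreal \<bar>R \<xi> * (gamma_weight g t * (norm \<xi> powr (2 * s) * h t \<xi>))\<bar> \<partial>lborel)
          = ennreal \<bar>R \<xi>\<bar> * (\<integral>\<^sup>+t. ennreal (gamma_weight g t * (norm \<xi> powr (2 * s) * h t \<xi>)) \<partial>lborel)"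
          by (subst nn_integral_cmult[symmetric]) (auto simp: abs_mult gamma_weight_nonneg h_def ennreal_mult[symmetric])
        also have "\<dots> \<le> ennreal \<bar>R \<xi>\<bar> * (ennreal (2 powr (- ?N / 2) * 4 powr s) * ennreal (Gamma s))"
        proof (rule mult_left_mono)
          have "(\<integral>\<^sup>+t. ennreal (gamma_weight s t * exp (- ((norm \<xi>)\<^sup>2 / (4 * t)))) \<partial>lborel) \<le> (\<integral>\<^sup>+t. ennreal (gamma_weight s t * exp (- (t * 0))) \<partial>lborel)"
          proof (rule nn_integral_mono)
            fix t :: real
            show "ennreal (gamma_weight s t * exp (- ((norm \<xi>)\<^sup>2 / (4 * t)))) \<le> ennreal (gamma_weight s t * exp (- (t * 0)))"
              by (cases "0 < t") (auto intro!: ennreal_leI mult_left_mono gamma_weight_nonneg simp: gamma_weight_def)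
          qed
          also have "\<dots> = ennreal (Gamma s)" using nn_integral_gamma_weight[of s 0] s by simp
          finally show "(\<integral>\<^sup>+t. ennreal (gamma_weight g t * (norm \<xi> powr (2 * s) * h t \<xi>)) \<partial>lborel) \<le> ennreal (2 powr (- ?N / 2) * 4 powr s) * ennreal (Gamma s)"
            unfolding h_def gaussian_fourier_mixture[OF elim] by (intro mult_left_mono) auto
        qed simp
        finally show ?case using s by (simp add: ennreal_mult[symmetric] Gamma_real_nonneg)
      qed
    qed
    also have "\<dots> < \<infinity>"
      using Ri by (simp add: nn_integral_multc integrable_iff_bounded ennreal_mult_less_top)
    finally show "(\<integral>\<^sup>+\<xi>. \<integral>\<^sup>+t. ennreal \<bar>R \<xi> * (gamma_weight g t * (norm \<xi> powr (2 * s) * h t \<xi>))\<bar> \<partial>lborel \<partial>lborel) < \<infinity>" .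
  qed measurable
  also have "\<dots> = (LINT \<xi>|lborel. (2 powr (- ?N / 2) * 4 powr s) * (LINT t|lborel. R \<xi> * (gamma_weight s t * exp (- ((norm \<xi>)\<^sup>2 / (4 * t))))))"
  proof (rule integral_cong_AE)
    show "AE \<xi> in lborel. (LINT t|lborel. R \<xi> * (gamma_weight g t * (norm \<xi> powr (2 * s) * h t \<xi>)))
      = (2 powr (- ?N / 2) * 4 powr s) * (LINT t|lborel. R \<xi> * (gamma_weight s t * exp (- ((norm \<xi>)\<^sup>2 / (4 * t)))))"
      using AE_lborel_singleton[of "0 :: real^'n"]
    proof eventually_elim
      case (elim \<xi>)
      have "(LINT t|lborel. gamma_weight g t * (norm \<xi> powr (2 * s) * h t \<xi>)) = (2 powr (- ?N / 2) * 4 powr s) * (LINT t|lborel. gamma_weight s t * exp (- ((norm \<xi>)\<^sup>2 / (4 * t))))"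
        using gaussian_fourier_mixture[OF elim]
        by (subst (1 2) integral_eq_nn_integral) (auto simp: gamma_weight_nonneg h_def enn2real_mult)
      then show ?case by simp
    qed
  qed measurable
  also have "\<dots> = (2 powr (- ?N / 2) * 4 powr s) * (LINT \<xi>|lborel. LINT t|lborel. R \<xi> * (gamma_weight s t * exp (- ((norm \<xi>)\<^sup>2 / (4 * t)))))" by simp
  also have "(LINT \<xi>|lborel. LINT t|lborel. R \<xi> * (gamma_weight s t * exp (- ((norm \<xi>)\<^sup>2 / (4 * t)))))
    = (LINT t|lborel. LINT \<xi>|lborel. R \<xi> * (gamma_weight s t * exp (- ((norm \<xi>)\<^sup>2 / (4 * t)))))"
  proof (rule lborel_pair.Fubini_nn(2))
    have "(\<integral>\<^sup>+t. \<integral>\<^sup>+\<xi>. ennreal \<bar>R \<xi> * (gamma_weight s t * exp (- ((norm \<xi>)\<^sup>2 / (4 * t))))\<bar> \<partial>lborel \<partial>lborel)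
      \<le> (\<integral>\<^sup>+t. \<integral>\<^sup>+\<xi>. ennreal (gamma_weight s t * exp (- (t * 0))) * ennreal \<bar>R \<xi>\<bar> \<partial>lborel \<partial>lborel)"
    proof (intro nn_integral_mono)
      fix t and \<xi> :: "real^'n"
      have "gamma_weight s t * exp (- ((norm \<xi>)\<^sup>2 / (4 * t))) \<le> gamma_weight s t"
        by (cases "0 < t") (auto intro!: mult_left_le gamma_weight_nonneg simp: gamma_weight_def)
      from mult_left_mono[OF this, of "\<bar>R \<xi>\<bar>"]
      show "ennreal \<bar>R \<xi> * (gamma_weight s t * exp (- ((norm \<xi>)\<^sup>2 / (4 * t))))\<bar> \<le> ennreal (gamma_weight s t * exp (- (t * 0))) * ennreal \<bar>R \<xi>\<bar>"
        by (simp add: abs_mult gamma_weight_nonneg ennreal_mult[symmetric] mult.commute ennreal_leI)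
    qed
    also have "\<dots> = ennreal (Gamma s) * (\<integral>\<^sup>+\<xi>. ennreal \<bar>R \<xi>\<bar> \<partial>lborel)"
      using nn_integral_gamma_weight[of s 0] s by (simp add: nn_integral_cmult nn_integral_multc)
    also have "\<dots> < \<infinity>" using Ri by (simp add: integrable_iff_bounded ennreal_mult_less_top)
    finally show "(\<integral>\<^sup>+t. \<integral>\<^sup>+\<xi>. ennreal \<bar>R \<xi> * (gamma_weight s t * exp (- ((norm \<xi>)\<^sup>2 / (4 * t))))\<bar> \<partial>lborel \<partial>lborel) < \<infinity>" .
  qed measurable
  also have "\<dots> = (LINT t|lborel. 2 powr (?N / 2) * (LINT x|lborel. \<phi> x * (gamma_weight (s + ?N / 2) t * gaussian t x)))"
  proof (intro Bochner_Integration.integral_cong refl)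
    fix t :: real
    show "(LINT \<xi>|lborel. R \<xi> * (gamma_weight s t * exp (- ((norm \<xi>)\<^sup>2 / (4 * t)))))
      = 2 powr (?N / 2) * (LINT x|lborel. \<phi> x * (gamma_weight (s + ?N / 2) t * gaussian t x))"
    proof (cases "0 < t")
      case True
      \<comment> \<open>The Gaussian in \<xi> with this parameter has \<open>gaussian t\<close> as
        its transform, up to the factor \<open>(2 * t) powr (?N / 2)\<close>.\<close>
      define c where "c = 1 / (4 * t)"
      have c: "0 < c" using True by (simp add: c_def)
      let ?E = "\<lambda>\<xi>::real^'n. complex_of_real (exp (- (c * (norm \<xi>)\<^sup>2)))"
      have Ei: "integrable lborel ?E" using integrable_gaussian[OF c, where 'a="real^'n"] by (rule integrable_of_real)
      have FE: "fourier ?E x = of_real ((2 * t) powr (?N / 2) * gaussian t x)" for x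
      proof -
        have "(2 * c) powr (- ?N / 2) = (2 * t) powr (?N / 2)" using True by (simp add: c_def powr_divide powr_minus)
        moreover have "(norm x)\<^sup>2 / (4 * c) = t * (norm x)\<^sup>2" using True by (simp add: c_def)
        ultimately show ?thesis using fourier_gaussian[OF c, of x] by (simp add: gaussian_def)
      qed
      have FEi: "integrable lborel (\<lambda>\<xi>. ?F \<phi> \<xi> * ?E \<xi>)"
        by (rule Bochner_Integration.integrable_bound[OF Fi]) (use c in \<open>auto simp: norm_mult intro!: AE_I2 mult_left_le\<close>)
      have "(LINT \<xi>|lborel. R \<xi> * exp (- (c * (norm \<xi>)\<^sup>2))) = (LINT \<xi>|lborel. Re (?F \<phi> \<xi> * ?E \<xi>))"
        by (simp add: R_def)
      also have "\<dots> = Re (LINT \<xi>|lborel. ?F \<phi> \<xi> * ?E \<xi>)" by (rule integral_Re[OF FEi])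
      also have "(LINT \<xi>|lborel. ?F \<phi> \<xi> * ?E \<xi>) = (LINT x|lborel. of_real (\<phi> x) * fourier ?E x)"
        by (rule fourier_multiplication_formula[OF \<phi>i Ei])
      also have "\<dots> = (LINT x|lborel. of_real (\<phi> x * ((2 * t) powr (?N / 2) * gaussian t x)))"
        unfolding FE by simp
      also have "\<dots> = of_real (LINT x|lborel. \<phi> x * ((2 * t) powr (?N / 2) * gaussian t x))"
      proof (rule integral_of_real)
        have "integrable lborel (\<lambda>x. (2 * t) powr (?N / 2) * (\<phi> x * gaussian t x))"
          by (intro integrable_mult_right, rule Bochner_Integration.integrable_bound[OF test_function_integrable[OF \<phi>]])
             (use True in \<open>auto simp: abs_mult gaussian_def intro!: AE_I2 mult_left_le\<close>)
        then show "integrable lborel (\<lambda>x. \<phi> x * ((2 * t) powr (?N / 2) * gaussian t x))" by (simp add: mult_ac)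
      qed
      finally have *: "(LINT \<xi>|lborel. R \<xi> * exp (- (c * (norm \<xi>)\<^sup>2))) = (LINT x|lborel. \<phi> x * ((2 * t) powr (?N / 2) * gaussian t x))" by simp
      have "(LINT \<xi>|lborel. R \<xi> * (gamma_weight s t * exp (- ((norm \<xi>)\<^sup>2 / (4 * t))))) = (LINT \<xi>|lborel. gamma_weight s t * (R \<xi> * exp (- (c * (norm \<xi>)\<^sup>2))))"
        by (simp add: c_def mult_ac)
      also have "\<dots> = gamma_weight s t * (LINT x|lborel. \<phi> x * ((2 * t) powr (?N / 2) * gaussian t x))"
        using * by simp
      also have "\<dots> = (LINT x|lborel. 2 powr (?N / 2) * (\<phi> x * ((gamma_weight s t * t powr (?N / 2)) * gaussian t x)))"
        using True by (subst integral_mult_right_zero[symmetric]) (simp add: powr_mult mult_ac)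
      finally show ?thesis by (simp add: gamma_weight_powr)
    qed (simp add: gamma_weight_def)
  qed
  also have "\<dots> = 2 powr (?N / 2) * (LINT t|lborel. LINT x|lborel. \<phi> x * (gamma_weight (s + ?N / 2) t * gaussian t x))" by simp
  also have "(LINT t|lborel. LINT x|lborel. \<phi> x * (gamma_weight (s + ?N / 2) t * gaussian t x)) = (LINT x|lborel. LINT t|lborel. \<phi> x * (gamma_weight (s + ?N / 2) t * gaussian t x))"
  proof (rule lborel_pair.Fubini_nn(2))
    have [measurable]: "(\<lambda>(t, x). gaussian t x) \<in> borel_measurable (borel \<Otimes>\<^sub>M (borel :: (real^'n) measure))" unfolding gaussian_def by measurable
    have [measurable]: "(\<lambda>(x, t). gaussian t x) \<in> borel_measurable ((borel :: (real^'n) measure) \<Otimes>\<^sub>M borel)" unfolding gaussian_def by measurable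
    have a: "0 < s + ?N / 2" using s by (simp add: add_pos_nonneg)
    have "(\<integral>\<^sup>+x. \<integral>\<^sup>+t. ennreal \<bar>\<phi> x * (gamma_weight (s + ?N / 2) t * gaussian t x)\<bar> \<partial>lborel \<partial>lborel)
      = (\<integral>\<^sup>+x. ennreal \<bar>\<phi> x\<bar> * ennreal (Gamma (s + ?N / 2) * (1 + (norm x)\<^sup>2) powr (- (s + ?N / 2))) \<partial>lborel)"
    proof (rule nn_integral_cong)
      fix x
      show "(\<integral>\<^sup>+t. ennreal \<bar>\<phi> x * (gamma_weight (s + ?N / 2) t * gaussian t x)\<bar> \<partial>lborel) = ennreal \<bar>\<phi> x\<bar> * ennreal (Gamma (s + ?N / 2) * (1 + (norm x)\<^sup>2) powr (- (s + ?N / 2)))"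
        unfolding nn_integral_gamma_weight[OF a zero_le_power2, symmetric]
        by (subst nn_integral_cmult[symmetric]) (auto simp: abs_mult gamma_weight_nonneg gaussian_def ennreal_mult[symmetric])
    qed
    also have "\<dots> \<le> (\<integral>\<^sup>+x. ennreal \<bar>\<phi> x\<bar> * ennreal (Gamma (s + ?N / 2)) \<partial>lborel)"
    proof (intro nn_integral_mono mult_left_mono ennreal_leI)
      fix x :: "real^'n"
      show "Gamma (s + ?N / 2) * (1 + (norm x)\<^sup>2) powr (- (s + ?N / 2)) \<le> Gamma (s + ?N / 2)"
        using bubble_le_1[of "s + ?N / 2" x] a by (intro mult_left_le) (auto simp: bubble_def Gamma_real_nonneg)
    qed simp
    also have "\<dots> < \<infinity>" using test_function_integrable[OF \<phi>] by (simp add: nn_integral_multc integrable_iff_bounded ennreal_mult_less_top)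
    finally show "(\<integral>\<^sup>+x. \<integral>\<^sup>+t. ennreal \<bar>\<phi> x * (gamma_weight (s + ?N / 2) t * gaussian t x)\<bar> \<partial>lborel \<partial>lborel) < \<infinity>" .
    show "(\<lambda>(x, t). \<phi> x * (gamma_weight (s + ?N / 2) t * gaussian t x)) \<in> borel_measurable (lborel \<Otimes>\<^sub>M lborel)" by measurable
  qed
  also have "\<dots> = (LINT x|lborel. Gamma (s + ?N / 2) * (bubble (s + ?N / 2) x * \<phi> x))"
  proof (intro Bochner_Integration.integral_cong refl)
    fix x
    have a: "0 < s + ?N / 2" using s by (simp add: add_pos_nonneg)
    show "(LINT t|lborel. \<phi> x * (gamma_weight (s + ?N / 2) t * gaussian t x)) = Gamma (s + ?N / 2) * (bubble (s + ?N / 2) x * \<phi> x)"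
      using gamma_weight_integral(2)[OF a, of "(norm x)\<^sup>2"] by (simp add: gaussian_def bubble_def)
  qed
  also have "\<dots> = Gamma (s + ?N / 2) * (LINT x|lborel. bubble (s + ?N / 2) x * \<phi> x)" by simp
  finally have "gagliardo_inner s (bubble g) \<phi> = ?k * ((2 powr (- ?N / 2) * 4 powr s) * (2 powr (?N / 2) * (Gamma (s + ?N / 2) * (LINT x|lborel. bubble (s + ?N / 2) x * \<phi> x)))) / Gamma g" .
  moreover have "2 powr (- ?N / 2) * 2 powr (?N / 2) = (1 :: real)" by (simp flip: powr_add)
  ultimately show ?thesis by (simp add: bubble_const_def mult.assoc[symmetric])
qed

end

text \<open>\<open>soft_shift e t\<close> smoothly approximates \<open>t\<close> and vanishes for \<open>t \<le> e\<close>. Composing it with the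
  decaying positive bubble therefore gives test functions; being a Lipschitz perturbation of the
  identity, it keeps their Gagliardo seminorms dominated by that of the bubble.\<close>

definition exp_cutoff :: "real \<Rightarrow> real poly \<Rightarrow> real \<Rightarrow> real" where
  "exp_cutoff e P t = (if e < t then poly P (1 / (t - e)) * exp (- (e / (t - e))) else 0)"

text \<open>In the variable \<open>y = 1 / (t - e)\<close> differentiation with respect to
  \<open>t\<close> is \<open>- y^2\<close> times differentiation with respect to \<open>y\<close>.
  It therefore preserves the form polynomial times \<open>exp (- e * y)\<close> and acts on the
  polynomial by this formula.\<close>

definition exp_cutoff_step :: "real \<Rightarrow> real poly \<Rightarrow> real poly" where
  "exp_cutoff_step e P = monom 1 2 * (smult e P - pderiv P)"

text \<open>The power \<open>k\<close> is kept general for the induction: peeling off a coefficient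
  of \<open>P\<close> raises it by one.\<close>

lemma poly_mult_exp_tendsto_0:
  fixes P :: "real poly"
  assumes "0 < e"
  shows "((\<lambda>y. y ^ k * poly P y * exp (- (e * y))) \<longlongrightarrow> 0) at_top"
proof (induction P arbitrary: k)
  case (pCons a P)
  have "((\<lambda>y::real. y ^ k * exp (- (e * y))) \<longlongrightarrow> 0) at_top"
    using assms by real_asymp
  from tendsto_add[OF tendsto_mult_left[OF this, of a] pCons.IH[of "Suc k"]]
  show ?case by (simp add: algebra_simps)
qed simp

text \<open>The delicate point is \<open>t = e\<close>: the right difference quotient is a
  polynomial in \<open>y = 1 / h\<close> times \<open>exp (- e * y)\<close>, with \<open>y\<close>
  tending to infinity, and the left one is 0.\<close>

lemma exp_cutoff_has_derivative:
  assumes e: "0 < e"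
  shows "(exp_cutoff e P has_real_derivative exp_cutoff e (exp_cutoff_step e P) t) (at t)"
proof -
  consider "e < t" | "t < e" | "t = e" by linarith
  then show ?thesis
  proof cases
    case 1
    have "((\<lambda>t. poly P (1 / (t - e)) * exp (- (e / (t - e)))) has_real_derivative exp_cutoff e (exp_cutoff_step e P) t) (at t)"
      unfolding exp_cutoff_def exp_cutoff_step_def using 1
      by (auto intro!: derivative_eq_intros poly_DERIV[THEN DERIV_chain2] simp: poly_monom power2_eq_square divide_simps)
         (simp add: algebra_simps)
    then show ?thesis
      by (rule has_field_derivative_transform_within_open[of _ _ _ "{e<..}"]) (use 1 in \<open>auto simp: exp_cutoff_def\<close>)
  next
    case 2
    have "((\<lambda>t. 0) has_real_derivative 0) (at t)" by simp
    then have "(exp_cutoff e P has_real_derivative 0) (at t)"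
      by (rule has_field_derivative_transform_within_open[of _ _ _ "{..<e}"]) (use 2 in \<open>auto simp: exp_cutoff_def\<close>)
    then show ?thesis using 2 by (simp add: exp_cutoff_def)
  next
    case 3
    have "((\<lambda>h. exp_cutoff e P (e + h) / h) \<longlongrightarrow> 0) (at 0)"
    proof (rule filterlim_split_at)
      have "((\<lambda>y. y ^ 1 * poly P y * exp (- (e * y))) \<longlongrightarrow> 0) at_top"
        by (rule poly_mult_exp_tendsto_0[OF e])
      then have "((\<lambda>h. inverse h ^ 1 * poly P (inverse h) * exp (- (e * inverse h))) \<longlongrightarrow> 0) (at_right 0)"
        by (rule filterlim_compose[OF _ filterlim_inverse_at_top_right])
      then show "((\<lambda>h. exp_cutoff e P (e + h) / h) \<longlongrightarrow> 0) (at_right 0)"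
      proof (rule Lim_transform_eventually)
        show "\<forall>\<^sub>F h in at_right 0. inverse h ^ 1 * poly P (inverse h) * exp (- (e * inverse h)) = exp_cutoff e P (e + h) / h"
          using eventually_at_right_less[of "0::real"] by eventually_elim (simp add: exp_cutoff_def field_simps)
      qed
      show "((\<lambda>h. exp_cutoff e P (e + h) / h) \<longlongrightarrow> 0) (at_left 0)"
      proof (rule Lim_transform_eventually[OF tendsto_const])
        show "\<forall>\<^sub>F h in at_left 0. 0 = exp_cutoff e P (e + h) / h"
          by (auto simp: eventually_at_filter exp_cutoff_def)
      qed
    qed
    then show ?thesis unfolding 3 DERIV_def by (simp add: exp_cutoff_def)
  qed
qed

definition soft_shift :: "real \<Rightarrow> real \<Rightarrow> real" where
  "soft_shift e t = (t - e) * exp_cutoff e 1 t"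

text \<open>With \<open>y = e / (t - e)\<close> the derivative is \<open>(1 + y) * exp (- y)\<close>
  for \<open>e < t\<close>, which lies between 0 and 1 because \<open>1 + y \<le> exp y\<close>. The
  factor \<open>t - e\<close> in \<open>soft_shift\<close> is what produces this form.\<close>

lemma soft_shift_derivative:
  assumes e: "0 < e"
  shows "\<exists>d. 0 \<le> d \<and> d \<le> 1 \<and> (soft_shift e has_real_derivative d) (at t)"
proof -
  have D: "(soft_shift e has_real_derivative (exp_cutoff e 1 t + (t - e) * exp_cutoff e (exp_cutoff_step e 1) t)) (at t)"
    unfolding soft_shift_def[abs_def]
    by (rule derivative_eq_intros exp_cutoff_has_derivative[OF e] refl | simp)+
  have "0 \<le> exp_cutoff e 1 t + (t - e) * exp_cutoff e (exp_cutoff_step e 1) t \<and> exp_cutoff e 1 t + (t - e) * exp_cutoff e (exp_cutoff_step e 1) t \<le> 1"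
  proof (cases "e < t")
    case True
    define y where "y = e / (t - e)"
    have y: "0 < y" using True e by (simp add: y_def)
    have "poly (exp_cutoff_step e 1) (1 / r) = e / r / r" for r
      by (simp add: exp_cutoff_step_def poly_monom pderiv_1 power2_eq_square)
    then have "exp_cutoff e 1 t + (t - e) * exp_cutoff e (exp_cutoff_step e 1) t = (1 + y) * exp (- y)"
      using True by (simp add: exp_cutoff_def y_def distrib_right)
    moreover have "(1 + y) * exp (- y) \<le> exp y * exp (- y)" using exp_ge_add_one_self by (intro mult_right_mono) auto
    ultimately show ?thesis using y by (simp flip: exp_add)
  qed (simp add: exp_cutoff_def)
  with D show ?thesis by blast
qed

text \<open>\<open>soft_shift e\<close> minus the identity has a derivative between -1 and 0. Used
  to dominate the difference quotients of an approximation error by those of the approximated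
  function.\<close>

lemma soft_shift_lipschitz:
  assumes e: "0 < e"
  shows "\<bar>(soft_shift e a - a) - (soft_shift e b - b)\<bar> \<le> \<bar>a - b\<bar>"
proof -
  have *: "\<bar>(soft_shift e b - b) - (soft_shift e a - a)\<bar> \<le> b - a" if ab: "a < b" for a b
  proof -
    obtain d where d: "\<And>t. 0 \<le> d t" "\<And>t. d t \<le> 1" "\<And>t. (soft_shift e has_real_derivative d t) (at t)"
      using soft_shift_derivative[OF e] by metis
    have "((\<lambda>t. soft_shift e t - t) has_real_derivative d t - 1) (at t)" for t
      by (auto intro!: derivative_eq_intros d)
    then obtain z where "(soft_shift e b - b) - (soft_shift e a - a) = (b - a) * (d z - 1)"
      using MVT2[OF ab, of "\<lambda>t. soft_shift e t - t" "\<lambda>t. d t - 1"] by blast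
    moreover have "\<bar>d z - 1\<bar> \<le> 1" using d(1,2)[of z] by linarith
    ultimately show ?thesis using ab by (simp add: abs_mult mult_left_le)
  qed
  show ?thesis using *[of a b] *[of b a] by (cases a b rule: linorder_cases) (auto simp: abs_minus_commute)
qed

lemma soft_shift_bounds:
  assumes "0 < e" "0 \<le> t"
  shows "0 \<le> soft_shift e t" "soft_shift e t \<le> t"
proof -
  show "0 \<le> soft_shift e t" by (simp add: soft_shift_def exp_cutoff_def)
  show "soft_shift e t \<le> t"
  proof (cases "e < t")
    case True
    then have "(t - e) * exp (- (e / (t - e))) \<le> (t - e) * 1" using assms by (intro mult_left_mono) auto
    also have "\<dots> \<le> t" using assms by simp
    finally show ?thesis using True assms by (simp add: soft_shift_def exp_cutoff_def)
  qed (use assms in \<open>simp add: soft_shift_def exp_cutoff_def\<close>)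
qed

lemma soft_shift_tendsto:
  assumes e: "\<And>n. 0 < e n" "e \<longlonglongrightarrow> 0" and t: "0 < t"
  shows "(\<lambda>n. soft_shift (e n) t) \<longlonglongrightarrow> t"
proof -
  have "(\<lambda>n. (t - e n) * exp (- (e n / (t - e n)))) \<longlonglongrightarrow> (t - 0) * exp (- (0 / (t - 0)))"
    using t by (intro tendsto_intros e) auto
  then have "(\<lambda>n. (t - e n) * exp (- (e n / (t - e n)))) \<longlonglongrightarrow> t" by simp
  then show ?thesis
  proof (rule Lim_transform_eventually)
    show "\<forall>\<^sub>F n in sequentially. (t - e n) * exp (- (e n / (t - e n))) = soft_shift (e n) t"
      using order_tendstoD(2)[OF e(2) t] by eventually_elim (simp add: soft_shift_def exp_cutoff_def)
  qed
qed

text \<open>The bubble is a power of \<open>1 + t\<close> at the squared norm. This power is smooth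
  on \<open>{-1<..}\<close>, which contains all values of the squared norm, and \<open>d j\<close>
  is its \<open>j\<close>-th derivative.\<close>

lemma C_k_bubble: "C_k m (bubble a :: real^'n \<Rightarrow> real)"
proof -
  define d where "d j t = (\<Prod>i<j. - a - real i) * (1 + t) powr (- a - real j)" for j t
  have "C_k m (\<lambda>x::real^'n. d 0 ((norm x)\<^sup>2))"
  proof (rule C_k_compose[where X="{-1<..}" and d=d])
    fix j and t :: real assume "t \<in> {-1<..}"
    then have "0 < 1 + t" by simp
    then have "((\<lambda>t. (1 + t) powr (- a - real j)) has_real_derivative (- a - real j) * (1 + t) powr (- a - real j - 1)) (at t)"
      by (auto intro!: derivative_eq_intros)
    then have "(d j has_real_derivative (\<Prod>i<j. - a - real i) * ((- a - real j) * (1 + t) powr (- a - real j - 1))) (at t)"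
      unfolding d_def[abs_def] by (rule DERIV_cmult)
    moreover have "- a - real j - 1 = - a - real (Suc j)" by simp
    ultimately show "(d j has_real_derivative d (Suc j) t) (at t)" by (simp only: d_def prod.lessThan_Suc mult.assoc)
  next
    show "(norm x)\<^sup>2 \<in> {-1<..}" for x :: "real^'n" by (simp add: less_le_trans[OF _ zero_le_power2])
  qed (rule C_k_norm_square)
  then show ?thesis by (simp add: d_def bubble_def[abs_def])
qed

lemma soft_shift_bubble_test:
  assumes e: "0 < e" and a: "0 < a"
  shows "(\<lambda>x::real^'n. soft_shift e (bubble a x)) \<in> test_functions UNIV"
proof (rule test_functionI)
  define d where "d j = exp_cutoff e ((exp_cutoff_step e ^^ j) 1)" for j
  have "C_k m (\<lambda>x::real^'n. d 0 (bubble a x))" for m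
    by (rule C_k_compose[where X=UNIV, OF _ _ C_k_bubble]) (simp_all add: d_def exp_cutoff_has_derivative[OF e])
  then have "C_k m (\<lambda>x::real^'n. (1 * bubble a x + (- e) * 1) * d 0 (bubble a x))" for m
    by (intro C_k_mult C_k_linear_combination C_k_bubble C_k_const)
  then show "C_k m (\<lambda>x::real^'n. soft_shift e (bubble a x))" for m by (simp add: soft_shift_def d_def)
  \<comment> \<open>Beyond this radius the bubble is at most \<open>e\<close>, where the shifted
    function is 0.\<close>
  fix x :: "real^'n" assume "e powr (- 1 / (2 * a)) < norm x"
  then have "(e powr (- 1 / (2 * a))) powr 2 < norm x powr 2" by (intro powr_less_mono2) auto
  moreover have "norm x powr 2 = (norm x)\<^sup>2" using \<open>_ < norm x\<close> by (simp add: powr_numeral less_le_trans[OF _ less_imp_le])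
  ultimately have "e powr (- 1 / a) < 1 + (norm x)\<^sup>2" using a by (simp add: powr_powr)
  then have "(1 + (norm x)\<^sup>2) powr (- a) \<le> (e powr (- 1 / a)) powr (- a)" using a e by (intro powr_mono2') auto
  also have "\<dots> = e" using a e by (simp add: powr_powr)
  finally show "soft_shift e (bubble a x) = 0" by (simp add: soft_shift_def exp_cutoff_def bubble_def)
qed

section \<open>The bubble as an element of the energy space, and its Gagliardo form there\<close>

context
  fixes s :: real and dim :: "'n::finite itself" and g :: real
  assumes s: "0 < s" "s < 1" and dim: "2 * s < CARD('n)"
  defines "g \<equiv> (real CARD('n) - 2 * s) / 2"
begin

private lemma g_pos'': "0 < g" using dim by (simp add: g_def)

lemma bubble_Lp: "bubble g x powr (two_star (real CARD('n)) s) = bubble (real CARD('n)) x"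
proof -
  have "g * two_star (real CARD('n)) s = real CARD('n)" using dim by (simp add: g_def two_star_def field_simps)
  then show ?thesis by (simp add: bubble_powr)
qed

lemma integrable_bubble:
  assumes "real CARD('n) / 2 < a"
  shows "integrable lborel (bubble a :: real^'n \<Rightarrow> real)"
  using nn_integral_japanese_bracket_finite[where 'a="real^'n", of a] assms
  by (intro integrableI_nonneg) (auto simp: bubble_def)

text \<open>Dominated convergence in both senses that \<open>D_limit\<close> requires: the quotient
  of the error is dominated by that of the bubble because the shift minus the identity is
  1-Lipschitz, and the error itself by the bubble because the shift stays between 0 and its
  argument.\<close>

theorem bubble_D_space: "(bubble g :: real^'n \<Rightarrow> real) \<in> D_space s"
proof -
  let ?U = "bubble g :: real^'n \<Rightarrow> real" and ?p = "two_star (real CARD('n)) s"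
  let ?M = "lborel \<Otimes>\<^sub>M lborel :: ((real^'n) \<times> (real^'n)) measure"
  define e where "e n = 1 / real (Suc n)" for n
  have e: "e \<longlonglongrightarrow> 0" "\<And>n. 0 < e n"
    unfolding e_def by (rule LIMSEQ_Suc[OF lim_1_over_n, unfolded of_nat_Suc[symmetric]]) simp
  define \<phi> where "\<phi> n x = soft_shift (e n) (?U x)" for n x
  have t: "\<phi> n \<in> test_functions UNIV" for n unfolding \<phi>_def by (rule soft_shift_bubble_test[OF e(2) g_pos''])
  note [measurable] = test_function_measurable[OF t]
  have lim: "(\<lambda>n. \<phi> n x) \<longlonglongrightarrow> ?U x" for x
    unfolding \<phi>_def by (rule soft_shift_tendsto[OF e(2,1) bubble_pos])
  have "D_limit s \<phi> ?U"
  proof (rule D_limitI[OF s dim t])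
    have "(\<lambda>n. \<integral>\<^sup>+z. ennreal ((gagliardo_quotient s (\<lambda>x. \<phi> n x - ?U x) z)\<^sup>2) \<partial>?M) \<longlonglongrightarrow> (\<integral>\<^sup>+z. 0 \<partial>?M)"
    proof (rule nn_integral_dominated_convergence[where w="\<lambda>z. ennreal ((gagliardo_quotient s ?U z)\<^sup>2)"])
      show "AE z in ?M. ennreal ((gagliardo_quotient s (\<lambda>x. \<phi> n x - ?U x) z)\<^sup>2) \<le> ennreal ((gagliardo_quotient s ?U z)\<^sup>2)" for n
      proof (intro AE_I2 ennreal_leI)
        fix z
        have "\<bar>gagliardo_quotient s (\<lambda>x. \<phi> n x - ?U x) z\<bar> \<le> \<bar>gagliardo_quotient s ?U z\<bar>"
          unfolding gagliardo_quotient_def abs_mult \<phi>_def by (intro mult_right_mono soft_shift_lipschitz e) auto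
        then show "(gagliardo_quotient s (\<lambda>x. \<phi> n x - ?U x) z)\<^sup>2 \<le> (gagliardo_quotient s ?U z)\<^sup>2"
          by (simp add: abs_le_square_iff)
      qed
      show "(\<integral>\<^sup>+z. ennreal ((gagliardo_quotient s ?U z)\<^sup>2) \<partial>?M) < \<infinity>"
        using gagliardo_bubble_finite[OF s dim] by (simp add: gagliardo_eq_quotient g_def)
      show "AE z in ?M. (\<lambda>n. ennreal ((gagliardo_quotient s (\<lambda>x. \<phi> n x - ?U x) z)\<^sup>2)) \<longlonglongrightarrow> 0"
      proof (rule AE_I2)
        fix z
        have "(\<lambda>n. (((\<phi> n (fst z) - ?U (fst z)) - (\<phi> n (snd z) - ?U (snd z))) * norm (fst z - snd z) powr (- (real DIM(real^'n) + 2 * s) / 2))\<^sup>2)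
          \<longlonglongrightarrow> (((?U (fst z) - ?U (fst z)) - (?U (snd z) - ?U (snd z))) * norm (fst z - snd z) powr (- (real DIM(real^'n) + 2 * s) / 2))\<^sup>2"
          by (rule tendsto_power[OF tendsto_mult[OF tendsto_diff[OF tendsto_diff[OF lim tendsto_const] tendsto_diff[OF lim tendsto_const]] tendsto_const]])
        then have "(\<lambda>n. (gagliardo_quotient s (\<lambda>x. \<phi> n x - ?U x) z)\<^sup>2) \<longlonglongrightarrow> 0"
          by (simp add: gagliardo_quotient_def)
        then show "(\<lambda>n. ennreal ((gagliardo_quotient s (\<lambda>x. \<phi> n x - ?U x) z)\<^sup>2)) \<longlonglongrightarrow> 0"
          using tendsto_ennrealI by fastforce
      qed
    qed measurable
    then show "(\<lambda>n. gagliardo s (\<lambda>x. \<phi> n x - ?U x)) \<longlonglongrightarrow> 0"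
      by (simp add: gagliardo_eq_quotient)
    have p: "0 < ?p" by (rule two_star_pos[OF s dim])
    have "(\<lambda>n. \<integral>\<^sup>+x. ennreal (\<bar>\<phi> n x - ?U x\<bar> powr ?p) \<partial>lborel) \<longlonglongrightarrow> (\<integral>\<^sup>+(x::real^'n). 0 \<partial>lborel)"
    proof (rule nn_integral_dominated_convergence[where w="\<lambda>x. ennreal (?U x powr ?p)"])
      show "AE x in lborel. ennreal (\<bar>\<phi> n x - ?U x\<bar> powr ?p) \<le> ennreal (?U x powr ?p)" for n
      proof (intro AE_I2 ennreal_leI powr_mono2)
        fix x
        show "\<bar>\<phi> n x - ?U x\<bar> \<le> ?U x"
          using soft_shift_bounds[OF e(2), of "?U x" n] bubble_pos[of g x] unfolding \<phi>_def by linarith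
      qed (use p in auto)
      show "(\<integral>\<^sup>+x. ennreal (?U x powr ?p) \<partial>lborel) < \<infinity>"
        unfolding bubble_Lp using integrable_bubble[of "real CARD('n)"] by (simp add: integrable_iff_bounded less_imp_le[OF bubble_pos])
      show "AE x in lborel. (\<lambda>n. ennreal (\<bar>\<phi> n x - ?U x\<bar> powr ?p)) \<longlonglongrightarrow> 0"
      proof (rule AE_I2)
        fix x
        have "(\<lambda>n. \<bar>\<phi> n x - ?U x\<bar> powr ?p) \<longlonglongrightarrow> \<bar>?U x - ?U x\<bar> powr ?p"
          using p by (intro tendsto_powr' tendsto_intros lim) auto
        then have "(\<lambda>n. \<bar>\<phi> n x - ?U x\<bar> powr ?p) \<longlonglongrightarrow> 0" using p by simp
        then show "(\<lambda>n. ennreal (\<bar>\<phi> n x - ?U x\<bar> powr ?p)) \<longlonglongrightarrow> 0"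
          using tendsto_ennrealI by fastforce
      qed
    qed measurable
    then show "(\<lambda>n. \<integral>\<^sup>+x. ennreal (\<bar>\<phi> n x - ?U x\<bar> powr ?p) \<partial>lborel) \<longlonglongrightarrow> 0" by simp
  qed measurable
  then show ?thesis by (auto simp: D_space_def)
qed

text \<open>Young's inequality with a free parameter \<open>c\<close> stands in for Hoelder's: a
  small \<open>c\<close> makes the second term small independently of \<open>h\<close>, and a small
  \<open>P\<close> then controls the first. The exponent conjugate to the critical one raises this
  bubble to the integrable \<open>bubble (real CARD('n))\<close>.\<close>

lemma integrable_bubble_mult:
  fixes h :: "real^'n \<Rightarrow> real"
  assumes [measurable]: "h \<in> borel_measurable borel"
    and h: "(\<integral>\<^sup>+x. ennreal (\<bar>h x\<bar> powr two_star (real CARD('n)) s) \<partial>lborel) \<le> ennreal P" and c: "0 < c" and P: "0 \<le> P"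
  shows "integrable lborel (\<lambda>x. bubble (s + real CARD('n) / 2) x * h x)"
    and "\<bar>LINT x|lborel. bubble (s + real CARD('n) / 2) x * h x\<bar>
      \<le> (1 / c) powr two_star (real CARD('n)) s * P
        + c powr (2 * real CARD('n) / (real CARD('n) + 2 * s)) * (LINT x|lborel. bubble (real CARD('n)) (x::real^'n))"
proof -
  let ?p = "two_star (real CARD('n)) s" and ?q = "2 * real CARD('n) / (real CARD('n) + 2 * s)" and ?f = "bubble (s + real CARD('n) / 2) :: real^'n \<Rightarrow> real"
  have "?p - 1 = (real CARD('n) + 2 * s) / (real CARD('n) - 2 * s)" using dim by (simp add: two_star_def field_simps)
  then have p: "1 < ?p" "?p / (?p - 1) = ?q"
    using dim s by (simp add: two_star_def field_simps, simp add: two_star_def)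
  have fq: "?f x powr ?q = bubble (real CARD('n)) x" for x
  proof -
    have "(s + real CARD('n) / 2) * ?q = real CARD('n)" using s by (simp add: add_pos_pos divide_simps)
    then show ?thesis by (simp only: bubble_powr)
  qed
  have pt: "\<bar>?f x * h x\<bar> \<le> (1 / c) powr ?p * \<bar>h x\<bar> powr ?p + c powr ?q * bubble (real CARD('n)) x" for x
  proof -
    have "\<bar>?f x * h x\<bar> = (\<bar>h x\<bar> / c) * (c * ?f x)" using c bubble_pos[of "s + real CARD('n) / 2" x] by (simp add: abs_mult)
    also have "\<dots> \<le> (\<bar>h x\<bar> / c) powr ?p + (c * ?f x) powr (?p / (?p - 1))"
      using c p bubble_pos[of "s + real CARD('n) / 2" x] by (intro mult_le_powr_add_powr) auto
    also have "\<dots> = (1 / c) powr ?p * \<bar>h x\<bar> powr ?p + c powr ?q * bubble (real CARD('n)) x"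
      unfolding p(2) fq[symmetric] by (simp add: powr_mult powr_divide)
    finally show ?thesis .
  qed
  have hi: "integrable lborel (\<lambda>x. \<bar>h x\<bar> powr ?p)"
    using h by (intro integrableI_nonneg) (auto intro: order_le_less_trans)
  have bi: "integrable lborel (bubble (real CARD('n)) :: real^'n \<Rightarrow> real)" by (rule integrable_bubble) simp
  have ri: "integrable lborel (\<lambda>x. (1 / c) powr ?p * \<bar>h x\<bar> powr ?p + c powr ?q * bubble (real CARD('n)) x)"
    using hi bi by simp
  show i: "integrable lborel (\<lambda>x. ?f x * h x)"
    by (rule Bochner_Integration.integrable_bound[OF ri]) (auto intro!: AE_I2 order_trans[OF pt abs_ge_self])
  have "\<bar>LINT x|lborel. ?f x * h x\<bar> \<le> (LINT x|lborel. \<bar>?f x * h x\<bar>)" by (rule integral_abs_bound)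
  also have "\<dots> \<le> (LINT x|lborel. (1 / c) powr ?p * \<bar>h x\<bar> powr ?p + c powr ?q * bubble (real CARD('n)) x)"
    by (rule integral_mono[OF integrable_abs[OF i] ri pt])
  also have "\<dots> = (1 / c) powr ?p * (LINT x|lborel. \<bar>h x\<bar> powr ?p) + c powr ?q * (LINT x|lborel. bubble (real CARD('n)) (x::real^'n))"
    using hi bi by simp
  also have "(LINT x|lborel. \<bar>h x\<bar> powr ?p) \<le> P"
    using h P by (subst integral_eq_nn_integral) (auto simp: enn2real_leI)
  finally show "\<bar>LINT x|lborel. ?f x * h x\<bar> \<le> (1 / c) powr ?p * P + c powr ?q * (LINT x|lborel. bubble (real CARD('n)) (x::real^'n))"
    by (simp add: mult_left_mono)
qed

private lemma gagliardo_zero: "gagliardo s (\<lambda>x. 0) = 0"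
  by (simp add: gagliardo_def)

text \<open>The formula is known for test functions, and both sides are continuous along an
  approximating sequence of \<open>h\<close>.\<close>

theorem gagliardo_inner_bubble:
  fixes h :: "real^'n \<Rightarrow> real"
  assumes h: "h \<in> D_space s"
  shows "gagliardo_inner s (bubble g) h = gagliardo_const CARD('n) s * bubble_const TYPE('n) s * (LINT x|lborel. bubble (s + real CARD('n) / 2) x * h x)"
proof -
  let ?p = "two_star (real CARD('n)) s" and ?f = "bubble (s + real CARD('n) / 2) :: real^'n \<Rightarrow> real" and ?q = "2 * real CARD('n) / (real CARD('n) + 2 * s)"
  note [measurable] = D_space_measurable[OF s dim h]
  obtain \<phi> where D: "D_limit s \<phi> h" using h by (auto simp: D_space_def)
  note t = D_limit_test[OF s dim D]
  note [measurable] = test_function_measurable[OF t]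
  have q: "0 < ?q" using s by (simp add: add_pos_pos)
  have hf: "(\<integral>\<^sup>+x. ennreal (\<bar>h x\<bar> powr ?p) \<partial>lborel) < \<infinity>" by (rule D_space_Lp_finite[OF s dim h])
  have \<phi>f: "(\<integral>\<^sup>+x. ennreal (\<bar>\<phi> n x\<bar> powr ?p) \<partial>lborel) < \<infinity>" for n by (rule test_function_Lp_finite[OF s dim t])
  have int: "integrable lborel (\<lambda>x. ?f x * v x)" if [measurable]: "v \<in> borel_measurable borel" and v: "(\<integral>\<^sup>+x. ennreal (\<bar>v x\<bar> powr ?p) \<partial>lborel) < \<infinity>" for v :: "real^'n \<Rightarrow> real"
    using integrable_bubble_mult(1)[of v "enn2real (\<integral>\<^sup>+x. ennreal (\<bar>v x\<bar> powr ?p) \<partial>lborel)" 1] v by simp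
  define J where "J = (LINT x|lborel. bubble (real CARD('n)) (x::real^'n))"
  have J: "0 \<le> J" unfolding J_def by (intro integral_nonneg_AE AE_I2) (simp add: less_imp_le[OF bubble_pos])
  have "(\<lambda>n. (LINT x|lborel. ?f x * \<phi> n x) - (LINT x|lborel. ?f x * h x)) \<longlonglongrightarrow> 0"
  proof (rule LIMSEQ_I)
    fix r :: real assume r: "0 < r"
    \<comment> \<open>Makes the part of the bound that does not involve the approximation at most
      \<open>r / 3\<close>, hence below \<open>r / 2\<close>; \<open>J + 1\<close> keeps the
      quotient defined when \<open>J\<close> is 0.\<close>
    define c where "c = (r / (3 * (J + 1))) powr (1 / ?q)"
    have c: "0 < c" "c powr ?q * J < r / 2"
    proof -
      show "0 < c" using r J by (simp add: c_def)
      have "(X powr (1 / q)) powr q = X" if "0 < q" "0 < X" for X q :: real using that by (simp add: powr_powr)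
      from this[OF q, of "r / (3 * (J + 1))"] have "c powr ?q = r / (3 * (J + 1))" unfolding c_def using r J by simp
      then have "c powr ?q * J = r / 3 * (J / (J + 1))" by simp
      also have "\<dots> \<le> r / 3 * 1" using r J by (intro mult_left_mono) (auto simp: field_simps)
      also have "\<dots> < r / 2" using r by simp
      finally show "c powr ?q * J < r / 2" .
    qed
    \<comment> \<open>With \<open>c\<close> fixed, \<open>P\<close> is the accuracy in the critical
      Lebesgue space for which the remaining term is exactly \<open>r / 2\<close>.\<close>
    define P where "P = r / 2 / (1 / c) powr ?p"
    have P: "0 < P" "(1 / c) powr ?p * P = r / 2" using r c by (auto simp: P_def)
    obtain M where M: "\<And>n. M \<le> n \<Longrightarrow> (\<integral>\<^sup>+x. ennreal (\<bar>\<phi> n x - h x\<bar> powr ?p) \<partial>lborel) < ennreal P"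
      using order_tendstoD(2)[OF D_limit_Lp[OF s dim D], of "ennreal P"] P by (auto simp: eventually_sequentially)
    have "norm ((LINT x|lborel. ?f x * \<phi> n x) - (LINT x|lborel. ?f x * h x) - 0) < r" if "M \<le> n" for n
    proof -
      have "(LINT x|lborel. ?f x * \<phi> n x) - (LINT x|lborel. ?f x * h x) = (LINT x|lborel. ?f x * (\<phi> n x - h x))"
        unfolding right_diff_distrib by (intro Bochner_Integration.integral_diff[symmetric] int hf \<phi>f) measurable
      moreover have "\<bar>LINT x|lborel. ?f x * (\<phi> n x - h x)\<bar> \<le> (1 / c) powr ?p * P + c powr ?q * J"
        unfolding J_def using M[OF that] c P by (intro integrable_bubble_mult(2)) auto
      ultimately show ?thesis using P c by simp
    qed
    then show "\<exists>M. \<forall>n\<ge>M. norm ((LINT x|lborel. ?f x * \<phi> n x) - (LINT x|lborel. ?f x * h x) - 0) < r" by blast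
  qed
  then have "(\<lambda>n. LINT x|lborel. ?f x * \<phi> n x) \<longlonglongrightarrow> (LINT x|lborel. ?f x * h x)" by (rule LIM_zero_cancel)
  then have "(\<lambda>n. gagliardo_const CARD('n) s * bubble_const TYPE('n) s * (LINT x|lborel. ?f x * \<phi> n x)) \<longlonglongrightarrow> gagliardo_const CARD('n) s * bubble_const TYPE('n) s * (LINT x|lborel. ?f x * h x)"
    by (rule tendsto_mult_left)
  moreover have lim2: "(\<lambda>n. gagliardo_inner s (bubble g) (\<phi> n)) \<longlonglongrightarrow> gagliardo_inner s (bubble g) h"
    by (rule gagliardo_inner_tendsto[OF s dim])
       (use gagliardo_bubble_finite[OF s dim] test_function_gagliardo_finite[OF s dim t] D_space_gagliardo_finite[OF s dim h]
          D_limit_gagliardo[OF s dim D] in \<open>auto simp: g_def gagliardo_zero\<close>)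
  moreover have "gagliardo_inner s (bubble g) (\<phi> n) = gagliardo_const CARD('n) s * bubble_const TYPE('n) s * (LINT x|lborel. ?f x * \<phi> n x)" for n
    using gagliardo_inner_bubble_test[OF s dim t, of n] by (simp add: g_def)
  ultimately show ?thesis by (simp only: LIMSEQ_unique)
qed

end

section \<open>The Riesz potential of the bubble\<close>

text \<open>With \<open>1 / r = 1 / t + 1 / u\<close> the product of two Gaussians integrates to a Gaussian of parameter \<open>r\<close>;
  for fixed \<open>t\<close> the variable \<open>u\<close> is traded for \<open>r\<close>, after which the \<open>t\<close>-integral is a shifted Gamma integral.\<close>

lemma nn_integral_gaussian_convolution:
  fixes x :: "'a::euclidean_space"
  assumes "0 < t" "0 < u"
  shows "(\<integral>\<^sup>+y. ennreal (exp (- (t * (norm y)\<^sup>2)) * exp (- (u * (norm (x - y))\<^sup>2))) \<partial>lborel)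
    = ennreal ((pi / (t + u)) powr (DIM('a) / 2) * exp (- (t * u / (t + u) * (norm x)\<^sup>2)))"
proof -
  \<comment> \<open>The combined quadratic exponent is smallest at \<open>c *\<^sub>R x\<close>;
    shifting the variable there completes the square.\<close>
  define c where "c = u / (t + u)"
  have tu: "0 < t + u" using assms by simp
  have sq: "t * (norm (c *\<^sub>R x + y))\<^sup>2 + u * (norm (x - (c *\<^sub>R x + y)))\<^sup>2 = (t + u) * (norm y)\<^sup>2 + t * u / (t + u) * (norm x)\<^sup>2" for y
  proof -
    have c: "c * (t + u) = u" using tu by (simp add: c_def)
    have "t * (norm (c *\<^sub>R x + y))\<^sup>2 + u * (norm (x - (c *\<^sub>R x + y)))\<^sup>2
      = (t + u) * (norm y)\<^sup>2 + (t * c\<^sup>2 + u * (1 - c)\<^sup>2) * (norm x)\<^sup>2 + 2 * (c * (t + u) - u) * (x \<bullet> y)"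
      unfolding power2_norm_eq_inner by (simp add: inner_add_left inner_add_right inner_diff_left inner_diff_right inner_commute power2_eq_square algebra_simps)
    also have "t * c\<^sup>2 + u * (1 - c)\<^sup>2 = t * u / (t + u)"
    proof -
      have "1 - c = t / (t + u)" using tu by (simp add: c_def field_simps)
      then have "t * c\<^sup>2 + u * (1 - c)\<^sup>2 = (t * u) * (t + u) / (t + u)\<^sup>2" using tu by (simp add: c_def power_divide add_divide_distrib[symmetric]) (simp add: power2_eq_square algebra_simps)
      then show ?thesis using tu by (simp add: power2_eq_square)
    qed
    finally show ?thesis using c by simp
  qed
  have "(\<integral>\<^sup>+y. ennreal (exp (- (t * (norm y)\<^sup>2)) * exp (- (u * (norm (x - y))\<^sup>2))) \<partial>lborel)
    = (\<integral>\<^sup>+y. ennreal (exp (- (t * (norm (c *\<^sub>R x + y))\<^sup>2)) * exp (- (u * (norm (x - (c *\<^sub>R x + y)))\<^sup>2))) \<partial>lborel)"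
    by (rule nn_integral_lborel_shift[symmetric]) measurable
  also have "\<dots> = (\<integral>\<^sup>+y. ennreal (exp (- (t * u / (t + u) * (norm x)\<^sup>2))) * ennreal (exp (- ((t + u) * (norm (y::'a))\<^sup>2))) \<partial>lborel)"
  proof (rule nn_integral_cong)
    fix y
    have "exp (- (t * (norm (c *\<^sub>R x + y))\<^sup>2)) * exp (- (u * (norm (x - (c *\<^sub>R x + y)))\<^sup>2)) = exp (- (t * u / (t + u) * (norm x)\<^sup>2)) * exp (- ((t + u) * (norm y)\<^sup>2))"
      unfolding exp_add[symmetric] using sq[of y] by (intro arg_cong[where f=exp]) linarith
    then show "ennreal (exp (- (t * (norm (c *\<^sub>R x + y))\<^sup>2)) * exp (- (u * (norm (x - (c *\<^sub>R x + y)))\<^sup>2)))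
      = ennreal (exp (- (t * u / (t + u) * (norm x)\<^sup>2))) * ennreal (exp (- ((t + u) * (norm y)\<^sup>2)))"
      by (simp add: ennreal_mult[symmetric])
  qed
  also have "\<dots> = ennreal (exp (- (t * u / (t + u) * (norm x)\<^sup>2))) * ennreal ((pi / (t + u)) powr (DIM('a) / 2))"
    by (subst nn_integral_cmult, measurable) (simp only: nn_integral_gaussian[OF tu])
  finally show ?thesis by (simp add: ennreal_mult[symmetric] mult.commute)
qed

text \<open>The substitution \<open>1 / r = 1 / t + 1 / u\<close> is a reciprocal, a shift by
  \<open>1 / t\<close> and a second reciprocal. The factor \<open>(t / (t + u))\<^sup>2\<close> is
  its Jacobian, and \<open>r\<close> runs through the values below \<open>t\<close>.\<close>

lemma nn_integral_parallel_sum: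
  fixes f :: "real \<Rightarrow> real"
  assumes t: "0 < t" and [measurable]: "f \<in> borel_measurable borel" and nn: "\<And>r. 0 \<le> f r"
  shows "(\<integral>\<^sup>+u\<in>{0<..}. ennreal (f (t * u / (t + u)) * (t / (t + u))\<^sup>2) \<partial>lborel) = (\<integral>\<^sup>+r. ennreal (f r) * indicator {0<..<t} r \<partial>lborel)"
proof -
  have "(\<integral>\<^sup>+u\<in>{0<..}. ennreal (f (t * u / (t + u)) * (t / (t + u))\<^sup>2) \<partial>lborel)
    = (\<integral>\<^sup>+u\<in>{0<..}. ennreal ((f (t * (1 / u) / (t + 1 / u)) * (t / (t + 1 / u))\<^sup>2) / u\<^sup>2) \<partial>lborel)"
    by (rule nn_integral_reciprocal[where f="\<lambda>u. f (t * u / (t + u)) * (t / (t + u))\<^sup>2"]) measurable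
  also have "\<dots> = (\<integral>\<^sup>+u. ennreal (f (1 / (1 / t + u)) / (1 / t + u)\<^sup>2) * indicator {1 / t<..} (1 / t + u) \<partial>lborel)"
  proof (rule nn_integral_cong)
    fix u :: real
    show "ennreal ((f (t * (1 / u) / (t + 1 / u)) * (t / (t + 1 / u))\<^sup>2) / u\<^sup>2) * indicator {0<..} u
      = ennreal (f (1 / (1 / t + u)) / (1 / t + u)\<^sup>2) * indicator {1 / t<..} (1 / t + u)"
    proof (cases "0 < u")
      case True
      have a: "0 < 1 / t + u" using t True by (simp add: add_pos_pos)
      have b: "t + 1 / u = (t / u) * (1 / t + u)" using t True by (simp add: field_simps)
      have "t * (1 / u) / (t + 1 / u) = 1 / (1 / t + u)" unfolding b using t True a by (simp add: divide_divide_eq_left')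
      moreover have "(t / (t + 1 / u))\<^sup>2 / u\<^sup>2 = 1 / (1 / t + u)\<^sup>2"
      proof -
        have "t / (t + 1 / u) / u = 1 / (1 / t + u)" unfolding b using t True by simp
        then have "(t / (t + 1 / u) / u)\<^sup>2 = (1 / (1 / t + u))\<^sup>2" by simp
        then show ?thesis by (simp only: power_divide power_one)
      qed
      ultimately have "(f (t * (1 / u) / (t + 1 / u)) * (t / (t + 1 / u))\<^sup>2) / u\<^sup>2 = f (1 / (1 / t + u)) / (1 / t + u)\<^sup>2"
        by (simp only: times_divide_eq_right[symmetric]) simp
      then show ?thesis using True by simp
    qed simp
  qed
  also have "\<dots> = (\<integral>\<^sup>+v. ennreal (f (1 / v) / v\<^sup>2) * indicator {1 / t<..} v \<partial>lborel)"
    by (rule nn_integral_lborel_shift[where a="1 / t" and f="\<lambda>v. ennreal (f (1 / v) / v\<^sup>2) * indicator {1 / t<..} v"]) measurable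
  also have "\<dots> = (\<integral>\<^sup>+v\<in>{0<..}. ennreal ((f (1 / v) * indicator {0<..<t} (1 / v)) / v\<^sup>2) \<partial>lborel)"
  proof (rule nn_integral_cong)
    fix v :: real
    have "1 / v < t \<longleftrightarrow> 1 / t < v" if "0 < v" using that t by (simp add: field_simps)
    moreover have "1 / t < v \<Longrightarrow> 0 < v" using t by (meson divide_pos_pos less_trans zero_less_one)
    ultimately show "ennreal (f (1 / v) / v\<^sup>2) * indicator {1 / t<..} v = ennreal ((f (1 / v) * indicator {0<..<t} (1 / v)) / v\<^sup>2) * indicator {0<..} v"
      by (auto split: split_indicator)
  qed
  also have "\<dots> = (\<integral>\<^sup>+r\<in>{0<..}. ennreal (f r * indicator {0<..<t} r) \<partial>lborel)"
    by (rule nn_integral_reciprocal[where f="\<lambda>r. f r * indicator {0<..<t} r", symmetric]) measurable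
  also have "\<dots> = (\<integral>\<^sup>+r. ennreal (f r) * indicator {0<..<t} r \<partial>lborel)"
    by (intro nn_integral_cong) (auto split: split_indicator)
  finally show ?thesis .
qed

definition riesz_const :: "real \<Rightarrow> real \<Rightarrow> real" where
  "riesz_const N a = pi powr (N / 2) * Gamma ((N - a) / 2) / Gamma (N - a / 2)"

lemma riesz_const_pos: "0 < a \<Longrightarrow> a < N \<Longrightarrow> 0 < riesz_const N a"
  by (simp add: riesz_const_def Gamma_real_pos)

text \<open>The exponent \<open>DIM('a) - a / 2\<close> is the one for which the powers separate in
  the variables \<open>t\<close> and \<open>r\<close>: the \<open>t\<close>-dependence is a shifted
  Gamma density with parameter \<open>(DIM('a) - a) / 2\<close>, and what remains in
  \<open>r\<close> is the mixture that represents \<open>bubble (a / 2)\<close>.\<close>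

theorem riesz_potential_bubble:
  fixes x :: "'a::euclidean_space" and a :: real
  assumes a: "0 < a" "a < real DIM('a)"
  shows "(\<integral>\<^sup>+y. ennreal (bubble (real DIM('a) - a / 2) y * norm (x - y) powr (- a)) \<partial>lborel)
    = ennreal (riesz_const (real DIM('a)) a * bubble (a / 2) x)"
proof -
  let ?N = "real DIM('a)"
  define b where "b = ?N - a / 2"
  define q where "q = (norm x)\<^sup>2"
  have b: "0 < b" using a by (simp add: b_def)
  let ?h = "\<lambda>u. u powr (a / 2 - 1)"
  have ind: "indicator {r<..} t = (if r < t then 1 else (0::real))" for r t :: real by (simp add: indicator_def)
  have "(\<integral>\<^sup>+y. ennreal (bubble b y * norm (x - y) powr (- a)) \<partial>lborel)
    = (\<integral>\<^sup>+y. ennreal (1 / (Gamma b * Gamma (a / 2))) * (\<integral>\<^sup>+t. (\<integral>\<^sup>+u\<in>{0<..}. ennreal (gamma_weight b t * ?h u * (exp (- (t * (norm y)\<^sup>2)) * exp (- (u * (norm (x - y))\<^sup>2)))) \<partial>lborel) \<partial>lborel) \<partial>lborel)"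
  proof (rule nn_integral_cong_AE)
    show "AE y in lborel. ennreal (bubble b y * norm (x - y) powr (- a))
      = ennreal (1 / (Gamma b * Gamma (a / 2))) * (\<integral>\<^sup>+t. (\<integral>\<^sup>+u\<in>{0<..}. ennreal (gamma_weight b t * ?h u * (exp (- (t * (norm y)\<^sup>2)) * exp (- (u * (norm (x - y))\<^sup>2)))) \<partial>lborel) \<partial>lborel)"
      using AE_lborel_singleton[of x]
    proof eventually_elim
      case (elim y)
      have "norm (x - y) powr (- a) = ((norm (x - y))\<^sup>2) powr (- (a / 2))"
      proof -
        have "(norm (x - y) powr 2) powr (- (a / 2)) = norm (x - y) powr (2 * (- (a / 2)))" by (simp only: powr_powr)
        then show ?thesis using elim by simp
      qed
      then have k: "ennreal (norm (x - y) powr (- a)) = ennreal (1 / Gamma (a / 2)) * (\<integral>\<^sup>+u\<in>{0<..}. ennreal (?h u * exp (- ((norm (x - y))\<^sup>2 * u))) \<partial>lborel)"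
        using elim a by (simp add: powr_nn_integral_Gamma[symmetric])
      have v: "ennreal (bubble b y) = ennreal (1 / Gamma b) * (\<integral>\<^sup>+t. ennreal (gamma_weight b t * exp (- (t * (norm y)\<^sup>2))) \<partial>lborel)"
      proof -
        have "Gamma b \<noteq> 0" by (rule less_imp_neq[OF Gamma_real_pos[OF b], symmetric])
        then show ?thesis using b by (simp add: nn_integral_gamma_weight ennreal_mult[symmetric] bubble_def Gamma_real_nonneg)
      qed
      have "ennreal (bubble b y * norm (x - y) powr (- a)) = ennreal (1 / (Gamma b * Gamma (a / 2))) *
        ((\<integral>\<^sup>+t. ennreal (gamma_weight b t * exp (- (t * (norm y)\<^sup>2))) \<partial>lborel) * (\<integral>\<^sup>+u\<in>{0<..}. ennreal (?h u * exp (- ((norm (x - y))\<^sup>2 * u))) \<partial>lborel))"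
      proof -
        have "ennreal (1 / (Gamma b * Gamma (a / 2))) = ennreal (1 / Gamma b) * ennreal (1 / Gamma (a / 2))"
          using b a by (simp add: ennreal_mult[symmetric] Gamma_real_nonneg)
        moreover have "ennreal (bubble b y * norm (x - y) powr (- a)) = ennreal (bubble b y) * ennreal (norm (x - y) powr (- a))"
          by (rule ennreal_mult) (auto simp: less_imp_le[OF bubble_pos])
        ultimately show ?thesis unfolding k v by (simp only: mult_ac)
      qed
      also have "(\<integral>\<^sup>+t. ennreal (gamma_weight b t * exp (- (t * (norm y)\<^sup>2))) \<partial>lborel) * (\<integral>\<^sup>+u\<in>{0<..}. ennreal (?h u * exp (- ((norm (x - y))\<^sup>2 * u))) \<partial>lborel)
        = (\<integral>\<^sup>+t. (\<integral>\<^sup>+u\<in>{0<..}. ennreal (gamma_weight b t * ?h u * (exp (- (t * (norm y)\<^sup>2)) * exp (- (u * (norm (x - y))\<^sup>2)))) \<partial>lborel) \<partial>lborel)"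
      proof (subst nn_integral_multc[symmetric], measurable, rule nn_integral_cong)
        fix t :: real
        show "ennreal (gamma_weight b t * exp (- (t * (norm y)\<^sup>2))) * (\<integral>\<^sup>+u\<in>{0<..}. ennreal (?h u * exp (- ((norm (x - y))\<^sup>2 * u))) \<partial>lborel)
          = (\<integral>\<^sup>+u\<in>{0<..}. ennreal (gamma_weight b t * ?h u * (exp (- (t * (norm y)\<^sup>2)) * exp (- (u * (norm (x - y))\<^sup>2)))) \<partial>lborel)"
          by (subst nn_integral_cmult[symmetric], measurable, rule nn_integral_cong)
             (simp add: mult.assoc[symmetric] ennreal_mult[symmetric] gamma_weight_nonneg, simp add: mult_ac)
      qed
      finally show ?case .
    qed
  qed
  also have "\<dots> = ennreal (1 / (Gamma b * Gamma (a / 2))) * (\<integral>\<^sup>+y. (\<integral>\<^sup>+t. (\<integral>\<^sup>+u\<in>{0<..}. ennreal (gamma_weight b t * ?h u * (exp (- (t * (norm y)\<^sup>2)) * exp (- (u * (norm (x - y))\<^sup>2)))) \<partial>lborel) \<partial>lborel) \<partial>lborel)"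
    by (rule nn_integral_cmult) measurable
  also have "(\<integral>\<^sup>+y. (\<integral>\<^sup>+t. (\<integral>\<^sup>+u\<in>{0<..}. ennreal (gamma_weight b t * ?h u * (exp (- (t * (norm y)\<^sup>2)) * exp (- (u * (norm (x - y))\<^sup>2)))) \<partial>lborel) \<partial>lborel) \<partial>lborel)
    = (\<integral>\<^sup>+t. \<integral>\<^sup>+y. (\<integral>\<^sup>+u\<in>{0<..}. ennreal (gamma_weight b t * ?h u * (exp (- (t * (norm y)\<^sup>2)) * exp (- (u * (norm (x - y))\<^sup>2)))) \<partial>lborel) \<partial>lborel \<partial>lborel)"
    by (rule lborel_pair.Fubini') measurable
  also have "\<dots> = (\<integral>\<^sup>+t. \<integral>\<^sup>+u. \<integral>\<^sup>+y. ennreal (gamma_weight b t * ?h u * (exp (- (t * (norm y)\<^sup>2)) * exp (- (u * (norm (x - y))\<^sup>2)))) * indicator {0<..} u \<partial>lborel \<partial>lborel \<partial>lborel)"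
    by (rule nn_integral_cong, rule lborel_pair.Fubini') measurable
  also have "\<dots> = (\<integral>\<^sup>+t. \<integral>\<^sup>+r. ennreal (pi powr (?N / 2) * (indicator {r<..} t * (t - r) powr ((?N - a) / 2 - 1) * exp (- t)) * (indicator {0<..} r * ?h r * exp (- (r * q)))) \<partial>lborel \<partial>lborel)"
  proof (rule nn_integral_cong)
    fix t :: real
    show "(\<integral>\<^sup>+u. \<integral>\<^sup>+y. ennreal (gamma_weight b t * ?h u * (exp (- (t * (norm y)\<^sup>2)) * exp (- (u * (norm (x - y))\<^sup>2)))) * indicator {0<..} u \<partial>lborel \<partial>lborel)
      = (\<integral>\<^sup>+r. ennreal (pi powr (?N / 2) * (indicator {r<..} t * (t - r) powr ((?N - a) / 2 - 1) * exp (- t)) * (indicator {0<..} r * ?h r * exp (- (r * q)))) \<partial>lborel)"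
    proof (cases "0 < t")
      case t: True
      \<comment> \<open>The integrand in the new variable. The absolute value agrees with
        \<open>t - r\<close> on the range \<open>{0<..<t}\<close> of the substitution.\<close>
      define f where "f r = pi powr (?N / 2) * (\<bar>t - r\<bar> powr ((?N - a) / 2 - 1) * exp (- t)) * (r powr (a / 2 - 1) * exp (- (r * q)))" for r
      have [measurable]: "f \<in> borel_measurable borel" unfolding f_def[abs_def] by measurable
      have "(\<integral>\<^sup>+u. \<integral>\<^sup>+y. ennreal (gamma_weight b t * ?h u * (exp (- (t * (norm y)\<^sup>2)) * exp (- (u * (norm (x - y))\<^sup>2)))) * indicator {0<..} u \<partial>lborel \<partial>lborel)
        = (\<integral>\<^sup>+u\<in>{0<..}. ennreal (f (t * u / (t + u)) * (t / (t + u))\<^sup>2) \<partial>lborel)"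
      proof (rule nn_integral_cong)
        fix u :: real
        show "(\<integral>\<^sup>+y. ennreal (gamma_weight b t * ?h u * (exp (- (t * (norm y)\<^sup>2)) * exp (- (u * (norm (x - y))\<^sup>2)))) * indicator {0<..} u \<partial>lborel)
          = ennreal (f (t * u / (t + u)) * (t / (t + u))\<^sup>2) * indicator {0<..} u"
        proof (cases "0 < u")
          case u: True
          define w where "w = t + u"
          have w: "0 < w" using t u by (simp add: w_def)
          have "(\<integral>\<^sup>+y. ennreal (gamma_weight b t * ?h u * (exp (- (t * (norm y)\<^sup>2)) * exp (- (u * (norm (x - y))\<^sup>2)))) \<partial>lborel)
            = ennreal (gamma_weight b t * ?h u) * (\<integral>\<^sup>+y. ennreal (exp (- (t * (norm y)\<^sup>2)) * exp (- (u * (norm (x - y))\<^sup>2))) \<partial>lborel)"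
            by (subst nn_integral_cmult[symmetric]) (auto simp: ennreal_mult[symmetric] gamma_weight_nonneg)
          also have "\<dots> = ennreal (gamma_weight b t * ?h u * ((pi / w) powr (?N / 2) * exp (- (t * u / w * q))))"
            unfolding nn_integral_gaussian_convolution[OF t u] q_def w_def
            by (rule ennreal_mult[symmetric]) (auto simp: gamma_weight_nonneg)
          also have "gamma_weight b t * ?h u * ((pi / w) powr (?N / 2) * exp (- (t * u / w * q))) = f (t * u / w) * (t / w)\<^sup>2"
          proof -
            \<comment> \<open>For \<open>r = t * u / w\<close> the difference \<open>t - r\<close>
              is \<open>t\<^sup>2 / w\<close>. The count of the powers of \<open>t\<close> and
              \<open>w\<close> that follows is where \<open>b = ?N - a / 2\<close> is used.\<close>
            have tw: "t - t * u / w = t\<^sup>2 / w" using w by (simp add: w_def field_simps power2_eq_square)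
            have 1: "\<bar>t - t * u / w\<bar> powr ((?N - a) / 2 - 1) = (t powr 2) powr ((?N - a) / 2 - 1) / w powr ((?N - a) / 2 - 1)"
              unfolding tw using t w by (simp add: powr_divide)
            have 2: "(t * u / w) powr (a / 2 - 1) = t powr (a / 2 - 1) * ?h u / w powr (a / 2 - 1)"
              using t u w by (simp add: powr_divide powr_mult)
            have 3: "(t / w)\<^sup>2 = t powr 2 / w powr 2" using t w by (simp add: power_divide)
            have 4: "t powr (b - 1) = t powr (2 * ((?N - a) / 2 - 1)) * t powr (a / 2 - 1) * t powr 2"
              unfolding powr_add[symmetric] by (rule arg_cong[where f="\<lambda>r. t powr r"]) (simp add: b_def field_simps)
            have 5: "w powr (?N / 2) = w powr ((?N - a) / 2 - 1) * w powr (a / 2 - 1) * w powr 2"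
              unfolding powr_add[symmetric] by (rule arg_cong[where f="\<lambda>r. w powr r"]) (simp add: field_simps)
            have 6: "gamma_weight b t = t powr (b - 1) * exp (- t)" using t by (simp add: gamma_weight_def)
            have 7: "(pi / w) powr (?N / 2) = pi powr (?N / 2) / w powr (?N / 2)" using w by (simp add: powr_divide)
            show ?thesis unfolding f_def 1 2 3 6 7 4 5 powr_powr by (simp add: field_simps)
          qed
          finally show ?thesis using u by (simp add: w_def)
        qed simp
      qed
      also have "\<dots> = (\<integral>\<^sup>+r. ennreal (f r) * indicator {0<..<t} r \<partial>lborel)"
        by (rule nn_integral_parallel_sum[OF t]) (measurable, simp add: f_def)
      also have "\<dots> = (\<integral>\<^sup>+r. ennreal (pi powr (?N / 2) * (indicator {r<..} t * (t - r) powr ((?N - a) / 2 - 1) * exp (- t)) * (indicator {0<..} r * ?h r * exp (- (r * q)))) \<partial>lborel)"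
        by (intro nn_integral_cong) (auto simp: f_def split: split_indicator)
      finally show ?thesis .
    next
      case False
      then show ?thesis by (auto simp: gamma_weight_def split: split_indicator intro!: nn_integral_zero' AE_I2)
    qed
  qed
  also have "\<dots> = (\<integral>\<^sup>+r. \<integral>\<^sup>+t. ennreal (pi powr (?N / 2) * (indicator {r<..} t * (t - r) powr ((?N - a) / 2 - 1) * exp (- t)) * (indicator {0<..} r * ?h r * exp (- (r * q)))) \<partial>lborel \<partial>lborel)"
    by (rule lborel_pair.Fubini') (simp only: ind, measurable)
  also have "\<dots> = (\<integral>\<^sup>+r. ennreal (pi powr (?N / 2) * Gamma ((?N - a) / 2)) * ennreal (gamma_weight (a / 2) r * exp (- (r * q))) \<partial>lborel)"
  proof (rule nn_integral_cong)
    fix r :: real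
    \<comment> \<open>Shifting \<open>t\<close> by \<open>r\<close> splits off
      \<open>exp (- r)\<close>, which completes \<open>gamma_weight (a / 2) r\<close>, and leaves a
      Gamma integral in \<open>t\<close>.\<close>
    have "(\<integral>\<^sup>+t. ennreal (pi powr (?N / 2) * (indicator {r<..} t * (t - r) powr ((?N - a) / 2 - 1) * exp (- t)) * (indicator {0<..} r * ?h r * exp (- (r * q)))) \<partial>lborel)
      = (\<integral>\<^sup>+t. ennreal (pi powr (?N / 2) * (indicator {r<..} (r + t) * (r + t - r) powr ((?N - a) / 2 - 1) * exp (- (r + t))) * (indicator {0<..} r * ?h r * exp (- (r * q)))) \<partial>lborel)"
      by (rule nn_integral_lborel_shift[symmetric]) measurable
    also have "\<dots> = (\<integral>\<^sup>+t. ennreal (pi powr (?N / 2) * (gamma_weight (a / 2) r * exp (- (r * q)))) * ennreal (gamma_weight ((?N - a) / 2) t * exp (- (t * 0))) \<partial>lborel)"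
    proof (rule nn_integral_cong)
      fix t :: real
      have "pi powr (?N / 2) * (indicator {r<..} (r + t) * (r + t - r) powr ((?N - a) / 2 - 1) * exp (- (r + t))) * (indicator {0<..} r * ?h r * exp (- (r * q)))
        = pi powr (?N / 2) * (gamma_weight (a / 2) r * exp (- (r * q))) * (gamma_weight ((?N - a) / 2) t * exp (- (t * 0)))"
        by (auto simp: gamma_weight_def exp_diff exp_minus field_simps split: split_indicator)
      then show "ennreal (pi powr (?N / 2) * (indicator {r<..} (r + t) * (r + t - r) powr ((?N - a) / 2 - 1) * exp (- (r + t))) * (indicator {0<..} r * ?h r * exp (- (r * q))))
        = ennreal (pi powr (?N / 2) * (gamma_weight (a / 2) r * exp (- (r * q)))) * ennreal (gamma_weight ((?N - a) / 2) t * exp (- (t * 0)))"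
        by (simp only:) (rule ennreal_mult, auto simp: gamma_weight_nonneg)
    qed
    also have "\<dots> = ennreal (pi powr (?N / 2) * (gamma_weight (a / 2) r * exp (- (r * q)))) * ennreal (Gamma ((?N - a) / 2))"
      using nn_integral_gamma_weight[of "(?N - a) / 2" 0] a by (subst nn_integral_cmult) simp_all
    also have "\<dots> = ennreal (pi powr (?N / 2) * Gamma ((?N - a) / 2)) * ennreal (gamma_weight (a / 2) r * exp (- (r * q)))"
      using a by (simp add: ennreal_mult[symmetric] gamma_weight_nonneg Gamma_real_nonneg mult_ac)
    finally show "(\<integral>\<^sup>+t. ennreal (pi powr (?N / 2) * (indicator {r<..} t * (t - r) powr ((?N - a) / 2 - 1) * exp (- t)) * (indicator {0<..} r * ?h r * exp (- (r * q)))) \<partial>lborel)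
      = ennreal (pi powr (?N / 2) * Gamma ((?N - a) / 2)) * ennreal (gamma_weight (a / 2) r * exp (- (r * q)))" .
  qed
  also have "\<dots> = ennreal (pi powr (?N / 2) * Gamma ((?N - a) / 2)) * ennreal (Gamma (a / 2) * bubble (a / 2) x)"
    using nn_integral_gamma_weight[of "a / 2" q] a by (subst nn_integral_cmult) (simp_all add: bubble_def q_def)
  finally have "(\<integral>\<^sup>+y. ennreal (bubble b y * norm (x - y) powr (- a)) \<partial>lborel)
    = ennreal (1 / (Gamma b * Gamma (a / 2)) * (pi powr (?N / 2) * Gamma ((?N - a) / 2) * (Gamma (a / 2) * bubble (a / 2) x)))"
    using a b by (simp add: ennreal_mult[symmetric] Gamma_real_nonneg less_imp_le[OF bubble_pos])
  also have "1 / (Gamma b * Gamma (a / 2)) * (pi powr (?N / 2) * Gamma ((?N - a) / 2) * (Gamma (a / 2) * bubble (a / 2) x)) = riesz_const ?N a * bubble (a / 2) x"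
    using less_imp_neq[OF Gamma_real_pos[of "a / 2"]] a by (simp add: riesz_const_def b_def)
  finally show ?thesis unfolding b_def .
qed

section \<open>Expansion of the energy\<close>

lemma powr_le_of_near_one:
  fixes x e :: real
  assumes "1 / 2 \<le> x" "x \<le> 3 / 2"
  shows "x powr e \<le> 2 powr \<bar>e\<bar>"
proof (cases "0 \<le> e")
  case True
  then have "x powr e \<le> 2 powr e" using assms by (intro powr_mono2) auto
  then show ?thesis using True by simp
next
  case False
  then have "x powr e \<le> (1 / 2) powr e" using assms by (intro powr_mono2') auto
  also have "\<dots> = 2 powr (- e)" by (simp add: powr_divide powr_minus field_simps)
  finally show ?thesis using False by simp
qed

text \<open>Near 0 the remainder is quadratic, by the mean value theorem used twice between 1/2 and
  3/2; away from 0 each term is bounded by a multiple of \<open>\<bar>t\<bar> powr q\<close>. For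
  \<open>q\<close> above 2 neither bound alone holds for all \<open>t\<close>, hence the two
  regimes.\<close>

lemma powr_taylor_unit:
  fixes q :: real
  assumes q: "1 < q"
  obtains K where "0 < K" "\<And>t. \<bar>t\<bar> \<le> 1 / 2 \<Longrightarrow> \<bar>\<bar>1 + t\<bar> powr q - 1 - q * t\<bar> \<le> K * t\<^sup>2"
    "\<And>t. 1 / 2 < \<bar>t\<bar> \<Longrightarrow> \<bar>\<bar>1 + t\<bar> powr q - 1 - q * t\<bar> \<le> K * \<bar>t\<bar> powr q"
proof -
  define L where "L = (q - 1) * 2 powr \<bar>q - 2\<bar>"
  have L: "0 < L" using q by (simp add: L_def)
  define K where "K = q * L + (3 powr q + 2 powr q + q * 2 powr q)"
  have near: "\<bar>\<bar>1 + t\<bar> powr q - 1 - q * t\<bar> \<le> q * L * t\<^sup>2" if t: "\<bar>t\<bar> \<le> 1 / 2" for t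
  proof -
    let ?S = "{1 - \<bar>t\<bar>..1 + \<bar>t\<bar>}"
    have S: "1 / 2 \<le> x" "x \<le> 3 / 2" "\<bar>x - 1\<bar> \<le> \<bar>t\<bar>" if "x \<in> ?S" for x using that t by auto
    have d1: "\<bar>x powr (q - 1) - 1\<bar> \<le> L * \<bar>t\<bar>" if x: "x \<in> ?S" for x
    proof -
      have "norm (x powr (q - 1) - 1 powr (q - 1)) \<le> L * norm (x - 1)"
      proof (rule field_differentiable_bound[where S="?S" and f'="\<lambda>x. (q - 1) * x powr (q - 2)"])
        fix z assume z: "z \<in> ?S"
        then show "((\<lambda>x. x powr (q - 1)) has_field_derivative (q - 1) * z powr (q - 2)) (at z within ?S)"
          using S(1)[OF z] by (auto intro!: derivative_eq_intros)
        show "norm ((q - 1) * z powr (q - 2)) \<le> L"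
          unfolding L_def using q powr_le_of_near_one[OF S(1,2)[OF z], of "q - 2"] by (simp add: abs_mult)
      qed (use x in auto)
      also have "\<dots> \<le> L * \<bar>t\<bar>" using S(3)[OF x] L by (intro mult_left_mono) auto
      finally show ?thesis by simp
    qed
    have "norm (((1 + t) powr q - q * (1 + t)) - (1 powr q - q * 1)) \<le> (q * L * \<bar>t\<bar>) * norm ((1 + t) - 1)"
    proof (rule field_differentiable_bound[where S="?S" and f="\<lambda>x. x powr q - q * x" and f'="\<lambda>x. q * (x powr (q - 1) - 1)"])
      fix z assume z: "z \<in> ?S"
      then show "((\<lambda>x. x powr q - q * x) has_field_derivative q * (z powr (q - 1) - 1)) (at z within ?S)"
        using S(1)[OF z] by (auto intro!: derivative_eq_intros simp: algebra_simps)
      show "norm (q * (z powr (q - 1) - 1)) \<le> q * L * \<bar>t\<bar>"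
        using d1[OF z] q by (simp add: abs_mult mult.assoc)
    qed auto
    moreover have "\<bar>1 + t\<bar> = 1 + t" using t by linarith
    ultimately show ?thesis by (simp add: power2_eq_square algebra_simps flip: abs_mult)
  qed
  have far: "\<bar>\<bar>1 + t\<bar> powr q - 1 - q * t\<bar> \<le> (3 powr q + 2 powr q + q * 2 powr q) * \<bar>t\<bar> powr q" if t: "1 / 2 < \<bar>t\<bar>" for t
  proof -
    have 1: "\<bar>1 + t\<bar> powr q \<le> 3 powr q * \<bar>t\<bar> powr q"
    proof -
      have "\<bar>1 + t\<bar> powr q \<le> (3 * \<bar>t\<bar>) powr q" using q t by (intro powr_mono2) auto
      then show ?thesis by (simp add: powr_mult)
    qed
    have 2: "2 * \<bar>t\<bar> \<le> 2 powr q * \<bar>t\<bar> powr q"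
    proof -
      have "(2 * \<bar>t\<bar>) powr 1 \<le> (2 * \<bar>t\<bar>) powr q" using q t by (intro powr_mono) auto
      then show ?thesis by (simp add: powr_mult)
    qed
    have 3: "1 \<le> 2 powr q * \<bar>t\<bar> powr q" using 2 t by linarith
    have 4: "q * \<bar>t\<bar> \<le> q * (2 powr q * \<bar>t\<bar> powr q)" using 2 q by (intro mult_left_mono) linarith+
    have "\<bar>\<bar>1 + t\<bar> powr q - 1 - q * t\<bar> \<le> \<bar>1 + t\<bar> powr q + 1 + q * \<bar>t\<bar>"
    proof -
      have "\<bar>q * t\<bar> = q * \<bar>t\<bar>" using q by (simp add: abs_mult)
      moreover have "0 \<le> \<bar>1 + t\<bar> powr q" by simp
      ultimately show ?thesis by linarith
    qed
    also have "\<dots> \<le> (3 powr q + 2 powr q + q * 2 powr q) * \<bar>t\<bar> powr q" using 1 3 4 by (simp add: algebra_simps)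
    finally show ?thesis .
  qed
  have K: "0 < K" "q * L \<le> K" "3 powr q + 2 powr q + q * 2 powr q \<le> K" using q L by (auto simp: K_def add_pos_pos)
  show thesis
  proof (rule that[OF K(1)])
    show "\<bar>\<bar>1 + t\<bar> powr q - 1 - q * t\<bar> \<le> K * t\<^sup>2" if "\<bar>t\<bar> \<le> 1 / 2" for t
      using near[OF that] mult_right_mono[OF K(2), of "t\<^sup>2"] by simp
    show "\<bar>\<bar>1 + t\<bar> powr q - 1 - q * t\<bar> \<le> K * \<bar>t\<bar> powr q" if "1 / 2 < \<bar>t\<bar>" for t
      using far[OF that] mult_right_mono[OF K(3), of "\<bar>t\<bar> powr q"] by simp
  qed
qed

lemma powr_mult_powr_le:
  fixes v w a b :: real
  assumes "0 < v" "0 \<le> w" "0 \<le> a" "0 \<le> b"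
  shows "v powr a * w powr b \<le> (v + w) powr (a + b)"
proof -
  have "v powr a * w powr b \<le> (v + w) powr a * (v + w) powr b"
    using assms by (intro mult_mono powr_mono2) auto
  then show ?thesis by (simp add: powr_add)
qed

text \<open>Homogeneity in \<open>v\<close> reduces the claim to \<open>t = A * w / v\<close>. The
  exponent 1 + \<theta> lies below both 2 and \<open>q\<close>, so for \<open>A \<le> 1\<close> it
  serves both regimes. The amplitude \<open>A\<close> is kept apart from the profile
  \<open>w\<close> so that the constant depends on neither.\<close>

lemma powr_taylor:
  fixes q \<theta> :: real
  assumes q: "1 + \<theta> \<le> q" and \<theta>: "0 < \<theta>" "\<theta> \<le> 1"
  obtains K where "0 < K"
    "\<And>v w A. 0 < v \<Longrightarrow> 0 < A \<Longrightarrow> A \<le> 1 \<Longrightarrow>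
       \<bar>\<bar>v + A * w\<bar> powr q - v powr q - q * (v powr (q - 1) * (A * w))\<bar> \<le> K * A powr (1 + \<theta>) * (v + \<bar>w\<bar>) powr q"
    "\<And>v w A. 0 < v \<Longrightarrow> 0 < A \<Longrightarrow> A \<le> 1 \<Longrightarrow> \<bar>\<bar>v + A * w\<bar> powr q - v powr q\<bar> \<le> K * A * (v + \<bar>w\<bar>) powr q"
proof -
  have q1: "1 < q" using q \<theta> by simp
  obtain K where K: "0 < K" "\<And>t. \<bar>t\<bar> \<le> 1 / 2 \<Longrightarrow> \<bar>\<bar>1 + t\<bar> powr q - 1 - q * t\<bar> \<le> K * t\<^sup>2"
    "\<And>t. 1 / 2 < \<bar>t\<bar> \<Longrightarrow> \<bar>\<bar>1 + t\<bar> powr q - 1 - q * t\<bar> \<le> K * \<bar>t\<bar> powr q"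
    using powr_taylor_unit[OF q1] by metis
  have second: "\<bar>\<bar>v + A * w\<bar> powr q - v powr q - q * (v powr (q - 1) * (A * w))\<bar> \<le> K * A powr (1 + \<theta>) * (v + \<bar>w\<bar>) powr q"
    if v: "0 < v" and A: "0 < A" "A \<le> 1" for v w A
  proof -
    define t where "t = A * w / v"
    have tv: "A * w = t * v" using v by (simp add: t_def)
    have abs_t: "\<bar>t\<bar> = A * \<bar>w\<bar> / v" using v A by (simp add: t_def abs_mult)
    have "\<bar>v + A * w\<bar> powr q - v powr q - q * (v powr (q - 1) * (A * w)) = v powr q * (\<bar>1 + t\<bar> powr q - 1 - q * t)"
    proof -
      have "v + A * w = v * (1 + t)" by (simp add: tv algebra_simps)
      then have "\<bar>v + A * w\<bar> = v * \<bar>1 + t\<bar>" using v by (simp add: abs_mult)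
      then have "\<bar>v + A * w\<bar> powr q = v powr q * \<bar>1 + t\<bar> powr q" using v by (simp add: powr_mult)
      moreover have "v powr (q - 1) * (A * w) = v powr q * t" using v by (simp add: tv powr_diff)
      ultimately show ?thesis by (simp add: algebra_simps)
    qed
    then have eq: "\<bar>\<bar>v + A * w\<bar> powr q - v powr q - q * (v powr (q - 1) * (A * w))\<bar> = v powr q * \<bar>\<bar>1 + t\<bar> powr q - 1 - q * t\<bar>"
      by (simp add: abs_mult)
    show ?thesis
    proof (cases "\<bar>t\<bar> \<le> 1 / 2")
      case True
      have "t\<^sup>2 \<le> \<bar>t\<bar> powr (1 + \<theta>)"
      proof (cases "t = 0")
        case False
        then have "\<bar>t\<bar> powr 2 \<le> \<bar>t\<bar> powr (1 + \<theta>)" using True \<theta> by (intro powr_mono') auto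
        then show ?thesis using False by simp
      qed simp
      then have "\<bar>\<bar>1 + t\<bar> powr q - 1 - q * t\<bar> \<le> K * \<bar>t\<bar> powr (1 + \<theta>)"
        using K(2)[OF True] K(1) by (meson mult_left_mono less_imp_le order_trans)
      then have "v powr q * \<bar>\<bar>1 + t\<bar> powr q - 1 - q * t\<bar> \<le> v powr q * (K * \<bar>t\<bar> powr (1 + \<theta>))"
        by (intro mult_left_mono) auto
      also have "\<dots> = K * A powr (1 + \<theta>) * (v powr (q - (1 + \<theta>)) * \<bar>w\<bar> powr (1 + \<theta>))"
        unfolding abs_t using v A by (simp add: powr_divide powr_mult powr_diff)
      also have "\<dots> \<le> K * A powr (1 + \<theta>) * (v + \<bar>w\<bar>) powr (q - (1 + \<theta>) + (1 + \<theta>))"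
        using K(1) v q \<theta> by (intro mult_left_mono powr_mult_powr_le) auto
      finally show ?thesis unfolding eq by simp
    next
      case False
      then have "v powr q * \<bar>\<bar>1 + t\<bar> powr q - 1 - q * t\<bar> \<le> v powr q * (K * \<bar>t\<bar> powr q)"
        by (intro mult_left_mono K(3)) auto
      also have "\<dots> = K * (A powr q * \<bar>w\<bar> powr q)"
        unfolding abs_t using v A by (simp add: powr_divide powr_mult)
      also have "\<dots> \<le> K * (A powr (1 + \<theta>) * (v + \<bar>w\<bar>) powr q)"
        using K(1) A v q q1 by (intro mult_left_mono mult_mono powr_mono' powr_mono2) auto
      finally show ?thesis unfolding eq by (simp add: mult.assoc)
    qed
  qed
  have first: "\<bar>\<bar>v + A * w\<bar> powr q - v powr q\<bar> \<le> (K + q) * A * (v + \<bar>w\<bar>) powr q" if v: "0 < v" and A: "0 < A" "A \<le> 1" for v w A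
  proof -
    have "A powr (1 + \<theta>) \<le> A powr 1" using A \<theta> by (intro powr_mono') auto
    then have "K * A powr (1 + \<theta>) * (v + \<bar>w\<bar>) powr q \<le> K * A * (v + \<bar>w\<bar>) powr q"
      using K(1) A by (intro mult_right_mono mult_left_mono) auto
    moreover have "\<bar>q * (v powr (q - 1) * (A * w))\<bar> \<le> q * A * (v + \<bar>w\<bar>) powr q"
    proof -
      have "v powr (q - 1) * \<bar>w\<bar> powr 1 \<le> (v + \<bar>w\<bar>) powr (q - 1 + 1)" using v q1 by (intro powr_mult_powr_le) auto
      then have "q * A * (v powr (q - 1) * \<bar>w\<bar>) \<le> q * A * (v + \<bar>w\<bar>) powr q" using q1 A by (intro mult_left_mono) auto
      then show ?thesis using q1 A by (simp add: abs_mult mult_ac)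
    qed
    ultimately show ?thesis using second[OF that, of w] unfolding distrib_right by linarith
  qed
  show thesis
  proof (rule that[of "K + q"])
    show "0 < K + q" using K(1) q1 by simp
    fix v w A :: real assume *: "0 < v" "0 < A" "A \<le> 1"
    have "K * (A powr (1 + \<theta>) * (v + \<bar>w\<bar>) powr q) \<le> (K + q) * (A powr (1 + \<theta>) * (v + \<bar>w\<bar>) powr q)"
      using q1 by (intro mult_right_mono) auto
    then show "\<bar>\<bar>v + A * w\<bar> powr q - v powr q - q * (v powr (q - 1) * (A * w))\<bar> \<le> (K + q) * A powr (1 + \<theta>) * (v + \<bar>w\<bar>) powr q"
      using second[OF *, of w] by (simp add: mult.assoc)
  qed (use first in auto)
qed

text \<open>The majorant \<open>(v x + \<bar>w x\<bar>) powr p\<close> has integral at most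
  \<open>H\<close> for every normalised \<open>w\<close>, so integrating the pointwise expansion
  keeps its order in \<open>A\<close> with a constant uniform in \<open>w\<close>.\<close>

lemma local_energy_expansion:
  fixes v :: "'a \<Rightarrow> real"
  assumes p: "1 + \<theta> \<le> p" "0 < \<theta>" "\<theta> \<le> 1"
    and [measurable]: "v \<in> borel_measurable M" and v: "\<And>x. 0 < v x" "(\<integral>\<^sup>+x. ennreal (v x powr p) \<partial>M) \<le> ennreal V" "0 \<le> V"
  obtains K where "0 < K" "\<And>w A. w \<in> borel_measurable M \<Longrightarrow> (\<integral>\<^sup>+x. ennreal (\<bar>w x\<bar> powr p) \<partial>M) \<le> 1 \<Longrightarrow> 0 < A \<Longrightarrow> A \<le> 1 \<Longrightarrow>
     \<bar>(LINT x|M. \<bar>v x + A * w x\<bar> powr p) - (LINT x|M. \<bar>v x\<bar> powr p) - p * A * (LINT x|M. v x powr (p - 1) * w x)\<bar> \<le> K * A powr (1 + \<theta>)"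
proof -
  have p1: "1 < p" using p by simp
  obtain K where K: "0 < K"
    "\<And>v w A. 0 < v \<Longrightarrow> 0 < A \<Longrightarrow> A \<le> 1 \<Longrightarrow>
       \<bar>\<bar>v + A * w\<bar> powr p - v powr p - p * (v powr (p - 1) * (A * w))\<bar> \<le> K * A powr (1 + \<theta>) * (v + \<bar>w\<bar>) powr p"
    using powr_taylor[OF p] by metis
  define H where "H = 2 powr p * (V + 1)"
  have H: "0 < H" using v(3) by (simp add: H_def)
  show thesis
  proof (rule that[of "K * H"])
    show "0 < K * H" using K H by simp
    fix w :: "'a \<Rightarrow> real" and A :: real
    assume [measurable]: "w \<in> borel_measurable M" and w: "(\<integral>\<^sup>+x. ennreal (\<bar>w x\<bar> powr p) \<partial>M) \<le> 1" and A: "0 < A" "A \<le> 1"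
    let ?Z = "\<lambda>x. (v x + \<bar>w x\<bar>) powr p"
    have "(\<integral>\<^sup>+x. ennreal (?Z x) \<partial>M) = (\<integral>\<^sup>+x. ennreal (\<bar>v x + \<bar>w x\<bar>\<bar> powr p) \<partial>M)"
      using v(1) by (intro nn_integral_cong) (simp add: add_pos_nonneg less_imp_le)
    also have "\<dots> \<le> ennreal (2 powr p) * ((\<integral>\<^sup>+x. ennreal (\<bar>v x\<bar> powr p) \<partial>M) + (\<integral>\<^sup>+x. ennreal (\<bar>\<bar>w x\<bar>\<bar> powr p) \<partial>M))"
      using p1 by (intro nn_integral_powr_add_le) auto
    also have "\<dots> \<le> ennreal (2 powr p) * (ennreal V + ennreal 1)"
      using v w by (intro mult_left_mono add_mono) (auto simp: less_imp_le)
    also have "\<dots> = ennreal H"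
      using v(3) by (simp add: H_def ennreal_mult ennreal_1[symmetric] ennreal_plus[symmetric] del: ennreal_plus ennreal_1)
    finally have Z: "(\<integral>\<^sup>+x. ennreal (?Z x) \<partial>M) \<le> ennreal H" .
    have Zi: "integrable M ?Z" using Z by (intro integrableI_nonneg) (auto intro: order_le_less_trans)
    have ZH: "(LINT x|M. ?Z x) \<le> H" using Z H by (subst integral_eq_nn_integral) (auto simp: enn2real_leI)
    have i1: "integrable M (\<lambda>x. \<bar>v x + A * w x\<bar> powr p)"
    proof (rule Bochner_Integration.integrable_bound[OF Zi])
      show "AE x in M. norm (\<bar>v x + A * w x\<bar> powr p) \<le> norm (?Z x)"
      proof (rule AE_I2)
        fix x
        have "A * \<bar>w x\<bar> \<le> 1 * \<bar>w x\<bar>" using A by (intro mult_right_mono) auto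
        then have "\<bar>v x + A * w x\<bar> \<le> v x + \<bar>w x\<bar>" using v(1)[of x] A abs_triangle_ineq[of "v x" "A * w x"] by (simp add: abs_mult)
        then show "norm (\<bar>v x + A * w x\<bar> powr p) \<le> norm (?Z x)" using p1 by (auto intro!: powr_mono2)
      qed
    qed measurable
    have i2: "integrable M (\<lambda>x. \<bar>v x\<bar> powr p)"
      by (rule Bochner_Integration.integrable_bound[OF Zi]) (use v(1) p1 in \<open>auto intro!: AE_I2 powr_mono2 simp: less_imp_le\<close>)
    have i3: "integrable M (\<lambda>x. v x powr (p - 1) * w x)"
    proof (rule Bochner_Integration.integrable_bound[OF Zi])
      show "AE x in M. norm (v x powr (p - 1) * w x) \<le> norm (?Z x)"
      proof (rule AE_I2)
        fix x
        have "v x powr (p - 1) * \<bar>w x\<bar> powr 1 \<le> (v x + \<bar>w x\<bar>) powr (p - 1 + 1)" using v p1 by (intro powr_mult_powr_le) auto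
        then show "norm (v x powr (p - 1) * w x) \<le> norm (?Z x)" by (simp add: abs_mult)
      qed
    qed measurable
    have eq: "(LINT x|M. \<bar>v x + A * w x\<bar> powr p) - (LINT x|M. \<bar>v x\<bar> powr p) - p * A * (LINT x|M. v x powr (p - 1) * w x)
      = (LINT x|M. \<bar>v x + A * w x\<bar> powr p - \<bar>v x\<bar> powr p - p * A * (v x powr (p - 1) * w x))"
      using i1 i2 i3 by simp
    have "\<bar>(LINT x|M. \<bar>v x + A * w x\<bar> powr p) - (LINT x|M. \<bar>v x\<bar> powr p) - p * A * (LINT x|M. v x powr (p - 1) * w x)\<bar> \<le> (LINT x|M. \<bar>\<bar>v x + A * w x\<bar> powr p - \<bar>v x\<bar> powr p - p * A * (v x powr (p - 1) * w x)\<bar>)"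
      unfolding eq by (rule integral_abs_bound)
    also have "\<dots> \<le> (LINT x|M. K * A powr (1 + \<theta>) * ?Z x)"
    proof (rule integral_mono)
      show "integrable M (\<lambda>x. \<bar>\<bar>v x + A * w x\<bar> powr p - \<bar>v x\<bar> powr p - p * A * (v x powr (p - 1) * w x)\<bar>)"
        by (intro integrable_abs Bochner_Integration.integrable_diff integrable_mult_right i1 i2 i3)
      show "integrable M (\<lambda>x. K * A powr (1 + \<theta>) * ?Z x)" by (rule integrable_mult_right[OF Zi])
      fix x
      have "p * A * (v x powr (p - 1) * w x) = p * (v x powr (p - 1) * (A * w x))" by simp
      then show "\<bar>\<bar>v x + A * w x\<bar> powr p - \<bar>v x\<bar> powr p - p * A * (v x powr (p - 1) * w x)\<bar> \<le> K * A powr (1 + \<theta>) * ?Z x"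
        using K(2)[OF v(1) A, of x "w x"] by (simp only: abs_of_pos[OF v(1)])
    qed
    also have "\<dots> = K * A powr (1 + \<theta>) * (LINT x|M. ?Z x)" by simp
    also have "\<dots> \<le> K * A powr (1 + \<theta>) * H" using K ZH by (intro mult_left_mono) auto
    finally show "\<bar>(LINT x|M. \<bar>v x + A * w x\<bar> powr p) - (LINT x|M. \<bar>v x\<bar> powr p) - p * A * (LINT x|M. v x powr (p - 1) * w x)\<bar> \<le> K * H * A powr (1 + \<theta>)"
      by (simp add: mult_ac)
  qed
qed

text \<open>Everything is majorised by \<open>Z x * Z y\<close> times the kernel with
  \<open>Z x = (v x + \<bar>w x\<bar>) powr q\<close>. The Hardy-Littlewood-Sobolev exponent
  \<open>r\<close> satisfies \<open>q * r = p\<close>, so a bound in the critical Lebesgue space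
  makes the double integral of the majorant at most \<open>H\<close>, uniformly in normalised
  \<open>w\<close>.\<close>

lemma nonlocal_energy_expansion:
  fixes v :: "'a::euclidean_space \<Rightarrow> real" and a q \<theta> :: real
  assumes a: "0 < a" "a < DIM('a)" and q: "1 + \<theta> \<le> q" "0 < \<theta>" "\<theta> \<le> 1"
    and p: "p = q * (2 * real DIM('a) / (2 * real DIM('a) - a))"
    and [measurable]: "v \<in> borel_measurable borel" and v: "\<And>x. 0 < v x" "(\<integral>\<^sup>+x. ennreal (v x powr p) \<partial>lborel) \<le> ennreal V" "0 \<le> V"
  obtains K where "0 < K" "\<And>w A. w \<in> borel_measurable borel \<Longrightarrow> (\<integral>\<^sup>+x. ennreal (\<bar>w x\<bar> powr p) \<partial>lborel) \<le> 1 \<Longrightarrow> 0 < A \<Longrightarrow> A \<le> 1 \<Longrightarrow>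
     \<bar>(LINT x|lborel. LINT y|lborel. \<bar>v x + A * w x\<bar> powr q * \<bar>v y + A * w y\<bar> powr q / norm (x - y) powr a)
      - (LINT x|lborel. LINT y|lborel. \<bar>v x\<bar> powr q * \<bar>v y\<bar> powr q / norm (x - y) powr a)
      - 2 * q * A * (LINT x|lborel. v x powr (q - 1) * w x * (LINT y|lborel. v y powr q * norm (x - y) powr (- a)))\<bar> \<le> K * A powr (1 + \<theta>)"
proof -
  let ?N = "real DIM('a)" and ?P = "lborel \<Otimes>\<^sub>M lborel :: ('a \<times> 'a) measure"
  define r where "r = 2 * ?N / (2 * ?N - a)"
  have q1: "1 < q" using q by simp
  have r: "1 < r" using a by (simp add: r_def)
  have pr: "p = q * r" by (simp add: p r_def)
  have p0: "0 \<le> p" using q1 r by (simp add: pr)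
  obtain K where K: "0 < K"
    "\<And>v w A. 0 < v \<Longrightarrow> 0 < A \<Longrightarrow> A \<le> 1 \<Longrightarrow>
       \<bar>\<bar>v + A * w\<bar> powr q - v powr q - q * (v powr (q - 1) * (A * w))\<bar> \<le> K * A powr (1 + \<theta>) * (v + \<bar>w\<bar>) powr q"
    "\<And>v w A. 0 < v \<Longrightarrow> 0 < A \<Longrightarrow> A \<le> 1 \<Longrightarrow> \<bar>\<bar>v + A * w\<bar> powr q - v powr q\<bar> \<le> K * A * (v + \<bar>w\<bar>) powr q"
    using powr_taylor[OF q] by metis
  obtain C where C: "0 < C" "\<And>(f :: 'a \<Rightarrow> real) g A B. f \<in> borel_measurable borel \<Longrightarrow> g \<in> borel_measurable borel \<Longrightarrow>
    (\<forall>x. 0 \<le> f x) \<Longrightarrow> (\<forall>x. 0 \<le> g x) \<Longrightarrow> 0 < A \<Longrightarrow> 0 < B \<Longrightarrow>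
    (\<integral>\<^sup>+x. ennreal (f x powr r) \<partial>lborel) \<le> ennreal (A powr r) \<Longrightarrow>
    (\<integral>\<^sup>+x. ennreal (g x powr r) \<partial>lborel) \<le> ennreal (B powr r) \<Longrightarrow>
    (\<integral>\<^sup>+x. \<integral>\<^sup>+y. ennreal (f x * g y * norm (x - y) powr (- a)) \<partial>lborel \<partial>lborel) \<le> ennreal (C * A * B)"
    using Hardy_Littlewood_Sobolev[OF a] unfolding r_def by blast
  define Hp where "Hp = 2 powr p * (V + 1)"
  have Hp: "0 < Hp" using v(3) by (simp add: Hp_def)
  define H where "H = C * Hp powr (1 / r) * Hp powr (1 / r)"
  have H: "0 < H" using C Hp by (simp add: H_def)
  let ?k = "\<lambda>x y. norm (x - y) powr (- a) :: real"
  show thesis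
  proof (rule that[of "(K * K + 2 * K) * H"])
    show "0 < (K * K + 2 * K) * H" using K(1) H by (simp add: add_pos_pos)
    fix w :: "'a \<Rightarrow> real" and A :: real
    assume [measurable]: "w \<in> borel_measurable borel" and w: "(\<integral>\<^sup>+x. ennreal (\<bar>w x\<bar> powr p) \<partial>lborel) \<le> 1" and A: "0 < A" "A \<le> 1"
    define Z where "Z x = (v x + \<bar>w x\<bar>) powr q" for x
    have [measurable]: "Z \<in> borel_measurable borel" unfolding Z_def[abs_def] by measurable
    have Z0: "0 \<le> Z x" for x by (simp add: Z_def)
    have "(\<integral>\<^sup>+x. ennreal (Z x powr r) \<partial>lborel) = (\<integral>\<^sup>+x. ennreal (\<bar>v x + \<bar>w x\<bar>\<bar> powr p) \<partial>lborel)"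
      using v(1) by (intro nn_integral_cong) (simp add: Z_def powr_powr pr add_pos_nonneg less_imp_le)
    also have "\<dots> \<le> ennreal (2 powr p) * ((\<integral>\<^sup>+x. ennreal (\<bar>v x\<bar> powr p) \<partial>lborel) + (\<integral>\<^sup>+x. ennreal (\<bar>\<bar>w x\<bar>\<bar> powr p) \<partial>lborel))"
      using p0 by (intro nn_integral_powr_add_le) auto
    also have "\<dots> \<le> ennreal (2 powr p) * (ennreal V + ennreal 1)"
      using v w by (intro mult_left_mono add_mono) (auto simp: less_imp_le)
    also have "\<dots> = ennreal ((Hp powr (1 / r)) powr r)"
      using v(3) Hp r by (simp add: Hp_def ennreal_mult ennreal_1[symmetric] ennreal_plus[symmetric] powr_powr del: ennreal_plus ennreal_1)
    finally have Z: "(\<integral>\<^sup>+x. ennreal (Z x powr r) \<partial>lborel) \<le> ennreal ((Hp powr (1 / r)) powr r)" .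
    let ?\<Phi> = "\<lambda>z. Z (fst z) * Z (snd z) * ?k (fst z) (snd z)"
    have "(\<integral>\<^sup>+z. ennreal (?\<Phi> z) \<partial>?P) = (\<integral>\<^sup>+x. \<integral>\<^sup>+y. ennreal (?\<Phi> (x, y)) \<partial>lborel \<partial>lborel)"
      by (rule lborel.nn_integral_fst[symmetric]) measurable
    also have "\<dots> \<le> ennreal H"
      unfolding H_def fst_conv snd_conv using Z Z0 Hp by (intro C) auto
    finally have \<Phi>: "(\<integral>\<^sup>+z. ennreal (?\<Phi> z) \<partial>?P) \<le> ennreal H" .
    have \<Phi>i: "integrable ?P ?\<Phi>" using \<Phi> Z0 by (intro integrableI_nonneg) (auto intro: order_le_less_trans)
    have \<Phi>H: "(LINT z|(?P). ?\<Phi> z) \<le> H" using \<Phi> H Z0 by (subst integral_eq_nn_integral) (auto simp: enn2real_leI)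
    define f where "f x = \<bar>v x + A * w x\<bar> powr q" for x
    define f0 where "f0 x = v x powr q" for x
    define l where "l x = v x powr (q - 1) * w x" for x
    have [measurable]: "f \<in> borel_measurable borel" "f0 \<in> borel_measurable borel" "l \<in> borel_measurable borel"
      unfolding f_def[abs_def] f0_def[abs_def] l_def[abs_def] by measurable
    have fZ: "\<bar>f x\<bar> \<le> Z x" for x
    proof -
      have "A * \<bar>w x\<bar> \<le> 1 * \<bar>w x\<bar>" using A by (intro mult_right_mono) auto
      then have "\<bar>v x + A * w x\<bar> \<le> v x + \<bar>w x\<bar>" using v(1)[of x] A abs_triangle_ineq[of "v x" "A * w x"] by (simp add: abs_mult)
      then show ?thesis unfolding f_def Z_def using q1 by (auto intro!: powr_mono2)
    qed
    have f0Z: "\<bar>f0 x\<bar> \<le> Z x" for x unfolding f0_def Z_def using q1 v(1)[of x] by (auto intro!: powr_mono2)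
    have lZ: "\<bar>l x\<bar> \<le> Z x" for x
    proof -
      have "v x powr (q - 1) * \<bar>w x\<bar> powr 1 \<le> (v x + \<bar>w x\<bar>) powr (q - 1 + 1)" using v q1 by (intro powr_mult_powr_le) auto
      then show ?thesis by (simp add: l_def Z_def abs_mult)
    qed
    have int: "integrable ?P (\<lambda>z. g (fst z) * h (snd z) * ?k (fst z) (snd z))"
      if [measurable]: "g \<in> borel_measurable borel" "h \<in> borel_measurable borel" and gh: "\<And>x. \<bar>g x\<bar> \<le> Z x" "\<And>x. \<bar>h x\<bar> \<le> Z x" for g h
      by (rule Bochner_Integration.integrable_bound[OF \<Phi>i])
         (auto simp: abs_mult abs_of_nonneg[OF Z0] intro!: AE_I2 mult_right_mono mult_mono gh Z0)
    have iter: "(LINT x|lborel. LINT y|lborel. \<bar>u x\<bar> powr q * \<bar>u y\<bar> powr q / norm (x - y) powr a) = (LINT z|(?P). g (fst z) * g (snd z) * ?k (fst z) (snd z))"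
      if [measurable]: "g \<in> borel_measurable borel" and g: "\<And>x. \<bar>g x\<bar> \<le> Z x" "\<And>x. g x = \<bar>u x\<bar> powr q" for u g
      using lborel_pair.integral_fst'[OF int[OF that(1) that(1) g(1) g(1)]]
      by (simp add: g(2) powr_minus_divide)
    have 1: "(LINT x|lborel. LINT y|lborel. \<bar>v x + A * w x\<bar> powr q * \<bar>v y + A * w y\<bar> powr q / norm (x - y) powr a) = (LINT z|(?P). f (fst z) * f (snd z) * ?k (fst z) (snd z))"
      by (rule iter) (use fZ in \<open>auto simp: f_def\<close>)
    have 2: "(LINT x|lborel. LINT y|lborel. \<bar>v x\<bar> powr q * \<bar>v y\<bar> powr q / norm (x - y) powr a) = (LINT z|(?P). f0 (fst z) * f0 (snd z) * ?k (fst z) (snd z))"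
      by (rule iter) (use v(1) f0Z in \<open>auto simp: f0_def less_imp_le\<close>)
    note ilf = int[OF \<open>l \<in> borel_measurable borel\<close> \<open>f0 \<in> borel_measurable borel\<close> lZ f0Z]
    note ifl = int[OF \<open>f0 \<in> borel_measurable borel\<close> \<open>l \<in> borel_measurable borel\<close> f0Z lZ]
    have 3: "(LINT x|lborel. v x powr (q - 1) * w x * (LINT y|lborel. v y powr q * norm (x - y) powr (- a))) = (LINT z|(?P). l (fst z) * f0 (snd z) * ?k (fst z) (snd z))"
      using lborel_pair.integral_fst'[OF ilf] by (simp add: l_def f0_def mult.assoc)
    \<comment> \<open>The two linear terms agree by symmetry of the kernel; this is the origin of
      the factor 2.\<close>
    have 4: "(LINT z|(?P). f0 (fst z) * l (snd z) * ?k (fst z) (snd z)) = (LINT z|(?P). l (fst z) * f0 (snd z) * ?k (fst z) (snd z))"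
    proof -
      have "(LINT z|(?P). f0 (fst z) * l (snd z) * ?k (fst z) (snd z)) = (LINT z|(?P). (case z of (x, y) \<Rightarrow> (\<lambda>z. l (fst z) * f0 (snd z) * ?k (fst z) (snd z)) (y, x)))"
        by (intro Bochner_Integration.integral_cong refl) (auto simp: norm_minus_commute mult_ac)
      also have "\<dots> = (LINT z|(?P). l (fst z) * f0 (snd z) * ?k (fst z) (snd z))"
        by (rule lborel_pair.integral_product_swap) measurable
      finally show ?thesis .
    qed
    have pt: "\<bar>f x * f y * ?k x y - f0 x * f0 y * ?k x y - q * A * (l x * f0 y * ?k x y) - q * A * (f0 x * l y * ?k x y)\<bar>
      \<le> (K * K + 2 * K) * A powr (1 + \<theta>) * (Z x * Z y * ?k x y)" for x y
    proof -
      define R where "R x = f x - f0 x - q * A * l x" for x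
      have R: "\<bar>R x\<bar> \<le> K * A powr (1 + \<theta>) * Z x" for x
      proof -
        have "q * A * l x = q * (v x powr (q - 1) * (A * w x))" by (simp add: l_def)
        then show ?thesis unfolding R_def f_def f0_def Z_def using K(2)[OF v(1) A, of x "w x"] by (simp only:)
      qed
      have D: "\<bar>f x - f0 x\<bar> \<le> K * A * Z x" for x
        unfolding f_def f0_def Z_def by (rule K(3)[OF v(1) A])
      have "A * A \<le> A powr (1 + \<theta>)"
      proof -
        have "A powr 2 \<le> A powr (1 + \<theta>)" using A q by (intro powr_mono') auto
        then show ?thesis using A by (simp add: power2_eq_square)
      qed
      then have A2: "(K * A * Z x) * (K * A * Z y) \<le> K * K * A powr (1 + \<theta>) * (Z x * Z y)"
        using mult_left_mono[of "A * A" "A powr (1 + \<theta>)" "K * K * (Z x * Z y)"] K(1) Z0 by (simp add: mult_ac)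
      \<comment> \<open>The error of a product: the product of both increments, which the
        first-order bounds make quadratic in \<open>A\<close>, and two terms with one Taylor
        remainder \<open>R\<close> each.\<close>
      have e: "f x * f y - f0 x * f0 y - q * A * (l x * f0 y) - q * A * (f0 x * l y) = (f x - f0 x) * (f y - f0 y) + f0 x * R y + R x * f0 y"
        by (simp add: R_def algebra_simps)
      have "\<bar>(f x - f0 x) * (f y - f0 y) + f0 x * R y + R x * f0 y\<bar> \<le> \<bar>f x - f0 x\<bar> * \<bar>f y - f0 y\<bar> + \<bar>f0 x\<bar> * \<bar>R y\<bar> + \<bar>R x\<bar> * \<bar>f0 y\<bar>"
        unfolding abs_mult[symmetric] by linarith
      also have "\<dots> \<le> (K * A * Z x) * (K * A * Z y) + Z x * (K * A powr (1 + \<theta>) * Z y) + (K * A powr (1 + \<theta>) * Z x) * Z y"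
        using K(1) A Z0 by (intro add_mono mult_mono D R f0Z) auto
      also have "\<dots> \<le> K * K * A powr (1 + \<theta>) * (Z x * Z y) + Z x * (K * A powr (1 + \<theta>) * Z y) + (K * A powr (1 + \<theta>) * Z x) * Z y"
        using A2 by simp
      also have "\<dots> = (K * K + 2 * K) * A powr (1 + \<theta>) * (Z x * Z y)" by (simp add: algebra_simps)
      finally have "\<bar>f x * f y - f0 x * f0 y - q * A * (l x * f0 y) - q * A * (f0 x * l y)\<bar> * ?k x y \<le> (K * K + 2 * K) * A powr (1 + \<theta>) * (Z x * Z y) * ?k x y"
        unfolding e by (intro mult_right_mono) auto
      also have "\<bar>f x * f y - f0 x * f0 y - q * A * (l x * f0 y) - q * A * (f0 x * l y)\<bar> * ?k x y
        = \<bar>(f x * f y - f0 x * f0 y - q * A * (l x * f0 y) - q * A * (f0 x * l y)) * ?k x y\<bar>" by (simp add: abs_mult)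
      also have "(f x * f y - f0 x * f0 y - q * A * (l x * f0 y) - q * A * (f0 x * l y)) * ?k x y
        = f x * f y * ?k x y - f0 x * f0 y * ?k x y - q * A * (l x * f0 y * ?k x y) - q * A * (f0 x * l y * ?k x y)"
        by (simp add: left_diff_distrib mult.assoc)
      finally show ?thesis by (simp add: mult.assoc)
    qed
    let ?E = "\<lambda>z. f (fst z) * f (snd z) * ?k (fst z) (snd z) - f0 (fst z) * f0 (snd z) * ?k (fst z) (snd z)
       - q * A * (l (fst z) * f0 (snd z) * ?k (fst z) (snd z)) - q * A * (f0 (fst z) * l (snd z) * ?k (fst z) (snd z))"
    note iff = int[OF \<open>f \<in> borel_measurable borel\<close> \<open>f \<in> borel_measurable borel\<close> fZ fZ]
    note i00 = int[OF \<open>f0 \<in> borel_measurable borel\<close> \<open>f0 \<in> borel_measurable borel\<close> f0Z f0Z]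
    have Ei: "integrable ?P ?E"
      by (intro Bochner_Integration.integrable_diff integrable_mult_right iff i00 ilf ifl)
    have eq: "(LINT z|(?P). f (fst z) * f (snd z) * ?k (fst z) (snd z)) - (LINT z|(?P). f0 (fst z) * f0 (snd z) * ?k (fst z) (snd z))
       - 2 * q * A * (LINT z|(?P). l (fst z) * f0 (snd z) * ?k (fst z) (snd z)) = (LINT z|(?P). ?E z)"
      using iff i00 ilf ifl 4 by simp
    have "\<bar>(LINT z|(?P). f (fst z) * f (snd z) * ?k (fst z) (snd z)) - (LINT z|(?P). f0 (fst z) * f0 (snd z) * ?k (fst z) (snd z))
       - 2 * q * A * (LINT z|(?P). l (fst z) * f0 (snd z) * ?k (fst z) (snd z))\<bar> \<le> (LINT z|(?P). \<bar>?E z\<bar>)"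
      unfolding eq by (rule integral_abs_bound)
    also have "\<dots> \<le> (LINT z|(?P). (K * K + 2 * K) * A powr (1 + \<theta>) * ?\<Phi> z)"
      by (rule integral_mono[OF integrable_abs[OF Ei] integrable_mult_right[OF \<Phi>i] pt])
    also have "\<dots> = (K * K + 2 * K) * A powr (1 + \<theta>) * (LINT z|(?P). ?\<Phi> z)" by simp
    also have "\<dots> \<le> (K * K + 2 * K) * A powr (1 + \<theta>) * H" using K(1) \<Phi>H by (intro mult_left_mono) auto
    finally show "\<bar>(LINT x|lborel. LINT y|lborel. \<bar>v x + A * w x\<bar> powr q * \<bar>v y + A * w y\<bar> powr q / norm (x - y) powr a)
      - (LINT x|lborel. LINT y|lborel. \<bar>v x\<bar> powr q * \<bar>v y\<bar> powr q / norm (x - y) powr a)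
      - 2 * q * A * (LINT x|lborel. v x powr (q - 1) * w x * (LINT y|lborel. v y powr q * norm (x - y) powr (- a)))\<bar> \<le> (K * K + 2 * K) * H * A powr (1 + \<theta>)"
      unfolding 1 2 3 by (simp add: mult_ac)
  qed
qed

section \<open>The scaled bubble as a solution\<close>

lemma powr_sum_eq_solution:
  fixes R a :: "nat \<Rightarrow> real" and b c :: real
  assumes I: "finite I" and R: "\<And>i. i \<in> I \<Longrightarrow> 0 \<le> R i" and a: "\<And>i. i \<in> I \<Longrightarrow> 0 < a i" and b: "0 < b" and c: "0 < c"
  shows "\<exists>t>0. (\<Sum>i\<in>I. R i * t powr a i) + t powr b = c"
proof -
  define f where "f t = (\<Sum>i\<in>I. R i * t powr a i) + t powr b" for t
  \<comment> \<open>At \<open>m\<close> the last term alone equals \<open>c\<close>, which brackets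
    a solution between 0 and \<open>m\<close>.\<close>
  define m where "m = c powr (1 / b)"
  have m: "0 < m" using c by (simp add: m_def)
  have "f m \<ge> c"
  proof -
    have "m powr b = c" using b c by (simp add: m_def powr_powr)
    moreover have "0 \<le> (\<Sum>i\<in>I. R i * m powr a i)" using R by (intro sum_nonneg) auto
    ultimately show ?thesis by (simp add: f_def)
  qed
  moreover have f0: "f 0 = 0" using a b by (simp add: f_def)
  moreover have "continuous_on {0..m} f"
    unfolding f_def[abs_def] using a b
    by (intro continuous_on_add continuous_on_sum continuous_on_mult_left continuous_on_powr' continuous_on_id continuous_on_const) auto
  ultimately obtain t where t: "0 \<le> t" "f t = c"
    using IVT'[of f 0 c m] m c by auto
  moreover have "t \<noteq> 0" using t f0 c by auto
  ultimately show ?thesis unfolding f_def by (metis less_le)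
qed

text \<open>For \<delta> above 0 the amplitude \<open>A = C * \<delta>\<close> gives a bound of
  higher order than \<delta>. For \<delta> = 0 every positive \<open>A\<close> up to 1 is
  admissible, and shrinking it forces \<open>m \<le> 0\<close>; this is why \<open>A\<close> is a
  free variable.\<close>

lemma linear_bound_of_powr_bound:
  fixes C K \<theta> e :: real
  assumes C: "0 < C" and K: "0 < K" and \<theta>: "0 < \<theta>" and e: "0 < e"
  shows "\<exists>d>0. \<forall>\<delta> m. 0 \<le> \<delta> \<longrightarrow> \<delta> < d \<longrightarrow>
    (\<forall>A. 0 < A \<longrightarrow> A \<le> 1 \<longrightarrow> C * \<delta> \<le> A \<longrightarrow> m \<le> \<delta>\<^sup>2 / 2 + K * A powr (1 + \<theta>)) \<longrightarrow> m \<le> e * \<delta>"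
proof -
  define B where "B = K * C powr (1 + \<theta>)"
  have B: "0 < B" using K C by (simp add: B_def)
  \<comment> \<open>Three requirements: \<open>C * \<delta> \<le> 1\<close>, so that this amplitude
    is admissible, and half of \<open>e * \<delta>\<close> each for the quadratic term and for the
    power term.\<close>
  define d where "d = min (1 / C) (min e ((e / (2 * B)) powr (1 / \<theta>)))"
  have d: "0 < d" using C e B by (simp add: d_def)
  have "m \<le> e * \<delta>" if \<delta>: "0 \<le> \<delta>" "\<delta> < d" and m: "\<And>A. 0 < A \<Longrightarrow> A \<le> 1 \<Longrightarrow> C * \<delta> \<le> A \<Longrightarrow> m \<le> \<delta>\<^sup>2 / 2 + K * A powr (1 + \<theta>)" for \<delta> m
  proof (cases "\<delta> = 0")
    case True
    have "m \<le> 0"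
    proof (rule ccontr)
      assume "\<not> m \<le> 0"
      then have m0: "0 < m" by simp
      define A where "A = min 1 ((m / (2 * K)) powr (1 / (1 + \<theta>)))"
      have A: "0 < A" "A \<le> 1" using m0 K by (auto simp: A_def)
      have "A powr (1 + \<theta>) \<le> ((m / (2 * K)) powr (1 / (1 + \<theta>))) powr (1 + \<theta>)"
        using A \<theta> by (intro powr_mono2) (auto simp: A_def)
      also have "\<dots> = m / (2 * K)" using m0 K \<theta> by (simp add: powr_powr)
      finally have "K * A powr (1 + \<theta>) \<le> m / 2" using K by (simp add: field_simps)
      moreover have "m \<le> K * A powr (1 + \<theta>)" using m[OF A] A True by simp
      ultimately show False using m0 by simp
    qed
    then show ?thesis using True by simp
  next
    case False
    then have \<delta>0: "0 < \<delta>" using \<delta> by simp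
    have C\<delta>: "C * \<delta> \<le> 1" using \<delta> C by (simp add: d_def field_simps)
    have "m \<le> \<delta>\<^sup>2 / 2 + K * (C * \<delta>) powr (1 + \<theta>)" using C \<delta>0 C\<delta> by (intro m) auto
    also have "K * (C * \<delta>) powr (1 + \<theta>) = B * \<delta> powr \<theta> * \<delta>"
      using C \<delta>0 by (simp add: B_def powr_mult powr_add)
    also have "\<delta> powr \<theta> \<le> ((e / (2 * B)) powr (1 / \<theta>)) powr \<theta>"
      using \<delta> \<theta> by (intro powr_mono2) (auto simp: d_def)
    then have "B * \<delta> powr \<theta> * \<delta> \<le> e / 2 * \<delta>"
      using \<delta>0 \<theta> B e by (intro mult_right_mono) (auto simp: powr_powr field_simps)
    moreover have "\<delta>\<^sup>2 / 2 \<le> e / 2 * \<delta>"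
      using \<delta> mult_right_mono[of \<delta> e \<delta>] by (simp add: d_def power2_eq_square)
    ultimately show ?thesis by (simp add: field_simps)
  qed
  then show ?thesis using d by blast
qed

section \<open>Inner product, Kelvin transform, nonlinearity and energy at a scaled bubble\<close>

context
  fixes s :: real and dim :: "'n::finite itself" and g p N :: real
  assumes s: "0 < s" "s < 1" and dim: "2 * s < CARD('n)"
  defines "N \<equiv> real CARD('n)"
  defines "g \<equiv> (real CARD('n) - 2 * s) / 2" and "p \<equiv> two_star (real CARD('n)) s"
begin

lemma D_inner_bubble:
  fixes h :: "real^'n \<Rightarrow> real"
  assumes h: "h \<in> D_space s"
  shows "(\<lambda>x::real^'n. \<tau> * bubble g x) \<in> D_space s"
    "D_inner s (\<lambda>x. \<tau> * bubble g x) h = \<tau> * bubble_const TYPE('n) s * (LINT x|lborel. bubble (s + N / 2) x * h x)"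
proof -
  note b = bubble_D_space[OF s dim, folded g_def]
  show v: "(\<lambda>x::real^'n. \<tau> * bubble g x) \<in> D_space s"
    using D_space_linear_combination[OF s dim b b, of \<tau> 0] by simp
  show "D_inner s (\<lambda>x. \<tau> * bubble g x) h = \<tau> * bubble_const TYPE('n) s * (LINT x|lborel. bubble (s + N / 2) x * h x)"
    using D_inner_eq_gagliardo[OF s dim v h] gagliardo_inner_bubble[OF s dim h, folded g_def]
      gagliardo_const_pos[OF s, of "CARD('n)"]
    by (simp add: gagliardo_inner_scale_left N_def)
qed

lemma riesz_potential_scaled_bubble:
  fixes x :: "real^'n" and a q \<tau> :: real
  assumes \<tau>: "0 < \<tau>" and a: "0 < a" "a < N" and q: "g * q = N - a / 2"
  shows "(LINT y|lborel. (\<tau> * bubble g y) powr q * norm (x - y) powr (- a)) = \<tau> powr q * (riesz_const N a * bubble (a / 2) x)"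
proof -
  have "(LINT y|lborel. bubble (N - a / 2) y * norm (x - y) powr (- a)) = riesz_const N a * bubble (a / 2) x"
  proof -
    have "(LINT y|lborel. bubble (N - a / 2) y * norm (x - y) powr (- a)) = enn2real (\<integral>\<^sup>+y. ennreal (bubble (N - a / 2) y * norm (x - y) powr (- a)) \<partial>lborel)"
      by (rule integral_eq_nn_integral) (auto intro!: AE_I2 mult_nonneg_nonneg simp: less_imp_le[OF bubble_pos])
    also have "\<dots> = riesz_const N a * bubble (a / 2) x"
      using riesz_potential_bubble[of a x] a riesz_const_pos[OF a] by (simp add: N_def less_imp_le[OF bubble_pos] less_imp_le)
    finally show ?thesis .
  qed
  then show ?thesis using \<tau> by (simp add: powr_mult less_imp_le[OF bubble_pos] bubble_powr q mult.assoc)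
qed

text \<open>The arithmetic of criticality. The first identity makes the Riesz potential of the
  bubble explicit, those with value \<open>s + N / 2\<close> bring all terms of the equation to one
  profile, and the lower bounds \<open>1 + 2 * s / (N - 2 * s)\<close> give the order of the Taylor
  expansion.\<close>

lemma critical_exponents:
  assumes a: "a < N"
  shows "g * two_star_hls N s a = N - a / 2" "a / 2 + g * (two_star_hls N s a - 1) = s + N / 2"
    "p = two_star_hls N s a * (2 * N / (2 * N - a))" "1 + 2 * s / (N - 2 * s) \<le> two_star_hls N s a"
    "two_star_hls N s a - 2 = (4 * s - a) / (N - 2 * s)"
    "g * (p - 1) = s + N / 2" "p - 2 = 4 * s / (N - 2 * s)" "1 + 2 * s / (N - 2 * s) \<le> p"
proof -
  have d: "N - 2 * s \<noteq> 0" "0 < N - 2 * s" using dim by (auto simp: N_def)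
  have e: "g = (N - 2 * s) / 2" "p = 2 * N / (N - 2 * s)" by (simp_all add: g_def N_def p_def two_star_def)
  show "g * two_star_hls N s a = N - a / 2" "a / 2 + g * (two_star_hls N s a - 1) = s + N / 2"
    "two_star_hls N s a - 2 = (4 * s - a) / (N - 2 * s)" "g * (p - 1) = s + N / 2" "p - 2 = 4 * s / (N - 2 * s)"
    using d by (simp_all add: e two_star_hls_def field_simps)
  show "p = two_star_hls N s a * (2 * N / (2 * N - a))" using d a s dim by (simp add: e two_star_hls_def N_def)
  show "1 + 2 * s / (N - 2 * s) \<le> two_star_hls N s a" "1 + 2 * s / (N - 2 * s) \<le> p"
  proof -
    have 1: "1 + 2 * s / (N - 2 * s) = N / (N - 2 * s)" using d by (simp add: field_simps)
    have "N \<le> 2 * N" by (simp add: N_def)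
    then show "1 + 2 * s / (N - 2 * s) \<le> two_star_hls N s a" "1 + 2 * s / (N - 2 * s) \<le> p"
      unfolding 1 e two_star_hls_def using d a by (auto intro!: divide_right_mono)
  qed
qed

text \<open>Inversion divides \<open>1 + (norm x)\<^sup>2\<close> by
  \<open>(norm x)\<^sup>2\<close>, and the prefactor cancels the resulting power of
  \<open>norm x\<close>. At the origin the prefactor is 0 by the conventions for \<open>powr\<close>
  and division.\<close>

lemma kelvin_bubble:
  fixes x :: "real^'n"
  shows "kelvin s (\<lambda>x. \<tau> * bubble g x) x = (if x = 0 then 0 else \<tau> * bubble g x)"
proof (cases "x = 0")
  case False
  then have n: "0 < norm x" by simp
  have "norm (x /\<^sub>R (norm x)\<^sup>2) = 1 / norm x" using n by (simp add: power2_eq_square field_simps)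
  then have "bubble g (x /\<^sub>R (norm x)\<^sup>2) = ((1 + (norm x)\<^sup>2) / (norm x)\<^sup>2) powr (- g)"
    using n by (simp add: bubble_def power_divide field_simps)
  also have "\<dots> = bubble g x / ((norm x)\<^sup>2) powr (- g)"
    by (subst powr_divide) (auto simp: bubble_def)
  also have "((norm x)\<^sup>2) powr (- g) = norm x powr (- (real CARD('n) - 2 * s))"
  proof -
    have "(norm x powr 2) powr (- g) = norm x powr (2 * (- g))" by (simp only: powr_powr)
    moreover have "2 * (- g) = - (real CARD('n) - 2 * s)" by (simp add: g_def field_simps)
    ultimately show ?thesis using n by simp
  qed
  finally have "bubble g (x /\<^sub>R (norm x)\<^sup>2) = bubble g x * norm x powr (real CARD('n) - 2 * s)" unfolding powr_minus by (simp add: divide_inverse)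
  then show ?thesis using False n by (simp add: kelvin_def)
qed (simp add: kelvin_def)

text \<open>Stated for functions that agree with the bubble at \<open>x\<close> and almost
  everywhere, so that it applies to the Kelvin transform, which differs from the bubble at the
  origin.\<close>

lemma nonlinearity_bubble:
  fixes x :: "real^'n"
  assumes \<tau>: "0 < \<tau>" and \<alpha>: "\<And>i. i \<in> {1..k} \<Longrightarrow> 0 < \<alpha> i \<and> \<alpha> i < N"
    and v: "v x = \<tau> * bubble g x" "AE y in lborel. v y = \<tau> * bubble g y" and [measurable]: "v \<in> borel_measurable borel"
  shows "nonlinearity s k \<alpha> v x
    = ((\<Sum>i=1..k. riesz_const N (\<alpha> i) * \<tau> powr (2 * two_star_hls N s (\<alpha> i) - 1)) + \<tau> powr (p - 1)) * bubble (s + N / 2) x"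
proof -
  have pos: "0 < \<tau> * bubble g y" for y :: "real^'n" using \<tau> by (simp add: bubble_pos)
  have step: "(\<tau> * bubble g x) powr r * (\<tau> * bubble g x) = \<tau> powr (r + 1) * bubble (g * (r + 1)) x" for r
  proof -
    have "(\<tau> * bubble g x) powr r * (\<tau> * bubble g x) = (\<tau> * bubble g x) powr (r + 1)" using pos[of x] by (simp add: powr_add)
    then show ?thesis using \<tau> by (simp add: powr_mult less_imp_le[OF bubble_pos] bubble_powr)
  qed
  have "(LINT y|lborel. \<bar>v y\<bar> powr ((2 * N - \<alpha> i) / (N - 2 * s)) / norm (x - y) powr \<alpha> i) * \<bar>v x\<bar> powr ((4 * s - \<alpha> i) / (N - 2 * s)) * v x
    = riesz_const N (\<alpha> i) * \<tau> powr (2 * two_star_hls N s (\<alpha> i) - 1) * bubble (s + N / 2) x" if i: "i \<in> {1..k}" for i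
  proof -
    let ?q = "two_star_hls N s (\<alpha> i)"
    note e = critical_exponents[OF conjunct2[OF \<alpha>[OF i]]]
    have "(LINT y|lborel. \<bar>v y\<bar> powr ?q / norm (x - y) powr \<alpha> i) = (LINT y|lborel. (\<tau> * bubble g y) powr ?q * norm (x - y) powr (- \<alpha> i))"
    proof (rule integral_cong_AE)
      show "AE y in lborel. \<bar>v y\<bar> powr ?q / norm (x - y) powr \<alpha> i = (\<tau> * bubble g y) powr ?q * norm (x - y) powr (- \<alpha> i)"
        using v(2) by eventually_elim (simp add: powr_minus_divide abs_of_pos[OF pos])
    qed measurable
    also have "\<dots> = \<tau> powr ?q * (riesz_const N (\<alpha> i) * bubble (\<alpha> i / 2) x)"
      using \<alpha>[OF i] by (intro riesz_potential_scaled_bubble \<tau> e) auto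
    finally have 1: "(LINT y|lborel. \<bar>v y\<bar> powr ((2 * N - \<alpha> i) / (N - 2 * s)) / norm (x - y) powr \<alpha> i) = \<tau> powr ?q * (riesz_const N (\<alpha> i) * bubble (\<alpha> i / 2) x)"
      by (simp only: two_star_hls_def)
    have 2: "\<bar>v x\<bar> powr ((4 * s - \<alpha> i) / (N - 2 * s)) * v x = \<tau> powr (?q - 1) * bubble (g * (?q - 1)) x"
      using step[of "?q - 2"] unfolding v(1) abs_of_pos[OF pos] e(5)[symmetric] by simp
    have "\<tau> powr ?q * \<tau> powr (?q - 1) = \<tau> powr (2 * ?q - 1)" using \<tau> by (simp flip: powr_add)
    moreover have "bubble (\<alpha> i / 2) x * bubble (g * (?q - 1)) x = bubble (s + N / 2) x" by (simp only: bubble_mult e)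
    ultimately have "(\<tau> powr ?q * \<tau> powr (?q - 1)) * (bubble (\<alpha> i / 2) x * bubble (g * (?q - 1)) x) = \<tau> powr (2 * ?q - 1) * bubble (s + N / 2) x"
      by simp
    then show ?thesis unfolding mult.assoc 1 2 by (simp add: mult_ac)
  qed
  moreover have "\<bar>v x\<bar> powr (4 * s / (N - 2 * s)) * v x = \<tau> powr (p - 1) * bubble (s + N / 2) x"
  proof -
    have "0 < N" using dim s by (simp add: N_def)
    note e = critical_exponents[OF this]
    show ?thesis using step[of "p - 2"] unfolding v(1) abs_of_pos[OF pos] e(7)[symmetric] by (simp add: e(6)[symmetric])
  qed
  ultimately show ?thesis
    unfolding nonlinearity_def Let_def N_def[symmetric] by (simp add: sum_distrib_right distrib_right)
qed

text \<open>By the Sobolev inequality \<open>A\<close> dominates the size of \<open>h\<close> in the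
  critical Lebesgue space, so \<open>w = h / A\<close> is normalised and the uniform expansions
  apply. Their linear parts are all multiples of the same integral and add up to the coefficient
  \<open>c\<close>.\<close>

lemma energy_expansion:
  fixes k :: nat and \<alpha> :: "nat \<Rightarrow> real" and \<tau> :: real
  assumes \<tau>: "0 < \<tau>" and \<alpha>: "\<And>i. i \<in> {1..k} \<Longrightarrow> 0 < \<alpha> i \<and> \<alpha> i < N"
  defines "v \<equiv> \<lambda>x::real^'n. \<tau> * bubble g x"
  defines "c \<equiv> (\<Sum>i=1..k. riesz_const N (\<alpha> i) * \<tau> powr (2 * two_star_hls N s (\<alpha> i) - 1)) + \<tau> powr (p - 1)"
  shows "\<exists>C>0. \<exists>K>0. \<exists>\<theta>>0. \<forall>h\<in>D_space s. \<forall>A. 0 < A \<longrightarrow> A \<le> 1 \<longrightarrow> C * D_norm s h \<le> A \<longrightarrow>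
    \<bar>energy s k \<alpha> (\<lambda>x. v x + h x) - energy s k \<alpha> v - (D_inner s v h - c * (LINT x|lborel. bubble (s + N / 2) x * h x))\<bar>
      \<le> (D_norm s h)\<^sup>2 / 2 + K * A powr (1 + \<theta>)"
proof -
  have N: "0 < N" "real DIM(real^'n) = N" "0 < N - 2 * s" using dim s by (auto simp: N_def)
  \<comment> \<open>All exponents in the energy are at least \<open>1 + 2 * s / (N - 2 * s)\<close>;
    the minimum with 1 keeps the order of the remainder at most 2.\<close>
  define \<theta> where "\<theta> = min 1 (2 * s / (N - 2 * s))"
  have \<theta>: "0 < \<theta>" "\<theta> \<le> 1" "\<theta> \<le> 2 * s / (N - 2 * s)" using s N by (auto simp: \<theta>_def)
  define q where "q i = two_star_hls N s (\<alpha> i)" for i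
  define r where "r i = riesz_const N (\<alpha> i) * \<tau> powr (2 * q i - 1)" for i
  define F where "F i u = (LINT x|lborel. LINT y|lborel. \<bar>u x\<bar> powr q i * \<bar>u y\<bar> powr q i / norm (x - y) powr \<alpha> i)" for i and u :: "real^'n \<Rightarrow> real"
  define G where "G u = (LINT x|lborel. \<bar>u x\<bar> powr p)" for u :: "real^'n \<Rightarrow> real"
  define J where "J h = (LINT x|lborel. bubble (s + N / 2) x * h x)" for h :: "real^'n \<Rightarrow> real"
  have vD: "v \<in> D_space s" unfolding v_def by (rule D_inner_bubble(1)[OF bubble_D_space[OF s dim]])
  have [measurable]: "v \<in> borel_measurable borel" by (rule D_space_measurable[OF s dim vD])
  have vpos: "0 < v x" for x using \<tau> by (simp add: v_def bubble_pos)
  have vpowr: "v x powr b = \<tau> powr b * bubble (g * b) x" for x b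
    using \<tau> by (simp add: v_def powr_mult less_imp_le[OF bubble_pos] bubble_powr)
  define V where "V = enn2real (\<integral>\<^sup>+x. ennreal (v x powr p) \<partial>lborel)"
  have V: "(\<integral>\<^sup>+x. ennreal (v x powr p) \<partial>lborel) \<le> ennreal V" "0 \<le> V"
    using D_space_Lp_finite[OF s dim vD] by (simp_all add: V_def p_def abs_of_pos[OF vpos])
  note ep = critical_exponents[OF N(1)]
  have p: "1 + \<theta> \<le> p" using ep(8) \<theta> by linarith
  have q: "1 + \<theta> \<le> q i" if "i \<in> {1..k}" for i
    using critical_exponents(4)[of "\<alpha> i"] \<alpha>[OF that] \<theta> by (simp add: q_def)
  define ok where "ok w A \<longleftrightarrow> w \<in> borel_measurable borel \<and> (\<integral>\<^sup>+x. ennreal (\<bar>w x\<bar> powr p) \<partial>lborel) \<le> 1 \<and> 0 < A \<and> A \<le> 1" for w :: "real^'n \<Rightarrow> real" and A :: real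
  have nonloc: "\<exists>K>0. \<forall>w A. ok w A \<longrightarrow>
      \<bar>F i (\<lambda>x. v x + A * w x) - F i v - 2 * q i * A * (r i * J w)\<bar> \<le> K * A powr (1 + \<theta>)" if i: "i \<in> {1..k}" for i
  proof -
    have a: "0 < \<alpha> i" "\<alpha> i < N" using \<alpha>[OF i] by auto
    note e = critical_exponents[OF a(2), folded q_def]
    have lin: "(LINT x|lborel. v x powr (q i - 1) * w x * (LINT y|lborel. v y powr q i * norm (x - y) powr (- \<alpha> i))) = r i * J w" for w
    proof -
      have eq: "v x powr (q i - 1) * w x * (LINT y|lborel. v y powr q i * norm (x - y) powr (- \<alpha> i)) = r i * (bubble (s + N / 2) x * w x)" for x
      proof -
        have "(LINT y|lborel. v y powr q i * norm (x - y) powr (- \<alpha> i)) = \<tau> powr q i * (riesz_const N (\<alpha> i) * bubble (\<alpha> i / 2) x)"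
          unfolding v_def by (rule riesz_potential_scaled_bubble[OF \<tau> a e(1)])
        moreover have "\<tau> powr (q i - 1) * \<tau> powr q i = \<tau> powr (2 * q i - 1)" using \<tau> by (simp flip: powr_add)
        moreover have "bubble (\<alpha> i / 2) x * bubble (g * (q i - 1)) x = bubble (s + N / 2) x" by (simp only: bubble_mult e)
        moreover have "v x powr (q i - 1) * w x * (\<tau> powr q i * (riesz_const N (\<alpha> i) * bubble (\<alpha> i / 2) x))
          = riesz_const N (\<alpha> i) * (\<tau> powr (q i - 1) * \<tau> powr q i) * ((bubble (\<alpha> i / 2) x * bubble (g * (q i - 1)) x) * w x)"
          unfolding vpowr by (simp only: mult_ac)
        ultimately show ?thesis by (simp only: r_def)
      qed
      show ?thesis unfolding eq J_def by simp
    qed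
    show ?thesis
    proof (rule nonlocal_energy_expansion[of "\<alpha> i" \<theta> "q i" p v V, OF _ _ q[OF i] \<theta>(1,2) _ _ vpos V])
      show "p = q i * (2 * real DIM(real^'n) / (2 * real DIM(real^'n) - \<alpha> i))" unfolding N(2) by (rule e(3))
      fix K :: real
      assume K: "0 < K" and *: "\<And>w A. w \<in> borel_measurable borel \<Longrightarrow> (\<integral>\<^sup>+x. ennreal (\<bar>w x\<bar> powr p) \<partial>lborel) \<le> 1 \<Longrightarrow> 0 < A \<Longrightarrow> A \<le> 1 \<Longrightarrow>
        \<bar>(LINT x|lborel. LINT y|lborel. \<bar>v x + A * w x\<bar> powr q i * \<bar>v y + A * w y\<bar> powr q i / norm (x - y) powr \<alpha> i)
        - (LINT x|lborel. LINT y|lborel. \<bar>v x\<bar> powr q i * \<bar>v y\<bar> powr q i / norm (x - y) powr \<alpha> i)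
        - 2 * q i * A * (LINT x|lborel. v x powr (q i - 1) * w x * (LINT y|lborel. v y powr q i * norm (x - y) powr (- \<alpha> i)))\<bar> \<le> K * A powr (1 + \<theta>)"
      show ?thesis
      proof (intro exI[of _ K] conjI allI impI K)
        fix w A assume "ok w A"
        then show "\<bar>F i (\<lambda>x. v x + A * w x) - F i v - 2 * q i * A * (r i * J w)\<bar> \<le> K * A powr (1 + \<theta>)"
          using *[of w A] unfolding F_def lin ok_def by simp
      qed
    qed (use a N in auto)
  qed
  then have "\<forall>i\<in>{1..k}. \<exists>K. 0 < K \<and> (\<forall>w A. ok w A \<longrightarrow>
      \<bar>F i (\<lambda>x. v x + A * w x) - F i v - 2 * q i * A * (r i * J w)\<bar> \<le> K * A powr (1 + \<theta>))" by blast
  from bchoice[OF this] obtain Kf where Kf: "\<forall>i\<in>{1..k}. 0 < Kf i \<and> (\<forall>w A. ok w A \<longrightarrow>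
      \<bar>F i (\<lambda>x. v x + A * w x) - F i v - 2 * q i * A * (r i * J w)\<bar> \<le> Kf i * A powr (1 + \<theta>))" ..
  obtain K0 where K0: "0 < K0" "\<And>w A. w \<in> borel_measurable lborel \<Longrightarrow> (\<integral>\<^sup>+x. ennreal (\<bar>w x\<bar> powr p) \<partial>lborel) \<le> 1 \<Longrightarrow> 0 < A \<Longrightarrow> A \<le> 1 \<Longrightarrow>
      \<bar>(LINT x|lborel. \<bar>v x + A * w x\<bar> powr p) - (LINT x|lborel. \<bar>v x\<bar> powr p) - p * A * (LINT x|lborel. v x powr (p - 1) * w x)\<bar> \<le> K0 * A powr (1 + \<theta>)"
    by (rule local_energy_expansion[OF p \<theta>(1,2) _ vpos V]) auto
  have lin0: "(LINT x|lborel. v x powr (p - 1) * w x) = \<tau> powr (p - 1) * J w" for w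
    unfolding vpowr ep(6) J_def by (simp add: mult.assoc)
  obtain C where C: "0 < C" "\<And>u. u \<in> D_space s \<Longrightarrow> (\<integral>\<^sup>+x. ennreal (\<bar>u (x::real^'n)\<bar> powr p) \<partial>lborel) \<le> ennreal ((C * D_norm s u) powr p)"
    using D_sobolev[OF s dim, folded p_def] by blast
  define K where "K = (\<Sum>i=1..k. Kf i) + K0"
  have "0 \<le> (\<Sum>i=1..k. Kf i)" using Kf by (intro sum_nonneg less_imp_le) blast
  then have K: "0 < K" using K0(1) by (simp add: K_def)
  have energy: "energy s k \<alpha> u = 1 / 2 * (D_norm s u)\<^sup>2 - (\<Sum>i=1..k. 1 / (2 * q i) * F i u) - 1 / p * G u" for u
    unfolding energy_def Let_def F_def G_def N_def p_def q_def by (rule refl)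
  have main: "\<bar>energy s k \<alpha> (\<lambda>x. v x + h x) - energy s k \<alpha> v - (D_inner s v h - c * J h)\<bar> \<le> (D_norm s h)\<^sup>2 / 2 + K * A powr (1 + \<theta>)"
    if h: "h \<in> D_space s" and A: "0 < A" "A \<le> 1" "C * D_norm s h \<le> A" for h A
  proof -
    define w where "w x = h x / A" for x
    have [measurable]: "h \<in> borel_measurable borel" by (rule D_space_measurable[OF s dim h])
    have [measurable]: "w \<in> borel_measurable borel" unfolding w_def[abs_def] by measurable
    have vh: "(\<lambda>x. v x + A * w x) = (\<lambda>x. v x + h x)" using A by (simp add: w_def)
    have AJ: "A * J w = J h" using A by (simp add: J_def w_def)
    have "(\<integral>\<^sup>+x. ennreal (\<bar>w x\<bar> powr p) \<partial>lborel) = (\<integral>\<^sup>+x. ennreal (1 / A powr p) * ennreal (\<bar>h x\<bar> powr p) \<partial>lborel)"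
      using A by (intro nn_integral_cong) (simp add: w_def powr_divide ennreal_mult[symmetric])
    also have "\<dots> = ennreal (1 / A powr p) * (\<integral>\<^sup>+x. ennreal (\<bar>h x\<bar> powr p) \<partial>lborel)" by (rule nn_integral_cmult) measurable
    also have "\<dots> \<le> ennreal (1 / A powr p) * ennreal ((C * D_norm s h) powr p)" by (intro mult_left_mono C(2) h) auto
    also have "\<dots> \<le> ennreal (1 / A powr p) * ennreal (A powr p)"
      using A C(1) p \<theta> by (intro mult_left_mono ennreal_leI powr_mono2) (auto simp: D_norm_def)
    also have "\<dots> = 1" using A by (simp add: ennreal_mult[symmetric])
    finally have w: "(\<integral>\<^sup>+x. ennreal (\<bar>w x\<bar> powr p) \<partial>lborel) \<le> 1" .
    have wA: "ok w A" using w A by (simp add: ok_def)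
    let ?A = "A powr (1 + \<theta>)"
    \<comment> \<open>The factor \<open>2 * q i\<close> of the linear term cancels the denominator
      in the energy, and dividing the remainder by a number above 1 preserves its bound.\<close>
    have Fi: "\<bar>1 / (2 * q i) * F i (\<lambda>x. v x + h x) - 1 / (2 * q i) * F i v - r i * J h\<bar> \<le> Kf i * ?A" if i: "i \<in> {1..k}" for i
    proof -
      let ?X = "F i (\<lambda>x. v x + A * w x) - F i v - 2 * q i * A * (r i * J w)"
      have q0: "1 < q i" using q[OF i] \<theta> by simp
      have "?X = F i (\<lambda>x. v x + h x) - F i v - 2 * q i * (r i * J h)" unfolding vh AJ[symmetric] by simp
      then have "1 / (2 * q i) * F i (\<lambda>x. v x + h x) - 1 / (2 * q i) * F i v - r i * J h = ?X / (2 * q i)"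
        using q0 by (simp only: diff_divide_distrib) simp
      also have "\<bar>?X / (2 * q i)\<bar> \<le> \<bar>?X\<bar> / 1" unfolding abs_divide using q0 by (intro divide_left_mono) auto
      moreover have "\<bar>?X\<bar> \<le> Kf i * ?A" using bspec[OF Kf i] wA by blast
      ultimately show ?thesis by simp
    qed
    have G: "\<bar>1 / p * G (\<lambda>x. v x + h x) - 1 / p * G v - \<tau> powr (p - 1) * J h\<bar> \<le> K0 * ?A"
    proof -
      let ?X = "G (\<lambda>x. v x + A * w x) - G v - p * A * (\<tau> powr (p - 1) * J w)"
      have p0: "1 < p" using p \<theta> by simp
      have "?X = G (\<lambda>x. v x + h x) - G v - p * (\<tau> powr (p - 1) * J h)" unfolding vh AJ[symmetric] by simp
      then have "1 / p * G (\<lambda>x. v x + h x) - 1 / p * G v - \<tau> powr (p - 1) * J h = ?X / p"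
        using p0 by (simp only: diff_divide_distrib) simp
      also have "\<bar>?X / p\<bar> \<le> \<bar>?X\<bar> / 1" unfolding abs_divide using p0 by (intro divide_left_mono) auto
      finally show ?thesis using K0(2)[OF _ w A(1,2), unfolded lin0] by (simp add: G_def)
    qed
    let ?S = "\<Sum>i=1..k. 1 / (2 * q i) * F i (\<lambda>x. v x + h x) - 1 / (2 * q i) * F i v - r i * J h"
    have "\<bar>?S\<bar> \<le> (\<Sum>i=1..k. Kf i * ?A)" by (rule order_trans[OF sum_abs sum_mono[OF Fi]])
    moreover have "energy s k \<alpha> (\<lambda>x. v x + h x) - energy s k \<alpha> v - (D_inner s v h - c * J h)
      = (D_norm s h)\<^sup>2 / 2 - ?S - (1 / p * G (\<lambda>x. v x + h x) - 1 / p * G v - \<tau> powr (p - 1) * J h)"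
      unfolding energy D_norm_square_add[OF s dim vD h] c_def r_def[symmetric, folded q_def] q_def[symmetric]
      by (simp add: sum_subtractf sum.distrib sum_distrib_left sum_distrib_right r_def algebra_simps)
    moreover have "(\<Sum>i=1..k. Kf i * ?A) + K0 * ?A = K * ?A" by (simp add: K_def distrib_right sum_distrib_right)
    moreover have "\<bar>(D_norm s h)\<^sup>2 / 2\<bar> = (D_norm s h)\<^sup>2 / 2" by simp
    ultimately show ?thesis using G by linarith
  qed
  show ?thesis using C(1) K \<theta>(1) main unfolding J_def by blast
qed

end

theorem theorem1p3:
  fixes s :: real and k :: nat and \<alpha> :: "nat \<Rightarrow> real"
  assumes "CARD('n::finite) \<ge> 3"
    and "0 < s" "s < 1"
    and "2 \<le> k"
    and "0 < \<alpha> 1" "strict_mono_on {1..k} \<alpha>" "\<alpha> k < real CARD('n)"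
  shows "\<exists>v :: real^'n \<Rightarrow> real.
           critical_point s (energy s k \<alpha>) v \<and> ae_nonneg v \<and> \<not> (AE x in lborel. v x = 0) \<and>
           weak_solution_on (UNIV - {0}) s k \<alpha> (kelvin s v) \<and> ae_nonneg (kelvin s v)"
proof -
  define N where "N = real CARD('n)"
  define g where "g = (N - 2 * s) / 2"
  define p where "p = two_star N s"
  note s = \<open>0 < s\<close> \<open>s < 1\<close>
  have dim: "2 * s < CARD('n)" using assms(1) s by linarith
  have N: "0 < N" "0 < N - 2 * s" using dim s by (auto simp: N_def)
  have \<alpha>: "0 < \<alpha> i \<and> \<alpha> i < N" if i: "i \<in> {1..k}" for i
    using i assms(5,7) strict_mono_onD[OF assms(6), of 1 i] strict_mono_onD[OF assms(6), of i k]
    by (cases "i = 1"; cases "i = k") (auto simp: N_def)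
  define R where "R i = riesz_const N (\<alpha> i)" for i
  define q where "q i = two_star_hls N s (\<alpha> i)" for i
  have R: "0 < R i" if "i \<in> {1..k}" for i using \<alpha>[OF that] by (simp add: R_def riesz_const_pos)
  have q: "0 < 2 * q i - 2" if "i \<in> {1..k}" for i
  proof -
    have "0 < 2 * s / (N - 2 * s)" using s N by simp
    then show ?thesis using critical_exponents(4)[OF s dim, of "\<alpha> i"] \<alpha>[OF that] by (simp add: q_def N_def)
  qed
  have p: "0 < p - 2" using s N by (simp add: p_def two_star_def field_simps)
  define \<Lambda> where "\<Lambda> = bubble_const TYPE('n) s"
  \<comment> \<open>The equation for the amplitude, divided by \<tau>. The exponents that remain are
    still positive, so the left side takes all values from 0 upwards as \<tau> grows.\<close>
  have "\<exists>\<tau>>0. (\<Sum>i\<in>{1..k}. R i * \<tau> powr (2 * q i - 2)) + \<tau> powr (p - 2) = \<Lambda>"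
    using R q p bubble_const_pos[OF s dim] by (intro powr_sum_eq_solution) (auto simp: \<Lambda>_def less_imp_le)
  then obtain \<tau> where \<tau>: "0 < \<tau>" and eq: "(\<Sum>i\<in>{1..k}. R i * \<tau> powr (2 * q i - 2)) + \<tau> powr (p - 2) = \<Lambda>" by blast
  define c where "c = (\<Sum>i=1..k. R i * \<tau> powr (2 * q i - 1)) + \<tau> powr (p - 1)"
  have c: "c = \<tau> * \<Lambda>"
  proof -
    have "\<tau> powr (b + 1) = \<tau> * \<tau> powr b" for b using \<tau> by (simp add: powr_add)
    from this[of "2 * q i - 2" for i] this[of "p - 2"] show ?thesis
      unfolding c_def eq[symmetric] by (simp add: distrib_left sum_distrib_left mult.left_commute)
  qed
  note ctxt = s dim \<tau>
  define v where "v = (\<lambda>x::real^'n. \<tau> * bubble g x)"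
  have vpos: "0 < v x" for x using \<tau> by (simp add: v_def bubble_pos)
  have vD: "v \<in> D_space s"
    and inner: "\<And>h. h \<in> D_space s \<Longrightarrow> D_inner s v h = c * (LINT x|lborel. bubble (s + N / 2) x * h x)"
    using D_inner_bubble[OF s dim, where \<tau>=\<tau>] bubble_D_space[OF s dim] unfolding v_def g_def N_def c \<Lambda>_def by blast+
  have vm [measurable]: "v \<in> borel_measurable borel" by (rule D_space_measurable[OF s dim vD])
  have crit: "critical_point s (energy s k \<alpha>) v"
    unfolding critical_point_def
  proof (intro conjI vD allI impI)
    have "\<exists>C>0. \<exists>K>0. \<exists>\<theta>>0. \<forall>h\<in>D_space s. \<forall>A. 0 < A \<longrightarrow> A \<le> 1 \<longrightarrow> C * D_norm s h \<le> A \<longrightarrow>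
      \<bar>energy s k \<alpha> (\<lambda>x. v x + h x) - energy s k \<alpha> v - (D_inner s v h - c * (LINT x|lborel. bubble (s + N / 2) x * h x))\<bar>
      \<le> (D_norm s h)\<^sup>2 / 2 + K * A powr (1 + \<theta>)"
      unfolding v_def c_def R_def q_def p_def g_def N_def by (rule energy_expansion[OF ctxt]) (use \<alpha> in \<open>simp add: N_def\<close>)
    then obtain C K \<theta> where CK: "0 < C" "0 < K" "0 < \<theta>" and ex: "\<forall>h\<in>D_space s. \<forall>A. 0 < A \<longrightarrow> A \<le> 1 \<longrightarrow> C * D_norm s h \<le> A \<longrightarrow>
      \<bar>energy s k \<alpha> (\<lambda>x. v x + h x) - energy s k \<alpha> v - (D_inner s v h - c * (LINT x|lborel. bubble (s + N / 2) x * h x))\<bar>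
      \<le> (D_norm s h)\<^sup>2 / 2 + K * A powr (1 + \<theta>)" by (elim exE conjE)
    fix e :: real assume e: "0 < e"
    obtain d where d: "0 < d"
      "\<And>\<delta> m. 0 \<le> \<delta> \<Longrightarrow> \<delta> < d \<Longrightarrow> (\<And>A. 0 < A \<Longrightarrow> A \<le> 1 \<Longrightarrow> C * \<delta> \<le> A \<Longrightarrow> m \<le> \<delta>\<^sup>2 / 2 + K * A powr (1 + \<theta>)) \<Longrightarrow> m \<le> e * \<delta>"
      using linear_bound_of_powr_bound[OF CK e] by blast
    \<comment> \<open>By \<open>inner\<close> the linear part of the expansion is 0 for every
      \<open>h\<close>, so only the remainder is left to estimate.\<close>
    have "\<bar>energy s k \<alpha> (\<lambda>x. v x + h x) - energy s k \<alpha> v\<bar> \<le> e * D_norm s h" if "h \<in> D_space s" "D_norm s h < d" for h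
      using that bspec[OF ex that(1)] by (intro d(2)) (auto simp: inner D_norm_def)
    then show "\<exists>d>0. \<forall>h\<in>D_space s. D_norm s h < d \<longrightarrow> \<bar>energy s k \<alpha> (\<lambda>x. v x + h x) - energy s k \<alpha> v\<bar> \<le> e * D_norm s h"
      using d(1) by blast
  qed
  \<comment> \<open>The transform alters \<open>v\<close> at the origin only, so the second problem
    concerns the same element of the energy space.\<close>
  have kv: "kelvin s v = (\<lambda>x. if x = 0 then 0 else v x)"
    using kelvin_bubble[OF s dim, of \<tau>] unfolding v_def g_def N_def by (intro ext) simp
  have kAE: "AE x in lborel. v x = kelvin s v x"
    using AE_lborel_singleton[of "0::real^'n"] by eventually_elim (simp add: kv)
  have vAE: "AE x in lborel. kelvin s v x = \<tau> * bubble g x" using kAE by eventually_elim (simp add: v_def)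
  have km [measurable]: "kelvin s v \<in> borel_measurable borel" unfolding kv by measurable
  have weak: "weak_solution_on (UNIV - {0}) s k \<alpha> (kelvin s v)"
    unfolding weak_solution_on_def
  proof (intro conjI ballI D_space_cong_AE[OF kAE vD km])
    fix \<phi> :: "real^'n \<Rightarrow> real" assume \<phi>: "\<phi> \<in> test_functions (UNIV - {0})"
    have \<phi>D: "\<phi> \<in> D_space s" by (rule test_function_D_space[OF s dim test_function_UNIV[OF \<phi>]])
    have "0 \<notin> closure {x. \<phi> x \<noteq> 0}" using \<phi> by (auto simp: test_functions_def)
    \<comment> \<open>At the origin the transformed function is 0 while the bubble is positive;
      there the identity of the integrands rests on the vanishing of the test function.\<close>
    then have \<phi>0: "\<phi> 0 = 0" using closure_subset[of "{x. \<phi> x \<noteq> 0}"] by auto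
    have rhs: "nonlinearity s k \<alpha> (kelvin s v) x * \<phi> x = c * (bubble (s + N / 2) x * \<phi> x)" for x
    proof (cases "x = 0")
      case False
      have "kelvin s v x = \<tau> * bubble g x" unfolding kv using False by (simp add: v_def)
      from nonlinearity_bubble[OF ctxt, of k \<alpha> "kelvin s v" x, folded N_def, folded g_def p_def, folded R_def q_def, folded c_def, OF \<alpha> this vAE km]
      have "nonlinearity s k \<alpha> (kelvin s v) x = c * bubble (s + N / 2) x" by simp
      then show ?thesis by simp
    qed (simp add: \<phi>0)
    have "integrable lborel (\<lambda>x. bubble (s + N / 2) x * \<phi> x)"
      using integrable_bubble_mult(1)[OF s dim D_space_measurable[OF s dim \<phi>D], of "enn2real (\<integral>\<^sup>+x. ennreal (\<bar>\<phi> x\<bar> powr two_star (real CARD('n)) s) \<partial>lborel)" 1]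
        D_space_Lp_finite[OF s dim \<phi>D] by (simp add: N_def)
    then show "integrable lborel (\<lambda>x. nonlinearity s k \<alpha> (kelvin s v) x * \<phi> x)" unfolding rhs by simp
    have "D_inner s (kelvin s v) \<phi> = D_inner s v \<phi>" by (simp add: D_inner_def half_laplacian_cong_AE[OF kAE])
    then show "D_inner s (kelvin s v) \<phi> = (LINT x|lborel. nonlinearity s k \<alpha> (kelvin s v) x * \<phi> x)"
      unfolding rhs using inner[OF \<phi>D] by simp
  qed
  have "\<not> (AE x in lborel. v x = 0)"
  proof
    assume "AE x in lborel. v x = 0"
    then have "AE x in (lborel :: (real^'n) measure). False" by eventually_elim (use vpos in \<open>simp add: less_imp_neq[symmetric]\<close>)
    then show False by (simp add: trivial_limit_def[symmetric] ae_filter_eq_bot_iff)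
  qed
  then show ?thesis
    using crit weak vpos by (intro exI[of _ v]) (auto simp: ae_nonneg_def kv less_imp_le)
qed

end
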